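(* Let $N>6$ be an integer and let $k$ be an integer with $2<k<N/2$. Then $A_1(N)_{\mathbf Q(\zeta)}=\mathbf Q(\zeta)(\Lambda_k,j)$.
   Context: $\zeta=\exp(2\pi i/N)$, and $j$ is the modular invariant function. $\Gamma_1(N)$ is the group of matrices $\begin{pmatrix}a&b\\c&d\end{pmatrix}\in\mathrm{SL}_2(\mathbf Z)$ with $a-1\equiv c\equiv 0 \pmod N$, and $A_1(N)$ is the field of modular functions with respect to $\Gamma_1(N)$. $A(N)$ is the field of modular functions with respect to the principal congruence subgroup $\Gamma(N)$ of level $N$; for a subfield $\mathfrak F$ of $A(N)$, $\mathfrak F_{\mathbf Q(\zeta)}$ denotes the subfield of $\mathfrak F$ consisting of all modular functions in $\mathfrak F$ whose Fourier coefficients (in the expansion in powers of $q=\exp(2\pi i\tau/N)$) lie in $\mathbf Q(\zeta)$. For $\tau$ in the complex upper half plane, $\wp(z;\tau)$ is the Weierstrass $\wp$-function of the lattice $\mathbf Z+\mathbf Z\tau$, and $$\Lambda_k(\tau)=\frac{\wp(k/N;\tau)-\wp(1/N;\tau)}{\wp(2/N;\tau)-\wp(1/N;\tau)}.$$ *)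

theory Defs
  imports "HOL-Complex_Analysis.Complex_Analysis" "HOL-Algebra.Generated_Fields"
    "HOL-Algebra.Algebraic_Closure_Type" "HOL-Number_Theory.Cong"
begin

section \<open>The field of meromorphic functions on the upper half plane\<close>

definition uhp :: "complex set" where
  "uhp = {\<tau>. Im \<tau> > 0}"

text \<open>
  A meromorphic function on \<open>uhp\<close> is represented by one function \<open>complex \<Rightarrow> complex\<close>: it has no
  removable singularities in \<open>uhp\<close>, takes the value 0 at its poles and vanishes outside \<open>uhp\<close>.
  Hence equality in the field is equality of HOL functions. Pointwise sums and products are put
  back in this form by \<open>uhp_normalize\<close>.
\<close>

definition uhp_normalize :: "(complex \<Rightarrow> complex) \<Rightarrow> complex \<Rightarrow> complex" where
  "uhp_normalize f = (\<lambda>\<tau>. if \<tau> \<in> uhp then remove_sings f \<tau> else 0)"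

definition uhp_const :: "complex \<Rightarrow> complex \<Rightarrow> complex" where
  "uhp_const c = (\<lambda>\<tau>. if \<tau> \<in> uhp then c else 0)"

definition mero_uhp :: "(complex \<Rightarrow> complex) ring" where
  "mero_uhp = \<lparr>
     carrier = {f. f nicely_meromorphic_on uhp \<and> (\<forall>\<tau>. \<tau> \<notin> uhp \<longrightarrow> f \<tau> = 0)},
     monoid.mult = (\<lambda>f g. uhp_normalize (\<lambda>\<tau>. f \<tau> * g \<tau>)),
     one = uhp_const 1,
     ring.zero = uhp_const 0,
     add = (\<lambda>f g. uhp_normalize (\<lambda>\<tau>. f \<tau> + g \<tau>)) \<rparr>"

lemma open_uhp: "open uhp"
  by (simp add: uhp_def open_halfspace_Im_gt)

lemma connected_uhp: "connected uhp"
  by (simp add: uhp_def convex_connected convex_halfspace_Im_gt)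

lemma eventually_in_uhp: "z \<in> uhp \<Longrightarrow> eventually (\<lambda>w. w \<in> uhp) (at z)"
  by (rule eventually_at_in_open') (rule open_uhp)

lemma nicely_meromorphic_uhp_cong:
  assumes eq: "\<And>z. z \<in> uhp \<Longrightarrow> f z = g z" and g: "g nicely_meromorphic_on uhp"
  shows "f nicely_meromorphic_on uhp"
proof -
  have ev: "eventually (\<lambda>w. f w = g w) (at z)" if "z \<in> uhp" for z
    using eventually_in_uhp[OF that] by eventually_elim (rule eq)
  have "f meromorphic_on uhp"
    using g meromorphic_on_cong[OF ev refl] by (simp add: nicely_meromorphic_on_def)
  moreover have "(is_pole f z \<and> f z = 0) \<or> f \<midarrow>z\<rightarrow> f z" if z: "z \<in> uhp" for z
  proof -
    have "(is_pole g z \<and> g z = 0) \<or> g \<midarrow>z\<rightarrow> g z"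
      using g z by (simp add: nicely_meromorphic_on_def)
    moreover have "is_pole f z \<longleftrightarrow> is_pole g z"
      by (rule is_pole_cong) (use ev[OF z] in auto)
    moreover have "f \<midarrow>z\<rightarrow> f z \<longleftrightarrow> g \<midarrow>z\<rightarrow> g z"
      unfolding eq[OF z] by (rule tendsto_cong) (rule ev[OF z])
    ultimately show ?thesis
      by (simp add: eq[OF z])
  qed
  ultimately show ?thesis
    by (simp add: nicely_meromorphic_on_def)
qed

lemma uhp_normalize_closed:
  assumes "f meromorphic_on uhp"
  shows "uhp_normalize f \<in> carrier mero_uhp"
proof -
  have "uhp_normalize f nicely_meromorphic_on uhp"
    by (rule nicely_meromorphic_uhp_cong[OF _ remove_sings_nicely_meromorphic[OF assms]])
       (simp add: uhp_normalize_def)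
  thus ?thesis
    by (simp add: mero_uhp_def uhp_normalize_def)
qed

lemma uhp_normalize_eventually:
  assumes "f meromorphic_on uhp" "z \<in> uhp"
  shows "eventually (\<lambda>w. uhp_normalize f w = f w) (at z)"
proof -
  have "isolated_singularity_at f z"
    using assms by (meson meromorphic_onE)
  from eventually_remove_sings_eq_at[OF this] eventually_in_uhp[OF assms(2)] show ?thesis
    by eventually_elim (simp add: uhp_normalize_def)
qed

lemma uhp_normalize_cong:
  assumes "\<And>z. z \<in> uhp \<Longrightarrow> eventually (\<lambda>w. f w = g w) (at z)"
  shows "uhp_normalize f = uhp_normalize g"
  by (auto simp: uhp_normalize_def fun_eq_iff intro!: remove_sings_cong assms)

lemma uhp_normalize_id:
  assumes "f \<in> carrier mero_uhp"
  shows "uhp_normalize f = f"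
proof
  fix z
  show "uhp_normalize f z = f z"
  proof (cases "z \<in> uhp")
    case True
    hence "(is_pole f z \<and> f z = 0) \<or> f \<midarrow>z\<rightarrow> f z"
      using assms by (simp add: mero_uhp_def nicely_meromorphic_on_def)
    thus ?thesis
      using True by (auto simp: uhp_normalize_def remove_sings_at_pole)
  qed (use assms in \<open>auto simp: uhp_normalize_def mero_uhp_def\<close>)
qed

lemma mero_uhp_meromorphic: "f \<in> carrier mero_uhp \<Longrightarrow> f meromorphic_on uhp"
  by (simp add: mero_uhp_def nicely_meromorphic_on_def)

lemma uhp_const_closed: "uhp_const c \<in> carrier mero_uhp"
proof -
  have "uhp_const c nicely_meromorphic_on uhp"
    by (rule nicely_meromorphic_uhp_cong[of _ "\<lambda>_. c"]) (auto simp: uhp_const_def)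
  thus ?thesis
    by (simp add: mero_uhp_def uhp_const_def)
qed

lemma uhp_const_eventually:
  assumes "z \<in> uhp"
  shows "eventually (\<lambda>w. uhp_const c w = c) (at z)"
  using eventually_in_uhp[OF assms] by eventually_elim (simp add: uhp_const_def)

lemma mero_uhp_eqI:
  assumes "f \<in> carrier mero_uhp" "g \<in> carrier mero_uhp"
    and "\<And>z. z \<in> uhp \<Longrightarrow> eventually (\<lambda>w. f w = g w) (at z)"
  shows "f = g"
  using uhp_normalize_cong[OF assms(3)] uhp_normalize_id assms(1,2) by metis

lemma mero_uhp_mult:
  assumes "f \<in> carrier mero_uhp" "g \<in> carrier mero_uhp"
  shows "f \<otimes>\<^bsub>mero_uhp\<^esub> g \<in> carrier mero_uhp"
    and "z \<in> uhp \<Longrightarrow> eventually (\<lambda>w. (f \<otimes>\<^bsub>mero_uhp\<^esub> g) w = f w * g w) (at z)"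
proof -
  have mer: "(\<lambda>w. f w * g w) meromorphic_on uhp"
    using assms by (intro meromorphic_intros mero_uhp_meromorphic)
  have eq: "f \<otimes>\<^bsub>mero_uhp\<^esub> g = uhp_normalize (\<lambda>w. f w * g w)"
    by (simp add: mero_uhp_def)
  show "f \<otimes>\<^bsub>mero_uhp\<^esub> g \<in> carrier mero_uhp"
    unfolding eq by (rule uhp_normalize_closed[OF mer])
  show "z \<in> uhp \<Longrightarrow> eventually (\<lambda>w. (f \<otimes>\<^bsub>mero_uhp\<^esub> g) w = f w * g w) (at z)"
    unfolding eq by (rule uhp_normalize_eventually[OF mer])
qed

lemma mero_uhp_add:
  assumes "f \<in> carrier mero_uhp" "g \<in> carrier mero_uhp"
  shows "f \<oplus>\<^bsub>mero_uhp\<^esub> g \<in> carrier mero_uhp"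
    and "z \<in> uhp \<Longrightarrow> eventually (\<lambda>w. (f \<oplus>\<^bsub>mero_uhp\<^esub> g) w = f w + g w) (at z)"
proof -
  have mer: "(\<lambda>w. f w + g w) meromorphic_on uhp"
    using assms by (intro meromorphic_intros mero_uhp_meromorphic)
  have eq: "f \<oplus>\<^bsub>mero_uhp\<^esub> g = uhp_normalize (\<lambda>w. f w + g w)"
    by (simp add: mero_uhp_def)
  show "f \<oplus>\<^bsub>mero_uhp\<^esub> g \<in> carrier mero_uhp"
    unfolding eq by (rule uhp_normalize_closed[OF mer])
  show "z \<in> uhp \<Longrightarrow> eventually (\<lambda>w. (f \<oplus>\<^bsub>mero_uhp\<^esub> g) w = f w + g w) (at z)"
    unfolding eq by (rule uhp_normalize_eventually[OF mer])
qed

lemma mero_uhp_one: "\<one>\<^bsub>mero_uhp\<^esub> = uhp_const 1"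
  and mero_uhp_zero: "\<zero>\<^bsub>mero_uhp\<^esub> = uhp_const 0"
  by (simp_all add: mero_uhp_def)

lemma cring_mero_uhp: "cring mero_uhp"
proof (rule cringI)
  show "abelian_group mero_uhp"
  proof (rule abelian_groupI)
    fix f g h
    assume f: "f \<in> carrier mero_uhp" and g: "g \<in> carrier mero_uhp" and h: "h \<in> carrier mero_uhp"
    show "(f \<oplus>\<^bsub>mero_uhp\<^esub> g) \<oplus>\<^bsub>mero_uhp\<^esub> h = f \<oplus>\<^bsub>mero_uhp\<^esub> (g \<oplus>\<^bsub>mero_uhp\<^esub> h)"
    proof (rule mero_uhp_eqI)
      fix z assume z: "z \<in> uhp"
      show "eventually (\<lambda>w. ((f \<oplus>\<^bsub>mero_uhp\<^esub> g) \<oplus>\<^bsub>mero_uhp\<^esub> h) w =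
              (f \<oplus>\<^bsub>mero_uhp\<^esub> (g \<oplus>\<^bsub>mero_uhp\<^esub> h)) w) (at z)"
        using mero_uhp_add(2)[OF f g z] mero_uhp_add(2)[OF mero_uhp_add(1)[OF f g] h z]
              mero_uhp_add(2)[OF g h z] mero_uhp_add(2)[OF f mero_uhp_add(1)[OF g h] z]
        by eventually_elim simp
    qed (intro mero_uhp_add f g h)+
  next
    fix f g assume "f \<in> carrier mero_uhp" and "g \<in> carrier mero_uhp"
    thus "f \<oplus>\<^bsub>mero_uhp\<^esub> g \<in> carrier mero_uhp"
      by (rule mero_uhp_add)
    show "f \<oplus>\<^bsub>mero_uhp\<^esub> g = g \<oplus>\<^bsub>mero_uhp\<^esub> f"
      by (simp add: mero_uhp_def add.commute)
  next
    fix f assume f: "f \<in> carrier mero_uhp"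
    have "(\<lambda>w. uhp_const 0 w + f w) = f"
      by (simp add: uhp_const_def)
    thus "\<zero>\<^bsub>mero_uhp\<^esub> \<oplus>\<^bsub>mero_uhp\<^esub> f = f"
      using uhp_normalize_id[OF f] by (simp add: mero_uhp_def)
    define g where "g = uhp_normalize (\<lambda>w. - f w)"
    have mer: "(\<lambda>w. - f w) meromorphic_on uhp"
      using f by (intro meromorphic_intros mero_uhp_meromorphic)
    have g: "g \<in> carrier mero_uhp"
      unfolding g_def by (rule uhp_normalize_closed[OF mer])
    have "g \<oplus>\<^bsub>mero_uhp\<^esub> f = \<zero>\<^bsub>mero_uhp\<^esub>"
      unfolding mero_uhp_zero
    proof (rule mero_uhp_eqI)
      fix z assume z: "z \<in> uhp"
      show "eventually (\<lambda>w. (g \<oplus>\<^bsub>mero_uhp\<^esub> f) w = uhp_const 0 w) (at z)"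
        using mero_uhp_add(2)[OF g f z] uhp_normalize_eventually[OF mer z]
              uhp_const_eventually[OF z, of 0]
        by eventually_elim (simp add: g_def)
    qed (intro mero_uhp_add f g uhp_const_closed)+
    thus "\<exists>g\<in>carrier mero_uhp. g \<oplus>\<^bsub>mero_uhp\<^esub> f = \<zero>\<^bsub>mero_uhp\<^esub>"
      using g by blast
  qed (simp_all add: mero_uhp_zero uhp_const_closed)
next
  show "comm_monoid mero_uhp"
  proof (rule comm_monoidI)
    fix f g h
    assume f: "f \<in> carrier mero_uhp" and g: "g \<in> carrier mero_uhp" and h: "h \<in> carrier mero_uhp"
    show "(f \<otimes>\<^bsub>mero_uhp\<^esub> g) \<otimes>\<^bsub>mero_uhp\<^esub> h = f \<otimes>\<^bsub>mero_uhp\<^esub> (g \<otimes>\<^bsub>mero_uhp\<^esub> h)"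
    proof (rule mero_uhp_eqI)
      fix z assume z: "z \<in> uhp"
      show "eventually (\<lambda>w. ((f \<otimes>\<^bsub>mero_uhp\<^esub> g) \<otimes>\<^bsub>mero_uhp\<^esub> h) w =
              (f \<otimes>\<^bsub>mero_uhp\<^esub> (g \<otimes>\<^bsub>mero_uhp\<^esub> h)) w) (at z)"
        using mero_uhp_mult(2)[OF f g z] mero_uhp_mult(2)[OF mero_uhp_mult(1)[OF f g] h z]
              mero_uhp_mult(2)[OF g h z] mero_uhp_mult(2)[OF f mero_uhp_mult(1)[OF g h] z]
        by eventually_elim simp
    qed (intro mero_uhp_mult f g h)+
  next
    fix f g assume "f \<in> carrier mero_uhp" and "g \<in> carrier mero_uhp"
    thus "f \<otimes>\<^bsub>mero_uhp\<^esub> g \<in> carrier mero_uhp"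
      by (rule mero_uhp_mult)
    show "f \<otimes>\<^bsub>mero_uhp\<^esub> g = g \<otimes>\<^bsub>mero_uhp\<^esub> f"
      by (simp add: mero_uhp_def mult.commute)
  next
    fix f assume f: "f \<in> carrier mero_uhp"
    hence "(\<lambda>w. uhp_const 1 w * f w) = f"
      by (auto simp: uhp_const_def mero_uhp_def)
    thus "\<one>\<^bsub>mero_uhp\<^esub> \<otimes>\<^bsub>mero_uhp\<^esub> f = f"
      using uhp_normalize_id[OF f] by (simp add: mero_uhp_def)
  qed (simp_all add: mero_uhp_one uhp_const_closed)
next
  fix f g h
  assume f: "f \<in> carrier mero_uhp" and g: "g \<in> carrier mero_uhp" and h: "h \<in> carrier mero_uhp"
  show "(f \<oplus>\<^bsub>mero_uhp\<^esub> g) \<otimes>\<^bsub>mero_uhp\<^esub> h =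
          f \<otimes>\<^bsub>mero_uhp\<^esub> h \<oplus>\<^bsub>mero_uhp\<^esub> g \<otimes>\<^bsub>mero_uhp\<^esub> h"
  proof (rule mero_uhp_eqI)
    fix z assume z: "z \<in> uhp"
    show "eventually (\<lambda>w. ((f \<oplus>\<^bsub>mero_uhp\<^esub> g) \<otimes>\<^bsub>mero_uhp\<^esub> h) w =
            (f \<otimes>\<^bsub>mero_uhp\<^esub> h \<oplus>\<^bsub>mero_uhp\<^esub> g \<otimes>\<^bsub>mero_uhp\<^esub> h) w) (at z)"
      using mero_uhp_add(2)[OF f g z] mero_uhp_mult(2)[OF mero_uhp_add(1)[OF f g] h z]
            mero_uhp_mult(2)[OF f h z] mero_uhp_mult(2)[OF g h z]
            mero_uhp_add(2)[OF mero_uhp_mult(1)[OF f h] mero_uhp_mult(1)[OF g h] z]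
      by eventually_elim (simp add: algebra_simps)
  qed (intro mero_uhp_mult mero_uhp_add f g h)+
qed

theorem field_mero_uhp: "field mero_uhp"
proof (rule cring.cring_fieldI2[OF cring_mero_uhp])
  have "\<i> \<in> uhp"
    by (simp add: uhp_def)
  hence "uhp_const 0 \<i> \<noteq> uhp_const 1 \<i>"
    by (simp add: uhp_const_def)
  thus "\<zero>\<^bsub>mero_uhp\<^esub> \<noteq> \<one>\<^bsub>mero_uhp\<^esub>"
    unfolding mero_uhp_zero mero_uhp_one by metis
next
  fix f assume f: "f \<in> carrier mero_uhp" and nz: "f \<noteq> \<zero>\<^bsub>mero_uhp\<^esub>"
  have "\<not> (\<forall>z\<in>uhp. f z = 0)"
    using f nz by (auto simp: mero_uhp_zero uhp_const_def mero_uhp_def fun_eq_iff)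
  hence "eventually (\<lambda>z. f z \<noteq> 0) (cosparse uhp)"
    using nicely_meromorphic_imp_constant_or_avoid[OF _ open_uhp connected_uhp, of f 0] f
    by (auto simp: mero_uhp_def)
  hence ne: "eventually (\<lambda>w. f w \<noteq> 0) (at z)" if "z \<in> uhp" for z
    using that by (simp add: eventually_cosparse_open_eq open_uhp)
  define g where "g = uhp_normalize (\<lambda>w. inverse (f w))"
  have mer: "(\<lambda>w. inverse (f w)) meromorphic_on uhp"
    using f by (intro meromorphic_intros mero_uhp_meromorphic)
  have g: "g \<in> carrier mero_uhp"
    unfolding g_def by (rule uhp_normalize_closed[OF mer])
  have "f \<otimes>\<^bsub>mero_uhp\<^esub> g = \<one>\<^bsub>mero_uhp\<^esub>"
    unfolding mero_uhp_one
  proof (rule mero_uhp_eqI)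
    fix z assume z: "z \<in> uhp"
    show "eventually (\<lambda>w. (f \<otimes>\<^bsub>mero_uhp\<^esub> g) w = uhp_const 1 w) (at z)"
      using mero_uhp_mult(2)[OF f g z] uhp_normalize_eventually[OF mer z]
            uhp_const_eventually[OF z, of 1] ne[OF z]
      by eventually_elim (simp add: g_def)
  qed (intro mero_uhp_mult f g uhp_const_closed)+
  thus "\<exists>g\<in>carrier mero_uhp. f \<otimes>\<^bsub>mero_uhp\<^esub> g = \<one>\<^bsub>mero_uhp\<^esub>"
    using g by blast
qed


section \<open>Modular functions\<close>

definition moebius :: "int^2^2 \<Rightarrow> complex \<Rightarrow> complex" where
  "moebius A \<tau> = (of_int (A $ 1 $ 1) * \<tau> + of_int (A $ 1 $ 2)) /
                 (of_int (A $ 2 $ 1) * \<tau> + of_int (A $ 2 $ 2))"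

definition SL2Z :: "(int^2^2) set" where
  "SL2Z = {A. det A = 1}"

definition Gamma1 :: "int \<Rightarrow> (int^2^2) set" where
  "Gamma1 N = {A \<in> SL2Z. [A $ 1 $ 1 - 1 = 0] (mod N) \<and> [A $ 2 $ 1 = 0] (mod N)}"

text \<open>
  \<open>has_fourier_expansion N f F\<close>: for \<open>Im \<tau>\<close> large, \<open>f \<tau>\<close> is the sum of the Laurent series \<open>F\<close>
  at \<open>q = exp (2 \<pi> \<i> \<tau> / N)\<close>. A formal Laurent series has only finitely many negative powers.
\<close>
definition has_fourier_expansion :: "int \<Rightarrow> (complex \<Rightarrow> complex) \<Rightarrow> complex fls \<Rightarrow> bool" where
  "has_fourier_expansion N f F \<longleftrightarrow>
     fls_conv_radius F > 0 \<and>
     eventually (\<lambda>\<tau>. f \<tau> = eval_fls F (exp (2 * of_real pi * \<i> * \<tau> / of_int N)))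
       (filtercomap Im at_top)"

text \<open>
  For \<open>\<Gamma>\<close> between the principal congruence subgroup of level \<open>N\<close> and \<open>SL2Z\<close>. Every cusp is
  \<open>\<gamma> \<infinity>\<close> for some \<open>\<gamma> \<in> SL2Z\<close>, and \<open>f \<circ> \<gamma>\<close> is then invariant under \<open>\<tau> \<mapsto> \<tau> + N\<close>, so that the
  last condition is meromorphy at all cusps.
\<close>
definition modular_functions :: "int \<Rightarrow> (int^2^2) set \<Rightarrow> (complex \<Rightarrow> complex) set" where
  "modular_functions N \<Gamma> =
     {f \<in> carrier mero_uhp.
        (\<forall>\<gamma>\<in>\<Gamma>. \<forall>\<tau>\<in>uhp. f (moebius \<gamma> \<tau>) = f \<tau>) \<and>
        (\<forall>\<gamma>\<in>SL2Z. \<exists>F. has_fourier_expansion N (\<lambda>\<tau>. f (moebius \<gamma> \<tau>)) F)}"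

definition modular_field1 :: "int \<Rightarrow> (complex \<Rightarrow> complex) set" where
  "modular_field1 N = modular_functions N (Gamma1 N)"

definition with_fourier_coeffs_in ::
    "int \<Rightarrow> complex set \<Rightarrow> (complex \<Rightarrow> complex) set \<Rightarrow> (complex \<Rightarrow> complex) set" where
  "with_fourier_coeffs_in N K \<FF> =
     {f \<in> \<FF>. \<exists>F. has_fourier_expansion N f F \<and> (\<forall>n. fls_nth F n \<in> K)}"

definition zeta :: "int \<Rightarrow> complex" where
  "zeta N = exp (2 * of_real pi * \<i> / of_int N)"

text \<open>A generated subfield contains 1, so this is the field generated by \<open>zeta N\<close> over \<open>\<rat>\<close>.\<close>
definition cyclotomic_field :: "int \<Rightarrow> complex set" where
  "cyclotomic_field N = generate_field ring_of_type_algebra {zeta N}"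

text \<open>\<open>K(S)\<close>, the elements of \<open>K\<close> being regarded as constant functions.\<close>
definition function_field_adjoin ::
    "complex set \<Rightarrow> (complex \<Rightarrow> complex) set \<Rightarrow> (complex \<Rightarrow> complex) set" where
  "function_field_adjoin K S = generate_field mero_uhp (uhp_const ` K \<union> S)"


section \<open>Elliptic and modular invariants\<close>

definition period_lattice :: "complex \<Rightarrow> complex set" where
  "period_lattice \<tau> = {of_int m + of_int n * \<tau> | m n. True}"

definition wp :: "complex \<Rightarrow> complex \<Rightarrow> complex" where
  "wp z \<tau> = 1 / z ^ 2 + (\<Sum>\<^sub>\<infinity>\<omega>\<in>period_lattice \<tau> - {0}. (1 / (z - \<omega>) ^ 2 - 1 / \<omega> ^ 2))"

definition g2 :: "complex \<Rightarrow> complex" where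
  "g2 \<tau> = 60 * (\<Sum>\<^sub>\<infinity>\<omega>\<in>period_lattice \<tau> - {0}. 1 / \<omega> ^ 4)"

definition g3 :: "complex \<Rightarrow> complex" where
  "g3 \<tau> = 140 * (\<Sum>\<^sub>\<infinity>\<omega>\<in>period_lattice \<tau> - {0}. 1 / \<omega> ^ 6)"

text \<open>Normalized by \<open>j \<i> = 1728\<close>. The cut-off at \<open>uhp\<close> in \<open>klein_j\<close> and \<open>Lambda\<close> is the
  convention for elements of \<open>mero_uhp\<close>.\<close>
definition klein_j :: "complex \<Rightarrow> complex" where
  "klein_j = (\<lambda>\<tau>. if \<tau> \<in> uhp then 1728 * g2 \<tau> ^ 3 / (g2 \<tau> ^ 3 - 27 * g3 \<tau> ^ 2) else 0)"

definition Lambda :: "int \<Rightarrow> int \<Rightarrow> complex \<Rightarrow> complex" where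
  "Lambda N k = (\<lambda>\<tau>. if \<tau> \<in> uhp then
       (wp (of_int k / of_int N) \<tau> - wp (1 / of_int N) \<tau>) /
       (wp (2 / of_int N) \<tau> - wp (1 / of_int N) \<tau>) else 0)"

end

theory Submission
  imports Defs "HOL-Real_Asymp.Real_Asymp"
begin

text \<open>
  For \<open>\<gamma>\<close> in \<open>SL2Z\<close> with bottom row \<open>(c, d)\<close>, \<open>\<Lambda>\<^sub>k \<circ> \<gamma>\<close> is the quotient of differences of division
  values \<open>\<wp>(j (c \<tau> + d) / N; \<tau>)\<close>, \<open>j = 1, 2, k\<close>. It depends on \<open>(c, d)\<close> modulo \<open>N\<close> only, and the
  orders and leading coefficients of these differences at \<open>\<i>\<infinity>\<close> are explicit. If \<open>\<Lambda>\<^sub>k \<circ> \<gamma> = \<Lambda>\<^sub>k\<close>,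
  comparing them at all cusps gives \<open>\<gamma> \<in> \<plusminus>\<Gamma>\<^sub>1(N)\<close>. Therefore each \<open>f\<close> in \<open>A\<^sub>1(N)\<close> is a function on the
  finite orbit of \<open>\<Lambda>\<^sub>k\<close>, and Lagrange interpolation writes \<open>f\<close> as a rational expression in \<open>\<Lambda>\<^sub>k\<close> whose
  coefficients are invariant under \<open>SL2Z\<close>, hence rational in \<open>j\<close>. The coefficients of
  this expression are complex numbers; writing them in a basis over \<open>K = \<rat>(\<zeta>)\<close> splits the linear
  relation \<open>f B(\<Lambda>\<^sub>k, j) = A(\<Lambda>\<^sub>k, j)\<close> between Fourier series over \<open>K\<close> into relations with coefficients in \<open>K\<close>.
\<close>

text \<open>At the row (0, 1), that is at i\<infinity> itself, all differences of division values
  have order 0, so orders there say nothing. The comparison is therefore made at the rows (c x + d,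
  -c), which arise from \<gamma> by a further matrix (x, -1; 1, 0), and the reference is the row (1,
  0). At a row with first coordinate e, the difference for the multiples i and j has as its order
  the smaller of the distances of i e and j e to the multiples of N, so the stabilizer becomes a
  question about residues modulo N. The conditions for all x together force N | c. Orders alone do
  not settle d, because the multiples 2 and k can exchange roles; the leading coefficients decide
  between them. Two cases remain, distance 1 and N = 3 a + 1 with a the distance of d, and the
  inverse matrix, which satisfies the same conditions, removes the second. The factor (2 pi i)^2 of
  division values would spoil the coefficient field, but it cancels in \<open>Lambda N k\<close> and
  in j. The descent is linear algebra rather than Galois theory: a relation between monomials in the
  generators is linear in its coefficients, and an expansion at one cusp determines the
  function.\<close>

no_notation fps_nth (infixl "$" 75)

section \<open>Lattice sums\<close>

lemma uhp_D: "\<tau> \<in> uhp \<Longrightarrow> Im \<tau> > 0"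
  by (simp add: uhp_def)

definition lattice_point :: "complex \<Rightarrow> int \<times> int \<Rightarrow> complex" where
  "lattice_point \<tau> p = of_int (fst p) + of_int (snd p) * \<tau>"

lemma period_lattice_range: "period_lattice \<tau> = range (lattice_point \<tau>)"
  by (fastforce simp: period_lattice_def lattice_point_def image_iff)

lemma lattice_point_diff: "lattice_point \<tau> p - lattice_point \<tau> p' = lattice_point \<tau> (p - p')"
  by (simp add: lattice_point_def algebra_simps)

lemma lattice_point_eq_0_iff:
  assumes "\<tau> \<in> uhp"
  shows "lattice_point \<tau> p = 0 \<longleftrightarrow> p = 0"
proof
  assume *: "lattice_point \<tau> p = 0"
  have "Im (lattice_point \<tau> p) = of_int (snd p) * Im \<tau>"
    by (simp add: lattice_point_def)
  with * uhp_D[OF assms] have "snd p = 0" by simp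
  with * show "p = 0" by (auto simp: lattice_point_def prod_eq_iff)
qed (simp add: lattice_point_def)

lemma inj_lattice_point: "\<tau> \<in> uhp \<Longrightarrow> inj (lattice_point \<tau>)"
  by (rule injI) (metis lattice_point_diff lattice_point_eq_0_iff right_minus_eq)

lemma bij_lattice_point:
  "\<tau> \<in> uhp \<Longrightarrow> bij_betw (lattice_point \<tau>) (UNIV - {0}) (period_lattice \<tau> - {0})"
  "\<tau> \<in> uhp \<Longrightarrow> bij_betw (lattice_point \<tau>) UNIV (period_lattice \<tau>)"
proof -
  assume \<tau>: "\<tau> \<in> uhp"
  show *: "bij_betw (lattice_point \<tau>) UNIV (period_lattice \<tau>)"
    using inj_lattice_point[OF \<tau>] by (simp add: bij_betw_def period_lattice_range)
  have "bij_betw (lattice_point \<tau>) (UNIV - {0}) (period_lattice \<tau> - {lattice_point \<tau> 0})"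
    by (rule bij_betw_DiffI[OF *]) (auto simp: period_lattice_range)
  moreover have "lattice_point \<tau> 0 = 0" by (simp add: lattice_point_def)
  ultimately show "bij_betw (lattice_point \<tau>) (UNIV - {0}) (period_lattice \<tau> - {0})"
    by (simp only:)
qed

lemma period_lattice_props:
  shows "0 \<in> period_lattice \<tau>" "1 \<in> period_lattice \<tau>" "\<tau> \<in> period_lattice \<tau>"
    and "a \<in> period_lattice \<tau> \<Longrightarrow> b \<in> period_lattice \<tau> \<Longrightarrow> a + b \<in> period_lattice \<tau>"
    and "a \<in> period_lattice \<tau> \<Longrightarrow> b \<in> period_lattice \<tau> \<Longrightarrow> a - b \<in> period_lattice \<tau>"
    and "a \<in> period_lattice \<tau> \<Longrightarrow> - a \<in> period_lattice \<tau>"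
    and "a \<in> period_lattice \<tau> \<Longrightarrow> of_int n * a \<in> period_lattice \<tau>"
proof -
  show "0 \<in> period_lattice \<tau>" "1 \<in> period_lattice \<tau>" "\<tau> \<in> period_lattice \<tau>"
    using rangeI[of "lattice_point \<tau>" "(0, 0)"] rangeI[of "lattice_point \<tau>" "(1, 0)"]
          rangeI[of "lattice_point \<tau>" "(0, 1)"]
    unfolding period_lattice_range by (simp_all add: lattice_point_def[of _ "(_, _)"])
  show "a + b \<in> period_lattice \<tau>" if ab: "a \<in> period_lattice \<tau>" "b \<in> period_lattice \<tau>" for a b
  proof -
    obtain p p' where "a = lattice_point \<tau> p" "b = lattice_point \<tau> p'"
      using ab unfolding period_lattice_range by blast
    hence "a + b = lattice_point \<tau> (p + p')" by (simp add: lattice_point_def algebra_simps)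
    thus ?thesis by (simp add: period_lattice_range)
  qed
  show "of_int n * a \<in> period_lattice \<tau>" if a: "a \<in> period_lattice \<tau>" for a n
  proof -
    obtain p where "a = lattice_point \<tau> p" using a unfolding period_lattice_range by blast
    hence "of_int n * a = lattice_point \<tau> (n * fst p, n * snd p)"
      by (simp add: lattice_point_def algebra_simps)
    thus ?thesis by (simp add: period_lattice_range)
  qed
  from this[of _ "-1"] show neg: "- a \<in> period_lattice \<tau>" if "a \<in> period_lattice \<tau>" for a
    using that by simp
  show "a - b \<in> period_lattice \<tau>" if ab: "a \<in> period_lattice \<tau>" "b \<in> period_lattice \<tau>" for a b
  proof -
    obtain p p' where "a = lattice_point \<tau> p" "b = lattice_point \<tau> p'"
      using ab unfolding period_lattice_range by blast
    thus ?thesis by (simp add: lattice_point_diff period_lattice_range)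
  qed
qed

text \<open>The imaginary part bounds the coefficient of \<tau>, and subtracting that multiple of
  \<tau> bounds the other coefficient. Discreteness of the lattice and convergence of all lattice
  sums rest on this linear bound.\<close>

lemma lattice_point_norm_ge:
  assumes "\<tau> \<in> uhp"
  obtains C where "C > 0" "\<And>p. of_int (\<bar>fst p\<bar> + \<bar>snd p\<bar>) \<le> C * norm (lattice_point \<tau> p)"
proof
  define C where "C = 1 + (norm \<tau> + 1) / Im \<tau>"
  have im: "Im \<tau> > 0" using assms by (rule uhp_D)
  thus "C > 0" by (auto simp: C_def intro!: add_pos_nonneg divide_nonneg_pos)
  fix p :: "int \<times> int"
  obtain m n where p: "p = (m, n)" by fastforce
  define x where "x = norm (lattice_point \<tau> p)"
  have "\<bar>Im (lattice_point \<tau> p)\<bar> \<le> x" unfolding x_def by (rule abs_Im_le_cmod)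
  hence "\<bar>of_int n\<bar> * Im \<tau> \<le> x" using im by (simp add: lattice_point_def p abs_mult)
  hence n: "of_int \<bar>n\<bar> \<le> x / Im \<tau>" using im by (simp add: field_simps)
  have "of_int m = lattice_point \<tau> p - of_int n * \<tau>" by (simp add: lattice_point_def p)
  hence "norm (of_int m :: complex) \<le> x + norm (of_int n * \<tau>)"
    unfolding x_def by (metis norm_triangle_ineq4)
  also have "norm (of_int n * \<tau>) = of_int \<bar>n\<bar> * norm \<tau>" by (simp add: norm_mult)
  also have "\<dots> \<le> x / Im \<tau> * norm \<tau>" using n by (intro mult_right_mono) auto
  finally have "of_int \<bar>m\<bar> \<le> x + x / Im \<tau> * norm \<tau>" by simp
  with n have "of_int \<bar>m\<bar> + of_int \<bar>n\<bar> \<le> x + x / Im \<tau> * norm \<tau> + x / Im \<tau>" by linarith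
  also have "\<dots> = C * x" by (simp add: C_def add_divide_distrib algebra_simps)
  finally show "of_int (\<bar>fst p\<bar> + \<bar>snd p\<bar>) \<le> C * norm (lattice_point \<tau> p)"
    by (simp add: p x_def)
qed

lemma finite_lattice_points_le:
  assumes "\<tau> \<in> uhp"
  shows "finite {p. norm (lattice_point \<tau> p) \<le> R}"
proof -
  obtain C where C: "C > 0" "\<And>p. of_int (\<bar>fst p\<bar> + \<bar>snd p\<bar>) \<le> C * norm (lattice_point \<tau> p)"
    using lattice_point_norm_ge[OF assms] by blast
  define B where "B = \<lceil>C * R\<rceil>"
  have "{p. norm (lattice_point \<tau> p) \<le> R} \<subseteq> {-B..B} \<times> {-B..B}"
  proof
    fix p assume "p \<in> {p. norm (lattice_point \<tau> p) \<le> R}"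
    hence "C * norm (lattice_point \<tau> p) \<le> C * R" using C(1) by simp
    hence "of_int (\<bar>fst p\<bar> + \<bar>snd p\<bar>) \<le> C * R" using C(2)[of p] by linarith
    hence "\<bar>fst p\<bar> + \<bar>snd p\<bar> \<le> B" unfolding B_def by linarith
    thus "p \<in> {-B..B} \<times> {-B..B}" by (cases p) auto
  qed
  thus ?thesis by (rule finite_subset) auto
qed

lemma finite_period_lattice_ball:
  assumes "\<tau> \<in> uhp"
  shows "finite {\<omega> \<in> period_lattice \<tau>. norm \<omega> \<le> R}"
proof -
  have "{\<omega> \<in> period_lattice \<tau>. norm \<omega> \<le> R} = lattice_point \<tau> ` {p. norm (lattice_point \<tau> p) \<le> R}"
    by (auto simp: period_lattice_range)
  thus ?thesis using finite_imageI[OF finite_lattice_points_le[OF assms]] by (simp only:)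
qed

section \<open>Absolute convergence of lattice sums\<close>

lemma int_powr_summable:
  "(\<lambda>m::int. (1 + real_of_int \<bar>m\<bar>) powr (-3/2)) summable_on UNIV"
proof -
  have s: "summable (\<lambda>n. (1 + real n) powr (-3/2))"
  proof -
    have "summable (\<lambda>n. real n powr (-3/2))" by (simp add: summable_real_powr_iff)
    hence "summable (\<lambda>n. real (Suc n) powr (-3/2))" by (subst summable_Suc_iff)
    thus ?thesis by (simp add: add.commute)
  qed
  have s2: "(\<lambda>n. (1 + real n) powr (-3/2)) summable_on UNIV"
    by (rule norm_summable_imp_summable_on) (use s in simp)
  have 1: "(\<lambda>m::int. (1 + real_of_int \<bar>m\<bar>) powr (-3/2)) summable_on range int"
    by (subst summable_on_reindex) (use s2 in \<open>auto simp: o_def inj_on_def\<close>)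
  have 2: "(\<lambda>m::int. (1 + real_of_int \<bar>m\<bar>) powr (-3/2)) summable_on range (\<lambda>n. - int n)"
    by (subst summable_on_reindex) (use s2 in \<open>auto simp: o_def inj_on_def\<close>)
  have "range int \<union> range (\<lambda>n. - int n) = UNIV"
    by (auto simp: image_iff) (metis int_cases2)
  thus ?thesis using summable_on_union[OF 1 2] by simp
qed

text \<open>A weight in product form splits the double sum into two single ones. The exponent 3/2
  exceeds 1, and it is half of the exponent 3 of the lattice sum to be dominated.\<close>

lemma lattice_weight_summable:
  "(\<lambda>p::int \<times> int. (1 + real_of_int \<bar>fst p\<bar>) powr (-3/2) * (1 + real_of_int \<bar>snd p\<bar>) powr (-3/2))
     summable_on UNIV"
proof -
  let ?a = "\<lambda>m::int. (1 + real_of_int \<bar>m\<bar>) powr (-3/2)"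
  have "(\<lambda>p. ?a (fst p) * ?a (snd p)) summable_on Sigma UNIV (\<lambda>_. UNIV)"
  proof (rule summable_on_SigmaI)
    show "((\<lambda>y. ?a (fst (x, y)) * ?a (snd (x, y))) has_sum (?a x * infsum ?a UNIV)) UNIV" for x
      using int_powr_summable by (auto intro!: has_sum_cmult_right has_sum_infsum)
    show "(\<lambda>x. ?a x * infsum ?a UNIV) summable_on UNIV"
      by (intro summable_on_cmult_left int_powr_summable)
  qed auto
  thus ?thesis by simp
qed

text \<open>For h = |m| + |n| \<ge> 1 both 1 + |m| and 1 + |n| are at most 2 h, so the 3/2-th power
  of their product is at most (2 h)^3, and h is at most C times the norm of the lattice point. At p
  = 0 the term is 1 / 0 = 0.\<close>

lemma lattice_cube_summable_pairs:
  assumes "\<tau> \<in> uhp"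
  shows "(\<lambda>p. 1 / norm (lattice_point \<tau> p) ^ 3) summable_on UNIV"
proof -
  let ?a = "\<lambda>m::int. (1 + real_of_int \<bar>m\<bar>) powr (-3/2)"
  obtain C where C: "C > 0" "\<And>p. of_int (\<bar>fst p\<bar> + \<bar>snd p\<bar>) \<le> C * norm (lattice_point \<tau> p)"
    using lattice_point_norm_ge[OF assms] by blast
  have "(\<lambda>p. 8 * C ^ 3 * (?a (fst p) * ?a (snd p))) summable_on UNIV"
    by (intro summable_on_cmult_right lattice_weight_summable)
  thus ?thesis
  proof (rule summable_on_comparison_test)
    fix p :: "int \<times> int"
    show "1 / norm (lattice_point \<tau> p) ^ 3 \<le> 8 * C ^ 3 * (?a (fst p) * ?a (snd p))"
    proof (cases "p = 0")
      case False
      define h where "h = real_of_int (\<bar>fst p\<bar> + \<bar>snd p\<bar>)"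
      have "\<bar>fst p\<bar> + \<bar>snd p\<bar> \<ge> 1" using False by (cases p) (auto simp: zero_prod_def)
      hence h: "h \<ge> 1" unfolding h_def by linarith
      define u v where "u = 1 + real_of_int \<bar>fst p\<bar>" and "v = 1 + real_of_int \<bar>snd p\<bar>"
      have uv: "u \<ge> 1" "v \<ge> 1" by (auto simp: u_def v_def)
      have "u \<le> 2 * h" "v \<le> 2 * h" using h by (auto simp: u_def v_def h_def)
      hence "u * v \<le> (2 * h) * (2 * h)" using uv by (intro mult_mono) auto
      hence "(u * v) powr (3/2) \<le> ((2 * h) * (2 * h)) powr (3/2)"
        using uv by (intro powr_mono2) auto
      also have "\<dots> = 8 * h ^ 3"
      proof -
        have "(2 * h) * (2 * h) = (2 * h) powr 2" using h by (simp add: power2_eq_square)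
        hence "((2 * h) * (2 * h)) powr (3/2) = (2 * h) powr (2 * (3/2))" by (simp only: powr_powr)
        also have "\<dots> = (2 * h) ^ 3" using h by simp
        finally show ?thesis by (simp only: power_mult_distrib) simp
      qed
      also have "h ^ 3 \<le> (C * norm (lattice_point \<tau> p)) ^ 3"
        using C(2)[of p] h by (intro power_mono) (auto simp: h_def)
      finally have *: "(u * v) powr (3/2) \<le> 8 * C ^ 3 * norm (lattice_point \<tau> p) ^ 3"
        by (simp add: power_mult_distrib)
      have pos: "norm (lattice_point \<tau> p) ^ 3 > 0" "(u * v) powr (3/2) > 0"
        using lattice_point_eq_0_iff[OF assms] False uv by auto
      have "1 / norm (lattice_point \<tau> p) ^ 3 \<le> 8 * C ^ 3 * inverse ((u * v) powr (3/2))"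
        using * pos by (simp add: field_simps)
      also have "inverse ((u * v) powr (3/2)) = u powr (-3/2) * v powr (-3/2)"
        using uv by (simp add: powr_mult powr_minus)
      finally show ?thesis by (simp add: u_def v_def)
    qed (use C in \<open>auto simp: lattice_point_def\<close>)
  qed auto
qed

lemma lattice_cube_summable:
  assumes "\<tau> \<in> uhp"
  shows "(\<lambda>\<omega>. 1 / norm \<omega> ^ 3) summable_on period_lattice \<tau>"
  using lattice_cube_summable_pairs[OF assms]
        summable_on_reindex_bij_betw[OF bij_lattice_point(2)[OF assms], of "\<lambda>\<omega>. 1 / norm \<omega> ^ 3"]
  by simp

lemma lattice_power_summable:
  assumes "\<tau> \<in> uhp" "k \<ge> 3"
  shows "(\<lambda>\<omega>. 1 / norm \<omega> ^ k) summable_on period_lattice \<tau>"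
proof -
  define F where "F = {\<omega> \<in> period_lattice \<tau>. norm \<omega> \<le> 1}"
  have fin: "finite F" unfolding F_def by (rule finite_period_lattice_ball[OF assms(1)])
  have "(\<lambda>\<omega>. 1 / norm \<omega> ^ k) summable_on (period_lattice \<tau> - F)"
  proof (rule summable_on_comparison_test)
    show "(\<lambda>\<omega>. 1 / norm \<omega> ^ 3) summable_on (period_lattice \<tau> - F)"
      by (rule summable_on_subset_banach[OF lattice_cube_summable[OF assms(1)]]) auto
    fix \<omega> assume "\<omega> \<in> period_lattice \<tau> - F"
    hence "norm \<omega> > 1" by (auto simp: F_def)
    hence "norm \<omega> ^ 3 \<le> norm \<omega> ^ k" "norm \<omega> ^ 3 > 0" 
      using assms(2) by (auto intro: power_increasing simp del: zero_less_norm_iff)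
    thus "1 / norm \<omega> ^ k \<le> 1 / norm \<omega> ^ 3" by (intro divide_left_mono) auto
  qed auto
  hence "(\<lambda>\<omega>. 1 / norm \<omega> ^ k) summable_on ((period_lattice \<tau> - F) \<union> F)"
    by (rule summable_on_union[OF _ summable_on_finite[OF fin]])
  thus ?thesis by (rule summable_on_subset_banach) auto
qed

text \<open>Subtracting 1 / \<omega>^2 leaves the numerator z (2 \<omega> - z), a gain of one order
  of decay. The constant is 10 = (5/2) / (1/2)^2, from upper and lower bounds of 2 \<omega> - z and
  z - \<omega> in terms of \<omega>.\<close>

lemma wp_term_bound:
  fixes z \<omega> :: complex
  assumes "norm \<omega> \<ge> 2 * norm z" "norm z \<le> R"
  shows "norm (1 / (z - \<omega>) ^ 2 - 1 / \<omega> ^ 2) \<le> 10 * R * (1 / norm \<omega> ^ 3 :: real)"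
proof (cases "\<omega> = 0")
  case True
  thus ?thesis using assms by auto
next
  case False
  have "norm (z - \<omega>) \<ge> norm \<omega> - norm z" by (metis norm_minus_commute norm_triangle_ineq2)
  hence zw: "norm (z - \<omega>) \<ge> norm \<omega> / 2" using assms by linarith
  hence zw0: "z \<noteq> \<omega>" using False by auto
  have R: "R \<ge> 0" using assms(2) norm_ge_zero order_trans by blast
  have "1 / (z - \<omega>) ^ 2 - 1 / \<omega> ^ 2 = z * (2 * \<omega> - z) / ((z - \<omega>) ^ 2 * \<omega> ^ 2)"
  proof -
    have "(z - \<omega>) ^ 2 \<noteq> 0" "\<omega> ^ 2 \<noteq> 0" using False zw0 by auto
    thus ?thesis by (subst diff_frac_eq) (auto simp: algebra_simps power2_eq_square)
  qed
  hence "norm (1 / (z - \<omega>) ^ 2 - 1 / \<omega> ^ 2) =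
           norm z * norm (2 * \<omega> - z) / (norm (z - \<omega>) ^ 2 * norm \<omega> ^ 2)"
    by (simp add: norm_mult norm_divide norm_power)
  also have "\<dots> \<le> R * (5/2 * norm \<omega>) / ((norm \<omega> / 2) ^ 2 * norm \<omega> ^ 2)"
  proof (intro frac_le mult_mono power_mono zw)
    have "norm (2 * \<omega> - z) \<le> norm (2 * \<omega>) + norm z" by (rule norm_triangle_ineq4)
    thus "norm (2 * \<omega> - z) \<le> 5/2 * norm \<omega>" using assms(1) by simp
  qed (use assms False R in auto)
  also have "\<dots> = 10 * R * (1 / norm \<omega> ^ 3)"
    using False by (simp add: field_simps power2_eq_square power3_eq_cube)
  finally show ?thesis .
qed

lemma wp_terms_summable:
  assumes "\<tau> \<in> uhp"
  shows "(\<lambda>\<omega>. norm (1 / (z - \<omega>) ^ 2 - 1 / \<omega> ^ 2)) summable_on period_lattice \<tau>"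
proof -
  define F where "F = {\<omega> \<in> period_lattice \<tau>. norm \<omega> \<le> 2 * norm z}"
  have fin: "finite F" unfolding F_def by (rule finite_period_lattice_ball[OF assms(1)])
  have "(\<lambda>\<omega>. norm (1 / (z - \<omega>) ^ 2 - 1 / \<omega> ^ 2)) summable_on (period_lattice \<tau> - F)"
  proof (rule summable_on_comparison_test)
    show "(\<lambda>\<omega>. 10 * norm z * (1 / norm \<omega> ^ 3)) summable_on (period_lattice \<tau> - F)"
      by (intro summable_on_cmult_right summable_on_subset_banach[OF lattice_cube_summable[OF assms(1)]]) auto
    fix \<omega> assume "\<omega> \<in> period_lattice \<tau> - F"
    thus "norm (1 / (z - \<omega>) ^ 2 - 1 / \<omega> ^ 2) \<le> 10 * norm z * (1 / norm \<omega> ^ 3)"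
      by (intro wp_term_bound) (auto simp: F_def)
  qed auto
  hence "(\<lambda>\<omega>. norm (1 / (z - \<omega>) ^ 2 - 1 / \<omega> ^ 2)) summable_on ((period_lattice \<tau> - F) \<union> F)"
    by (rule summable_on_union[OF _ summable_on_finite[OF fin]])
  thus ?thesis by (rule summable_on_subset_banach) auto
qed

lemmas wp_terms_summable' = abs_summable_summable[OF wp_terms_summable]

text \<open>With \<open>1 / 0 = 0\<close>, the term of \<open>\<omega> = 0\<close> is the principal part, so that the sum
  runs over the whole lattice.\<close>
lemma wp_altdef:
  assumes "\<tau> \<in> uhp"
  shows "wp z \<tau> = (\<Sum>\<^sub>\<infinity>\<omega>\<in>period_lattice \<tau>. 1 / (z - \<omega>) ^ 2 - 1 / \<omega> ^ 2)"
proof -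
  let ?t = "\<lambda>\<omega>. 1 / (z - \<omega>) ^ 2 - 1 / \<omega> ^ 2"
  have "(\<Sum>\<^sub>\<infinity>\<omega>\<in>insert 0 (period_lattice \<tau> - {0}). ?t \<omega>) = ?t 0 + (\<Sum>\<^sub>\<infinity>\<omega>\<in>period_lattice \<tau> - {0}. ?t \<omega>)"
    by (rule infsum_insert) (auto intro: summable_on_subset_banach[OF wp_terms_summable'[OF assms]])
  thus ?thesis using period_lattice_props(1)[of \<tau>] by (simp add: wp_def insert_absorb)
qed

section \<open>Parity and periodicity of the Weierstrass function\<close>

lemma infsum_diff:
  fixes f g :: "'a \<Rightarrow> complex"
  assumes "f summable_on A" "g summable_on A"
  shows "infsum (\<lambda>x. f x - g x) A = infsum f A - infsum g A"
  using infsum_add[OF assms(1) iffD2[OF summable_on_uminus assms(2)]] by (simp add: infsum_uminus)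

lemma wp_minus: "wp (-z) \<tau> = wp z \<tau>"
proof -
  have *: "(- z - \<omega>) ^ 2 = (z - (- \<omega>)) ^ 2" for \<omega> :: complex by (simp add: power2_eq_square algebra_simps)
  have "(\<Sum>\<^sub>\<infinity>\<omega>\<in>period_lattice \<tau> - {0}. 1 / (- z - \<omega>) ^ 2 - 1 / \<omega> ^ 2) =
        (\<Sum>\<^sub>\<infinity>\<omega>\<in>period_lattice \<tau> - {0}. 1 / (z - \<omega>) ^ 2 - 1 / \<omega> ^ 2)"
    by (rule infsum_reindex_bij_witness[of _ uminus uminus])
       (auto simp: * intro: period_lattice_props(6))
  thus ?thesis by (simp add: wp_def)
qed

text \<open>The difference of both sides does not depend on \<open>z\<close>, and it is its own negative
  by the substitution \<open>\<omega> \<mapsto> \<omega>\<^sub>0 - \<omega>\<close>.\<close>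
lemma wp_periodic:
  assumes \<tau>: "\<tau> \<in> uhp" and \<omega>0: "\<omega>0 \<in> period_lattice \<tau>"
  shows "wp (z + \<omega>0) \<tau> = wp z \<tau>"
proof -
  let ?L = "period_lattice \<tau>"
  have shift: "(\<Sum>\<^sub>\<infinity>\<omega>\<in>?L. f (\<omega> - \<omega>0)) = (\<Sum>\<^sub>\<infinity>\<omega>\<in>?L. f \<omega>)" for f :: "complex \<Rightarrow> complex"
    by (rule infsum_reindex_bij_witness[of _ "\<lambda>\<omega>. \<omega> + \<omega>0" "\<lambda>\<omega>. \<omega> - \<omega>0"])
       (auto intro: period_lattice_props(4,5) \<omega>0)
  have shift_sum: "(\<lambda>\<omega>. f (\<omega> - \<omega>0)) summable_on ?L" if "f summable_on ?L" for f :: "complex \<Rightarrow> complex"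
  proof -
    have "bij_betw (\<lambda>\<omega>. \<omega> - \<omega>0) ?L ?L"
      by (rule bij_betwI[of _ _ _ "\<lambda>\<omega>. \<omega> + \<omega>0"]) (auto intro: period_lattice_props(4,5) \<omega>0)
    from summable_on_reindex_bij_betw[OF this, of f] that show ?thesis by simp
  qed
  define c where "c = (\<Sum>\<^sub>\<infinity>\<omega>\<in>?L. 1 / (\<omega> - \<omega>0) ^ 2 - 1 / \<omega> ^ 2)"
  have "wp (z + \<omega>0) \<tau> - wp z \<tau> = c"
  proof -
    have "wp z \<tau> = (\<Sum>\<^sub>\<infinity>\<omega>\<in>?L. 1 / (z - (\<omega> - \<omega>0)) ^ 2 - 1 / (\<omega> - \<omega>0) ^ 2)"
      using shift[of "\<lambda>\<omega>. 1 / (z - \<omega>) ^ 2 - 1 / \<omega> ^ 2"] by (simp add: wp_altdef[OF \<tau>])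
    moreover have "(\<lambda>\<omega>. 1 / (z - (\<omega> - \<omega>0)) ^ 2 - 1 / (\<omega> - \<omega>0) ^ 2) summable_on ?L"
      using shift_sum[OF wp_terms_summable'[OF \<tau>, of z]] .
    ultimately have "wp (z + \<omega>0) \<tau> - wp z \<tau> =
        (\<Sum>\<^sub>\<infinity>\<omega>\<in>?L. (1 / (z + \<omega>0 - \<omega>) ^ 2 - 1 / \<omega> ^ 2) -
                  (1 / (z - (\<omega> - \<omega>0)) ^ 2 - 1 / (\<omega> - \<omega>0) ^ 2))"
      using wp_terms_summable'[OF \<tau>, of "z + \<omega>0"]
      by (simp add: wp_altdef[OF \<tau>] infsum_diff)
    thus ?thesis by (simp add: c_def algebra_simps)
  qed
  moreover have "c = 0"
  proof -
    have "c = (\<Sum>\<^sub>\<infinity>\<omega>\<in>?L. 1 / (\<omega>0 - \<omega> - \<omega>0) ^ 2 - 1 / (\<omega>0 - \<omega>) ^ 2)"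
      unfolding c_def
      by (rule infsum_reindex_bij_witness[of _ "\<lambda>\<omega>. \<omega>0 - \<omega>" "\<lambda>\<omega>. \<omega>0 - \<omega>"])
         (auto intro: period_lattice_props(4,5) \<omega>0)
    also have "\<dots> = (\<Sum>\<^sub>\<infinity>\<omega>\<in>?L. - (1 / (\<omega> - \<omega>0) ^ 2 - 1 / \<omega> ^ 2))"
      by (intro infsum_cong) (auto simp: power2_commute)
    also have "\<dots> = - c" unfolding c_def by (rule infsum_uminus)
    finally show ?thesis by simp
  qed
  ultimately show ?thesis by simp
qed

section \<open>The Weierstrass function\<close>

text \<open>The Weierstrass M-test over an unordered index set, so that lattice sums can be treated
  without an enumeration of the lattice.\<close>

lemma holomorphic_on_infsum:
  fixes f :: "'i \<Rightarrow> complex \<Rightarrow> complex"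
  assumes U: "open U" and hol: "\<And>i. i \<in> I \<Longrightarrow> f i holomorphic_on U"
    and bound: "\<And>i z. i \<in> I \<Longrightarrow> z \<in> U \<Longrightarrow> norm (f i z) \<le> M i" and M: "M summable_on I"
  shows "(\<lambda>z. \<Sum>\<^sub>\<infinity>i\<in>I. f i z) holomorphic_on U"
proof (rule holomorphic_onI)
  fix z assume "z \<in> U"
  then obtain r where r: "r > 0" "cball z r \<subseteq> U"
    using U open_contains_cball by blast
  have "uniform_limit (cball z r) (\<lambda>J z. (\<Sum>i\<in>J. f i z)) (\<lambda>z. (\<Sum>\<^sub>\<infinity>i\<in>I. f i z)) (finite_subsets_at_top I)"
    by (rule Weierstrass_m_test_general[OF _ M]) (use bound r in auto)
  moreover have "\<forall>\<^sub>F J in finite_subsets_at_top I. continuous_on (cball z r) (\<lambda>z. \<Sum>i\<in>J. f i z) \<and>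
      (\<lambda>z. \<Sum>i\<in>J. f i z) holomorphic_on ball z r"
  proof (rule eventually_finite_subsets_at_top_weakI)
    fix J assume "finite J" "J \<subseteq> I"
    hence "(\<lambda>z. \<Sum>i\<in>J. f i z) holomorphic_on U" by (intro holomorphic_on_sum hol) auto
    thus "continuous_on (cball z r) (\<lambda>z. \<Sum>i\<in>J. f i z) \<and> (\<lambda>z. \<Sum>i\<in>J. f i z) holomorphic_on ball z r"
      using r by (meson ball_subset_cball holomorphic_on_imp_continuous_on holomorphic_on_subset subset_trans)
  qed
  ultimately have "(\<lambda>z. \<Sum>\<^sub>\<infinity>i\<in>I. f i z) holomorphic_on ball z r"
    by (auto elim!: holomorphic_uniform_limit[rotated])
  hence "(\<lambda>z. \<Sum>\<^sub>\<infinity>i\<in>I. f i z) field_differentiable at z"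
    using r(1) by (auto simp: holomorphic_on_def at_within_open[OF _ open_ball])
  thus "(\<lambda>z. \<Sum>\<^sub>\<infinity>i\<in>I. f i z) field_differentiable at z within U"
    by (rule field_differentiable_at_within)
qed

lemma eventually_conv_radius:
  assumes "fps_conv_radius (G :: complex fps) > 0"
  shows "eventually (\<lambda>z. ereal (norm z) < fps_conv_radius G) (nhds (0::complex))"
proof -
  have "eventually (\<lambda>z. z \<in> eball 0 (fps_conv_radius G)) (nhds (0::complex))"
    using assms by (intro eventually_nhds_in_open) (auto simp: zero_ereal_def)
  thus ?thesis by eventually_elim (simp add: eball_def)
qed

lemma eval_fps_X_power_mult:
  assumes "fps_conv_radius (G :: complex fps) > 0"
  shows "eventually (\<lambda>z. eval_fps (fps_X ^ n * G) z = z ^ n * eval_fps G z) (nhds 0)"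
  using eventually_conv_radius[OF assms]
proof eventually_elim
  case (elim z)
  have "eval_fps (fps_X ^ n * G) z = eval_fps (fps_X ^ n) z * eval_fps G z"
    using elim by (intro eval_fps_mult) auto
  thus ?case by simp
qed

text \<open>If the lowest exponent m of f were below n, division by z^m would make its leading
  coefficient the limit of something bounded by C times the (n - m)-th power of the norm, hence 0.
  This turns estimates of remainders into statements on Taylor coefficients.\<close>

lemma analytic_bigo_factor:
  assumes f: "f analytic_on {0}" and bound: "eventually (\<lambda>z. norm (f z) \<le> C * norm z ^ n) (at 0)"
  obtains g where "g analytic_on {0}" "eventually (\<lambda>z. f z = z ^ n * g z) (nhds 0)"
proof -
  obtain F where F: "f has_fps_expansion F" using analytic_at_imp_has_fps_expansion_0[OF f] by blast
  hence evf: "eventually (\<lambda>z. eval_fps F z = f z) (nhds 0)" and radF: "fps_conv_radius F > 0"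
    by (simp_all add: has_fps_expansion_def)
  have le: "n \<le> subdegree F" if nz: "F \<noteq> 0"
  proof (rule ccontr)
    assume "\<not> n \<le> subdegree F"
    define m where "m = subdegree F"
    hence m: "m < n" using \<open>\<not> n \<le> subdegree F\<close> by simp
    define G where "G = fps_shift m F"
    have FG: "F = fps_X ^ m * G" unfolding G_def
      using fps_shift_times_fps_X_power[of m F] by (simp add: m_def mult.commute)
    have rad: "fps_conv_radius G > 0" using radF by (simp add: G_def)
    have "isCont (eval_fps G) 0"
      using rad by (intro analytic_at_imp_isCont analytic_on_eval_fps) (auto simp: zero_ereal_def)
    hence lim: "(eval_fps G \<longlongrightarrow> fps_nth G 0) (at 0)"
      by (simp add: isCont_def eval_fps_at_0)
    have evF: "eventually (\<lambda>z. f z = z ^ m * eval_fps G z) (nhds 0)"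
      using evf eval_fps_X_power_mult[OF rad, of m] by eventually_elim (simp add: FG)
    have "eventually (\<lambda>z. norm (eval_fps G z) \<le> C * norm z ^ (n - m)) (at 0)"
      using bound filter_leD[OF at_within_le_nhds evF] eventually_neq_at_within[of 0 0]
    proof eventually_elim
      case (elim z)
      hence "norm z ^ m * norm (eval_fps G z) \<le> C * norm z ^ (m + (n - m))"
        using m by (simp add: norm_mult norm_power)
      hence "norm z ^ m * norm (eval_fps G z) \<le> norm z ^ m * (C * norm z ^ (n - m))"
        by (simp add: power_add mult_ac)
      thus ?case using elim(3) by (subst (asm) mult_le_cancel_left_pos) auto
    qed
    moreover have "((\<lambda>z::complex. C * norm z ^ (n - m)) \<longlongrightarrow> C * norm (0::complex) ^ (n - m)) (at 0)"
      by (intro tendsto_intros)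
    hence "((\<lambda>z::complex. C * norm z ^ (n - m)) \<longlongrightarrow> 0) (at 0)" using m by (simp add: zero_power)
    ultimately have "(eval_fps G \<longlongrightarrow> 0) (at 0)" by (rule Lim_null_comparison)
    with lim have "fps_nth G 0 = 0" by (rule LIM_unique)
    thus False using nz by (simp add: G_def m_def)
  qed
  define G where "G = fps_shift n F"
  have FG: "F = fps_X ^ n * G"
  proof (cases "F = 0")
    case False
    thus ?thesis unfolding G_def using fps_shift_times_fps_X_power[OF le] by (simp add: mult.commute)
  qed (simp add: G_def)
  have rad: "fps_conv_radius G > 0" using radF by (simp add: G_def)
  show ?thesis
  proof (rule that[of "eval_fps G"])
    show "eval_fps G analytic_on {0}"
      using rad by (intro analytic_on_eval_fps) (auto simp: zero_ereal_def)
    show "eventually (\<lambda>z. f z = z ^ n * eval_fps G z) (nhds 0)"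
      using evf eval_fps_X_power_mult[OF rad, of n] by eventually_elim (simp add: FG)
  qed
qed

section \<open>Analyticity and poles of the Weierstrass function\<close>

definition wp_part :: "complex \<Rightarrow> complex \<Rightarrow> complex" where
  "wp_part \<tau> z = (\<Sum>\<^sub>\<infinity>\<omega>\<in>period_lattice \<tau> - {0}. 1 / (z - \<omega>) ^ 2 - 1 / \<omega> ^ 2)"

lemma wp_eq_part: "wp z \<tau> = 1 / z ^ 2 + wp_part \<tau> z"
  by (simp add: wp_def wp_part_def)

lemma wp_part_0: "wp_part \<tau> 0 = 0"
  by (simp add: wp_part_def)

lemma wp_part_analytic:
  assumes \<tau>: "\<tau> \<in> uhp"
  shows "wp_part \<tau> analytic_on - (period_lattice \<tau> - {0})"
proof -
  let ?L = "period_lattice \<tau>"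
  {
    fix z0 assume z0: "z0 \<in> - (?L - {0})"
    define R where "R = norm z0 + 1"
    \<comment> \<open>For lattice points outside the finite set \<open>F\<close>,
      \<open>wp_term_bound\<close> holds uniformly on \<open>ball 0 R\<close>, so the tail is
      holomorphic there and only finitely many terms have to be treated by hand.\<close>
    define F where "F = {\<omega> \<in> ?L. norm \<omega> \<le> 2 * R}"
    have fin: "finite F" unfolding F_def by (rule finite_period_lattice_ball[OF assms(1)])
    define U where "U = ball 0 R - (F - {0})"
    have U: "open U" unfolding U_def using fin by (intro open_Diff finite_imp_closed) auto
    have z0U: "z0 \<in> U" using z0 by (auto simp: U_def R_def F_def)
    let ?t = "\<lambda>\<omega> z. 1 / (z - \<omega>) ^ 2 - 1 / \<omega> ^ 2 :: complex"
    have "(\<lambda>z. (\<Sum>\<omega>\<in>F - {0}. ?t \<omega> z)) holomorphic_on U"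
      by (intro holomorphic_intros) (auto simp: U_def)
    moreover have "(\<lambda>z. \<Sum>\<^sub>\<infinity>\<omega>\<in>?L - F. ?t \<omega> z) holomorphic_on U"
    proof (rule holomorphic_on_infsum[OF U])
      have *: "norm \<omega> > 2 * R" if "\<omega> \<in> ?L - F" for \<omega>
        using that by (auto simp: F_def)
      show "?t \<omega> holomorphic_on U" if "\<omega> \<in> ?L - F" for \<omega>
        using *[OF that] by (intro holomorphic_intros) (use norm_ge_zero[of z0] in \<open>auto simp: U_def R_def simp del: norm_ge_zero\<close>)
      show "norm (?t \<omega> z) \<le> 10 * R * (1 / norm \<omega> ^ 3)" if "\<omega> \<in> ?L - F" "z \<in> U" for \<omega> z
        using *[OF that(1)] that(2) by (intro wp_term_bound) (auto simp: U_def)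
      show "(\<lambda>\<omega>. 10 * R * (1 / norm \<omega> ^ 3)) summable_on (?L - F)"
        by (intro summable_on_cmult_right summable_on_subset_banach[OF lattice_cube_summable[OF \<tau>]]) auto
    qed
    ultimately have "(\<lambda>z. (\<Sum>\<omega>\<in>F - {0}. ?t \<omega> z) + (\<Sum>\<^sub>\<infinity>\<omega>\<in>?L - F. ?t \<omega> z)) holomorphic_on U"
      by (rule holomorphic_on_add)
    moreover have "(\<Sum>\<omega>\<in>F - {0}. ?t \<omega> z) + (\<Sum>\<^sub>\<infinity>\<omega>\<in>?L - F. ?t \<omega> z) = wp_part \<tau> z" for z
    proof -
      have "0 \<in> F" using period_lattice_props(1)[of \<tau>] norm_ge_zero[of z0]
        by (auto simp: F_def R_def simp del: norm_ge_zero)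
      hence "?L - {0} = (F - {0}) \<union> (?L - F)"
        by (auto simp: F_def)
      hence "wp_part \<tau> z = infsum (\<lambda>\<omega>. ?t \<omega> z) ((F - {0}) \<union> (?L - F))"
        by (simp add: wp_part_def)
      also have "\<dots> = infsum (\<lambda>\<omega>. ?t \<omega> z) (F - {0}) + infsum (\<lambda>\<omega>. ?t \<omega> z) (?L - F)"
        using fin by (intro infsum_Un_disjoint summable_on_subset_banach[OF wp_terms_summable'[OF \<tau>]])
                     (auto simp: F_def)
      finally show ?thesis using fin by simp
    qed
    ultimately have "wp_part \<tau> holomorphic_on U" by simp
    hence "wp_part \<tau> analytic_on U" using U by (simp add: analytic_on_open)
    hence "wp_part \<tau> analytic_on {z0}" by (rule analytic_on_subset) (use z0U in auto)
  }
  thus ?thesis by (subst analytic_on_analytic_at) auto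
qed

lemma eventually_not_in_lattice:
  assumes "\<tau> \<in> uhp"
  shows "eventually (\<lambda>z. z \<notin> period_lattice \<tau>) (at z0)"
proof -
  define F where "F = {\<omega> \<in> period_lattice \<tau>. norm \<omega> \<le> norm z0 + 1}"
  have fin: "finite F" unfolding F_def by (rule finite_period_lattice_ball[OF assms(1)])
  have "open (ball 0 (norm z0 + 1) - (F - {z0}))"
    using fin by (intro open_Diff finite_imp_closed) auto
  hence "eventually (\<lambda>z. z \<in> ball 0 (norm z0 + 1) - (F - {z0}) - {z0}) (at z0)"
    by (intro eventually_at_in_open) auto
  thus ?thesis by eventually_elim (auto simp: F_def)
qed

lemma wp_analytic:
  assumes \<tau>: "\<tau> \<in> uhp"
  shows "(\<lambda>z. wp z \<tau>) analytic_on - period_lattice \<tau>"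
proof -
  have "wp_part \<tau> analytic_on - period_lattice \<tau>"
    using wp_part_analytic[OF \<tau>] by (rule analytic_on_subset) auto
  thus ?thesis unfolding wp_eq_part
    by (intro analytic_intros) (use period_lattice_props(1) in auto)
qed

lemma wp_analytic_at: "\<tau> \<in> uhp \<Longrightarrow> z \<notin> period_lattice \<tau> \<Longrightarrow> (\<lambda>z. wp z \<tau>) analytic_on {z}"
  by (rule analytic_on_subset[OF wp_analytic]) auto

lemma wp_part_analytic_0: "\<tau> \<in> uhp \<Longrightarrow> wp_part \<tau> analytic_on {0}"
  by (rule analytic_on_subset[OF wp_part_analytic]) auto

lemma wp_meromorphic:
  assumes \<tau>: "\<tau> \<in> uhp"
  shows "(\<lambda>z. wp z \<tau>) meromorphic_on UNIV"
proof -
  have "(\<lambda>z. wp z \<tau>) meromorphic_on {z}" for z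
  proof (cases "z \<in> period_lattice \<tau>")
    case False
    thus ?thesis by (intro analytic_on_imp_meromorphic_on wp_analytic_at \<tau>)
  next
    case True
    have "(\<lambda>w. wp (w - z) \<tau>) = (\<lambda>w. wp w \<tau>)"
    proof
      show "wp (w - z) \<tau> = wp w \<tau>" for w using wp_periodic[OF \<tau> True, of "w - z"] by simp
    qed
    moreover have "(\<lambda>w. wp w \<tau>) meromorphic_on {0}"
      unfolding wp_eq_part
      by (intro meromorphic_intros analytic_on_imp_meromorphic_on[OF wp_part_analytic_0[OF \<tau>]])
    hence "(\<lambda>w. wp (w - z) \<tau>) meromorphic_on {z}"
      by (rule meromorphic_on_compose) (auto intro!: analytic_intros)
    ultimately show ?thesis by simp
  qed
  thus ?thesis by (subst meromorphic_on_meromorphic_at) auto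
qed

lemma wp_is_pole_0:
  assumes \<tau>: "\<tau> \<in> uhp"
  shows "is_pole (\<lambda>z. wp z \<tau>) 0"
proof -
  have "(\<lambda>z. wp z \<tau>) = (\<lambda>z. (1 + z ^ 2 * wp_part \<tau> z) / z ^ 2)"
  proof
    show "wp z \<tau> = (1 + z ^ 2 * wp_part \<tau> z) / z ^ 2" for z
      by (cases "z = 0") (auto simp: wp_eq_part wp_part_0 add_divide_distrib)
  qed
  moreover have "is_pole (\<lambda>z. (1 + z ^ 2 * wp_part \<tau> z) / z ^ 2) 0"
  proof -
    obtain U where U: "open U" "0 \<in> U" "wp_part \<tau> holomorphic_on U"
      using wp_part_analytic_0[OF \<tau>] by (auto simp: analytic_at)
    show ?thesis
      by (rule is_pole_basic'[OF _ U(1,2)]) (auto intro!: holomorphic_intros U(3))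
  qed
  ultimately show ?thesis by simp
qed

lemma wp_is_pole_iff:
  assumes \<tau>: "\<tau> \<in> uhp"
  shows "is_pole (\<lambda>z. wp z \<tau>) z \<longleftrightarrow> z \<in> period_lattice \<tau>"
proof
  assume "is_pole (\<lambda>z. wp z \<tau>) z"
  thus "z \<in> period_lattice \<tau>" using wp_analytic_at[OF \<tau>] analytic_at_imp_no_pole by blast
next
  assume z: "z \<in> period_lattice \<tau>"
  have "(\<lambda>w. wp (z + w) \<tau>) = (\<lambda>w. wp w \<tau>)"
  proof
    show "wp (z + w) \<tau> = wp w \<tau>" for w using wp_periodic[OF \<tau> z, of w] by (simp add: add.commute)
  qed
  hence "is_pole (\<lambda>w. wp (z + w) \<tau>) 0" using wp_is_pole_0[OF \<tau>] by simp
  thus "is_pole (\<lambda>z. wp z \<tau>) z" by (simp add: is_pole_shift_0[of _ z])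
qed

definition wp' :: "complex \<Rightarrow> complex \<Rightarrow> complex" where
  "wp' z \<tau> = deriv (\<lambda>z. wp z \<tau>) z"

lemma wp'_periodic:
  assumes "\<tau> \<in> uhp" "\<omega> \<in> period_lattice \<tau>"
  shows "wp' (z + \<omega>) \<tau> = wp' z \<tau>"
proof -
  have "wp (z + \<omega> + w) \<tau> = wp (z + w) \<tau>" for w
    using wp_periodic[OF assms, of "z + w"] by (simp add: add_ac)
  hence "((\<lambda>z. wp z \<tau>) \<circ> (\<lambda>x. z + \<omega> + x)) = ((\<lambda>z. wp z \<tau>) \<circ> (\<lambda>x. z + x))"
    by (simp add: fun_eq_iff)
  thus ?thesis
    unfolding wp'_def deriv_shift_0[of _ "z + \<omega>"] deriv_shift_0[of _ z] by simp
qed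

lemma wp_has_deriv:
  assumes "\<tau> \<in> uhp" "z \<notin> period_lattice \<tau>"
  shows "((\<lambda>z. wp z \<tau>) has_field_derivative wp' z \<tau>) (at z)"
  using analytic_on_imp_differentiable_at[OF wp_analytic_at[OF assms]]
  by (simp add: wp'_def DERIV_deriv_iff_field_differentiable)

lemma wp'_minus:
  assumes "\<tau> \<in> uhp" "z \<notin> period_lattice \<tau>"
  shows "wp' (-z) \<tau> = - wp' z \<tau>"
proof -
  have *: "- z \<notin> period_lattice \<tau>" using assms(2) period_lattice_props(6)[of "-z" \<tau>] by auto
  have "((\<lambda>z. wp (-z) \<tau>) has_field_derivative wp' (-z) \<tau> * (-1)) (at z)"
    by (rule DERIV_chain2[where f = "\<lambda>z. wp z \<tau>" and g = uminus])
       (auto intro!: wp_has_deriv[OF assms(1) *] derivative_eq_intros)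
  thus ?thesis using DERIV_unique[OF _ wp_has_deriv[OF assms]] by (force simp: wp_minus)
qed

text \<open>The points z and -z differ by a period, while the derivative is odd.\<close>

lemma wp'_eq_0:
  assumes "\<tau> \<in> uhp" "z \<notin> period_lattice \<tau>" "2 * z \<in> period_lattice \<tau>"
  shows "wp' z \<tau> = 0"
proof -
  have "wp' (-z) \<tau> = wp' (-z + 2 * z) \<tau>" by (rule wp'_periodic[symmetric]) (use assms in auto)
  thus ?thesis using wp'_minus[OF assms(1,2)] by simp
qed

section \<open>Taylor expansion at the origin and the differential equation\<close>

lemma lattice_odd_sum:
  assumes "odd k"
  shows "(\<Sum>\<^sub>\<infinity>\<omega>\<in>period_lattice \<tau> - {0}. 1 / \<omega> ^ k) = 0"
proof -
  have "(\<Sum>\<^sub>\<infinity>\<omega>\<in>period_lattice \<tau> - {0}. 1 / \<omega> ^ k) = (\<Sum>\<^sub>\<infinity>\<omega>\<in>period_lattice \<tau> - {0}. - (1 / \<omega> ^ k))"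
    by (rule infsum_reindex_bij_witness[of _ uminus uminus])
       (use assms in \<open>auto intro: period_lattice_props(6)\<close>)
  also have "\<dots> = - (\<Sum>\<^sub>\<infinity>\<omega>\<in>period_lattice \<tau> - {0}. 1 / \<omega> ^ k)" by (rule infsum_uminus)
  finally show ?thesis by simp
qed

text \<open>The difference is exactly t^5 (6 - 5 t) / (1 - t)^2, and 34 = (6 + 5/2) /
  (1/2)^2.\<close>

lemma inverse_square_taylor:
  fixes t :: complex
  assumes "norm t \<le> 1/2"
  shows "norm (1 / (1 - t) ^ 2 - 1 - 2 * t - 3 * t ^ 2 - 4 * t ^ 3 - 5 * t ^ 4) \<le> 34 * norm t ^ 5"
proof -
  have t: "norm (1 - t) \<ge> 1/2"
    using norm_triangle_ineq2[of 1 t] assms by simp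
  hence t1: "1 - t \<noteq> 0" by auto
  have "(1 / (1 - t) ^ 2 - 1 - 2 * t - 3 * t ^ 2 - 4 * t ^ 3 - 5 * t ^ 4) * (1 - t) ^ 2 =
          1 - (1 + 2 * t + 3 * t ^ 2 + 4 * t ^ 3 + 5 * t ^ 4) * (1 - t) ^ 2"
    using t1 by (simp add: left_diff_distrib distrib_right)
  also have "\<dots> = t ^ 5 * (6 - 5 * t)" by (simp add: eval_nat_numeral algebra_simps)
  finally have "1 / (1 - t) ^ 2 - 1 - 2 * t - 3 * t ^ 2 - 4 * t ^ 3 - 5 * t ^ 4 = t ^ 5 * (6 - 5 * t) / (1 - t) ^ 2"
    using t1 by (subst eq_divide_eq) auto
  hence "norm (1 / (1 - t) ^ 2 - 1 - 2 * t - 3 * t ^ 2 - 4 * t ^ 3 - 5 * t ^ 4) =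
           norm t ^ 5 * norm (6 - 5 * t) / norm (1 - t) ^ 2"
    by (simp add: norm_mult norm_divide norm_power)
  also have "\<dots> \<le> norm t ^ 5 * (17/2) / (1/2) ^ 2"
  proof (intro frac_le mult_left_mono power_mono t)
    show "norm (6 - 5 * t) \<le> 17/2"
      using norm_triangle_ineq4[of 6 "5 * t"] assms by (simp add: norm_mult)
  qed auto
  finally show ?thesis by (simp add: power2_eq_square)
qed

lemma lattice_norm_ge:
  assumes \<tau>: "\<tau> \<in> uhp"
  obtains r where "r > 0" "\<And>\<omega>. \<omega> \<in> period_lattice \<tau> - {0} \<Longrightarrow> norm \<omega> \<ge> 2 * r"
proof -
  obtain B where B: "B > 0" "\<And>p. of_int (\<bar>fst p\<bar> + \<bar>snd p\<bar>) \<le> B * norm (lattice_point \<tau> p)"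
    using lattice_point_norm_ge[OF assms] by blast
  define r where "r = 1 / (2 * B)"
  have "norm \<omega> \<ge> 2 * r" if "\<omega> \<in> period_lattice \<tau> - {0}" for \<omega>
  proof -
    obtain p where p: "\<omega> = lattice_point \<tau> p" using \<open>\<omega> \<in> _\<close> by (auto simp: period_lattice_range)
    have "p \<noteq> 0" using \<open>\<omega> \<in> _\<close> p lattice_point_eq_0_iff[OF \<tau>] by auto
    hence "\<bar>fst p\<bar> + \<bar>snd p\<bar> \<ge> 1" by (cases p) (auto simp: zero_prod_def)
    hence "1 \<le> B * norm \<omega>" using B(2)[of p] unfolding p by linarith
    thus ?thesis using B(1) by (simp add: r_def field_simps)
  qed
  moreover have "r > 0" using B by (simp add: r_def)
  ultimately show ?thesis using that by blast
qed

text \<open>Each term is expanded in z / \<omega>, and odd powers cancel between \<omega> and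
  -\<omega>. The Taylor coefficients 3 and 5 turn 60 and 140 into 20 and 28. Keeping a remainder of
  order 5 is enough for the differential equation and avoids interchanging two infinite
  sums.\<close>

lemma wp_part_taylor:
  assumes \<tau>: "\<tau> \<in> uhp"
  obtains C where "eventually (\<lambda>z. norm (wp_part \<tau> z - g2 \<tau> / 20 * z ^ 2 - g3 \<tau> / 28 * z ^ 4) \<le> C * norm z ^ 5) (nhds 0)"
proof -
  let ?L = "period_lattice \<tau> - {0}"
  obtain r where r: "r > 0" and L: "\<And>\<omega>. \<omega> \<in> ?L \<Longrightarrow> norm \<omega> \<ge> 2 * r"
    using lattice_norm_ge[OF \<tau>] by blast
  have summ': "(\<lambda>\<omega>. 1 / norm \<omega> ^ k) summable_on ?L" if "k \<ge> 3" for k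
    by (rule summable_on_subset_banach[OF lattice_power_summable[OF \<tau> that]]) auto
  have summ: "(\<lambda>\<omega>::complex. 1 / \<omega> ^ k) summable_on ?L" if "k \<ge> 3" for k
    by (rule abs_summable_summable) (use summ'[OF that] in \<open>simp add: norm_divide norm_power\<close>)
  define C where "C = 34 * (\<Sum>\<^sub>\<infinity>\<omega>\<in>?L. 1 / norm \<omega> ^ 7)"
  have bound: "norm (wp_part \<tau> z - g2 \<tau> / 20 * z ^ 2 - g3 \<tau> / 28 * z ^ 4) \<le> C * norm z ^ 5"
    if z: "norm z < r" for z
  proof -
    define p where "p = (\<lambda>\<omega>. 2 * z * (1 / \<omega> ^ 3) + 3 * z ^ 2 * (1 / \<omega> ^ 4) + 4 * z ^ 3 * (1 / \<omega> ^ 5) + 5 * z ^ 4 * (1 / \<omega> ^ 6))"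
    let ?t = "\<lambda>\<omega>. 1 / (z - \<omega>) ^ 2 - 1 / \<omega> ^ 2"
    have p: "(p has_sum (2 * z * 0 + 3 * z ^ 2 * (g2 \<tau> / 60) + 4 * z ^ 3 * 0 + 5 * z ^ 4 * (g3 \<tau> / 140))) ?L"
      unfolding p_def
    proof (intro has_sum_add has_sum_cmult_right)
      show "((\<lambda>\<omega>. 1 / \<omega> ^ 3) has_sum 0) ?L" "((\<lambda>\<omega>. 1 / \<omega> ^ 5) has_sum 0) ?L"
        using has_sum_infsum[OF summ[of 3]] has_sum_infsum[OF summ[of 5]]
              lattice_odd_sum[of 3 \<tau>] lattice_odd_sum[of 5 \<tau>] by simp_all
      show "((\<lambda>\<omega>. 1 / \<omega> ^ 4) has_sum (g2 \<tau> / 60)) ?L" "((\<lambda>\<omega>. 1 / \<omega> ^ 6) has_sum (g3 \<tau> / 140)) ?L"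
        using has_sum_infsum[OF summ[of 4]] has_sum_infsum[OF summ[of 6]] by (simp_all add: g2_def g3_def)
    qed
    have "(?t has_sum wp_part \<tau> z) ?L"
      unfolding wp_part_def
      by (intro has_sum_infsum summable_on_subset_banach[OF wp_terms_summable'[OF \<tau>]]) auto
    from has_sum_add[OF this has_sum_uminusI[OF p]]
    have 1: "((\<lambda>\<omega>. ?t \<omega> - p \<omega>) has_sum (wp_part \<tau> z - g2 \<tau> / 20 * z ^ 2 - g3 \<tau> / 28 * z ^ 4)) ?L"
      by (simp add: algebra_simps)
    have 2: "((\<lambda>\<omega>. 34 * norm z ^ 5 * (1 / norm \<omega> ^ 7)) has_sum (34 * norm z ^ 5 * (\<Sum>\<^sub>\<infinity>\<omega>\<in>?L. 1 / norm \<omega> ^ 7))) ?L"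
      by (intro has_sum_cmult_right has_sum_infsum summ') auto
    have "norm (wp_part \<tau> z - g2 \<tau> / 20 * z ^ 2 - g3 \<tau> / 28 * z ^ 4) \<le> 34 * norm z ^ 5 * (\<Sum>\<^sub>\<infinity>\<omega>\<in>?L. 1 / norm \<omega> ^ 7)"
    proof (rule norm_infsum_le[OF 1 2])
      fix \<omega> assume \<omega>: "\<omega> \<in> ?L"
      hence \<omega>0: "\<omega> \<noteq> 0" by auto
      define t where "t = z / \<omega>"
      have t: "norm t \<le> 1/2" using L[OF \<omega>] z \<omega>0 by (simp add: t_def norm_divide field_simps)
      have z_eq: "z = t * \<omega>" using \<omega>0 by (simp add: t_def)
      have "(z - \<omega>) ^ 2 = \<omega> ^ 2 * (1 - t) ^ 2" unfolding z_eq by (simp add: power2_eq_square algebra_simps)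
      hence t1: "?t \<omega> = 1 / \<omega> ^ 2 * (1 / (1 - t) ^ 2) - 1 / \<omega> ^ 2" by simp
      have "p \<omega> = 1 / \<omega> ^ 2 * (2 * t + 3 * t ^ 2 + 4 * t ^ 3 + 5 * t ^ 4)"
        using \<omega>0 unfolding p_def z_eq by (simp add: field_simps) (simp add: eval_nat_numeral algebra_simps)
      with t1 have "?t \<omega> - p \<omega> = 1 / \<omega> ^ 2 * (1 / (1 - t) ^ 2 - 1 - 2 * t - 3 * t ^ 2 - 4 * t ^ 3 - 5 * t ^ 4)"
        by (simp only: ring_distribs) simp
      hence "norm (?t \<omega> - p \<omega>) = 1 / norm \<omega> ^ 2 * norm (1 / (1 - t) ^ 2 - 1 - 2 * t - 3 * t ^ 2 - 4 * t ^ 3 - 5 * t ^ 4)"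
        by (simp add: norm_mult norm_divide norm_power)
      also have "\<dots> \<le> 1 / norm \<omega> ^ 2 * (34 * norm t ^ 5)"
        by (intro mult_left_mono inverse_square_taylor t) auto
      also have "\<dots> = 34 * norm z ^ 5 * (1 / norm \<omega> ^ 7)"
        using \<omega>0 by (simp add: t_def norm_divide power_divide eval_nat_numeral)
      finally show "norm (?t \<omega> - p \<omega>) \<le> 34 * norm z ^ 5 * (1 / norm \<omega> ^ 7)" .
    qed
    thus ?thesis by (simp add: C_def mult_ac)
  qed
  have "eventually (\<lambda>z. z \<in> ball 0 r) (nhds (0 :: complex))"
    using r by (intro eventually_nhds_in_open) auto
  hence "eventually (\<lambda>z. norm (wp_part \<tau> z - g2 \<tau> / 20 * z ^ 2 - g3 \<tau> / 28 * z ^ 4) \<le> C * norm z ^ 5) (nhds 0)"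
    by eventually_elim (rule bound, simp)
  thus ?thesis by (rule that)
qed

text \<open>The value of a meromorphic function at a single point carries no information, so this
  form of the identity theorem speaks of punctured neighbourhoods in hypothesis and
  conclusion.\<close>

lemma meromorphic_identity:
  assumes "f meromorphic_on A" "open A" "connected A" "z0 \<in> A" "\<exists>\<^sub>F z in at z0. f z = c" "z \<in> A"
  shows "\<forall>\<^sub>F w in at z. f w = c"
proof -
  have "\<not> (\<forall>\<^sub>\<approx>x\<in>A. f x \<noteq> c)"
    using assms(2,4,5) by (auto simp: eventually_cosparse_open_eq frequently_def)
  hence "\<forall>\<^sub>\<approx>x\<in>A. f x = c"
    using meromorphic_imp_constant_or_avoid[OF assms(1-3), of c] by blast
  thus ?thesis using assms(2,6) by (auto simp: eventually_cosparse_open_eq)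
qed

text \<open>After removal of the singularities, the values are those taken on a compact set
  containing a period parallelogram, and Liouville applies. The conclusion is about limits because f
  itself may have arbitrary values at removable singularities, as the lattice points in
  \<open>wp_ode\<close> are.\<close>

lemma elliptic_no_poles_imp_const:
  assumes \<tau>: "\<tau> \<in> uhp" and mer: "f meromorphic_on UNIV" and np: "\<And>z. \<not> is_pole f z"
    and per: "\<And>z \<omega>. \<omega> \<in> period_lattice \<tau> \<Longrightarrow> f (z + \<omega>) = f z"
  obtains c where "\<And>z. f \<midarrow>z\<rightarrow> c"
proof -
  define g where "g = remove_sings f"
  have iso: "isolated_singularity_at f z" for z
    using mer by (meson UNIV_I meromorphic_onE)
  have "g nicely_meromorphic_on UNIV"
    unfolding g_def by (rule remove_sings_nicely_meromorphic[OF mer])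
  moreover have "\<not> is_pole g z" for z
    unfolding g_def using iso np by simp
  ultimately have "g analytic_on UNIV" by (intro nicely_meromorphic_without_singularities) auto
  hence hol: "g holomorphic_on UNIV" by (rule analytic_imp_holomorphic)
  have g_per: "g (z + \<omega>) = g z" if "\<omega> \<in> period_lattice \<tau>" for z \<omega>
  proof -
    have "f (z + \<omega> + w) = f (z + w)" for w
      using per[OF that, of "z + w"] by (simp add: add_ac)
    thus ?thesis unfolding g_def by (subst (1 2) remove_sings_shift_0) simp
  qed
  have "range g \<subseteq> g ` cball 0 (1 + norm \<tau>)"
  proof safe
    fix z
    define y where "y = Im z / Im \<tau>"
    define x where "x = Re (z - of_real y * \<tau>)"
    have im: "Im \<tau> > 0" using \<tau> by (rule uhp_D)
    have z: "z = of_real x + of_real y * \<tau>"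
      using im by (simp add: complex_eq_iff x_def y_def)
    define \<omega> where "\<omega> = lattice_point \<tau> (\<lfloor>x\<rfloor>, \<lfloor>y\<rfloor>)"
    have \<omega>: "\<omega> \<in> period_lattice \<tau>" by (simp add: \<omega>_def period_lattice_range)
    have "norm (z - \<omega>) \<le> 1 + norm \<tau>"
    proof -
      have "z - \<omega> = of_real (frac x) + of_real (frac y) * \<tau>"
        by (simp add: \<omega>_def z lattice_point_def frac_def algebra_simps)
      also have "norm \<dots> \<le> norm (of_real (frac x) :: complex) + norm (of_real (frac y) * \<tau>)"
        by (rule norm_triangle_ineq)
      also have "\<dots> \<le> 1 + 1 * norm \<tau>"
        unfolding norm_mult using frac_lt_1[of x] frac_lt_1[of y]
        by (intro add_mono mult_right_mono) auto
      finally show ?thesis by simp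
    qed
    moreover have "g (z - \<omega>) = g z" using g_per[OF \<omega>, of "z - \<omega>"] by simp
    ultimately show "g z \<in> g ` cball 0 (1 + norm \<tau>)"
      by (intro image_eqI[of _ _ "z - \<omega>"]) auto
  qed
  moreover have "compact (g ` cball 0 (1 + norm \<tau>))"
    using hol by (intro compact_continuous_image holomorphic_on_imp_continuous_on)
                 (auto intro: holomorphic_on_subset)
  ultimately have "bounded (range g)" using compact_imp_bounded bounded_subset by blast
  then obtain c where c: "\<And>z. g z = c"
    using Liouville_theorem[OF hol] by (auto simp: constant_on_def)
  have "f \<midarrow>z\<rightarrow> c" for z
  proof -
    have "eventually (\<lambda>w. f w = c) (at z)"
      using eventually_remove_sings_eq_at[OF iso[of z]] by eventually_elim (use c in \<open>simp add: g_def\<close>)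
    thus ?thesis by (rule tendsto_eventually)
  qed
  thus ?thesis by (rule that)
qed

text \<open>With \<open>\<alpha>\<close> and \<open>\<beta>\<close> the Taylor coefficients of z^2
  and z^4 of the regular part, the polar and the constant terms of the combination cancel
  identically.\<close>

lemma wp_ode_local:
  assumes \<tau>: "\<tau> \<in> uhp"
  shows "(\<lambda>z. wp' z \<tau> ^ 2 - 4 * wp z \<tau> ^ 3 + g2 \<tau> * wp z \<tau> + g3 \<tau>) \<midarrow>0\<rightarrow> 0"
proof -
  define \<alpha> \<beta> where "\<alpha> = g2 \<tau> / 20" and "\<beta> = g3 \<tau> / 28"
  define P where "P = wp_part \<tau>"
  have P: "P analytic_on {0}" unfolding P_def by (rule wp_part_analytic_0[OF \<tau>])
  obtain C where C: "eventually (\<lambda>z. norm (P z - \<alpha> * z ^ 2 - \<beta> * z ^ 4) \<le> C * norm z ^ 5) (nhds 0)"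
    using wp_part_taylor[OF \<tau>] unfolding P_def \<alpha>_def \<beta>_def by blast
  have "(\<lambda>z. P z - \<alpha> * z ^ 2 - \<beta> * z ^ 4) analytic_on {0}"
    by (intro analytic_intros P)
  from analytic_bigo_factor[OF this filter_leD[OF at_within_le_nhds C]]
  obtain R where R: "R analytic_on {0}" "eventually (\<lambda>z. P z - \<alpha> * z ^ 2 - \<beta> * z ^ 4 = z ^ 5 * R z) (nhds 0)"
    by blast
  define R' where "R' = deriv R"
  have R': "R' analytic_on {0}" unfolding R'_def by (intro analytic_intros R(1))
  obtain U where U: "open U" "0 \<in> U" "R holomorphic_on U"
    using R(1) by (auto simp: analytic_at)
  obtain V where V: "open V" "0 \<in> V" "\<And>z. z \<in> V \<Longrightarrow> P z - \<alpha> * z ^ 2 - \<beta> * z ^ 4 = z ^ 5 * R z"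
    using R(2) unfolding eventually_nhds by blast
  define S where "S = (\<lambda>z. 5 * R z + z * R' z)"
  define a b where "a = (\<lambda>z. 2 * \<alpha> + 4 * \<beta> * z ^ 2 + z ^ 3 * S z)" and "b = (\<lambda>z. \<alpha> + \<beta> * z ^ 2 + z ^ 3 * R z)"
  have contR: "isCont R 0" "isCont R' 0"
    using R(1) R' analytic_at_imp_isCont by blast+
  have contS: "isCont S 0" unfolding S_def by (intro continuous_intros contR)
  \<comment> \<open>This is what remains after the cancellation; each summand has a factor z and a
    continuous cofactor.\<close>
  define E where "E = (\<lambda>z. - z * (4 * S z + 12 * R z) + z ^ 2 * a z ^ 2 - 12 * z ^ 2 * b z ^ 2
                          - 4 * z ^ 6 * b z ^ 3 + 20 * \<alpha> * z ^ 2 * b z)"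
  have "isCont E 0" unfolding E_def a_def b_def by (intro continuous_intros contR contS)
  hence E0: "E \<midarrow>0\<rightarrow> 0" by (simp add: isCont_def E_def)
  have "eventually (\<lambda>z. z \<in> U \<inter> V - {0}) (at 0)"
    using U V by (intro eventually_at_in_open) auto
  moreover have "eventually (\<lambda>z. z \<notin> period_lattice \<tau>) (at 0)" by (rule eventually_not_in_lattice[OF \<tau>])
  ultimately have "eventually (\<lambda>z. E z = wp' z \<tau> ^ 2 - 4 * wp z \<tau> ^ 3 + g2 \<tau> * wp z \<tau> + g3 \<tau>) (at 0)"
  proof eventually_elim
    case (elim z)
    hence z: "z \<in> U" "z \<in> V" "z \<noteq> 0" "z \<notin> period_lattice \<tau>" by auto
    \<comment> \<open>With \<open>i\<close> as a letter subject to \<open>i * z = 1\<close>,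
      everything below is polynomial, and negative powers of z need no division.\<close>
    define i where "i = 1 / z"
    have i: "i * z = 1" using z(3) by (simp add: i_def)
    have Pz: "P z = z ^ 2 * b z" 
      using V(3)[OF z(2)] unfolding b_def by (simp add: algebra_simps eval_nat_numeral)
    have "((\<lambda>w. \<alpha> * w ^ 2 + \<beta> * w ^ 4 + w ^ 5 * R w) has_field_derivative z * a z) (at z)"
      unfolding a_def S_def R'_def
      by (rule derivative_eq_intros refl holomorphic_derivI[OF U(3,1) z(1)])+
         (simp add: algebra_simps eval_nat_numeral)
    hence "(P has_field_derivative z * a z) (at z)"
    proof (rule DERIV_cong_ev[OF refl _ refl, THEN iffD1, rotated])
      have "eventually (\<lambda>w. w \<in> V) (nhds z)" using V(1) z(2) by (rule eventually_nhds_in_open)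
      thus "eventually (\<lambda>w. \<alpha> * w ^ 2 + \<beta> * w ^ 4 + w ^ 5 * R w = P w) (nhds z)"
        by eventually_elim (use V(3) in \<open>force simp: algebra_simps\<close>)
    qed
    hence "((\<lambda>w. 1 / w ^ 2 + P w) has_field_derivative (- 2 / z ^ 3 + z * a z)) (at z)"
      using z(3) by (auto intro!: derivative_eq_intros simp: field_simps eval_nat_numeral)
    hence d: "wp' z \<tau> = - 2 * i ^ 3 + z * a z"
      unfolding wp'_def wp_eq_part P_def[symmetric] by (subst DERIV_imp_deriv) (auto simp: i_def power_divide)
    have w: "wp z \<tau> = i ^ 2 + z ^ 2 * b z"
      unfolding wp_eq_part P_def[symmetric] Pz by (simp add: i_def power_divide)
    have i2: "i ^ 2 * z ^ 2 = 1" using i by (simp flip: power_mult_distrib)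
    have "wp' z \<tau> ^ 2 = 4 * i ^ 6 - 4 * (i * z) * i ^ 2 * a z + z ^ 2 * a z ^ 2"
      unfolding d by (simp add: eval_nat_numeral algebra_simps)
    hence 1: "wp' z \<tau> ^ 2 = 4 * i ^ 6 - 4 * i ^ 2 * a z + z ^ 2 * a z ^ 2" by (simp add: i)
    have "wp z \<tau> ^ 3 = i ^ 6 + 3 * (i ^ 2 * z ^ 2) * i ^ 2 * b z + 3 * (i ^ 2 * z ^ 2) * z ^ 2 * b z ^ 2 + z ^ 6 * b z ^ 3"
      unfolding w by (simp add: eval_nat_numeral algebra_simps)
    hence 2: "wp z \<tau> ^ 3 = i ^ 6 + 3 * i ^ 2 * b z + 3 * z ^ 2 * b z ^ 2 + z ^ 6 * b z ^ 3" by (simp add: i2)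
    have ab: "- 4 * a z - 12 * b z + 20 * \<alpha> = - 28 * \<beta> * z ^ 2 - z ^ 3 * (4 * S z + 12 * R z)"
      by (simp add: a_def b_def algebra_simps)
    have "i ^ 2 * (- 4 * a z - 12 * b z + 20 * \<alpha>) =
             - 28 * \<beta> * (i ^ 2 * z ^ 2) - z * (i ^ 2 * z ^ 2) * (4 * S z + 12 * R z)"
      unfolding ab by (simp add: eval_nat_numeral algebra_simps)
    hence 3: "i ^ 2 * (- 4 * a z - 12 * b z + 20 * \<alpha>) = - 28 * \<beta> - z * (4 * S z + 12 * R z)"
      by (simp only: i2 mult_1_right)
    have g: "g2 \<tau> = 20 * \<alpha>" "g3 \<tau> = 28 * \<beta>" by (simp_all add: \<alpha>_def \<beta>_def)
    have "wp' z \<tau> ^ 2 - 4 * wp z \<tau> ^ 3 + g2 \<tau> * wp z \<tau> + g3 \<tau> =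
       i ^ 2 * (- 4 * a z - 12 * b z + 20 * \<alpha>) + z ^ 2 * a z ^ 2 - 12 * z ^ 2 * b z ^ 2 - 4 * z ^ 6 * b z ^ 3
         + 20 * \<alpha> * z ^ 2 * b z + 28 * \<beta>"
      unfolding 1 2 g unfolding w by (simp add: algebra_simps)
    thus ?case unfolding 3 E_def by simp
  qed
  thus ?thesis by (rule Lim_transform_eventually[OF E0])
qed

lemma wp'_meromorphic: "\<tau> \<in> uhp \<Longrightarrow> (\<lambda>z. wp' z \<tau>) meromorphic_on UNIV"
  unfolding wp'_def by (intro meromorphic_intros wp_meromorphic)

lemma wp'_analytic_at: "\<tau> \<in> uhp \<Longrightarrow> z \<notin> period_lattice \<tau> \<Longrightarrow> (\<lambda>z. wp' z \<tau>) analytic_on {z}"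
  unfolding wp'_def by (intro analytic_intros wp_analytic_at)

text \<open>The difference of the two sides is elliptic and can have poles only at lattice points,
  where it tends to 0. It is therefore constant, and the constant is that limit.\<close>

theorem wp_ode:
  assumes \<tau>: "\<tau> \<in> uhp" and z: "z \<notin> period_lattice \<tau>"
  shows "wp' z \<tau> ^ 2 = 4 * wp z \<tau> ^ 3 - g2 \<tau> * wp z \<tau> - g3 \<tau>"
proof -
  define D where "D = (\<lambda>z. wp' z \<tau> ^ 2 - 4 * wp z \<tau> ^ 3 + g2 \<tau> * wp z \<tau> + g3 \<tau>)"
  have per: "D (z + \<omega>) = D z" if "\<omega> \<in> period_lattice \<tau>" for z \<omega>
    using that by (simp add: D_def wp_periodic[OF \<tau>] wp'_periodic[OF \<tau>])
  have ana: "D analytic_on {z}" if "z \<notin> period_lattice \<tau>" for z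
    unfolding D_def using that by (intro analytic_intros wp'_analytic_at wp_analytic_at \<tau>) auto
  have lim0: "D \<midarrow>0\<rightarrow> 0" unfolding D_def by (rule wp_ode_local[OF \<tau>])
  have lim: "D \<midarrow>\<omega>\<rightarrow> 0" if "\<omega> \<in> period_lattice \<tau>" for \<omega>
  proof -
    have "(\<lambda>w. D (\<omega> + w)) = D" using per[OF that] by (auto simp: add.commute)
    hence "(\<lambda>w. D (\<omega> + w)) \<midarrow>0\<rightarrow> 0" using lim0 by simp
    thus ?thesis by (rule LIM_offset_zero_cancel)
  qed
  have "\<not> is_pole D z" for z
  proof (cases "z \<in> period_lattice \<tau>")
    case True
    from lim[OF this] show ?thesis
      unfolding is_pole_def using not_tendsto_and_filterlim_at_infinity[of "at z" D 0] by auto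
  qed (use ana analytic_at_imp_no_pole in blast)
  moreover have "D meromorphic_on UNIV"
    unfolding D_def by (intro meromorphic_intros wp'_meromorphic wp_meromorphic \<tau>)
  ultimately obtain c where c: "\<And>z. D \<midarrow>z\<rightarrow> c"
    using elliptic_no_poles_imp_const[OF \<tau> _ _ per] by blast
  have "c = 0" using LIM_unique[OF c lim0] .
  moreover have "D \<midarrow>z\<rightarrow> D z"
    using analytic_at_imp_isCont[OF ana[OF z]] by (simp add: isCont_def)
  ultimately have "D z = 0" using LIM_unique c by blast
  thus ?thesis by (simp add: D_def algebra_simps)
qed

section \<open>Injectivity of the Weierstrass function up to sign\<close>

lemma fps_ode_unique:
  fixes F G :: "complex fps"
  assumes F: "fps_deriv (fps_deriv F) = 6 * (F * F) - fps_const c"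
    and G: "fps_deriv (fps_deriv G) = 6 * (G * G) - fps_const c"
    and init: "fps_nth F 0 = fps_nth G 0" "fps_nth F 1 = fps_nth G 1"
  shows "F = G"
proof (rule fps_ext)
  fix n show "fps_nth F n = fps_nth G n"
  proof (induction n rule: less_induct)
    case (less n)
    consider "n = 0" | "n = 1" | m where "n = Suc (Suc m)"
      by (metis One_nat_def not0_implies_Suc)
    thus ?case
    proof cases
      \<comment> \<open>The equation expresses the coefficient of index m + 2 by coefficients of
        index at most m.\<close>
      case (3 m)
      have "fps_nth (F * F) m = fps_nth (G * G) m"
        unfolding fps_mult_nth using 3 by (intro sum.cong) (auto simp: less.IH)
      hence "fps_nth (fps_deriv (fps_deriv F)) m = fps_nth (fps_deriv (fps_deriv G)) m"
        unfolding F G numeral_fps_const by simp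
      thus ?thesis using 3 by (simp del: of_nat_Suc)
    qed (use init in auto)
  qed
qed

text \<open>The second order equation is used because the first order one does not determine a
  solution at points where the derivative vanishes, such as half periods. It arises from
  \<open>wp_ode\<close> by differentiating and cancelling twice the derivative, which is possible
  for power series at every u.\<close>

lemma wp_fps:
  assumes \<tau>: "\<tau> \<in> uhp" and u: "u \<notin> period_lattice \<tau>"
  obtains F where "(\<lambda>z. wp (u + z) \<tau>) has_fps_expansion F"
    "fps_nth F 0 = wp u \<tau>" "fps_nth F 1 = wp' u \<tau>"
    "fps_deriv (fps_deriv F) = 6 * (F * F) - fps_const (g2 \<tau> / 2)"
proof -
  obtain F where F: "(\<lambda>z. wp (u + z) \<tau>) has_fps_expansion F"
    using analytic_at_imp_has_fps_expansion[OF wp_analytic_at[OF \<tau> u]] by blast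
  have dF: "deriv (\<lambda>z. wp (u + z) \<tau>) has_fps_expansion fps_deriv F"
    by (rule has_fps_expansion_deriv[OF F])
  have "deriv (\<lambda>z. wp (u + z) \<tau>) = (\<lambda>z. wp' (u + z) \<tau>)"
  proof
    fix z
    show "deriv (\<lambda>z. wp (u + z) \<tau>) z = wp' (u + z) \<tau>"
      using deriv_shift_0[of "\<lambda>z. wp z \<tau>" "u + z"] deriv_shift_0[of "\<lambda>z. wp (u + z) \<tau>" z]
      by (simp add: wp'_def o_def add.assoc)
  qed
  hence dF': "(\<lambda>z. wp' (u + z) \<tau>) has_fps_expansion fps_deriv F" using dF by (simp only:)
  have 0: "fps_nth F 0 = wp u \<tau>" "fps_nth F 1 = wp' u \<tau>"
    using has_fps_expansion_imp_0_eq_fps_nth_0[OF F] has_fps_expansion_imp_0_eq_fps_nth_0[OF dF'] by simp_all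
  have ev: "eventually (\<lambda>z. u + z \<notin> period_lattice \<tau>) (nhds 0)"
  proof -
    have "eventually (\<lambda>z. z \<notin> period_lattice \<tau>) (nhds u)"
      using eventually_not_in_lattice[OF \<tau>, of u] u
      unfolding eventually_at_filter by (auto elim: eventually_mono)
    thus ?thesis by (simp add: nhds_to_0'[of u] eventually_filtermap add.commute)
  qed
  have lhs: "(\<lambda>z. wp' (u + z) \<tau> * wp' (u + z) \<tau>) has_fps_expansion fps_deriv F * fps_deriv F"
    by (intro fps_expansion_intros dF')
  have rhs: "(\<lambda>z. 4 * (wp (u + z) \<tau> * wp (u + z) \<tau> * wp (u + z) \<tau>) - g2 \<tau> * wp (u + z) \<tau> - g3 \<tau>)
     has_fps_expansion (fps_const 4 * (F * F * F) - fps_const (g2 \<tau>) * F - fps_const (g3 \<tau>))"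
    by (intro fps_expansion_intros F)
  have "eventually (\<lambda>z. wp' (u + z) \<tau> * wp' (u + z) \<tau> =
      4 * (wp (u + z) \<tau> * wp (u + z) \<tau> * wp (u + z) \<tau>) - g2 \<tau> * wp (u + z) \<tau> - g3 \<tau>) (nhds 0)"
    using ev
  proof eventually_elim
    case (elim z)
    from wp_ode[OF \<tau> this] show ?case by (simp add: power2_eq_square power3_eq_cube)
  qed
  from has_fps_expansion_cong[OF this refl] rhs
  have "(\<lambda>z. wp' (u + z) \<tau> * wp' (u + z) \<tau>) has_fps_expansion
      (fps_const 4 * (F * F * F) - fps_const (g2 \<tau>) * F - fps_const (g3 \<tau>))" by (rule iffD2)
  with lhs have eq: "fps_deriv F * fps_deriv F =
      fps_const 4 * (F * F * F) - fps_const (g2 \<tau>) * F - fps_const (g3 \<tau>)"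
    by (rule fps_expansion_unique_complex)
  \<comment> \<open>Otherwise \<open>wp\<close> would be constant near u, hence everywhere by the
    identity theorem, against its pole at 0.\<close>
  have "fps_deriv F \<noteq> 0"
  proof
    assume "fps_deriv F = 0"
    hence "F = fps_const (wp u \<tau>)" using 0 by (simp add: fps_deriv_eq_0_iff)
    hence "eventually (\<lambda>z. wp (u + z) \<tau> = wp u \<tau>) (nhds 0)"
      using F by (auto simp: has_fps_expansion_def eq_commute)
    hence "eventually (\<lambda>z. wp z \<tau> = wp u \<tau>) (nhds u)"
      by (simp add: nhds_to_0'[of u] eventually_filtermap add.commute)
    hence "eventually (\<lambda>z. wp z \<tau> = wp u \<tau>) (at u)" by (rule filter_leD[OF at_within_le_nhds])
    hence "frequently (\<lambda>z. wp z \<tau> = wp u \<tau>) (at u)" by (intro eventually_frequently) auto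
    hence "eventually (\<lambda>z. wp z \<tau> = wp u \<tau>) (at 0)"
      using meromorphic_identity[OF wp_meromorphic[OF \<tau>], of u "wp u \<tau>" 0] by auto
    hence "\<not> is_pole (\<lambda>z. wp z \<tau>) 0"
      using is_pole_cong[of "\<lambda>z. wp z \<tau>" "\<lambda>_. wp u \<tau>" 0 0] by auto
    thus False using wp_is_pole_0[OF \<tau>] by simp
  qed
  moreover have "fps_deriv (fps_deriv F * fps_deriv F) =
      fps_deriv (fps_const 4 * (F * F * F) - fps_const (g2 \<tau>) * F - fps_const (g3 \<tau>))"
    by (simp only: eq)
  hence "2 * fps_deriv F * fps_deriv (fps_deriv F) =
           2 * fps_deriv F * (6 * (F * F) - fps_const (g2 \<tau> / 2))"
  proof -
    have c: "fps_const (g2 \<tau>) = 2 * fps_const (g2 \<tau> / 2)" "fps_const (4::complex) = 4"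
      by (simp_all add: numeral_fps_const)
    assume "fps_deriv (fps_deriv F * fps_deriv F) =
      fps_deriv (fps_const 4 * (F * F * F) - fps_const (g2 \<tau>) * F - fps_const (g3 \<tau>))"
    thus ?thesis unfolding c by (simp add: algebra_simps)
  qed
  ultimately have "fps_deriv (fps_deriv F) = 6 * (F * F) - fps_const (g2 \<tau> / 2)" by simp
  with F 0 show ?thesis by (rule that)
qed

text \<open>Up to the sign of \<open>u'\<close>, \<open>\<wp>(u + z)\<close> and \<open>\<wp>(u' + z)\<close> are solutions of
  \<open>f'' = 6 f\<^sup>2 - g\<^sub>2 / 2\<close> with the same initial values.\<close>
theorem wp_eq_imp:
  assumes \<tau>: "\<tau> \<in> uhp" and u: "u \<notin> period_lattice \<tau>" "u' \<notin> period_lattice \<tau>"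
    and eq: "wp u \<tau> = wp u' \<tau>"
  shows "u - u' \<in> period_lattice \<tau> \<or> u + u' \<in> period_lattice \<tau>"
proof -
  have main: "v - u \<in> period_lattice \<tau>"
    if v: "v \<notin> period_lattice \<tau>" "wp v \<tau> = wp u \<tau>" "wp' v \<tau> = wp' u \<tau>" for v
  proof -
    obtain F where F: "(\<lambda>z. wp (u + z) \<tau>) has_fps_expansion F"
      "fps_nth F 0 = wp u \<tau>" "fps_nth F 1 = wp' u \<tau>"
      "fps_deriv (fps_deriv F) = 6 * (F * F) - fps_const (g2 \<tau> / 2)"
      using wp_fps[OF \<tau> u(1)] by blast
    obtain G where G: "(\<lambda>z. wp (v + z) \<tau>) has_fps_expansion G"
      "fps_nth G 0 = wp v \<tau>" "fps_nth G 1 = wp' v \<tau>"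
      "fps_deriv (fps_deriv G) = 6 * (G * G) - fps_const (g2 \<tau> / 2)"
      using wp_fps[OF \<tau> v(1)] by blast
    have "F = G" using fps_ode_unique[OF F(4) G(4)] F G v by simp
    with F(1) G(1) have "eventually (\<lambda>z. wp (u + z) \<tau> - wp (v + z) \<tau> = 0) (nhds 0)"
      unfolding has_fps_expansion_def by (auto elim: eventually_elim2)
    hence "eventually (\<lambda>z. wp (u + z) \<tau> - wp (v + z) \<tau> = 0) (at 0)"
      by (rule filter_leD[OF at_within_le_nhds])
    hence freq: "frequently (\<lambda>z. wp (u + z) \<tau> - wp (v + z) \<tau> = 0) (at 0)"
      by (intro eventually_frequently) auto
    have mer: "(\<lambda>z. wp (a + z) \<tau>) meromorphic_on UNIV" for a
      by (rule meromorphic_on_compose[OF wp_meromorphic[OF \<tau>]]) (auto intro!: analytic_intros)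
    \<comment> \<open>Agreement near 0 spreads to -u, where the first translate has a pole. The
      second then has one there too, which makes v - u a lattice point.\<close>
    have "eventually (\<lambda>z. wp (u + z) \<tau> - wp (v + z) \<tau> = 0) (at (- u))"
      by (rule meromorphic_identity[OF _ _ _ _ freq]) (auto intro!: meromorphic_intros mer)
    hence ev: "eventually (\<lambda>z. wp (u + z) \<tau> = wp (v + z) \<tau>) (at (- u))" by simp
    have shift: "is_pole (\<lambda>z. wp (a + z) \<tau>) (- u) \<longleftrightarrow> is_pole (\<lambda>z. wp z \<tau>) (a - u)" for a
    proof -
      have "wp (a + (- u + x)) \<tau> = wp (a - u + x) \<tau>" for x by (simp only: add.assoc diff_conv_add_uminus)
      thus ?thesis
        using is_pole_shift_0[of "\<lambda>z. wp (a + z) \<tau>" "-u"] is_pole_shift_0[of "\<lambda>z. wp z \<tau>" "a - u"]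
        by (simp only:)
    qed
    have "is_pole (\<lambda>z. wp z \<tau>) (v - u)"
      using is_pole_cong[OF ev refl] wp_is_pole_0[OF \<tau>] shift[of u] shift[of v] by simp
    thus ?thesis using wp_is_pole_iff[OF \<tau>] by simp
  qed
  have "wp' u \<tau> ^ 2 = wp' u' \<tau> ^ 2" using wp_ode[OF \<tau> u(1)] wp_ode[OF \<tau> u(2)] eq by simp
  hence "wp' u' \<tau> = wp' u \<tau> \<or> wp' u' \<tau> = - wp' u \<tau>" by (auto simp: power2_eq_iff)
  thus ?thesis
  proof
    assume "wp' u' \<tau> = wp' u \<tau>"
    from main[OF u(2) eq[symmetric] this] have "- (u' - u) \<in> period_lattice \<tau>"
      by (rule period_lattice_props(6))
    thus ?thesis by simp
  next
    assume *: "wp' u' \<tau> = - wp' u \<tau>"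
    have n: "- u' \<notin> period_lattice \<tau>" using u(2) period_lattice_props(6)[of "-u'" \<tau>] by auto
    have "- u' - u \<in> period_lattice \<tau>"
      using main[OF n] eq wp'_minus[OF \<tau> u(2)] * by (simp add: wp_minus)
    hence "- (- u' - u) \<in> period_lattice \<tau>" by (rule period_lattice_props(6))
    thus ?thesis by (simp add: add.commute)
  qed
qed

section \<open>Half-period values and the discriminant\<close>

definition e1 :: "complex \<Rightarrow> complex" where "e1 \<tau> = wp (1 / 2) \<tau>"
definition e2 :: "complex \<Rightarrow> complex" where "e2 \<tau> = wp (\<tau> / 2) \<tau>"
definition e3 :: "complex \<Rightarrow> complex" where "e3 \<tau> = wp ((\<tau> + 1) / 2) \<tau>"

lemma rat_lattice_iff:
  assumes \<tau>: "\<tau> \<in> uhp" and N: "N > (0::int)"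
  shows "(of_int r * \<tau> + of_int s) / of_int N \<in> period_lattice \<tau> \<longleftrightarrow> N dvd r \<and> N dvd s"
proof
  assume "(of_int r * \<tau> + of_int s) / of_int N \<in> period_lattice \<tau>"
  then obtain p where "(of_int r * \<tau> + of_int s) / of_int N = lattice_point \<tau> p"
    by (auto simp: period_lattice_range)
  hence "of_int r * \<tau> + of_int s = of_int N * lattice_point \<tau> p" using N by (simp add: field_simps)
  hence "lattice_point \<tau> (s - N * fst p, r - N * snd p) = 0"
    by (simp add: lattice_point_def algebra_simps)
  hence "(s - N * fst p, r - N * snd p) = 0" using lattice_point_eq_0_iff[OF \<tau>] by blast
  thus "N dvd r \<and> N dvd s" by (auto simp: zero_prod_def)
next
  assume "N dvd r \<and> N dvd s"
  then obtain a b where "r = N * a" "s = N * b" by (auto simp: dvd_def)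
  hence "(of_int r * \<tau> + of_int s) / of_int N = lattice_point \<tau> (b, a)"
    using N by (simp add: lattice_point_def field_simps)
  thus "(of_int r * \<tau> + of_int s) / of_int N \<in> period_lattice \<tau>"
    by (simp add: period_lattice_range)
qed

lemma wp_rat_eq_iff:
  assumes \<tau>: "\<tau> \<in> uhp" and N: "N > (0::int)"
    and "\<not> (N dvd r \<and> N dvd s)" "\<not> (N dvd r' \<and> N dvd s')"
    and "wp ((of_int r * \<tau> + of_int s) / of_int N) \<tau> = wp ((of_int r' * \<tau> + of_int s') / of_int N) \<tau>"
  shows "N dvd (r - r') \<and> N dvd (s - s') \<or> N dvd (r + r') \<and> N dvd (s + s')"
proof -
  have 1: "(of_int r * \<tau> + of_int s) / of_int N - (of_int r' * \<tau> + of_int s') / of_int N =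
          (of_int (r - r') * \<tau> + of_int (s - s')) / of_int N"
    and 2: "(of_int r * \<tau> + of_int s) / of_int N + (of_int r' * \<tau> + of_int s') / of_int N =
          (of_int (r + r') * \<tau> + of_int (s + s')) / of_int N"
    by (simp_all add: diff_divide_distrib add_divide_distrib ring_distribs)
  show ?thesis
    using wp_eq_imp[OF \<tau> _ _ assms(5)] assms(3,4) unfolding rat_lattice_iff[OF \<tau> N] 1 2 by blast
qed

lemma e_distinct:
  assumes \<tau>: "\<tau> \<in> uhp"
  shows "e1 \<tau> \<noteq> e2 \<tau>" "e1 \<tau> \<noteq> e3 \<tau>" "e2 \<tau> \<noteq> e3 \<tau>"
  using wp_rat_eq_iff[OF \<tau>, of 2 0 1 1 0] wp_rat_eq_iff[OF \<tau>, of 2 0 1 1 1] wp_rat_eq_iff[OF \<tau>, of 2 1 0 1 1]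
  by (auto simp: e1_def e2_def e3_def)

lemma e_roots:
  assumes \<tau>: "\<tau> \<in> uhp"
  shows "4 * e1 \<tau> ^ 3 = g2 \<tau> * e1 \<tau> + g3 \<tau>" "4 * e2 \<tau> ^ 3 = g2 \<tau> * e2 \<tau> + g3 \<tau>"
        "4 * e3 \<tau> ^ 3 = g2 \<tau> * e3 \<tau> + g3 \<tau>"
proof -
  have *: "4 * wp u \<tau> ^ 3 = g2 \<tau> * wp u \<tau> + g3 \<tau>"
    if "u = (of_int r * \<tau> + of_int s) / of_int 2" "\<not> (even r \<and> even s)" for u r s
  proof -
    have u: "u \<notin> period_lattice \<tau>" using rat_lattice_iff[OF \<tau>, of 2 r s] that(2) unfolding that(1) by simp
    have "2 * u = lattice_point \<tau> (s, r)" unfolding that(1) by (simp add: lattice_point_def)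
    hence "wp' u \<tau> = 0" by (intro wp'_eq_0[OF \<tau> u]) (simp add: period_lattice_range)
    thus ?thesis using wp_ode[OF \<tau> u] by (simp add: algebra_simps)
  qed
  show "4 * e1 \<tau> ^ 3 = g2 \<tau> * e1 \<tau> + g3 \<tau>" unfolding e1_def by (rule *[of _ 0 1]) auto
  show "4 * e2 \<tau> ^ 3 = g2 \<tau> * e2 \<tau> + g3 \<tau>" unfolding e2_def by (rule *[of _ 1 0]) auto
  show "4 * e3 \<tau> ^ 3 = g2 \<tau> * e3 \<tau> + g3 \<tau>" unfolding e3_def by (rule *[of _ 1 1]) auto
qed

text \<open>Vieta's relations and the discriminant of 4 X^3 - p X - q, by elimination from
  differences of the three equations. They give both the nonvanishing of the denominator of j and a
  formula for j in the half-period values.\<close>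

lemma cubic_roots:
  fixes x y z p q :: complex
  assumes "4 * x ^ 3 = p * x + q" "4 * y ^ 3 = p * y + q" "4 * z ^ 3 = p * z + q" "x \<noteq> y" "x \<noteq> z" "y \<noteq> z"
  shows "x + y + z = 0" "p = -4 * (x * y + x * z + y * z)" "q = 4 * x * y * z"
    "p ^ 3 - 27 * q ^ 2 = 16 * (x - y) ^ 2 * (x - z) ^ 2 * (y - z) ^ 2"
proof -
  have "(x - y) * (4 * (x ^ 2 + x * y + y ^ 2) - p) = (4 * x ^ 3 - p * x) - (4 * y ^ 3 - p * y)"
    by (simp add: eval_nat_numeral algebra_simps)
  also have "\<dots> = 0" unfolding assms(1,2) by simp
  finally have 1: "p = 4 * (x ^ 2 + x * y + y ^ 2)" using assms(4) by simp
  have "(x - z) * (4 * (x ^ 2 + x * z + z ^ 2) - p) = (4 * x ^ 3 - p * x) - (4 * z ^ 3 - p * z)"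
    by (simp add: eval_nat_numeral algebra_simps)
  also have "\<dots> = 0" unfolding assms(1,3) by simp
  finally have 2: "p = 4 * (x ^ 2 + x * z + z ^ 2)" using assms(5) by simp
  have "4 * (y - z) * (x + y + z) = 4 * (x ^ 2 + x * y + y ^ 2) - 4 * (x ^ 2 + x * z + z ^ 2)"
    by (simp add: eval_nat_numeral algebra_simps)
  also have "\<dots> = 0" unfolding 1[symmetric] 2[symmetric] by simp
  finally show s: "x + y + z = 0" using assms(6) by simp
  have "z = (x + y + z) - x - y" by simp
  hence z: "z = - x - y" unfolding s by simp
  show p: "p = -4 * (x * y + x * z + y * z)" unfolding 1 z by (simp add: eval_nat_numeral algebra_simps)
  have "q = 4 * x ^ 3 - p * x" using assms(1) by simp
  thus q: "q = 4 * x * y * z" unfolding 1 z by (simp add: eval_nat_numeral algebra_simps)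
  show "p ^ 3 - 27 * q ^ 2 = 16 * (x - y) ^ 2 * (x - z) ^ 2 * (y - z) ^ 2"
    unfolding p q unfolding z by (simp add: eval_nat_numeral algebra_simps)
qed

lemma g2_g3_e:
  assumes \<tau>: "\<tau> \<in> uhp"
  shows "e1 \<tau> + e2 \<tau> + e3 \<tau> = 0"
    "g2 \<tau> = -4 * (e1 \<tau> * e2 \<tau> + e1 \<tau> * e3 \<tau> + e2 \<tau> * e3 \<tau>)"
    "g2 \<tau> ^ 3 - 27 * g3 \<tau> ^ 2 = 16 * (e1 \<tau> - e2 \<tau>) ^ 2 * (e1 \<tau> - e3 \<tau>) ^ 2 * (e2 \<tau> - e3 \<tau>) ^ 2"
    "g2 \<tau> ^ 3 - 27 * g3 \<tau> ^ 2 \<noteq> 0"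
proof -
  note * = cubic_roots[OF e_roots[OF \<tau>] e_distinct[OF \<tau>]]
  show "e1 \<tau> + e2 \<tau> + e3 \<tau> = 0"
    "g2 \<tau> = -4 * (e1 \<tau> * e2 \<tau> + e1 \<tau> * e3 \<tau> + e2 \<tau> * e3 \<tau>)"
    "g2 \<tau> ^ 3 - 27 * g3 \<tau> ^ 2 = 16 * (e1 \<tau> - e2 \<tau>) ^ 2 * (e1 \<tau> - e3 \<tau>) ^ 2 * (e2 \<tau> - e3 \<tau>) ^ 2"
    by (fact *)+
  show "g2 \<tau> ^ 3 - 27 * g3 \<tau> ^ 2 \<noteq> 0"
    unfolding *(4) using e_distinct[OF \<tau>] by simp
qed

section \<open>Fourier expansion of division values\<close>

definition cexp :: "complex \<Rightarrow> complex" where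
  "cexp z = exp (2 * of_real pi * \<i> * z)"

lemma cexp_add: "cexp (a + b) = cexp a * cexp b"
  and cexp_minus: "cexp (- a) = inverse (cexp a)"
  and cexp_diff: "cexp (a - b) = cexp a / cexp b"
  and cexp_0 [simp]: "cexp 0 = 1"
  and cexp_nonzero [simp]: "cexp a \<noteq> 0"
  by (simp_all add: cexp_def ring_distribs exp_add exp_minus exp_diff)

lemma cexp_of_nat_mult: "cexp (of_nat n * a) = cexp a ^ n"
  unfolding cexp_def exp_of_nat_mult[symmetric] by (simp add: mult_ac)

lemma cexp_of_int [simp]: "cexp (of_int n) = 1"
  unfolding cexp_def by (subst exp_eq_1) auto

lemma cexp_eq_1_iff: "cexp z = 1 \<longleftrightarrow> z \<in> \<int>"
proof
  assume "cexp z = 1"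
  then obtain n :: int where n: "Re (2 * of_real pi * \<i> * z) = 0" "Im (2 * of_real pi * \<i> * z) = of_int (2 * n) * pi"
    unfolding cexp_def exp_eq_1 by auto
  hence "z = of_int n" by (auto simp: complex_eq_iff)
  thus "z \<in> \<int>" by simp
qed (auto elim!: Ints_cases)

lemma norm_cexp: "norm (cexp z) = exp (- 2 * pi * Im z)"
  by (simp add: cexp_def)

text \<open>For norm w < 1 this is the sum of n w^n. The closed form also makes sense for norm w > 1
  and shows the symmetry under w \<mapsto> 1 / w.\<close>

definition E :: "complex \<Rightarrow> complex" where "E w = w / (1 - w) ^ 2"

lemma E_inverse: "E (inverse w) = E w"
  by (cases "w = 0"; cases "w = 1") (auto simp: E_def field_simps power2_eq_square)

section \<open>Partial fractions of the squared cosecant\<close>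

lemma sin_pi_nonzero:
  assumes "z \<notin> \<int>"
  shows "sin (of_real pi * z :: complex) \<noteq> 0"
proof
  assume "sin (of_real pi * z) = 0"
  then obtain n :: int where "of_real pi * z = of_real (of_int n * pi)"
    unfolding Complex_Transcendental.sin_eq_0 by blast
  hence "z = of_int n" by (simp add: mult.commute)
  thus False using assms by simp
qed

lemma sin_square_E:
  assumes "z \<notin> \<int>"
  shows "of_real pi ^ 2 / sin (of_real pi * z) ^ 2 = (2 * of_real pi * \<i>) ^ 2 * E (cexp z)"
proof -
  define t where "t = exp (\<i> * (of_real pi * z))"
  have t0: "t \<noteq> 0" by (simp add: t_def)
  have s: "sin (of_real pi * z) = (t - inverse t) / (2 * \<i>)"
    by (simp add: sin_exp_eq t_def exp_minus)
  have w: "cexp z = t ^ 2" unfolding t_def cexp_def by (simp add: power2_eq_square mult_ac flip: exp_add)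
  have "t ^ 2 \<noteq> 1" using cexp_eq_1_iff[of z] assms w by simp
  hence "1 - t ^ 2 \<noteq> 0" by simp
  moreover have "t - inverse t = (t ^ 2 - 1) / t" using t0 by (simp add: field_simps power2_eq_square)
  ultimately show ?thesis unfolding s w E_def using t0
    by (simp add: field_simps power2_eq_square)
qed

text \<open>This is the logarithmic derivative of the reflection formula of Gamma. One more
  derivative writes the squared cosecant as a sum of two trigamma values, whose series are the two
  halves of a sum over the integers.\<close>

lemma Digamma_reflection:
  fixes z :: complex
  assumes "z \<notin> \<int>"
  shows "Digamma z - Digamma (1 - z) = - of_real pi * cos (of_real pi * z) / sin (of_real pi * z)"
proof -
  have z: "z \<notin> \<int>\<^sub>\<le>\<^sub>0" "1 - z \<notin> \<int>\<^sub>\<le>\<^sub>0"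
    using assms nonpos_Ints_subset_Ints Ints_diff[of 1 "1 - z"] by auto
  have sin0: "sin (of_real pi * z) \<noteq> 0"
    using assms by (rule sin_pi_nonzero)
  have "((\<lambda>w. Gamma w * Gamma (1 - w)) has_field_derivative
      Gamma z * Gamma (1 - z) * (Digamma z - Digamma (1 - z))) (at z)"
    by (rule derivative_eq_intros refl z)+ (simp add: algebra_simps)
  moreover have "((\<lambda>w. of_real pi / sin (of_real pi * w)) has_field_derivative
      of_real pi / sin (of_real pi * z) * (- of_real pi * cos (of_real pi * z) / sin (of_real pi * z))) (at z)"
    by (rule derivative_eq_intros refl sin0)+ (use sin0 in \<open>simp add: field_simps power2_eq_square\<close>)
  moreover have "(\<lambda>w. Gamma w * Gamma (1 - w)) = (\<lambda>w. of_real pi / sin (of_real pi * w :: complex))"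
    by (intro ext Gamma_reflection_complex)
  ultimately have "Gamma z * Gamma (1 - z) * (Digamma z - Digamma (1 - z)) =
      of_real pi / sin (of_real pi * z) * (- of_real pi * cos (of_real pi * z) / sin (of_real pi * z))"
    using DERIV_unique by metis
  hence "of_real pi / sin (of_real pi * z) * (Digamma z - Digamma (1 - z)) =
      of_real pi / sin (of_real pi * z) * (- of_real pi * cos (of_real pi * z) / sin (of_real pi * z))"
    by (simp only: Gamma_reflection_complex)
  thus ?thesis by (subst (asm) mult_left_cancel) (use sin0 in auto)
qed

lemma Polygamma_1_reflection:
  assumes "z \<notin> \<int>"
  shows "Polygamma 1 z + Polygamma 1 (1 - z) = of_real pi ^ 2 / sin (of_real pi * z :: complex) ^ 2"
proof -
  have z: "z \<notin> \<int>\<^sub>\<le>\<^sub>0" "1 - z \<notin> \<int>\<^sub>\<le>\<^sub>0"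
    using assms nonpos_Ints_subset_Ints Ints_diff[of 1 "1 - z"] by auto
  have sin0: "sin (of_real pi * z) \<noteq> 0"
    using assms by (rule sin_pi_nonzero)
  have 1: "((\<lambda>w. Digamma w - Digamma (1 - w)) has_field_derivative (Polygamma 1 z + Polygamma 1 (1 - z))) (at z)"
    by (rule derivative_eq_intros refl z)+ simp
  have cc: "cos x * cos x = 1 - sin x * sin x" for x :: complex
    using cos_squared_eq[of x] by (simp only: power2_eq_square)
  have 2: "((\<lambda>w. - of_real pi * cos (of_real pi * w) / sin (of_real pi * w)) has_field_derivative
       of_real pi ^ 2 / sin (of_real pi * z) ^ 2) (at z)"
    by (rule derivative_eq_intros refl sin0)+
       (use sin0 in \<open>simp add: field_simps power2_eq_square\<close>, simp add: cc algebra_simps)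
  have "open (- (\<int> :: complex set))" by (simp add: closed_Ints open_Compl)
  hence "eventually (\<lambda>w. w \<in> - \<int>) (nhds z)" using assms by (intro eventually_nhds_in_open) auto
  hence "eventually (\<lambda>w. Digamma w - Digamma (1 - w) = - of_real pi * cos (of_real pi * w) / sin (of_real pi * w)) (nhds z)"
    by eventually_elim (rule Digamma_reflection, simp)
  from DERIV_cong_ev[OF refl this refl] 1 2 show ?thesis using DERIV_unique by blast
qed

lemma inverse_square_summable:
  "summable (\<lambda>k. norm (inverse ((z + of_nat k :: complex) ^ 2)))"
proof -
  have "summable (\<lambda>k. norm (norm (inverse ((z + of_nat k :: complex) ^ 2))))"
  proof (rule summable_comparison_test_ev)
    show "summable (\<lambda>k. 4 * inverse (real k ^ 2))"
      by (intro summable_mult inverse_power_summable) auto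
    have "eventually (\<lambda>k. real k > 2 * norm z) at_top" by real_asymp
    thus "eventually (\<lambda>k. norm (norm (norm (inverse ((z + of_nat k :: complex) ^ 2)))) \<le> 4 * inverse (real k ^ 2)) at_top"
    proof eventually_elim
      case (elim k)
      have "norm (z + of_nat k) \<ge> norm (of_nat k :: complex) - norm z"
        by (metis add.commute norm_diff_ineq)
      hence *: "norm (z + of_nat k) \<ge> real k / 2" using elim by simp
      have k: "real k > 0" using elim norm_ge_zero[of z] by linarith
      have "inverse (norm (z + of_nat k) ^ 2) \<le> inverse ((real k / 2) ^ 2)"
        using * k by (intro le_imp_inverse_le power_mono) auto
      thus ?case by (simp add: norm_inverse norm_power norm_divide power_divide inverse_eq_divide)
    qed
  qed
  thus ?thesis by simp
qed

lemma int_split: "range int \<union> range (\<lambda>k. - int (Suc k)) = UNIV" "range int \<inter> range (\<lambda>k. - int (Suc k)) = {}"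
proof -
  show "range int \<union> range (\<lambda>k. - int (Suc k)) = UNIV"
  proof safe
    fix x assume "x \<notin> range (\<lambda>k. - int (Suc k))"
    hence "x \<ge> 0" by (metis int_cases of_nat_0_le_iff rangeI)
    thus "x \<in> range int" by (metis nat_0_le rangeI)
  qed auto
qed auto

lemma int_has_sum_split:
  fixes g :: "int \<Rightarrow> complex"
  assumes "((\<lambda>k. g (int k)) has_sum a) UNIV" "((\<lambda>k. g (- int (Suc k))) has_sum b) UNIV"
  shows "(g has_sum (a + b)) UNIV"
proof -
  have "(g has_sum a) (range int)"
    using assms(1) by (subst has_sum_reindex) (auto simp: inj_on_def o_def)
  moreover have "(g has_sum b) (range (\<lambda>k. - int (Suc k)))"
    using assms(2) by (subst has_sum_reindex) (auto simp: inj_on_def o_def)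
  ultimately have "(g has_sum (a + b)) (range int \<union> range (\<lambda>k. - int (Suc k)))"
    by (rule has_sum_Un_disjoint) (rule int_split)
  thus ?thesis by (simp only: int_split)
qed

text \<open>The indices m \<ge> 0 give the trigamma function at z, the indices m < 0 at 1 - z. The
  formula evaluates a whole row of the lattice sum in terms of exp(2 pi i z).\<close>

theorem int_inverse_square_sum:
  assumes "z \<notin> \<int>"
  shows "((\<lambda>m::int. 1 / (z + of_int m) ^ 2) has_sum ((2 * of_real pi * \<i>) ^ 2 * E (cexp z))) UNIV"
proof -
  have sum: "((\<lambda>k. inverse ((w + of_nat k :: complex) ^ 2)) has_sum Polygamma 1 w) UNIV" if "w \<noteq> 0" for w
  proof (rule norm_summable_imp_has_sum)
    show "summable (\<lambda>k. norm (inverse ((w + of_nat k :: complex) ^ 2)))"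
      by (rule inverse_square_summable)
    show "(\<lambda>k. inverse ((w + of_nat k :: complex) ^ 2)) sums Polygamma 1 w"
      using Polygamma_LIMSEQ[OF that, of 1] by (simp add: numeral_2_eq_2)
  qed
  have z: "z \<noteq> 0" "1 - z \<noteq> 0" using assms by auto
  have "((\<lambda>m::int. 1 / (z + of_int m) ^ 2) has_sum (Polygamma 1 z + Polygamma 1 (1 - z))) UNIV"
  proof (rule int_has_sum_split)
    show "((\<lambda>k. 1 / (z + of_int (int k)) ^ 2) has_sum Polygamma 1 z) UNIV"
      using sum[OF z(1)] by (simp add: inverse_eq_divide)
    have "(z + of_int (- int (Suc k))) ^ 2 = (1 - z + of_nat k) ^ 2" for k
      by (simp add: power2_eq_square algebra_simps)
    thus "((\<lambda>k. 1 / (z + of_int (- int (Suc k))) ^ 2) has_sum Polygamma 1 (1 - z)) UNIV"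
      using sum[OF z(2)] by (simp only: inverse_eq_divide)
  qed
  thus ?thesis by (simp only: Polygamma_1_reflection[OF assms] sin_square_E[OF assms])
qed

text \<open>Twice zeta(2), since 1 / 0 = 0 removes m = 0. Divided by (2 pi i)^2 it becomes the -1/12
  in the row of index 0 below.\<close>

lemma int_inverse_square_sum_0:
  "((\<lambda>m::int. 1 / (of_int m :: complex) ^ 2) has_sum (of_real pi ^ 2 / 3)) UNIV"
proof -
  have "summable (\<lambda>k. norm (1 / (1 + of_nat k :: complex) ^ 2))"
    using inverse_square_summable[of 1] by (simp add: inverse_eq_divide)
  moreover have "(\<lambda>k. 1 / (1 + of_nat k :: complex) ^ 2) sums (of_real pi ^ 2 / 6)"
  proof -
    have "(\<lambda>n. complex_of_real (1 / (real n + 1) ^ 2)) sums of_real (pi ^ 2 / 6)"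
      using sums_of_real[OF inverse_squares_sums, where ?'a = complex] by (simp add: add.commute)
    thus ?thesis by (simp add: add.commute)
  qed
  ultimately have s: "((\<lambda>k. 1 / (1 + of_nat k :: complex) ^ 2) has_sum (of_real pi ^ 2 / 6)) UNIV"
    by (rule norm_summable_imp_has_sum)
  have "((\<lambda>m::int. 1 / (of_int m :: complex) ^ 2) has_sum (of_real pi ^ 2 / 6 + of_real pi ^ 2 / 6)) UNIV"
  proof (rule int_has_sum_split)
    have "(of_int (- int (Suc k)) :: complex) ^ 2 = (1 + of_nat k) ^ 2" for k
      by (simp add: power2_eq_square algebra_simps)
    thus "((\<lambda>k. 1 / (of_int (- int (Suc k)) :: complex) ^ 2) has_sum (of_real pi ^ 2 / 6)) UNIV"
      using s by (simp only:)
    have "((\<lambda>k. 1 / (of_nat k :: complex) ^ 2) has_sum (of_real pi ^ 2 / 6)) (range Suc)"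
      using s by (subst has_sum_reindex) (auto simp: o_def)
    hence "((\<lambda>k. 1 / (of_nat k :: complex) ^ 2) has_sum (of_real pi ^ 2 / 6)) UNIV"
      by (rule has_sum_cong_neutral[THEN iffD1, rotated -1]) (auto simp: image_iff, metis not0_implies_Suc)
    thus "((\<lambda>k. 1 / (of_int (int k) :: complex) ^ 2) has_sum (of_real pi ^ 2 / 6)) UNIV" by simp
  qed
  thus ?thesis by simp
qed

text \<open>Absolute convergence allows summation row by row, and each row is evaluated by
  \<open>int_inverse_square_sum\<close>. The row of index 0 is complete because
  \<open>wp_altdef\<close> includes \<omega> = 0.\<close>

lemma wp_row_sum:
  assumes \<tau>: "\<tau> \<in> uhp" and z: "z \<notin> period_lattice \<tau>"
  shows "((\<lambda>n::int. (2 * of_real pi * \<i>) ^ 2 *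
           (E (cexp (z - of_int n * \<tau>)) - (if n = 0 then - 1 / 12 else E (cexp (of_int n * \<tau>))))) has_sum wp z \<tau>) UNIV"
proof -
  let ?t = "\<lambda>\<omega>. 1 / (z - \<omega>) ^ 2 - 1 / \<omega> ^ 2"
  have "(?t has_sum wp z \<tau>) (period_lattice \<tau>)"
    unfolding wp_altdef[OF \<tau>] by (rule has_sum_infsum[OF wp_terms_summable'[OF \<tau>]])
  hence "((\<lambda>p. ?t (lattice_point \<tau> p)) has_sum wp z \<tau>) UNIV"
    by (subst has_sum_reindex_bij_betw[OF bij_lattice_point(2)[OF \<tau>]])
  \<comment> \<open>\<open>has_sum_SigmaD\<close> sums over the second coordinate first, whereas a
    row fixes the coefficient of \<tau>, which is the second coordinate of
    \<open>lattice_point\<close>.\<close>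
  hence "((\<lambda>p. ?t (lattice_point \<tau> (prod.swap p))) has_sum wp z \<tau>) UNIV"
    by (subst has_sum_reindex_bij_betw[of prod.swap UNIV UNIV "\<lambda>p. ?t (lattice_point \<tau> p)"]) (auto simp: bij_swap)
  hence "((\<lambda>(n, m). ?t (lattice_point \<tau> (m, n))) has_sum wp z \<tau>) (Sigma UNIV (\<lambda>_. UNIV))"
    by (simp add: case_prod_unfold prod.swap_def)
  thus ?thesis
  proof (rule has_sum_SigmaD, simp only: prod.case)
    fix n :: int
    have im: "Im \<tau> > 0" using \<tau> by (rule uhp_D)
    have zn: "z - of_int n * \<tau> \<notin> \<int>"
    proof
      assume "z - of_int n * \<tau> \<in> \<int>"
      then obtain m where "z - of_int n * \<tau> = of_int m" by (auto elim: Ints_cases)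
      hence "z = lattice_point \<tau> (m, n)" by (simp add: lattice_point_def algebra_simps)
      thus False using z by (simp add: period_lattice_range)
    qed
    have neg: "((\<lambda>m::int. f (- m)) has_sum S) UNIV" if "(f has_sum S) UNIV" for f :: "int \<Rightarrow> complex" and S
      using that by (subst has_sum_reindex_bij_betw[of uminus UNIV UNIV f]) (auto intro: bij_uminus)
    have 1: "((\<lambda>m::int. 1 / (z - lattice_point \<tau> (m, n)) ^ 2) has_sum
        (2 * of_real pi * \<i>) ^ 2 * E (cexp (z - of_int n * \<tau>))) UNIV"
      using neg[OF int_inverse_square_sum[OF zn]] by (simp add: lattice_point_def algebra_simps)
    have 2: "((\<lambda>m::int. 1 / lattice_point \<tau> (m, n) ^ 2) has_sum
        (2 * of_real pi * \<i>) ^ 2 * (if n = 0 then - 1 / 12 else E (cexp (of_int n * \<tau>)))) UNIV"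
    proof (cases "n = 0")
      case True
      thus ?thesis using int_inverse_square_sum_0 by (simp add: lattice_point_def power_mult_distrib)
    next
      case False
      have "of_int n * \<tau> \<notin> \<int>"
      proof
        assume "of_int n * \<tau> \<in> \<int>"
        then obtain m where "of_int n * \<tau> = of_int m" by (auto elim: Ints_cases)
        hence "Im (of_int n * \<tau>) = 0" by simp
        thus False using im False by simp
      qed
      from int_inverse_square_sum[OF this] show ?thesis
        using False by (simp add: lattice_point_def add.commute)
    qed
    show "((\<lambda>m. ?t (lattice_point \<tau> (m, n))) has_sum (2 * of_real pi * \<i>) ^ 2 *
           (E (cexp (z - of_int n * \<tau>)) - (if n = 0 then - 1 / 12 else E (cexp (of_int n * \<tau>))))) UNIV"
      using has_sum_add[OF 1 has_sum_uminusI[OF 2]] by (simp add: right_diff_distrib)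
  qed
qed

lemma int_has_sum_fold:
  fixes g :: "int \<Rightarrow> complex"
  assumes "(g has_sum S) UNIV"
  shows "((\<lambda>k. g (int (Suc k)) + g (- int (Suc k))) has_sum (S - g 0)) UNIV"
proof -
  have summ: "g summable_on A" for A
    by (rule summable_on_subset_banach[OF has_sum_imp_summable[OF assms]]) auto
  have 1: "((\<lambda>k. g (int (Suc k))) has_sum infsum g (range (\<lambda>k. int (Suc k)))) UNIV"
    using has_sum_reindex[of "\<lambda>k. int (Suc k)" UNIV g] has_sum_infsum[OF summ[of "range (\<lambda>k. int (Suc k))"]]
    by (auto simp: inj_on_def o_def)
  have 2: "((\<lambda>k. g (- int (Suc k))) has_sum infsum g (range (\<lambda>k. - int (Suc k)))) UNIV"
    using has_sum_reindex[of "\<lambda>k. - int (Suc k)" UNIV g] has_sum_infsum[OF summ[of "range (\<lambda>k. - int (Suc k))"]]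
    by (auto simp: inj_on_def o_def)
  have "UNIV = insert 0 (range (\<lambda>k. int (Suc k)) \<union> range (\<lambda>k. - int (Suc k)))"
  proof (intro equalityI subsetI UNIV_I)
    show "x \<in> insert 0 (range (\<lambda>k. int (Suc k)) \<union> range (\<lambda>k. - int (Suc k)))" for x :: int
      by (cases x rule: int_cases3) (auto simp: image_iff gr0_conv_Suc)
  qed
  hence "S = infsum g (insert 0 (range (\<lambda>k. int (Suc k)) \<union> range (\<lambda>k. - int (Suc k))))"
    using infsumI[OF assms] by simp
  also have "\<dots> = g 0 + infsum g (range (\<lambda>k. int (Suc k)) \<union> range (\<lambda>k. - int (Suc k)))"
    by (rule infsum_insert) (auto intro: summ)
  also have "infsum g (range (\<lambda>k. int (Suc k)) \<union> range (\<lambda>k. - int (Suc k))) =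
      infsum g (range (\<lambda>k. int (Suc k))) + infsum g (range (\<lambda>k. - int (Suc k)))"
    by (rule infsum_Un_disjoint) (auto intro: summ)
  finally show ?thesis using has_sum_add[OF 1 2] by (simp add: algebra_simps)
qed

text \<open>\<open>wpq N r s x\<close> is \<open>(2\<pi>i)\<^sup>-\<^sup>2 \<wp>((r\<tau> + s)/N; \<tau>)\<close> in terms of \<open>x = exp(2\<pi>i\<tau>/N)\<close>, for \<open>0 \<le> r < N\<close>.\<close>

definition wpq_term :: "nat \<Rightarrow> nat \<Rightarrow> complex \<Rightarrow> nat \<Rightarrow> complex \<Rightarrow> complex" where
  "wpq_term N r c k x = E (c * x ^ (N * Suc k + r)) + E (inverse c * x ^ (N * Suc k - r)) - 2 * E (x ^ (N * Suc k))"

definition wpq :: "nat \<Rightarrow> nat \<Rightarrow> int \<Rightarrow> complex \<Rightarrow> complex" where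
  "wpq N r s x = 1 / 12 + E (cexp (of_int s / of_nat N) * x ^ r) +
     (\<Sum>\<^sub>\<infinity>k. wpq_term N r (cexp (of_int s / of_nat N)) k x)"

text \<open>The rows n and -n are added. The exponent r - N n of one of them is negative, and
  \<open>E_inverse\<close> replaces it by N n - r, which is positive because r < N. The row 0
  provides the constant 1/12 and E(c x^r).\<close>

theorem wp_eq_wpq:
  assumes \<tau>: "\<tau> \<in> uhp" and r: "r < N" and rs: "r \<noteq> 0 \<or> \<not> int N dvd s"
  shows "wp ((of_nat r * \<tau> + of_int s) / of_nat N) \<tau> = (2 * of_real pi * \<i>) ^ 2 * wpq N r s (cexp (\<tau> / of_nat N))"
proof -
  define c where "c = cexp (of_int s / of_nat N)"
  define x where "x = cexp (\<tau> / of_nat N)"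
  define z where "z = (of_nat r * \<tau> + of_int s) / of_nat N"
  define P where "P = (2 * of_real pi * \<i>) ^ 2"
  have c0: "c \<noteq> 0" "x \<noteq> 0" by (simp_all add: c_def x_def)
  have P0: "P \<noteq> 0" by (simp add: P_def)
  have N: "N > 0" using r by simp
  have "\<not> (int N dvd int r \<and> int N dvd s)" using r rs by (auto dest: zdvd_imp_le)
  hence z: "z \<notin> period_lattice \<tau>" using rat_lattice_iff[OF \<tau>, of "int N" "int r" s] N by (simp add: z_def)
  define g where "g = (\<lambda>n::int. P * (E (cexp (z - of_int n * \<tau>)) - (if n = 0 then - 1 / 12 else E (cexp (of_int n * \<tau>)))))"
  have g: "(g has_sum wp z \<tau>) UNIV" unfolding g_def P_def by (rule wp_row_sum[OF \<tau> z])
  have zw: "cexp z = c * x ^ r"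
    unfolding z_def c_def x_def by (simp add: add_divide_distrib cexp_add flip: cexp_of_nat_mult)
  have q: "cexp (of_nat n * \<tau>) = x ^ (N * n)" for n
    unfolding x_def using N by (simp flip: cexp_of_nat_mult)
  have q2: "cexp (\<tau> + of_nat k * \<tau>) = x ^ (N * Suc k)" for k
    using q[of "Suc k"] by (simp add: ring_distribs)
  have trm: "g (int (Suc k)) + g (- int (Suc k)) = P * wpq_term N r c k x" for k
  proof -
    have "cexp (z - of_int (int (Suc k)) * \<tau>) = cexp (z - (\<tau> + of_nat k * \<tau>))"
      by (simp add: algebra_simps)
    also have "\<dots> = c * x ^ r / x ^ (N * Suc k)" by (simp only: cexp_diff zw q2)
    also have "\<dots> = inverse (inverse c * x ^ (N * Suc k - r))"
    proof -
      have "r \<le> N * Suc k" using r by simp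
      hence "x ^ (N * Suc k) = x ^ r * x ^ (N * Suc k - r)" by (simp flip: power_add)
      thus ?thesis using c0 by (simp add: field_simps)
    qed
    finally have 1: "E (cexp (z - of_int (int (Suc k)) * \<tau>)) = E (inverse c * x ^ (N * Suc k - r))"
      by (simp only: E_inverse)
    have "cexp (z - of_int (- int (Suc k)) * \<tau>) = cexp (z + (\<tau> + of_nat k * \<tau>))"
      by (simp add: algebra_simps)
    also have "\<dots> = c * x ^ (N * Suc k + r)" by (simp only: cexp_add[of z] zw q2 power_add) (simp only: mult_ac)
    finally have 2: "cexp (z - of_int (- int (Suc k)) * \<tau>) = c * x ^ (N * Suc k + r)" .
    have "cexp (of_int (int (Suc k)) * \<tau>) = cexp (\<tau> + of_nat k * \<tau>)" by (simp add: ring_distribs)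
    hence 3: "cexp (of_int (int (Suc k)) * \<tau>) = x ^ (N * Suc k)" by (simp only: q2)
    have "cexp (of_int (- int (Suc k)) * \<tau>) = cexp (- (of_int (int (Suc k)) * \<tau>))"
      by (simp only: of_int_minus mult_minus_left)
    hence "cexp (of_int (- int (Suc k)) * \<tau>) = inverse (x ^ (N * Suc k))"
      by (simp only: cexp_minus 3)
    hence 4: "E (cexp (of_int (- int (Suc k)) * \<tau>)) = E (x ^ (N * Suc k))"
      by (simp only: E_inverse)
    have ne: "int (Suc k) \<noteq> 0" "- int (Suc k) \<noteq> 0" by auto
    show ?thesis unfolding g_def if_not_P[OF ne(1)] if_not_P[OF ne(2)] 1 2 3 4 wpq_term_def
      by (simp add: algebra_simps)
  qed
  have "((\<lambda>k. P * wpq_term N r c k x) has_sum (wp z \<tau> - g 0)) UNIV"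
    using int_has_sum_fold[OF g] by (simp only: trm)
  moreover have cancel: "inverse P * (P * t) = t" for t using P0 by simp
  ultimately have "((\<lambda>k. inverse P * (P * wpq_term N r c k x)) has_sum (inverse P * (wp z \<tau> - g 0))) UNIV"
    by (intro has_sum_cmult_right)
  hence "((\<lambda>k. wpq_term N r c k x) has_sum (inverse P * (wp z \<tau> - g 0))) UNIV"
    by (simp only: cancel)
  from infsumI[OF this] have "wpq N r s x = 1 / 12 + E (c * x ^ r) + inverse P * (wp z \<tau> - g 0)"
    by (simp only: wpq_def c_def)
  moreover have "g 0 = P * (E (c * x ^ r) + 1 / 12)" by (simp add: g_def zw)
  ultimately have "P * wpq N r s x = g 0 + (P * inverse P) * (wp z \<tau> - g 0)"
    by (simp only: ring_distribs mult.assoc add_ac)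
  hence "P * wpq N r s x = wp z \<tau>" using P0 by simp
  thus ?thesis by (simp add: P_def z_def x_def)
qed

section \<open>Power series and Laurent series over a subfield\<close>

definition is_subfield :: "complex set \<Rightarrow> bool" where
  "is_subfield K \<longleftrightarrow> 1 \<in> K \<and> (\<forall>a\<in>K. \<forall>b\<in>K. a - b \<in> K \<and> a * b \<in> K \<and> inverse a \<in> K)"

lemma is_subfieldD:
  assumes "is_subfield K"
  shows "1 \<in> K" "0 \<in> K" "a \<in> K \<Longrightarrow> b \<in> K \<Longrightarrow> a - b \<in> K" "a \<in> K \<Longrightarrow> - a \<in> K"
    "a \<in> K \<Longrightarrow> b \<in> K \<Longrightarrow> a + b \<in> K" "a \<in> K \<Longrightarrow> b \<in> K \<Longrightarrow> a * b \<in> K" "a \<in> K \<Longrightarrow> inverse a \<in> K"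
    "a \<in> K \<Longrightarrow> b \<in> K \<Longrightarrow> a / b \<in> K"
proof -
  show 1: "1 \<in> K" and diff: "\<And>a b. a \<in> K \<Longrightarrow> b \<in> K \<Longrightarrow> a - b \<in> K"
    and mult: "\<And>a b. a \<in> K \<Longrightarrow> b \<in> K \<Longrightarrow> a * b \<in> K" and inv: "\<And>a. a \<in> K \<Longrightarrow> inverse a \<in> K"
    using assms by (auto simp: is_subfield_def)
  show 0: "0 \<in> K" using diff[OF 1 1] by simp
  show neg: "\<And>a. a \<in> K \<Longrightarrow> - a \<in> K" using diff[OF 0] by fastforce
  show "a \<in> K \<Longrightarrow> b \<in> K \<Longrightarrow> a + b \<in> K" using diff[OF _ neg, of a b] by simp
  show "a \<in> K \<Longrightarrow> b \<in> K \<Longrightarrow> a / b \<in> K" using mult[OF _ inv, of a b] by (simp add: field_simps)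
qed

lemma subfield_sum:
  assumes "is_subfield K" "\<And>i. i \<in> I \<Longrightarrow> f i \<in> K"
  shows "sum f I \<in> K"
  using assms(2) by (induction I rule: infinite_finite_induct) (auto intro: is_subfieldD[OF assms(1)])

lemma subfield_of_nat: "is_subfield K \<Longrightarrow> of_nat n \<in> K"
  by (induction n) (auto intro: is_subfieldD)

lemma subfield_numeral: "is_subfield K \<Longrightarrow> numeral n \<in> K"
  using subfield_of_nat[of K "numeral n"] by simp

lemma subfield_power: "is_subfield K \<Longrightarrow> a \<in> K \<Longrightarrow> a ^ n \<in> K"
  by (induction n) (auto intro: is_subfieldD)

definition fps_over :: "complex set \<Rightarrow> complex fps set" where
  "fps_over K = {F. \<forall>n. fps_nth F n \<in> K}"

context
  fixes K assumes K: "is_subfield K"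
begin

lemma fps_over_const: "c \<in> K \<Longrightarrow> fps_const c \<in> fps_over K"
  and fps_over_add: "F \<in> fps_over K \<Longrightarrow> G \<in> fps_over K \<Longrightarrow> F + G \<in> fps_over K"
  and fps_over_diff: "F \<in> fps_over K \<Longrightarrow> G \<in> fps_over K \<Longrightarrow> F - G \<in> fps_over K"
  and fps_over_X_power: "fps_X ^ n \<in> fps_over K"
  using is_subfieldD[OF K] by (auto simp: fps_over_def)

lemma fps_over_mult: "F \<in> fps_over K \<Longrightarrow> G \<in> fps_over K \<Longrightarrow> F * G \<in> fps_over K"
  by (auto simp: fps_over_def fps_mult_nth intro!: subfield_sum[OF K] is_subfieldD[OF K])

lemma fps_over_1: "1 \<in> fps_over K"
  using fps_over_X_power[of 0] by simp

lemma fps_over_power: "F \<in> fps_over K \<Longrightarrow> F ^ n \<in> fps_over K"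
  by (induction n) (auto intro: fps_over_1 fps_over_mult)

lemma fps_over_sum: "(\<And>i. i \<in> I \<Longrightarrow> F i \<in> fps_over K) \<Longrightarrow> sum F I \<in> fps_over K"
  by (auto simp: fps_over_def fps_sum_nth intro!: subfield_sum[OF K])

text \<open>The coefficients of the inverse satisfy a recursion that divides only by the constant
  term. If that term is 0, the inverse is 0 by convention.\<close>

lemma fps_over_inverse:
  assumes "F \<in> fps_over K"
  shows "inverse F \<in> fps_over K"
proof (cases "fps_nth F 0 = 0")
  case True
  thus ?thesis using is_subfieldD(2)[OF K] by (simp add: fps_over_def fps_inverse_eq_0)
next
  case False
  have "fps_nth (inverse F) n \<in> K" for n
  proof (induction n rule: less_induct)
    case (less n)
    show ?case
    proof (cases n)
      case 0
      thus ?thesis using assms is_subfieldD(7)[OF K] by (simp add: fps_over_def)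
    next
      case (Suc m)
      have "0 = fps_nth (F * inverse F) n"
        using False Suc by (simp add: inverse_mult_eq_1')
      also have "\<dots> = (\<Sum>i=0..n. fps_nth F i * fps_nth (inverse F) (n - i))"
        by (rule fps_mult_nth)
      also have "\<dots> = fps_nth F 0 * fps_nth (inverse F) n + (\<Sum>i=Suc 0..n. fps_nth F i * fps_nth (inverse F) (n - i))"
        by (simp add: sum.atLeast_Suc_atMost)
      finally have "fps_nth (inverse F) n =
          - (\<Sum>i=Suc 0..n. fps_nth F i * fps_nth (inverse F) (n - i)) / fps_nth F 0"
        using False by (simp add: field_simps add_eq_0_iff)
      moreover have "(\<Sum>i=Suc 0..n. fps_nth F i * fps_nth (inverse F) (n - i)) \<in> K"
        using assms Suc by (intro subfield_sum[OF K] is_subfieldD(6)[OF K]) (auto simp: fps_over_def intro!: less)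
      ultimately show ?thesis using assms by (auto simp: fps_over_def intro!: is_subfieldD[OF K])
    qed
  qed
  thus ?thesis by (simp add: fps_over_def)
qed

end

definition fls_over :: "complex set \<Rightarrow> complex fls set" where
  "fls_over K = {F. \<forall>n. fls_nth F n \<in> K}"

context
  fixes K assumes K: "is_subfield K"
begin

lemma fls_over_const: "c \<in> K \<Longrightarrow> fls_const c \<in> fls_over K"
  and fls_over_add: "F \<in> fls_over K \<Longrightarrow> G \<in> fls_over K \<Longrightarrow> F + G \<in> fls_over K"
  and fls_over_diff: "F \<in> fls_over K \<Longrightarrow> G \<in> fls_over K \<Longrightarrow> F - G \<in> fls_over K"
  and fls_over_uminus: "F \<in> fls_over K \<Longrightarrow> - F \<in> fls_over K"
  and fls_over_shift: "F \<in> fls_over K \<Longrightarrow> fls_shift m F \<in> fls_over K"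
  using is_subfieldD[OF K] by (auto simp: fls_over_def fls_const_nth)

lemma fls_over_fps: "F \<in> fps_over K \<Longrightarrow> fps_to_fls F \<in> fls_over K"
  using is_subfieldD[OF K] by (auto simp: fls_over_def fps_over_def)

lemma fls_over_1: "1 \<in> fls_over K"
  using fls_over_const[of 1] is_subfieldD(1)[OF K] by simp

lemma fls_over_mult: "F \<in> fls_over K \<Longrightarrow> G \<in> fls_over K \<Longrightarrow> F * G \<in> fls_over K"
  by (auto simp: fls_over_def fls_times_nth(2) intro!: subfield_sum[OF K] is_subfieldD(6)[OF K])

lemma fls_over_power: "F \<in> fls_over K \<Longrightarrow> F ^ n \<in> fls_over K"
  by (induction n) (auto intro: fls_over_1 fls_over_mult)

lemma fls_over_inverse: "F \<in> fls_over K \<Longrightarrow> inverse F \<in> fls_over K"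
  unfolding fls_inverse_def
  by (intro fls_over_shift fls_over_fps fps_over_inverse[OF K]) (auto simp: fls_over_def fps_over_def)

lemma fls_over_divide: "F \<in> fls_over K \<Longrightarrow> G \<in> fls_over K \<Longrightarrow> F / G \<in> fls_over K"
  unfolding fls_divide_convert_times_inverse by (intro fls_over_mult fls_over_inverse)

end

section \<open>Convergence and coefficients of the expansion of division values\<close>

lemma E_mult_bound:
  assumes c: "norm c = 1" and x: "norm x \<le> \<rho>" "\<rho> < 1" and l: "k \<le> l" "l \<ge> 1"
  shows "norm (E (c * x ^ l)) \<le> norm x ^ k / (1 - \<rho>) ^ 2" "c * x ^ l \<noteq> 1"
proof -
  have x1: "norm x \<le> 1" using x by simp
  have "norm (c * x ^ l) = norm x ^ l" using c by (simp add: norm_mult norm_power)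
  moreover have "norm x ^ l \<le> norm x ^ 1" using l x1 by (intro power_decreasing) auto
  ultimately have "norm (c * x ^ l) \<le> \<rho>" using x by simp
  hence *: "norm (1 - c * x ^ l) \<ge> 1 - \<rho>"
    using norm_triangle_ineq2[of 1 "c * x ^ l"] by simp
  show "c * x ^ l \<noteq> 1" using * x(2) by auto
  have "norm (E (c * x ^ l)) = norm x ^ l / norm (1 - c * x ^ l) ^ 2"
    using c by (simp add: E_def norm_divide norm_mult norm_power)
  also have "\<dots> \<le> norm x ^ k / (1 - \<rho>) ^ 2"
    using * x x1 l by (intro frac_le power_mono power_decreasing) auto
  finally show "norm (E (c * x ^ l)) \<le> norm x ^ k / (1 - \<rho>) ^ 2" .
qed

text \<open>In the summand of index k all exponents of x are at least k + 1. This gives geometric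
  convergence, and only finitely many summands reach a given coefficient.\<close>

lemma wpq_exponents:
  assumes "r < N"
  shows "Suc k \<le> N * Suc k + r" "Suc k \<le> N * Suc k - r" "Suc k \<le> N * Suc k"
proof -
  have "Suc k + r \<le> N * Suc k"
  proof -
    obtain m where m: "N = Suc (r + m)" using assms by (metis less_imp_Suc_add)
    show ?thesis unfolding m by simp
  qed
  thus "Suc k \<le> N * Suc k + r" "Suc k \<le> N * Suc k - r" "Suc k \<le> N * Suc k" by simp_all
qed

lemma wpq_term_bound:
  assumes r: "r < N" and c: "norm c = 1" and x: "norm x \<le> \<rho>" "\<rho> < 1"
  shows "norm (wpq_term N r c k x) \<le> 4 * norm x ^ Suc k / (1 - \<rho>) ^ 2"
proof -
  have c': "norm (inverse c) = 1" using c by (simp add: norm_inverse)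
  have 1: "norm (E (c * x ^ (N * Suc k + r))) \<le> norm x ^ Suc k / (1 - \<rho>) ^ 2"
    using wpq_exponents(1)[OF r, of k] by (intro E_mult_bound c x) auto
  have 2: "norm (E (inverse c * x ^ (N * Suc k - r))) \<le> norm x ^ Suc k / (1 - \<rho>) ^ 2"
    using wpq_exponents(2)[OF r, of k] by (intro E_mult_bound c' x) auto
  have "norm (E (1 * x ^ (N * Suc k))) \<le> norm x ^ Suc k / (1 - \<rho>) ^ 2"
    using wpq_exponents(3)[OF r, of k] by (intro E_mult_bound x) auto
  hence 3: "norm (2 * E (x ^ (N * Suc k))) \<le> 2 * (norm x ^ Suc k / (1 - \<rho>) ^ 2)"
    unfolding norm_mult by simp
  show ?thesis
    unfolding wpq_term_def
    using norm_triangle_mono[OF norm_triangle_mono[OF 1 2] 3[folded norm_minus_cancel[of "2 * _"]]]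
    by (simp add: algebra_simps)
qed

lemma norm_cexp_real [simp]: "norm (cexp (of_int s / of_nat N)) = 1"
proof -
  have "of_int s / of_nat N = (complex_of_real (of_int s / of_nat N))" by simp
  thus ?thesis unfolding norm_cexp by (metis Im_complex_of_real exp_zero mult_zero_right)
qed

lemma cexp_frac_eq_1_iff:
  assumes "N > 0"
  shows "cexp (of_int s / of_nat N) = 1 \<longleftrightarrow> int N dvd s"
proof
  assume "cexp (of_int s / of_nat N) = 1"
  then obtain n where "of_int s / of_nat N = (of_int n :: complex)"
    unfolding cexp_eq_1_iff by (auto elim: Ints_cases)
  hence "(of_int s :: complex) = of_int (int N * n)" using assms by (simp add: field_simps)
  hence "s = int N * n" by (simp only: of_int_eq_iff)
  thus "int N dvd s" by simp
next
  assume "int N dvd s"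
  then obtain n where "s = int N * n" by (auto simp: dvd_def)
  hence "of_int s / of_nat N = (of_int n :: complex)" using assms by simp
  thus "cexp (of_int s / of_nat N) = 1" by simp
qed

lemma wpq_term_summable:
  assumes r: "r < N" and c: "norm c = 1" and x: "norm x < 1"
  shows "(\<lambda>k. wpq_term N r c k x) summable_on UNIV"
proof (rule norm_summable_imp_summable_on, rule summable_comparison_test_ev)
  show "summable (\<lambda>k. 4 * norm x ^ Suc k / (1 - norm x) ^ 2)"
    using x by (intro summable_divide summable_mult) (simp add: summable_Suc_iff summable_geometric)
  show "eventually (\<lambda>k. norm (norm (wpq_term N r c k x)) \<le> 4 * norm x ^ Suc k / (1 - norm x) ^ 2) at_top"
    using wpq_term_bound[OF r c order_refl x] by simp
qed

lemma wpq_holomorphic: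
  assumes r: "r < N" and rs: "r \<noteq> 0 \<or> \<not> int N dvd s"
  shows "wpq N r s holomorphic_on ball 0 1"
proof -
  define c where "c = cexp (of_int s / of_nat N)"
  have c: "norm c = 1" and c': "norm (inverse c) = 1" by (simp_all add: c_def norm_inverse)
  {
    fix x assume x: "x \<in> ball (0::complex) 1"
    \<comment> \<open>A radius strictly between \<open>norm x\<close> and 1, so that one geometric
      majorant holds on a neighbourhood of x.\<close>
    define \<rho> where "\<rho> = (1 + norm x) / 2"
    have \<rho>: "\<rho> < 1" "norm x < \<rho>" using x by (auto simp: \<rho>_def)
    have "(\<lambda>x. \<Sum>\<^sub>\<infinity>k. wpq_term N r c k x) holomorphic_on ball 0 \<rho>"
    proof (rule holomorphic_on_infsum)
      fix k :: nat
      have E: "(\<lambda>x. E (a * x ^ l)) holomorphic_on ball 0 \<rho>" if "norm a = 1" "l \<ge> 1" for a l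
        unfolding E_def using E_mult_bound(2)[OF that(1) _ \<rho>(1) order_refl that(2)]
        by (intro holomorphic_intros) force
      show "wpq_term N r c k holomorphic_on ball 0 \<rho>"
        unfolding wpq_term_def using E[OF c, of "N * Suc k + r"] E[OF c', of "N * Suc k - r"] E[of 1 "N * Suc k"]
          wpq_exponents[OF r, of k]
        by (intro holomorphic_intros) auto
      fix x :: complex assume "x \<in> ball 0 \<rho>"
      hence x: "norm x \<le> \<rho>" by simp
      have "norm (wpq_term N r c k x) \<le> 4 * norm x ^ Suc k / (1 - \<rho>) ^ 2"
        by (rule wpq_term_bound[OF r c x \<rho>(1)])
      also have "\<dots> \<le> 4 * \<rho> ^ Suc k / (1 - \<rho>) ^ 2"
        using x by (intro divide_right_mono mult_left_mono power_mono) auto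
      finally show "norm (wpq_term N r c k x) \<le> 4 * \<rho> ^ Suc k / (1 - \<rho>) ^ 2" .
    next
      have "\<rho> \<ge> 0" using \<rho>(2) norm_ge_zero[of x] by linarith
      hence "summable (\<lambda>k. norm (4 * \<rho> ^ Suc k / (1 - \<rho>) ^ 2))"
        using \<rho> by (simp add: norm_mult norm_power summable_divide summable_mult summable_geometric)
      thus "(\<lambda>k. 4 * \<rho> ^ Suc k / (1 - \<rho>) ^ 2) summable_on UNIV"
        by (rule norm_summable_imp_summable_on)
    qed auto
    moreover have "(\<lambda>x. E (c * x ^ r)) holomorphic_on ball 0 \<rho>"
    proof (cases "r = 0")
      case False
      thus ?thesis unfolding E_def using E_mult_bound(2)[OF c _ \<rho>(1) order_refl, of _ r]
        by (intro holomorphic_intros) force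
    qed auto
    ultimately have "wpq N r s holomorphic_on ball 0 \<rho>"
      unfolding wpq_def c_def[symmetric] by (intro holomorphic_intros)
    hence "wpq N r s field_differentiable at x"
      using \<rho>(2) by (auto simp: holomorphic_on_def at_within_open[OF _ open_ball])
    hence "wpq N r s field_differentiable at x within ball 0 1"
      by (rule field_differentiable_at_within)
  }
  thus ?thesis by (simp add: holomorphic_on_def)
qed

definition Efps :: "complex \<Rightarrow> nat \<Rightarrow> complex fps" where
  "Efps c l = fps_const c * fps_X ^ l * inverse ((1 - fps_const c * fps_X ^ l) ^ 2)"

lemma Efps_expansion:
  assumes "l \<noteq> 0 \<or> c \<noteq> 1"
  shows "(\<lambda>x. E (c * x ^ l)) has_fps_expansion Efps c l"
proof -
  have "fps_nth ((1 - fps_const c * fps_X ^ l) ^ 2) 0 \<noteq> 0"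
    using assms by (cases "l = 0") (auto simp: power2_eq_square)
  hence "(\<lambda>x. c * x ^ l * inverse ((1 - c * x ^ l) ^ 2)) has_fps_expansion Efps c l"
    unfolding Efps_def by (intro fps_expansion_intros)
  thus ?thesis by (simp add: E_def field_simps)
qed

lemma Efps_nth:
  assumes "l > 0"
  shows "n < l \<Longrightarrow> fps_nth (Efps c l) n = 0" "fps_nth (Efps c l) l = c"
proof -
  define G where "G = inverse ((1 - fps_const c * fps_X ^ l) ^ 2)"
  have G0: "fps_nth G 0 = 1" using assms by (simp add: G_def power2_eq_square)
  have eq: "Efps c l = fps_const c * (fps_X ^ l * G)" by (simp add: Efps_def G_def mult.assoc)
  show "n < l \<Longrightarrow> fps_nth (Efps c l) n = 0" "fps_nth (Efps c l) l = c"
    unfolding eq by (simp_all add: fps_X_power_mult_nth G0)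
qed

lemma Efps_over: "is_subfield K \<Longrightarrow> c \<in> K \<Longrightarrow> Efps c l \<in> fps_over K"
  unfolding Efps_def
  by (intro fps_over_mult fps_over_const fps_over_X_power fps_over_inverse fps_over_power fps_over_diff fps_over_1)

definition wpq_fps_term :: "nat \<Rightarrow> nat \<Rightarrow> complex \<Rightarrow> nat \<Rightarrow> complex fps" where
  "wpq_fps_term N r c k = Efps c (N * Suc k + r) + Efps (inverse c) (N * Suc k - r) - 2 * Efps 1 (N * Suc k)"

text \<open>The constant is 32 = 4 * 4 * 2: the three summands with weights 1, 1, 2, the factor (1 -
  1/2)^(-2), and the geometric series.\<close>

lemma wpq_tail_bound:
  assumes r: "r < N" and c: "norm c = 1" and x: "norm x \<le> 1/2"
  shows "norm ((\<Sum>\<^sub>\<infinity>k. wpq_term N r c k x) - (\<Sum>k<M. wpq_term N r c k x)) \<le> 32 * norm x ^ Suc M"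
proof -
  let ?t = "\<lambda>k. wpq_term N r c k x"
  have x1: "norm x < 1" using x by simp
  have "UNIV = {..<M} \<union> {M..}" by auto
  hence "(\<Sum>\<^sub>\<infinity>k. ?t k) = infsum ?t ({..<M} \<union> {M..})" by simp
  also have "\<dots> = infsum ?t {..<M} + infsum ?t {M..}"
    by (intro infsum_Un_disjoint summable_on_subset_banach[OF wpq_term_summable[OF r c x1]]) auto
  finally have eq: "(\<Sum>\<^sub>\<infinity>k. ?t k) - (\<Sum>k<M. ?t k) = infsum ?t {M..}" by simp
  have "((\<lambda>j. 16 * norm x ^ Suc M * norm x ^ j) has_sum (16 * norm x ^ Suc M * (1 / (1 - norm x)))) UNIV"
    using x1 by (intro has_sum_cmult_right norm_summable_imp_has_sum geometric_sums) (auto simp: norm_power summable_geometric)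
  hence "((\<lambda>j. 16 * norm x ^ Suc (M + j)) has_sum (16 * norm x ^ Suc M * (1 / (1 - norm x)))) UNIV"
    by (simp add: power_add mult_ac)
  hence "((\<lambda>k. 16 * norm x ^ Suc k) has_sum (16 * norm x ^ Suc M * (1 / (1 - norm x)))) {M..}"
    by (subst has_sum_reindex_bij_witness[of _ "\<lambda>j. M + j" "\<lambda>k. k - M" UNIV "\<lambda>j. 16 * norm x ^ Suc (M + j)"]) auto
  hence "norm (infsum ?t {M..}) \<le> 16 * norm x ^ Suc M * (1 / (1 - norm x))"
  proof (rule norm_infsum_le[rotated])
    show "(?t has_sum infsum ?t {M..}) {M..}"
      by (intro has_sum_infsum summable_on_subset_banach[OF wpq_term_summable[OF r c x1]]) auto
    fix k
    have "norm (?t k) \<le> 4 * norm x ^ Suc k / (1 - 1/2) ^ 2"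
      using wpq_term_bound[OF r c x] by simp
    thus "norm (?t k) \<le> 16 * norm x ^ Suc k" by (simp add: power2_eq_square)
  qed
  also have "\<dots> \<le> 16 * norm x ^ Suc M * 2"
    using x by (intro mult_left_mono) (auto simp: field_simps)
  finally show ?thesis unfolding eq by simp
qed

text \<open>The truncation after M summands differs from \<open>wpq\<close> by O(x^(M+1)), so by
  \<open>analytic_bigo_factor\<close> its coefficients up to index M are already right. Rearranging
  an infinite sum of power series is thus avoided.\<close>

theorem wpq_fps_expansion:
  assumes r: "r < N" and rs: "r \<noteq> 0 \<or> \<not> int N dvd s"
  defines "c \<equiv> cexp (of_int s / of_nat N)"
  obtains F where "wpq N r s has_fps_expansion F"
    "\<And>M n. n \<le> M \<Longrightarrow> fps_nth F n =
       fps_nth (fps_const (1 / 12) + Efps c r + (\<Sum>k<M. wpq_fps_term N r c k)) n"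
proof -
  have c: "norm c = 1" by (simp add: c_def)
  have N: "N > 0" using r by simp
  have rc: "r \<noteq> 0 \<or> c \<noteq> 1" using rs cexp_frac_eq_1_iff[OF N, of s] by (simp add: c_def)
  have "wpq N r s analytic_on ball 0 1"
    using wpq_holomorphic[OF r rs] by (simp add: analytic_on_open)
  hence ana: "wpq N r s analytic_on {0}" by (rule analytic_on_subset) auto
  then obtain F where F: "wpq N r s has_fps_expansion F"
    using analytic_at_imp_has_fps_expansion_0 by blast
  have "fps_nth F n = fps_nth (fps_const (1 / 12) + Efps c r + (\<Sum>k<M. wpq_fps_term N r c k)) n" if n: "n \<le> M" for n M
  proof -
    define P where "P = fps_const (1 / 12) + Efps c r + (\<Sum>k<M. wpq_fps_term N r c k)"
    define p where "p = (\<lambda>x. 1 / 12 + E (c * x ^ r) + (\<Sum>k<M. wpq_term N r c k x))"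
    have t: "wpq_term N r c k has_fps_expansion wpq_fps_term N r c k" for k
    proof -
      have "N * Suc k + r \<noteq> 0" "N * Suc k - r \<noteq> 0" "N * Suc k \<noteq> 0" using wpq_exponents[OF r, of k] by auto
      hence "(\<lambda>x. E (c * x ^ (N * Suc k + r)) + E (inverse c * x ^ (N * Suc k - r)) - 2 * E (1 * x ^ (N * Suc k)))
        has_fps_expansion wpq_fps_term N r c k"
        unfolding wpq_fps_term_def by (intro fps_expansion_intros Efps_expansion) auto
      thus ?thesis by (simp add: wpq_term_def[abs_def])
    qed
    have P: "p has_fps_expansion P"
      unfolding p_def P_def by (intro fps_expansion_intros Efps_expansion rc t)
    have diff: "(\<lambda>x. wpq N r s x - p x) has_fps_expansion F - P" by (intro fps_expansion_intros F P)
    have "(\<lambda>x. wpq N r s x - p x) analytic_on {0}"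
      by (rule has_fps_expansion_imp_analytic_0[OF diff])
    moreover have "eventually (\<lambda>x. norm (wpq N r s x - p x) \<le> 32 * norm x ^ Suc M) (at 0)"
    proof -
      have "eventually (\<lambda>x::complex. x \<in> ball 0 (1/2)) (nhds 0)" by (intro eventually_nhds_in_open) auto
      hence "eventually (\<lambda>x. norm (wpq N r s x - p x) \<le> 32 * norm x ^ Suc M) (nhds 0)"
      proof eventually_elim
        case (elim x)
        hence "norm x \<le> 1/2" by simp
        from wpq_tail_bound[OF r c this, of M] show ?case by (simp add: wpq_def p_def c_def[symmetric])
      qed
      thus ?thesis by (rule filter_leD[OF at_within_le_nhds])
    qed
    ultimately obtain g where g: "g analytic_on {0}" "eventually (\<lambda>x. wpq N r s x - p x = x ^ Suc M * g x) (nhds 0)"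
      by (rule analytic_bigo_factor)
    obtain G where "g has_fps_expansion G" using analytic_at_imp_has_fps_expansion_0[OF g(1)] by blast
    hence "(\<lambda>x. x ^ Suc M * g x) has_fps_expansion fps_X ^ Suc M * G" by (intro fps_expansion_intros)
    hence "(\<lambda>x. wpq N r s x - p x) has_fps_expansion fps_X ^ Suc M * G"
      using has_fps_expansion_cong[OF g(2) refl] by blast
    with diff have "F - P = fps_X ^ Suc M * G" by (rule fps_expansion_unique_complex)
    hence "fps_nth (F - P) n = fps_nth (fps_X ^ Suc M * G) n" by simp
    also have "\<dots> = 0" using n by (simp only: fps_X_power_mult_nth) simp
    finally show ?thesis by (simp add: P_def)
  qed
  with F show ?thesis by (rule that)
qed

definition wpF :: "nat \<Rightarrow> nat \<Rightarrow> int \<Rightarrow> complex fps" where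
  "wpF N r s = fps_expansion (wpq N r s) 0"

lemma wpF:
  assumes r: "r < N" and rs: "r \<noteq> 0 \<or> \<not> int N dvd s"
  shows "wpq N r s has_fps_expansion wpF N r s"
    "n \<le> M \<Longrightarrow> fps_nth (wpF N r s) n = fps_nth (fps_const (1 / 12) + Efps (cexp (of_int s / of_nat N)) r
         + (\<Sum>k<M. wpq_fps_term N r (cexp (of_int s / of_nat N)) k)) n"
proof -
  obtain F where F: "wpq N r s has_fps_expansion F"
    "\<And>M n. n \<le> M \<Longrightarrow> fps_nth F n = fps_nth (fps_const (1 / 12) + Efps (cexp (of_int s / of_nat N)) r
        + (\<Sum>k<M. wpq_fps_term N r (cexp (of_int s / of_nat N)) k)) n"
    using wpq_fps_expansion[OF r rs] by blast
  have "wpF N r s = F" unfolding wpF_def by (rule fps_expansion_eqI[OF F(1)])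
  with F show "wpq N r s has_fps_expansion wpF N r s"
    "n \<le> M \<Longrightarrow> fps_nth (wpF N r s) n = fps_nth (fps_const (1 / 12) + Efps (cexp (of_int s / of_nat N)) r
         + (\<Sum>k<M. wpq_fps_term N r (cexp (of_int s / of_nat N)) k)) n" by simp_all
qed

lemma wpF_over:
  assumes K: "is_subfield K" and r: "r < N" and rs: "r \<noteq> 0 \<or> \<not> int N dvd s"
    and c: "cexp (of_int s / of_nat N) \<in> K"
  shows "wpF N r s \<in> fps_over K"
proof -
  have "wpq_fps_term N r (cexp (of_int s / of_nat N)) k \<in> fps_over K" for k
  proof -
    have "2 * Efps 1 (N * Suc k) \<in> fps_over K"
      using fps_over_mult[OF K fps_over_const[OF K subfield_numeral[OF K]] Efps_over[OF K is_subfieldD(1)[OF K]]]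
      by (simp add: numeral_fps_const)
    thus ?thesis unfolding wpq_fps_term_def
      by (intro fps_over_add[OF K] fps_over_diff[OF K] Efps_over[OF K] c is_subfieldD(7)[OF K]) auto
  qed
  hence "fps_const (1 / 12) + Efps (cexp (of_int s / of_nat N)) r
         + (\<Sum>k<n. wpq_fps_term N r (cexp (of_int s / of_nat N)) k) \<in> fps_over K" for n
    by (intro fps_over_add[OF K] fps_over_sum[OF K] Efps_over[OF K] c fps_over_const[OF K]
              is_subfieldD(8)[OF K] is_subfieldD(1)[OF K] subfield_numeral[OF K]) auto
  thus ?thesis using wpF(2)[OF r rs order_refl] by (simp add: fps_over_def)
qed

text \<open>Below x^N only E(c x^r) and, from the summand k = 0, the term with exponent N - r
  contribute; all other exponents are at least N. These few coefficients determine all orders and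
  leading coefficients used later.\<close>

lemma wpF_nth_low:
  assumes r: "r < N" and rs: "r \<noteq> 0 \<or> \<not> int N dvd s" and n: "n < N"
  defines "c \<equiv> cexp (of_int s / of_nat N)"
  shows "fps_nth (wpF N r s) n = (if n = 0 then 1 / 12 else 0) + fps_nth (Efps c r) n
           + fps_nth (Efps (inverse c) (N - r)) n"
proof -
  have "fps_nth (wpq_fps_term N r c k) n = (if k = 0 then fps_nth (Efps (inverse c) (N - r)) n else 0)" for k
  proof -
    have "n < N * Suc k + r" "n < N * Suc k" using n by auto
    moreover have "n < N * Suc k - r" if k: "k \<noteq> 0"
    proof -
      obtain j where "k = Suc j" using not0_implies_Suc[OF k] by blast
      thus ?thesis using n r by simp
    qed
    moreover have "fps_nth (Efps a l) n = 0" if "n < l" for a l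
      using that by (intro Efps_nth) auto
    ultimately show ?thesis
      by (auto simp: wpq_fps_term_def numeral_fps_const)
  qed
  hence "(\<Sum>k<N. fps_nth (wpq_fps_term N r c k) n) =
      (\<Sum>k<N. if k = 0 then fps_nth (Efps (inverse c) (N - r)) n else 0)" by (intro sum.cong) auto
  also have "\<dots> = fps_nth (Efps (inverse c) (N - r)) n" using n by (simp add: sum.delta)
  finally show ?thesis
    using wpF(2)[OF r rs, of n N] n by (simp add: c_def fps_sum_nth)
qed

section \<open>Fourier expansions\<close>

abbreviation at_i_infinity :: "complex filter" where
  "at_i_infinity \<equiv> filtercomap Im at_top"

lemma eventually_at_i_infinity:
  "eventually P at_i_infinity \<longleftrightarrow> (\<exists>Y. \<forall>\<tau>. Im \<tau> > Y \<longrightarrow> P \<tau>)"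
  by (rule eventually_filtercomap_at_top_dense)

lemma eventually_at_i_infinity_uhp: "eventually (\<lambda>\<tau>. \<tau> \<in> uhp) at_i_infinity"
  unfolding eventually_at_i_infinity by (intro exI[of _ 0]) (simp add: uhp_def)

text \<open>Neighbourhoods of i\<infinity> correspond to punctured discs around 0, as every nonzero
  number is an exponential. Uniqueness and arithmetic of Fourier expansions are thereby inherited
  from Laurent expansions at 0.\<close>

lemma eventually_q_iff:
  assumes N: "N > (0 :: real)"
  shows "eventually (\<lambda>\<tau>. P (cexp (\<tau> / of_real N))) at_i_infinity \<longleftrightarrow> eventually P (at 0)"
proof
  assume "eventually (\<lambda>\<tau>. P (cexp (\<tau> / of_real N))) at_i_infinity"
  then obtain Y where Y: "\<And>\<tau>. Im \<tau> > Y \<Longrightarrow> P (cexp (\<tau> / of_real N))"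
    unfolding eventually_at_i_infinity by blast
  define r where "r = exp (- 2 * pi * Y / N)"
  have "P x" if x: "x \<noteq> 0" "norm x < r" for x
  proof -
    define \<tau> where "\<tau> = of_real N * Ln x / (2 * of_real pi * \<i>)"
    have "cexp (\<tau> / of_real N) = x" using x N by (simp add: cexp_def \<tau>_def)
    moreover have "ln (norm x) < - 2 * pi * Y / N"
      using x by (metis r_def exp_less_cancel_iff exp_ln zero_less_norm_iff)
    hence "N * ln (norm x) < - 2 * pi * Y" using N by (simp add: field_simps)
    moreover have "Im \<tau> = - N * ln (norm x) / (2 * pi)"
      using x by (simp add: \<tau>_def Im_divide power2_eq_square)
    hence "2 * pi * Im \<tau> = - (N * ln (norm x))" by (simp add: field_simps)
    ultimately have "2 * pi * Y < 2 * pi * Im \<tau>" by simp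
    hence "Y < Im \<tau>" by (subst (asm) mult_less_cancel_left_pos) auto
    from Y[OF this] \<open>cexp (\<tau> / of_real N) = x\<close> show ?thesis by simp
  qed
  hence "\<exists>r>0. \<forall>x\<in>UNIV. x \<noteq> 0 \<and> dist x 0 < r \<longrightarrow> P x"
    by (intro exI[of _ r]) (auto simp: r_def)
  thus "eventually P (at 0)" by (simp add: eventually_at)
next
  assume "eventually P (at 0)"
  then obtain r where r: "r > 0" "\<And>x. x \<noteq> 0 \<Longrightarrow> norm x < r \<Longrightarrow> P x"
    by (auto simp: eventually_at)
  have "P (cexp (\<tau> / of_real N))" if "Im \<tau> > - N * ln r / (2 * pi)" for \<tau>
  proof (rule r(2))
    have "- 2 * pi * Im (\<tau> / of_real N) < ln r" using that N by (simp add: field_simps)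
    hence "exp (- 2 * pi * Im (\<tau> / of_real N)) < exp (ln r)" by (simp only: exp_less_cancel_iff)
    thus "norm (cexp (\<tau> / of_real N)) < r" using r(1) by (simp add: norm_cexp)
  qed simp
  thus "eventually (\<lambda>\<tau>. P (cexp (\<tau> / of_real N))) at_i_infinity"
    unfolding eventually_at_i_infinity by blast
qed

lemma eventually_q_iff_int:
  assumes N: "N > (0 :: int)"
  shows "eventually (\<lambda>\<tau>. P (cexp (\<tau> / of_int N))) at_i_infinity \<longleftrightarrow> eventually P (at 0)"
  using eventually_q_iff[of "of_int N" P] N by simp

lemma fourier_iff:
  "has_fourier_expansion N f F \<longleftrightarrow>
     fls_conv_radius F > 0 \<and> eventually (\<lambda>\<tau>. f \<tau> = eval_fls F (cexp (\<tau> / of_int N))) at_i_infinity"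
  by (simp add: has_fourier_expansion_def cexp_def)

lemma fourier_laurent:
  assumes "has_fourier_expansion N f F"
  shows "eval_fls F has_laurent_expansion F"
    "eventually (\<lambda>\<tau>. f \<tau> = eval_fls F (cexp (\<tau> / of_int N))) at_i_infinity"
  using assms by (auto simp: fourier_iff intro: eval_fls_has_laurent_expansion)

lemma fourierI:
  assumes N: "N > 0" and G: "G has_laurent_expansion F"
    and ev: "eventually (\<lambda>\<tau>. f \<tau> = G (cexp (\<tau> / of_int N))) at_i_infinity"
  shows "has_fourier_expansion N f F"
proof -
  have "eventually (\<lambda>x. eval_fls F x = G x) (at 0)" and rad: "fls_conv_radius F > 0"
    using G by (auto simp: has_laurent_expansion_def)
  hence "eventually (\<lambda>\<tau>. eval_fls F (cexp (\<tau> / of_int N)) = G (cexp (\<tau> / of_int N))) at_i_infinity"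
    by (subst eventually_q_iff_int[OF N])
  with ev have "eventually (\<lambda>\<tau>. f \<tau> = eval_fls F (cexp (\<tau> / of_int N))) at_i_infinity"
    by eventually_elim simp
  with rad show ?thesis by (simp add: fourier_iff)
qed

lemma fourier_cong:
  assumes "eventually (\<lambda>\<tau>. f \<tau> = g \<tau>) at_i_infinity" "has_fourier_expansion N g F"
  shows "has_fourier_expansion N f F"
proof -
  have "eventually (\<lambda>\<tau>. f \<tau> = eval_fls F (cexp (\<tau> / of_int N))) at_i_infinity"
    using assms(1) fourier_laurent(2)[OF assms(2)] by eventually_elim simp
  with assms(2) show ?thesis by (simp add: fourier_iff)
qed

context
  fixes N :: int assumes N: "N > 0"
begin

lemma fourier_const: "has_fourier_expansion N (\<lambda>_. c) (fls_const c)"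
  by (rule fourierI[OF N]) (auto intro!: laurent_expansion_intros)

lemma fourier_add:
  assumes "has_fourier_expansion N f F" "has_fourier_expansion N g G"
  shows "has_fourier_expansion N (\<lambda>\<tau>. f \<tau> + g \<tau>) (F + G)"
  using eventually_conj[OF fourier_laurent(2)[OF assms(1)] fourier_laurent(2)[OF assms(2)]]
  by (intro fourierI[OF N has_laurent_expansion_add[OF fourier_laurent(1)[OF assms(1)] fourier_laurent(1)[OF assms(2)]]])
     (auto elim: eventually_mono)

lemma fourier_diff:
  assumes "has_fourier_expansion N f F" "has_fourier_expansion N g G"
  shows "has_fourier_expansion N (\<lambda>\<tau>. f \<tau> - g \<tau>) (F - G)"
  using eventually_conj[OF fourier_laurent(2)[OF assms(1)] fourier_laurent(2)[OF assms(2)]]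
  by (intro fourierI[OF N has_laurent_expansion_diff[OF fourier_laurent(1)[OF assms(1)] fourier_laurent(1)[OF assms(2)]]])
     (auto elim: eventually_mono)

lemma fourier_mult:
  assumes "has_fourier_expansion N f F" "has_fourier_expansion N g G"
  shows "has_fourier_expansion N (\<lambda>\<tau>. f \<tau> * g \<tau>) (F * G)"
  using eventually_conj[OF fourier_laurent(2)[OF assms(1)] fourier_laurent(2)[OF assms(2)]]
  by (intro fourierI[OF N has_laurent_expansion_mult[OF fourier_laurent(1)[OF assms(1)] fourier_laurent(1)[OF assms(2)]]])
     (auto elim: eventually_mono)

lemma fourier_inverse:
  assumes "has_fourier_expansion N f F"
  shows "has_fourier_expansion N (\<lambda>\<tau>. inverse (f \<tau>)) (inverse F)"
  using fourier_laurent(2)[OF assms(1)]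
  by (intro fourierI[OF N has_laurent_expansion_inverse[OF fourier_laurent(1)[OF assms(1)]]])
     (auto elim: eventually_mono)

lemma fourier_divide:
  assumes "has_fourier_expansion N f F" "has_fourier_expansion N g G"
  shows "has_fourier_expansion N (\<lambda>\<tau>. f \<tau> / g \<tau>) (F / G)"
  using eventually_conj[OF fourier_laurent(2)[OF assms(1)] fourier_laurent(2)[OF assms(2)]]
  by (intro fourierI[OF N has_laurent_expansion_divide[OF fourier_laurent(1)[OF assms(1)] fourier_laurent(1)[OF assms(2)]]])
     (auto elim: eventually_mono)

lemma fourier_power:
  assumes "has_fourier_expansion N f F"
  shows "has_fourier_expansion N (\<lambda>\<tau>. f \<tau> ^ n) (F ^ n)"
proof (induction n)
  case 0
  show ?case using fourier_const[of 1] by simp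
qed (auto intro: fourier_mult assms)

lemma fourier_sum:
  assumes "\<And>i. i \<in> I \<Longrightarrow> has_fourier_expansion N (f i) (F i)"
  shows "has_fourier_expansion N (\<lambda>\<tau>. \<Sum>i\<in>I. f i \<tau>) (\<Sum>i\<in>I. F i)"
  using assms
proof (induction I rule: infinite_finite_induct)
  case (insert i I)
  thus ?case by (auto intro: fourier_add)
qed (use fourier_const[of 0] in auto)

lemma fourier_unique:
  assumes "has_fourier_expansion N f F" "has_fourier_expansion N f G"
  shows "F = G"
proof -
  have "eventually (\<lambda>\<tau>. eval_fls F (cexp (\<tau> / of_int N)) = eval_fls G (cexp (\<tau> / of_int N))) at_i_infinity"
    using fourier_laurent(2)[OF assms(1)] fourier_laurent(2)[OF assms(2)] by eventually_elim simp
  hence "eventually (\<lambda>x. eval_fls F x = eval_fls G x) (at 0)"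
    by (subst (asm) eventually_q_iff_int[OF N])
  with fourier_laurent(1)[OF assms(2)] have "eval_fls F has_laurent_expansion G"
    using has_laurent_expansion_cong by blast
  thus ?thesis using fourier_laurent(1)[OF assms(1)] has_laurent_expansion_unique by blast
qed

lemma fourier_eq_0_iff:
  assumes "has_fourier_expansion N f F"
  shows "F = 0 \<longleftrightarrow> eventually (\<lambda>\<tau>. f \<tau> = 0) at_i_infinity"
proof
  assume "F = 0"
  with fourier_laurent(2)[OF assms] show "eventually (\<lambda>\<tau>. f \<tau> = 0) at_i_infinity" by simp
next
  assume ev: "eventually (\<lambda>\<tau>. f \<tau> = 0) at_i_infinity"
  have "has_fourier_expansion N f (fls_const 0)" by (rule fourier_cong[OF ev fourier_const])
  from fourier_unique[OF assms this] show "F = 0" by simp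
qed

end

section \<open>The action of the modular group\<close>

lemma SL2Z_det: "A \<in> SL2Z \<longleftrightarrow> A $ 1 $ 1 * A $ 2 $ 2 - A $ 1 $ 2 * A $ 2 $ 1 = 1"
  by (simp add: SL2Z_def det_2)

definition mat2 :: "int \<Rightarrow> int \<Rightarrow> int \<Rightarrow> int \<Rightarrow> int^2^2" where
  "mat2 a b c d = vector [vector [a, b], vector [c, d]]"

lemma mat2_nth [simp]:
  "mat2 a b c d $ 1 $ 1 = a" "mat2 a b c d $ 1 $ 2 = b" "mat2 a b c d $ 2 $ 1 = c" "mat2 a b c d $ 2 $ 2 = d"
  by (simp_all add: mat2_def)

definition automorphy :: "int^2^2 \<Rightarrow> complex \<Rightarrow> complex" where
  "automorphy A \<tau> = of_int (A $ 2 $ 1) * \<tau> + of_int (A $ 2 $ 2)"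

lemma automorphy_lattice: "automorphy A \<tau> = lattice_point \<tau> (A $ 2 $ 2, A $ 2 $ 1)"
  by (simp add: automorphy_def lattice_point_def)

lemma automorphy_nonzero: "A \<in> SL2Z \<Longrightarrow> \<tau> \<in> uhp \<Longrightarrow> automorphy A \<tau> \<noteq> 0"
  unfolding automorphy_lattice by (subst lattice_point_eq_0_iff) (auto simp: SL2Z_det zero_prod_def)

lemma moebius_Im:
  assumes "A \<in> SL2Z" "\<tau> \<in> uhp"
  shows "Im (moebius A \<tau>) = Im \<tau> / norm (automorphy A \<tau>) ^ 2"
proof -
  have "(A $ 1 $ 1 * A $ 2 $ 2 - A $ 1 $ 2 * A $ 2 $ 1) = 1" using assms(1) by (simp add: SL2Z_det)
  hence det: "real_of_int (A $ 1 $ 1) * of_int (A $ 2 $ 2) - of_int (A $ 1 $ 2) * of_int (A $ 2 $ 1) = 1"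
    by (metis of_int_1 of_int_diff of_int_mult)
  have "Im (moebius A \<tau>) = (real_of_int (A $ 1 $ 1) * of_int (A $ 2 $ 2) - of_int (A $ 1 $ 2) * of_int (A $ 2 $ 1)) * Im \<tau>
          / norm (automorphy A \<tau>) ^ 2"
    by (simp add: moebius_def automorphy_def Im_divide cmod_power2 algebra_simps)
  thus ?thesis by (simp add: det)
qed

lemma moebius_uhp: "A \<in> SL2Z \<Longrightarrow> \<tau> \<in> uhp \<Longrightarrow> moebius A \<tau> \<in> uhp"
  using moebius_Im[of A \<tau>] automorphy_nonzero[of A \<tau>] by (auto simp: uhp_def)

lemma mult2_nth:
  fixes A B :: "int^2^2"
  shows "(A ** B) $ i $ j = A $ i $ 1 * B $ 1 $ j + A $ i $ 2 * B $ 2 $ j"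
  by (simp add: matrix_matrix_mult_def sum_2)

lemma SL2Z_mult: "A \<in> SL2Z \<Longrightarrow> B \<in> SL2Z \<Longrightarrow> A ** B \<in> SL2Z"
  by (simp add: SL2Z_def det_mul)

definition inv2 :: "int^2^2 \<Rightarrow> int^2^2" where
  "inv2 A = mat2 (A $ 2 $ 2) (- (A $ 1 $ 2)) (- (A $ 2 $ 1)) (A $ 1 $ 1)"

lemma inv2: assumes "A \<in> SL2Z" shows "inv2 A \<in> SL2Z" "A ** inv2 A = mat 1" "inv2 A ** A = mat 1"
proof -
  show "inv2 A \<in> SL2Z" using assms by (simp add: SL2Z_det inv2_def algebra_simps)
  show "A ** inv2 A = mat 1" "inv2 A ** A = mat 1" using assms
    by (auto simp: vec_eq_iff mult2_nth forall_2 inv2_def mat_def SL2Z_det algebra_simps)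
qed

lemma moebius_mult:
  assumes "A \<in> SL2Z" "B \<in> SL2Z" "\<tau> \<in> uhp"
  shows "moebius (A ** B) \<tau> = moebius A (moebius B \<tau>)"
proof -
  define x y where "x = of_int (B $ 1 $ 1) * \<tau> + of_int (B $ 1 $ 2)" and "y = automorphy B \<tau>"
  have y: "y \<noteq> 0" unfolding y_def by (rule automorphy_nonzero[OF assms(2,3)])
  have B: "moebius B \<tau> = x / y" by (simp add: moebius_def x_def y_def automorphy_def)
  have "moebius (A ** B) \<tau> = (of_int (A $ 1 $ 1) * x + of_int (A $ 1 $ 2) * y) / (of_int (A $ 2 $ 1) * x + of_int (A $ 2 $ 2) * y)"
    by (simp add: moebius_def mult2_nth x_def y_def automorphy_def algebra_simps)
  also have "\<dots> = ((of_int (A $ 1 $ 1) * x + of_int (A $ 1 $ 2) * y) / y) / ((of_int (A $ 2 $ 1) * x + of_int (A $ 2 $ 2) * y) / y)"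
  proof -
    have "u / v = (u / y) / (v / y)" for u v using y by simp
    thus ?thesis .
  qed
  also have "\<dots> = moebius A (moebius B \<tau>)"
  proof -
    have "(of_int u * x + of_int v * y) / y = of_int u * (x / y) + of_int v" for u v
      using y by (simp add: add_divide_distrib)
    thus ?thesis by (simp only: B) (simp only: moebius_def)
  qed
  finally show ?thesis .
qed

lemma moebius_mat_1 [simp]: "moebius (mat 1) \<tau> = \<tau>"
  by (simp add: moebius_def mat_def)

lemma moebius_inv2:
  assumes "A \<in> SL2Z" "\<tau> \<in> uhp"
  shows "moebius A (moebius (inv2 A) \<tau>) = \<tau>" "moebius (inv2 A) (moebius A \<tau>) = \<tau>"
  using moebius_mult[OF assms(1) inv2(1)[OF assms(1)] assms(2)]
        moebius_mult[OF inv2(1)[OF assms(1)] assms] inv2(2,3)[OF assms(1)] by simp_all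

lemma mat_1_SL2Z: "mat 1 \<in> SL2Z"
  by (simp add: SL2Z_def)

lemma moebius_holomorphic: "A \<in> SL2Z \<Longrightarrow> moebius A holomorphic_on uhp"
  unfolding moebius_def using automorphy_nonzero[of A]
  by (intro holomorphic_intros) (auto simp: automorphy_def)

text \<open>Multiplication by c \<tau> + d takes the basis 1, A \<tau> to c \<tau> + d, a \<tau> +
  b, which is again a basis of the lattice of \<tau> because the determinant is 1. The
  transformation laws of \<open>wp\<close>, \<open>g2\<close> and \<open>g3\<close> all follow from
  this.\<close>

lemma period_lattice_moebius:
  assumes A: "A \<in> SL2Z" and \<tau>: "\<tau> \<in> uhp"
  shows "bij_betw (\<lambda>\<omega>. automorphy A \<tau> * \<omega>) (period_lattice (moebius A \<tau>)) (period_lattice \<tau>)"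
proof -
  define J where "J = automorphy A \<tau>"
  have J: "J \<noteq> 0" unfolding J_def by (rule automorphy_nonzero[OF A \<tau>])
  obtain a b c d where abcd: "a = A $ 1 $ 1" "b = A $ 1 $ 2" "c = A $ 2 $ 1" "d = A $ 2 $ 2" by blast
  have det: "a * d - b * c = 1" using A by (simp add: SL2Z_det abcd)
  have eq: "J * lattice_point (moebius A \<tau>) (m, n) = lattice_point \<tau> (m * d + n * b, m * c + n * a)" for m n
  proof -
    have "J * moebius A \<tau> = of_int a * \<tau> + of_int b"
      using J by (simp add: moebius_def J_def automorphy_def abcd)
    moreover have "J * lattice_point (moebius A \<tau>) (m, n) = of_int m * J + of_int n * (J * moebius A \<tau>)"
      by (simp add: lattice_point_def algebra_simps)
    ultimately have "J * lattice_point (moebius A \<tau>) (m, n) = of_int m * J + of_int n * (of_int a * \<tau> + of_int b)"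
      by (simp only:)
    thus ?thesis by (simp add: J_def automorphy_def lattice_point_def abcd algebra_simps)
  qed
  have "(\<lambda>\<omega>. J * \<omega>) ` period_lattice (moebius A \<tau>) = period_lattice \<tau>"
  proof (intro equalityI subsetI)
    fix \<omega> assume "\<omega> \<in> (\<lambda>\<omega>. J * \<omega>) ` period_lattice (moebius A \<tau>)"
    then obtain m n where "\<omega> = J * lattice_point (moebius A \<tau>) (m, n)"
      by (auto simp: period_lattice_range)
    thus "\<omega> \<in> period_lattice \<tau>" unfolding eq by (simp add: period_lattice_range)
  next
    fix \<omega> assume "\<omega> \<in> period_lattice \<tau>"
    then obtain u v where \<omega>: "\<omega> = lattice_point \<tau> (u, v)" by (auto simp: period_lattice_range)
    define m n where "m = a * u - b * v" and "n = d * v - c * u"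
    have "m * d + n * b = (a * d - b * c) * u" "m * c + n * a = (a * d - b * c) * v"
      by (simp_all add: m_def n_def algebra_simps)
    hence "m * d + n * b = u" "m * c + n * a = v" by (simp_all add: det)
    hence "\<omega> = J * lattice_point (moebius A \<tau>) (m, n)" unfolding eq \<omega> by simp
    thus "\<omega> \<in> (\<lambda>\<omega>. J * \<omega>) ` period_lattice (moebius A \<tau>)"
      unfolding period_lattice_range by (rule image_eqI[OF _ rangeI])
  qed
  thus ?thesis unfolding bij_betw_def using J by (auto simp: J_def inj_on_def)
qed

lemma wp_moebius:
  assumes A: "A \<in> SL2Z" and \<tau>: "\<tau> \<in> uhp"
  shows "wp z (moebius A \<tau>) = automorphy A \<tau> ^ 2 * wp (automorphy A \<tau> * z) \<tau>"
proof -
  define J where "J = automorphy A \<tau>"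
  have J: "J \<noteq> 0" unfolding J_def by (rule automorphy_nonzero[OF A \<tau>])
  have "wp z (moebius A \<tau>) = (\<Sum>\<^sub>\<infinity>\<omega>\<in>period_lattice (moebius A \<tau>). 1 / (z - \<omega>) ^ 2 - 1 / \<omega> ^ 2)"
    by (rule wp_altdef[OF moebius_uhp[OF A \<tau>]])
  also have "\<dots> = (\<Sum>\<^sub>\<infinity>\<omega>\<in>period_lattice (moebius A \<tau>). J ^ 2 * (1 / (J * z - J * \<omega>) ^ 2 - 1 / (J * \<omega>) ^ 2))"
  proof (intro infsum_cong)
    fix \<omega>
    have "(J * z - J * \<omega>) ^ 2 = J ^ 2 * (z - \<omega>) ^ 2" "(J * \<omega>) ^ 2 = J ^ 2 * \<omega> ^ 2"
      by (simp_all add: power_mult_distrib flip: right_diff_distrib)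
    thus "1 / (z - \<omega>) ^ 2 - 1 / \<omega> ^ 2 = J ^ 2 * (1 / (J * z - J * \<omega>) ^ 2 - 1 / (J * \<omega>) ^ 2)"
      using J by (simp add: right_diff_distrib)
  qed
  also have "\<dots> = (\<Sum>\<^sub>\<infinity>\<omega>\<in>period_lattice \<tau>. J ^ 2 * (1 / (J * z - \<omega>) ^ 2 - 1 / \<omega> ^ 2))"
    by (rule infsum_reindex_bij_betw[OF period_lattice_moebius[OF A \<tau>, folded J_def],
              of "\<lambda>\<omega>. J ^ 2 * (1 / (J * z - \<omega>) ^ 2 - 1 / \<omega> ^ 2)"])
  also have "\<dots> = J ^ 2 * wp (J * z) \<tau>"
    unfolding wp_altdef[OF \<tau>] by (rule infsum_cmult_right) (use wp_terms_summable'[OF \<tau>] in auto)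
  finally show ?thesis by (simp add: J_def)
qed

lemma eisenstein_moebius:
  assumes A: "A \<in> SL2Z" and \<tau>: "\<tau> \<in> uhp"
  shows "(\<Sum>\<^sub>\<infinity>\<omega>\<in>period_lattice (moebius A \<tau>) - {0}. 1 / \<omega> ^ k) =
         automorphy A \<tau> ^ k * (\<Sum>\<^sub>\<infinity>\<omega>\<in>period_lattice \<tau> - {0}. 1 / \<omega> ^ k)"
proof -
  define J where "J = automorphy A \<tau>"
  have J: "J \<noteq> 0" unfolding J_def by (rule automorphy_nonzero[OF A \<tau>])
  have bij: "bij_betw (\<lambda>\<omega>. J * \<omega>) (period_lattice (moebius A \<tau>) - {0}) (period_lattice \<tau> - {0})"
    using bij_betw_DiffI[OF period_lattice_moebius[OF A \<tau>], of "{0}" "{0}"] period_lattice_props(1)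
    by (simp add: J_def)
  have "(\<Sum>\<^sub>\<infinity>\<omega>\<in>period_lattice (moebius A \<tau>) - {0}. 1 / \<omega> ^ k) =
        (\<Sum>\<^sub>\<infinity>\<omega>\<in>period_lattice (moebius A \<tau>) - {0}. J ^ k * (1 / (J * \<omega>) ^ k))"
    using J by (intro infsum_cong) (simp add: power_mult_distrib)
  also have "\<dots> = (\<Sum>\<^sub>\<infinity>\<omega>\<in>period_lattice \<tau> - {0}. J ^ k * (1 / \<omega> ^ k))"
    by (rule infsum_reindex_bij_betw[OF bij, of "\<lambda>\<omega>. J ^ k * (1 / \<omega> ^ k)"])
  also have "\<dots> = J ^ k * (\<Sum>\<^sub>\<infinity>\<omega>\<in>period_lattice \<tau> - {0}. 1 / \<omega> ^ k)"
    by (rule infsum_cmult_right')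
  finally show ?thesis by (simp add: J_def)
qed

lemma klein_j_moebius:
  assumes A: "A \<in> SL2Z" and \<tau>: "\<tau> \<in> uhp"
  shows "klein_j (moebius A \<tau>) = klein_j \<tau>"
proof -
  define J where "J = automorphy A \<tau>"
  have J: "J \<noteq> 0" unfolding J_def by (rule automorphy_nonzero[OF A \<tau>])
  have g: "g2 (moebius A \<tau>) = J ^ 4 * g2 \<tau>" "g3 (moebius A \<tau>) = J ^ 6 * g3 \<tau>"
    unfolding g2_def g3_def eisenstein_moebius[OF A \<tau>] by (simp_all add: J_def)
  have "(J ^ 4 * g2 \<tau>) ^ 3 = J ^ 12 * g2 \<tau> ^ 3" "(J ^ 6 * g3 \<tau>) ^ 2 = J ^ 12 * g3 \<tau> ^ 2"
    by (simp_all add: power_mult_distrib flip: power_mult)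
  hence "klein_j (moebius A \<tau>) = J ^ 12 * (1728 * g2 \<tau> ^ 3) / (J ^ 12 * (g2 \<tau> ^ 3 - 27 * g3 \<tau> ^ 2))"
    unfolding klein_j_def g using moebius_uhp[OF A \<tau>] by (simp add: algebra_simps)
  also have "\<dots> = klein_j \<tau>" using J \<tau> by (simp add: klein_j_def)
  finally show ?thesis .
qed

section \<open>Division values\<close>

definition wp_div :: "int \<Rightarrow> int \<Rightarrow> int \<Rightarrow> complex \<Rightarrow> complex" where
  "wp_div N r s \<tau> = wp ((of_int r * \<tau> + of_int s) / of_int N) \<tau>"

text \<open>The factor (2 pi i)^2 is left out, so that the coefficients lie in the field generated
  by a root of unity; it cancels in quotients of differences. The first coordinate is reduced
  because \<open>wpq\<close> is built for 0 \<le> r < N.\<close>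

definition wp_fourier :: "int \<Rightarrow> int \<Rightarrow> int \<Rightarrow> complex fls" where
  "wp_fourier N r s = fps_to_fls (wpF (nat N) (nat (r mod N)) s)"

context
  fixes N :: int assumes N: "N > 0"
begin

lemma mod_nat_less: "nat (r mod N) < nat N"
  using N by simp

lemma not_dvd_cases:
  assumes "\<not> (N dvd r \<and> N dvd s)"
  shows "nat (r mod N) \<noteq> 0 \<or> \<not> int (nat N) dvd s"
proof -
  have "N dvd r" if "nat (r mod N) = 0"
    using that N pos_mod_sign[OF N, of r] by (intro mod_0_imp_dvd) linarith
  thus ?thesis using assms N by auto
qed

lemma wp_div_eq_wpq:
  assumes \<tau>: "\<tau> \<in> uhp" and rs: "\<not> (N dvd r \<and> N dvd s)"
  shows "wp_div N r s \<tau> = (2 * of_real pi * \<i>) ^ 2 * wpq (nat N) (nat (r mod N)) s (cexp (\<tau> / of_int N))"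
proof -
  have N': "(of_nat (nat N) :: complex) = of_int N" "(of_nat (nat (r mod N)) :: complex) = of_int (r mod N)"
    using N by simp_all
  have "(of_int r :: complex) = of_int (r mod N) + of_int N * of_int (r div N)"
    by (metis add.commute mult_div_mod_eq of_int_add of_int_mult)
  hence "(of_int r * \<tau> + of_int s) / of_int N = (of_int (r mod N) * \<tau> + of_int s) / of_int N + of_int (r div N) * \<tau>"
    using N by (simp add: field_simps)
  hence "wp_div N r s \<tau> = wp ((of_int (r mod N) * \<tau> + of_int s) / of_int N) \<tau>"
    unfolding wp_div_def by (simp only: wp_periodic[OF \<tau>] period_lattice_props(7)[OF period_lattice_props(3)])
  also have "\<dots> = (2 * of_real pi * \<i>) ^ 2 * wpq (nat N) (nat (r mod N)) s (cexp (\<tau> / of_int N))"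
    using wp_eq_wpq[OF \<tau> mod_nat_less not_dvd_cases[OF rs]] unfolding N' .
  finally show ?thesis .
qed

lemma wp_div_fourier:
  assumes rs: "\<not> (N dvd r \<and> N dvd s)"
  shows "has_fourier_expansion N (wp_div N r s) (fls_const ((2 * of_real pi * \<i>) ^ 2) * wp_fourier N r s)"
proof (rule fourierI[OF N])
  have "wpq (nat N) (nat (r mod N)) s has_laurent_expansion wp_fourier N r s"
    unfolding wp_fourier_def
    by (rule has_laurent_expansion_fps wpF(1)[OF mod_nat_less not_dvd_cases[OF rs]])+
  thus "(\<lambda>x. (2 * of_real pi * \<i>) ^ 2 * wpq (nat N) (nat (r mod N)) s x) has_laurent_expansion
      fls_const ((2 * of_real pi * \<i>) ^ 2) * wp_fourier N r s"
    by (intro laurent_expansion_intros)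
  show "eventually (\<lambda>\<tau>. wp_div N r s \<tau> = (2 * of_real pi * \<i>) ^ 2 *
      wpq (nat N) (nat (r mod N)) s (cexp (\<tau> / of_int N))) at_i_infinity"
    using eventually_at_i_infinity_uhp by eventually_elim (rule wp_div_eq_wpq[OF _ rs])
qed

lemma wp_div_holomorphic:
  assumes rs: "\<not> (N dvd r \<and> N dvd s)"
  shows "wp_div N r s holomorphic_on uhp"
proof -
  have "(\<lambda>\<tau>. wpq (nat N) (nat (r mod N)) s (cexp (\<tau> / of_int N))) holomorphic_on uhp"
  proof (rule holomorphic_on_compose_gen[where g = "wpq (nat N) (nat (r mod N)) s" and t = "ball 0 1", unfolded o_def])
    show "wpq (nat N) (nat (r mod N)) s holomorphic_on ball 0 1"
      by (rule wpq_holomorphic[OF mod_nat_less not_dvd_cases[OF rs]])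
    show "(\<lambda>\<tau>. cexp (\<tau> / of_int N)) ` uhp \<subseteq> ball 0 1"
      using N by (auto simp: norm_cexp uhp_def)
  qed (unfold cexp_def, intro holomorphic_intros, use N in auto)
  hence "(\<lambda>\<tau>. (2 * of_real pi * \<i>) ^ 2 * wpq (nat N) (nat (r mod N)) s (cexp (\<tau> / of_int N))) holomorphic_on uhp"
    by (intro holomorphic_intros)
  thus ?thesis by (rule holomorphic_transform) (simp add: wp_div_eq_wpq rs)
qed

lemma wp_div_eq_iff:
  assumes "\<tau> \<in> uhp" "\<not> (N dvd r \<and> N dvd s)" "\<not> (N dvd r' \<and> N dvd s')" "wp_div N r s \<tau> = wp_div N r' s' \<tau>"
  shows "N dvd (r - r') \<and> N dvd (s - s') \<or> N dvd (r + r') \<and> N dvd (s + s')"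
  using wp_rat_eq_iff[OF assms(1) N assms(2,3)] assms(4) by (simp add: wp_div_def)

end

text \<open>The distance of r to the multiples of N. For r not divisible by N it is the exponent of
  the first nonconstant term in the low part of the expansion of a division value with first
  coordinate r.\<close>

definition res_norm :: "int \<Rightarrow> int \<Rightarrow> int" where
  "res_norm N r = min (r mod N) ((- r) mod N)"

lemma neg_mod_eq:
  assumes "N > (0::int)"
  shows "(- r) mod N = (if r mod N = 0 then 0 else N - r mod N)"
  using assms by (simp add: zmod_zminus1_eq_if)

text \<open>Clearing denominators factors the difference as (a - b) (1 - a b): \<open>E\<close> has
  degree 2 and is invariant under inversion.\<close>

lemma E_eq_iff:
  assumes "a \<noteq> 1" "b \<noteq> 1" "E a = E b"
  shows "a = b \<or> a * b = 1"
proof -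
  have "a / (1 - a) ^ 2 = b / (1 - b) ^ 2" using assms(3) by (simp add: E_def)
  hence "a * (1 - b) ^ 2 = b * (1 - a) ^ 2" by (subst (asm) frac_eq_eq) (use assms in auto)
  hence "(a - b) * (1 - a * b) = 0" by (simp add: power2_eq_square algebra_simps)
  thus ?thesis by auto
qed

text \<open>Below x^N each expansion is a constant plus c x^\<rho> plus c^(-1) x^(N - \<rho>), with
  c a root of unity. If one of the first coordinates vanishes modulo N, the constants already
  differ. Otherwise the difference starts at the smallest of the four exponents, where equal
  coefficients would force the two division points to be equal up to sign.\<close>

lemma wp_fourier_diff:
  assumes N: "N > 0" and rs: "\<not> (N dvd r \<and> N dvd s)" and rs': "\<not> (N dvd r' \<and> N dvd s')"
    and ne: "\<not> (N dvd (r - r') \<and> N dvd (s - s'))" "\<not> (N dvd (r + r') \<and> N dvd (s + s'))"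
  shows "wp_fourier N r s \<noteq> wp_fourier N r' s'"
    "fls_subdegree (wp_fourier N r s - wp_fourier N r' s') = min (res_norm N r) (res_norm N r')"
proof -
  define \<rho> \<rho>' n where "\<rho> = nat (r mod N)" and "\<rho>' = nat (r' mod N)" and "n = nat N"
  define c c' where "c = cexp (of_int s / of_int N)" and "c' = cexp (of_int s' / of_int N)"
  define f where "f = (\<lambda>\<rho> c i. (if i = 0 then 1 / 12 else 0) + fps_nth (Efps c \<rho>) i + fps_nth (Efps (inverse c) (n - \<rho>)) i)"
  have n: "n > 0" "int n = N" "of_nat n = (of_int N :: complex)" using N by (simp_all add: n_def)
  have \<rho>: "\<rho> < n" "\<rho>' < n" "int \<rho> = r mod N" "int \<rho>' = r' mod N" using N by (simp_all add: \<rho>_def \<rho>'_def n_def)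
  have F: "fps_nth (wpF n \<rho> s) i = f \<rho> c i" "fps_nth (wpF n \<rho>' s') i = f \<rho>' c' i" if "i < n" for i
    using wpF_nth_low[OF mod_nat_less[OF N] not_dvd_cases[OF N rs], where n = i]
      wpF_nth_low[OF mod_nat_less[OF N] not_dvd_cases[OF N rs'], where n = i] that n unfolding f_def c_def c'_def \<rho>_def \<rho>'_def n_def by simp_all
  define w where "w = (\<lambda>\<rho>. if \<rho> = 0 then 0 else min \<rho> (n - \<rho>))"
  have w: "int (w \<rho>) = res_norm N r" "int (w \<rho>') = res_norm N r'"
    using \<rho> n unfolding w_def res_norm_def neg_mod_eq[OF N] by (auto simp: min_def of_nat_diff)
  have f0: "f \<sigma> a i = f \<sigma>' a' i" if "\<sigma> < n" "\<sigma>' < n" "i < min (w \<sigma>) (w \<sigma>')" for \<sigma> \<sigma>' a a' i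
  proof -
    have "\<sigma> \<noteq> 0" "\<sigma>' \<noteq> 0" "i < \<sigma>" "i < n - \<sigma>" "i < \<sigma>'" "i < n - \<sigma>'"
      using that by (auto simp: w_def split: if_splits)
    thus ?thesis using that by (simp add: f_def Efps_nth)
  qed
  have f_w: "f \<sigma> a i = (if i = \<sigma> then a else 0) + (if i = n - \<sigma> then inverse a else 0)"
    if "\<sigma> < n" "\<sigma> \<noteq> 0" "i \<le> w \<sigma>" "i > 0" for \<sigma> a i
  proof -
    have "i \<le> \<sigma>" "i \<le> n - \<sigma>" "0 < n - \<sigma>" using that by (auto simp: w_def)
    thus ?thesis using that Efps_nth(1)[of \<sigma> i a] Efps_nth(1)[of "n - \<sigma>" i "inverse a"]
        Efps_nth(2)[of \<sigma> a] Efps_nth(2)[of "n - \<sigma>" "inverse a"]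
      by (auto simp: f_def)
  qed
  have f_0: "f \<sigma> a 0 = 1 / 12 + (if \<sigma> = 0 then E a else 0)" if "\<sigma> < n" "\<sigma> \<noteq> 0 \<or> a \<noteq> 1" for \<sigma> a
  proof -
    have "fps_nth (Efps (inverse a) (n - \<sigma>)) 0 = 0" using that by (simp add: Efps_nth)
    moreover have "fps_nth (Efps a 0) 0 = E a" if "a \<noteq> 1"
      using has_fps_expansion_imp_0_eq_fps_nth_0[OF Efps_expansion[of 0 a]] that by simp
    ultimately show ?thesis using that by (auto simp: f_def Efps_nth)
  qed
  have cc: "c \<noteq> 0" "c' \<noteq> 0" by (simp_all add: c_def c'_def)
  have ceq: "c = c' \<Longrightarrow> N dvd (s - s')" "c * c' = 1 \<Longrightarrow> N dvd (s + s')"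
  proof -
    assume "c = c'"
    hence "cexp (of_int (s - s') / of_nat n) = 1"
      using n(3) cc by (simp add: c_def c'_def diff_divide_distrib cexp_diff)
    thus "N dvd (s - s')" using cexp_frac_eq_1_iff[OF n(1)] n(2) by blast
  next
    assume "c * c' = 1"
    hence "cexp (of_int (s + s') / of_nat n) = 1"
      using n(3) by (simp add: c_def c'_def add_divide_distrib cexp_add)
    thus "N dvd (s + s')" using cexp_frac_eq_1_iff[OF n(1)] n(2) by blast
  qed
  have req: "\<rho> = \<rho>' \<Longrightarrow> N dvd (r - r')" "\<rho> = n - \<rho>' \<or> \<rho> = 0 \<and> \<rho>' = 0 \<Longrightarrow> N dvd (r + r')"
  proof -
    assume "\<rho> = \<rho>'"
    hence "r mod N = r' mod N" using \<rho> by simp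
    thus "N dvd (r - r')" by (simp add: mod_eq_dvd_iff)
  next
    assume "\<rho> = n - \<rho>' \<or> \<rho> = 0 \<and> \<rho>' = 0"
    hence "int \<rho> + int \<rho>' = N \<or> int \<rho> + int \<rho>' = 0" using \<rho> n by auto
    hence "N dvd (int \<rho> + int \<rho>')" by auto
    hence "N dvd (r mod N + r' mod N)" using \<rho> by simp
    thus "N dvd (r + r')" by (simp add: dvd_eq_mod_eq_0 mod_add_eq)
  qed
  have c1: "c = 1 \<Longrightarrow> N dvd s" "c' = 1 \<Longrightarrow> N dvd s'"
    using cexp_frac_eq_1_iff[OF n(1), of s] cexp_frac_eq_1_iff[OF n(1), of s'] n by (simp_all add: c_def c'_def)
  have r0: "\<rho> = 0 \<Longrightarrow> N dvd r" "\<rho>' = 0 \<Longrightarrow> N dvd r'" using \<rho> by (auto simp: dvd_eq_mod_eq_0)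
  have rc: "\<rho> \<noteq> 0 \<or> c \<noteq> 1" "\<rho>' \<noteq> 0 \<or> c' \<noteq> 1" using c1 r0 rs rs' by auto
  define n0 where "n0 = min (w \<rho>) (w \<rho>')"
  have n0n: "n0 < n" using n \<rho> by (auto simp: n0_def w_def)
  have "f \<rho> c n0 \<noteq> f \<rho>' c' n0"
  proof (cases "n0 = 0")
    case True
    hence "\<rho> = 0 \<or> \<rho>' = 0" using \<rho> by (auto simp: n0_def w_def split: if_splits)
    thus ?thesis
    proof (cases "\<rho> = 0 \<and> \<rho>' = 0")
      case both: True
      have "E c \<noteq> E c'" using E_eq_iff[of c c'] rc both ceq req ne by auto
      thus ?thesis unfolding True using both f_0[OF \<rho>(1) rc(1)] f_0[OF \<rho>(2) rc(2)] by simp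
    next
      case False
      hence "\<rho> = 0 \<and> \<rho>' \<noteq> 0 \<or> \<rho> \<noteq> 0 \<and> \<rho>' = 0" using \<open>\<rho> = 0 \<or> \<rho>' = 0\<close> by auto
      thus ?thesis unfolding True f_0[OF \<rho>(1) rc(1)] f_0[OF \<rho>(2) rc(2)]
        using rc cc by (auto simp: E_def)
    qed
  next
    case False
    hence nz: "\<rho> \<noteq> 0" "\<rho>' \<noteq> 0" "n0 \<le> w \<rho>" "n0 \<le> w \<rho>'" "n0 > 0"
      by (auto simp: n0_def w_def split: if_splits)
    note fw = f_w[OF \<rho>(1) nz(1,3,5), of c] f_w[OF \<rho>(2) nz(2,4,5), of c']
    have n0: "n0 = \<rho> \<or> n0 = n - \<rho> \<or> n0 = \<rho>' \<or> n0 = n - \<rho>'"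
      using nz by (auto simp: n0_def w_def min_def split: if_splits)
    have le: "n0 \<le> \<rho>" "n0 \<le> n - \<rho>" "n0 \<le> \<rho>'" "n0 \<le> n - \<rho>'" using nz by (auto simp: w_def)
    show ?thesis
    proof
      assume eq: "f \<rho> c n0 = f \<rho>' c' n0"
      consider "n0 = \<rho>" "n0 \<noteq> n - \<rho>" | "n0 \<noteq> \<rho>" "n0 = n - \<rho>" | "n0 = \<rho>" "n0 = n - \<rho>" | "n0 \<noteq> \<rho>" "n0 \<noteq> n - \<rho>" by blast
      thus False
      proof cases
        case 1
        hence v: "f \<rho> c n0 = c" using fw(1) by simp
        hence "f \<rho>' c' n0 \<noteq> 0" using eq cc by simp
        hence "n0 = \<rho>' \<or> n0 = n - \<rho>'" using fw(2) by (auto split: if_splits)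
        thus False
        proof
          assume a: "n0 = \<rho>'"
          hence "n0 \<noteq> n - \<rho>'" using 1 by auto
          hence "c = c'" using v eq fw(2) a by simp
          thus False using ceq req ne 1 a by auto
        next
          assume a: "n0 = n - \<rho>'"
          hence "n0 \<noteq> \<rho>'" using 1 \<rho> by auto
          hence "c = inverse c'" using v eq fw(2) a by simp
          hence "c * c' = 1" using cc by simp
          thus False using ceq req ne 1 a by auto
        qed
      next
        case 2
        hence v: "f \<rho> c n0 = inverse c" using fw(1) by simp
        hence "f \<rho>' c' n0 \<noteq> 0" using eq cc by simp
        hence "n0 = \<rho>' \<or> n0 = n - \<rho>'" using fw(2) by (auto split: if_splits)
        thus False
        proof
          assume a: "n0 = \<rho>'"
          hence "n0 \<noteq> n - \<rho>'" using 2 \<rho> by auto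
          hence "inverse c = c'" using v eq fw(2) a by simp
          hence "c * c' = 1" using right_inverse[OF cc(1)] by simp
          moreover have "\<rho> = n - \<rho>'" using 2 a \<rho> by auto
          ultimately show False using ceq req ne by auto
        next
          assume a: "n0 = n - \<rho>'"
          hence "n0 \<noteq> \<rho>'" "\<rho> = \<rho>'" using 2 \<rho> by auto
          hence "c = c'" using v eq fw(2) a by simp
          thus False using ceq req ne \<open>\<rho> = \<rho>'\<close> by auto
        qed
      next
        \<comment> \<open>Here both \<rho> and \<rho>' are N / 2, so the two powers coincide in each
          expansion, and c + 1 / c determines c up to inversion.\<close>
        case 3
        hence "\<rho>' = \<rho>" using le \<rho> by auto
        hence "c + inverse c = c' + inverse c'" using eq fw 3 by simp
        hence "c * c' * (c + inverse c) = c * c' * (c' + inverse c')" by simp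
        moreover have "c * c' * (c + inverse c) = c * c * c' + c'" "c * c' * (c' + inverse c') = c * c' * c' + c"
          using cc by (simp_all add: distrib_left)
        ultimately have "c * c' * c' + c - (c * c * c' + c') = 0" by simp
        moreover have "(c - c') * (1 - c * c') = c * c' * c' + c - (c * c * c' + c')" by (simp add: algebra_simps)
        ultimately have "(c - c') * (1 - c * c') = 0" by simp
        hence "c = c' \<or> c * c' = 1" by auto
        thus False using ceq req ne 3 \<open>\<rho>' = \<rho>\<close> by auto
      next
        \<comment> \<open>Only the second expansion has a term at \<open>n0\<close>. It could vanish
          only as c' + 1 / c' with \<rho>' = N / 2, but minimality of \<open>n0\<close> would then
          make \<rho> equal to N / 2 as well.\<close>
        case 4
        hence v: "f \<rho> c n0 = 0" using fw(1) by simp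
        have "n0 = \<rho>' \<or> n0 = n - \<rho>'" using 4 n0 by blast
        hence "f \<rho>' c' n0 = 0" "n0 = \<rho>' \<and> n0 = n - \<rho>'"
          using v eq fw(2) cc by (auto split: if_splits)
        hence "\<rho> = \<rho>'" using le \<rho> by auto
        thus False using 4 \<open>n0 = \<rho>' \<and> n0 = n - \<rho>'\<close> by auto
      qed
    qed
  qed
  hence nth: "fls_nth (wp_fourier N r s - wp_fourier N r' s') (int n0) \<noteq> 0"
    using F[OF n0n] by (simp add: wp_fourier_def n_def \<rho>_def \<rho>'_def)
  thus "wp_fourier N r s \<noteq> wp_fourier N r' s'" by auto
  have "fls_subdegree (wp_fourier N r s - wp_fourier N r' s') = int n0"
  proof (rule fls_subdegree_eqI[OF nth])
    fix k assume k: "k < int n0"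
    show "fls_nth (wp_fourier N r s - wp_fourier N r' s') k = 0"
    proof (cases "k < 0")
      case False
      hence "nat k < n0" using k by simp
      hence "nat k < n" using n0n by simp
      moreover have "f \<rho> c (nat k) = f \<rho>' c' (nat k)"
        using \<open>nat k < n0\<close> by (intro f0 \<rho>) (simp add: n0_def)
      ultimately show ?thesis
        using F False by (simp add: wp_fourier_def n_def \<rho>_def \<rho>'_def)
    qed (simp add: wp_fourier_def)
  qed
  thus "fls_subdegree (wp_fourier N r s - wp_fourier N r' s') = min (res_norm N r) (res_norm N r')"
    unfolding n0_def using w by (simp add: of_nat_min)
qed

section \<open>The stabilizer of \<open>\<Lambda>\<^sub>k\<close>\<close>

definition Lambda_row :: "int \<Rightarrow> int \<Rightarrow> int \<Rightarrow> int \<Rightarrow> complex \<Rightarrow> complex" where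
  "Lambda_row N k c d \<tau> =
     (wp_div N (k * c) (k * d) \<tau> - wp_div N c d \<tau>) / (wp_div N (2 * c) (2 * d) \<tau> - wp_div N c d \<tau>)"

lemma Lambda_in_uhp:
  "\<tau> \<in> uhp \<Longrightarrow> Lambda N k \<tau> = (wp (of_int k / of_int N) \<tau> - wp (1 / of_int N) \<tau>) /
     (wp (2 / of_int N) \<tau> - wp (1 / of_int N) \<tau>)"
  by (simp only: Lambda_def if_True)

lemma Lambda_moebius:
  assumes A: "A \<in> SL2Z" and \<tau>: "\<tau> \<in> uhp"
  shows "Lambda N k (moebius A \<tau>) = Lambda_row N k (A $ 2 $ 1) (A $ 2 $ 2) \<tau>"
proof -
  define J where "J = automorphy A \<tau>"
  have J: "J ^ 2 \<noteq> 0" using automorphy_nonzero[OF A \<tau>] by (simp add: J_def)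
  have *: "wp (of_int j / of_int N) (moebius A \<tau>) = J ^ 2 * wp_div N (j * A $ 2 $ 1) (j * A $ 2 $ 2) \<tau>" for j
  proof -
    have "J * of_int j = of_int (j * A $ 2 $ 1) * \<tau> + of_int (j * A $ 2 $ 2)"
      by (simp add: J_def automorphy_def algebra_simps)
    hence "J * (of_int j / of_int N) = (of_int (j * A $ 2 $ 1) * \<tau> + of_int (j * A $ 2 $ 2)) / of_int N"
      by (simp only: times_divide_eq_right)
    thus ?thesis unfolding wp_moebius[OF A \<tau>] J_def[symmetric] wp_div_def by (simp only:)
  qed
  have "wp (1 / of_int N) (moebius A \<tau>) = J ^ 2 * wp_div N (A $ 2 $ 1) (A $ 2 $ 2) \<tau>"
    using *[of 1] by (simp only: of_int_1 mult_1)
  moreover have "wp (2 / of_int N) (moebius A \<tau>) = J ^ 2 * wp_div N (2 * A $ 2 $ 1) (2 * A $ 2 $ 2) \<tau>"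
    using *[of 2] by (simp only: of_int_numeral)
  ultimately have "Lambda N k (moebius A \<tau>) = (J ^ 2 * (wp_div N (k * A $ 2 $ 1) (k * A $ 2 $ 2) \<tau> - wp_div N (A $ 2 $ 1) (A $ 2 $ 2) \<tau>)) /
      (J ^ 2 * (wp_div N (2 * A $ 2 $ 1) (2 * A $ 2 $ 2) \<tau> - wp_div N (A $ 2 $ 1) (A $ 2 $ 2) \<tau>))"
    by (simp only: Lambda_in_uhp[OF moebius_uhp[OF A \<tau>]] *[of k] right_diff_distrib)
  also have "\<dots> = Lambda_row N k (A $ 2 $ 1) (A $ 2 $ 2) \<tau>"
    unfolding Lambda_row_def by (rule mult_divide_mult_cancel_left[OF J])
  finally show ?thesis .
qed

lemma Lambda_eq_row:
  assumes "\<tau> \<in> uhp"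
  shows "Lambda N k \<tau> = Lambda_row N k 0 1 \<tau>"
proof -
  have "(mat 1 :: int^2^2) $ 2 $ 1 = 0" "(mat 1 :: int^2^2) $ 2 $ 2 = 1" by (simp_all add: mat_def)
  thus ?thesis using Lambda_moebius[OF mat_1_SL2Z assms, of N k] by (simp only: moebius_mat_1)
qed

section \<open>Distances to the multiples of N\<close>

lemma res_norm_cong:
  assumes "a mod N = b mod N"
  shows "res_norm N a = res_norm N b"
  unfolding res_norm_def assms mod_minus_cong[OF assms] by (rule refl)

lemma res_norm_minus: "res_norm N (- a) = res_norm N a"
  unfolding res_norm_def minus_minus by (rule min.commute)

lemma res_norm_small:
  assumes "0 \<le> a" "2 * a \<le> N" "N > 0"
  shows "res_norm N a = a"
proof -
  have "a mod N = a" using assms by (intro mod_pos_pos_trivial) auto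
  thus ?thesis using neg_mod_eq[OF assms(3), of a] assms by (auto simp: res_norm_def)
qed

lemma res_norm_rep:
  assumes N: "N > 0"
  obtains \<sigma> t where "\<sigma> = 1 \<or> \<sigma> = -1" "e = \<sigma> * res_norm N e + N * t" "0 \<le> res_norm N e" "2 * res_norm N e \<le> N"
proof (cases "2 * (e mod N) \<le> N")
  case True
  have "res_norm N e = res_norm N (e mod N)" by (rule res_norm_cong) simp
  hence 1: "res_norm N e = e mod N" using res_norm_small[of "e mod N" N] True N by simp
  show ?thesis
    by (rule that[of 1 "e div N"]) (use 1 True N in simp_all)
next
  case False
  have "res_norm N e = res_norm N (N - e mod N)"
  proof -
    have "res_norm N e = res_norm N (- e)" by (simp add: res_norm_minus)
    also have "\<dots> = res_norm N (N - e mod N)" 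
    proof (rule res_norm_cong)
      have "- e = (N - e mod N) + N * (- 1 - e div N)" using mult_div_mod_eq[of N e] by (simp add: algebra_simps)
      thus "(- e) mod N = (N - e mod N) mod N" by (metis mod_mult_self2)
    qed
    finally show ?thesis .
  qed
  hence 1: "res_norm N e = N - e mod N"
    using res_norm_small[of "N - e mod N" N] False N pos_mod_bound[OF N, of e] by simp
  have "e = e mod N + N * (e div N)" by simp
  hence "e = -1 * (N - e mod N) + N * (e div N + 1)" by (simp add: algebra_simps)
  thus ?thesis
    using False N pos_mod_bound[OF N, of e] by (intro that[of "-1" "e div N + 1"]) (simp_all add: 1)
qed

lemma res_norm_mult_rep:
  assumes "N > 0" "\<sigma> = 1 \<or> \<sigma> = -1" "e = \<sigma> * a + N * t"
  shows "res_norm N (j * e) = res_norm N (j * a)"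
proof -
  have "(j * e) mod N = (\<sigma> * (j * a)) mod N"
    unfolding assms(3) by (simp add: algebra_simps)
  hence "res_norm N (j * e) = res_norm N (\<sigma> * (j * a))" by (rule res_norm_cong)
  thus ?thesis using assms(2) res_norm_minus[of N "j * a"] by auto
qed

lemma res_norm_0_le: "N > 0 \<Longrightarrow> 0 \<le> res_norm N e"
  by (simp add: res_norm_def)

text \<open>\<open>ladder N k e\<close> describes the orders of \<open>\<Lambda>\<^sub>k\<close> and \<open>\<Lambda>\<^sub>k - 1\<close> at a cusp
  with first coordinate \<open>e\<close>: they agree with those at the cusp with first coordinate \<open>1\<close>.\<close>

definition ladder :: "int \<Rightarrow> int \<Rightarrow> int \<Rightarrow> bool" where
  "ladder N k e \<longleftrightarrow> res_norm N e < res_norm N (2 * e) \<and> res_norm N e < res_norm N (k * e) \<and>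
     (res_norm N (2 * e) = res_norm N e + 1 \<or> res_norm N (k * e) = res_norm N e + 1)"

text \<open>Let a be the distance of e. As N - 2 a is congruent to -2 a, the distance of 2 e is at
  most N - 2 a, and the first inequality of \<open>ladder\<close> gives a < N - 2 a.\<close>

lemma ladder_third:
  assumes N: "N > 0" and lad: "ladder N k e"
  shows "3 * res_norm N e < N"
proof -
  define a where "a = res_norm N e"
  obtain \<sigma> t where e: "\<sigma> = 1 \<or> \<sigma> = -1" "e = \<sigma> * a + N * t" "0 \<le> a" "2 * a \<le> N"
    unfolding a_def using res_norm_rep[OF N] by metis
  have "a < res_norm N (2 * a)"
    using lad res_norm_mult_rep[OF N e(1,2), of 2] by (simp add: ladder_def a_def)
  moreover have "res_norm N (2 * a) = res_norm N (N - 2 * a)"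
  proof -
    have "res_norm N (N - 2 * a) = res_norm N (- (2 * a))" by (rule res_norm_cong) simp
    thus ?thesis by (simp add: res_norm_minus)
  qed
  moreover have "res_norm N (N - 2 * a) \<le> (N - 2 * a) mod N" by (simp add: res_norm_def)
  moreover have "(N - 2 * a) mod N \<le> N - 2 * a" using e by (intro zmod_le_nonneg_dividend) simp
  ultimately show ?thesis unfolding a_def by linarith
qed

text \<open>A subgroup of index \<open>\<ge> 3\<close> has a coset meeting the middle third of the residues.\<close>

lemma ladder_coset:
  assumes N: "N > 6" and lad: "\<And>x. ladder N k (c * x + d)"
  shows "N dvd c"
proof -
  have N0: "N > 0" using N by simp
  define g where "g = gcd c N"
  have g: "g > 0" "g dvd c" "g dvd N" using N by (auto simp: g_def)
  obtain u v where uv: "u * c + v * N = g" unfolding g_def using bezout_int by blast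
  obtain q where q: "N = g * q" using g(3) by (auto simp: dvd_def)
  have q0: "q > 0" using q N0 g(1) zero_less_mult_pos by blast
  have "\<not> q \<ge> 3"
  proof
    assume "q \<ge> 3"
    hence g3: "3 * g \<le> N" unfolding q using g(1) by (simp add: mult.commute mult_left_mono)
    define m where "m = (N + 2) div 3"
    \<comment> \<open>The class of d modulo g meets any g consecutive integers. Starting at m, the
      ceiling of N / 3, and with g \<le> N / 3, the representative lies in the middle third.\<close>
    define e where "e = m + (d - m) mod g"
    have m: "N \<le> 3 * m" "3 * m \<le> N + 2" unfolding m_def by presburger+
    have "0 \<le> (d - m) mod g" "(d - m) mod g \<le> g - 1" using g(1) pos_mod_bound[OF g(1), of "d - m"] by simp_all
    hence e: "N \<le> 3 * e" "3 * e \<le> 2 * N" using m g3 unfolding e_def by simp_all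
    have "g dvd e - d"
    proof -
      have "e - d = - (g * ((d - m) div g))" unfolding e_def using mult_div_mod_eq[of g "d - m"] by linarith
      thus ?thesis by simp
    qed
    then obtain t where t: "e - d = g * t" by (auto simp: dvd_def)
    \<comment> \<open>By the Bezout identity, e is attained modulo N as c x + d with x = u t, so
      \<open>ladder_third\<close> contradicts its position.\<close>
    have "c * (u * t) + d = e - N * (v * t)"
    proof -
      have "(u * c + v * N) * t = e - d" using uv t by simp
      thus ?thesis by (simp add: algebra_simps)
    qed
    hence "(c * (u * t) + d) mod N = e mod N" by (simp add: mod_diff_right_eq[symmetric])
    hence "res_norm N (c * (u * t) + d) = res_norm N e" by (rule res_norm_cong)
    hence lt: "3 * res_norm N e < N" using ladder_third[OF N0 lad] by metis
    show False
    proof (cases "2 * e \<le> N")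
      case True
      hence "res_norm N e = e" using e N0 by (intro res_norm_small) auto
      thus False using lt e by simp
    next
      case False
      have "res_norm N e = res_norm N (- e)" by (simp add: res_norm_minus)
      also have "\<dots> = res_norm N (N - e)" by (rule res_norm_cong) simp
      also have "\<dots> = N - e" using e False N0 by (intro res_norm_small) auto
      finally show False using lt e by simp
    qed
  qed
  moreover have "q \<noteq> 2"
  proof
    assume "q = 2"
    \<comment> \<open>Now c is congruent to N / 2 and the coset consists of d and d + N / 2. Both
      can avoid the middle third, so the equalities in \<open>ladder\<close> have to be
      used.\<close>
    hence Ng: "N = 2 * g" using q by simp
    obtain h where h: "c = g * h" using g(2) by (auto simp: dvd_def)
    have "odd h"
    proof
      assume "even h"
      then obtain h' where "h = 2 * h'" by blast
      hence "N dvd c" using Ng h by simp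
      hence "N dvd g" unfolding g_def by (rule gcd_greatest) simp
      thus False using zdvd_imp_le[of N g] Ng g(1) by simp
    qed
    then obtain h' where "h = 2 * h' + 1" using oddE by blast
    hence c: "c = g + N * h'" using h Ng by (simp add: algebra_simps)
    define a where "a = res_norm N d"
    obtain \<sigma> t where d: "\<sigma> = 1 \<or> \<sigma> = -1" "d = \<sigma> * a + N * t" "0 \<le> a" "2 * a \<le> N"
      unfolding a_def using res_norm_rep[OF N0] by metis
    have shift: "res_norm N (g + y) = g - res_norm N y" for y
    proof -
      obtain \<sigma>' t' where y: "\<sigma>' = 1 \<or> \<sigma>' = -1" "y = \<sigma>' * res_norm N y + N * t'" "0 \<le> res_norm N y" "2 * res_norm N y \<le> N"
        using res_norm_rep[OF N0] by metis
      define b where "b = res_norm N y"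
      have "(g + y) mod N = (- (\<sigma>' * (g - b))) mod N"
      proof -
        have "g + y - (- (\<sigma>' * (g - b))) = N * t' + (1 + \<sigma>') * g"
          using y(2) unfolding b_def[symmetric] by (simp add: algebra_simps)
        also have "N dvd \<dots>" using y(1) Ng by auto
        finally show ?thesis by (simp add: mod_eq_dvd_iff)
      qed
      hence "res_norm N (g + y) = res_norm N (\<sigma>' * (g - b))" by (metis res_norm_cong res_norm_minus)
      also have "\<dots> = res_norm N (g - b)" using y(1) res_norm_minus[of N "g - b"] by auto
      also have "\<dots> = g - b" using y(3,4) Ng N0 by (intro res_norm_small) (auto simp: b_def)
      finally show ?thesis by (simp add: b_def)
    qed
    have l0: "ladder N k d" using lad[of 0] by simp
    have l1: "ladder N k (c + d)" using lad[of 1] by simp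
    have m: "res_norm N (j * (c + d)) = res_norm N (j * g + j * d)" for j
    proof (rule res_norm_cong)
      have "j * (c + d) = (j * g + j * d) + N * (h' * j)" by (simp add: c algebra_simps)
      thus "(j * (c + d)) mod N = (j * g + j * d) mod N" by (simp only: mod_mult_self2)
    qed
    have m1: "res_norm N (c + d) = g - a" using m[of 1] shift[of d] by (simp add: a_def)
    have m2: "res_norm N (2 * (c + d)) = res_norm N (2 * d)"
      unfolding m by (rule res_norm_cong) (simp add: Ng)
    define b where "b = res_norm N (2 * d)"
    define x where "x = res_norm N (k * d)"
    have mk: "even k \<and> res_norm N (k * (c + d)) = x \<or> res_norm N (k * (c + d)) = g - x"
    proof (cases "even k")
      case True
      then obtain k' where k': "k = 2 * k'" by blast
      have "res_norm N (k * g + k * d) = res_norm N (k * d)"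
      proof (rule res_norm_cong)
        have "k * g + k * d = k * d + N * k'" unfolding k' Ng by (simp add: algebra_simps)
        thus "(k * g + k * d) mod N = (k * d) mod N" by (simp only: mod_mult_self2)
      qed
      thus ?thesis using True unfolding m x_def by simp
    next
      case False
      then obtain k' where k': "k = 2 * k' + 1" using oddE by blast
      have "res_norm N (k * g + k * d) = res_norm N (g + k * d)"
      proof (rule res_norm_cong)
        have "k * g + k * d = (g + k * d) + N * k'" unfolding k' Ng by (simp add: algebra_simps)
        thus "(k * g + k * d) mod N = (g + k * d) mod N" by (simp only: mod_mult_self2)
      qed
      thus ?thesis unfolding m x_def shift by simp
    qed
    have b: "b = res_norm N (2 * a)" using res_norm_mult_rep[OF N0 d(1,2), of 2] by (simp add: b_def)
    have A: "a < b" "a < x" "b = a + 1 \<or> x = a + 1"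
      using l0 unfolding ladder_def a_def b_def x_def by auto
    have B: "g - a < b" "g - a < res_norm N (k * (c + d))" "b = g - a + 1 \<or> res_norm N (k * (c + d)) = g - a + 1"
      using l1 unfolding ladder_def m1 m2 b_def by auto
    \<comment> \<open>Both members of the coset satisfy \<open>ladder\<close> with the same distance
      b of 2 d, which forces d to have distance N / 4. Then b = 2 a, and each remaining alternative
      either needs a = 1, that is N = 4, or violates an inequality.\<close>
    have ga: "g = 2 * a" using mk A B by arith
    have "b = g" unfolding b ga[symmetric] using Ng g(1) by (intro res_norm_small) auto
    moreover have "x = 0 \<or> x = g" if "even k"
    proof -
      obtain k' where k': "k = 2 * k'" using \<open>even k\<close> by blast
      have "x = res_norm N (k * a)" using res_norm_mult_rep[OF N0 d(1,2), of k] by (simp add: x_def)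
      also have "k * a = k' * g" by (simp add: k' ga)
      finally have x: "x = res_norm N (k' * g)" .
      show ?thesis
      proof (cases "even k'")
        case True
        then obtain j where "k' * g = 0 + N * j" using Ng by (metis add_0 dvdE mult.assoc mult.commute)
        hence "(k' * g) mod N = 0 mod N" by (simp only: mod_mult_self2)
        hence "x = res_norm N 0" unfolding x by (rule res_norm_cong)
        thus ?thesis by (simp add: res_norm_def)
      next
        case False
        then obtain j where "k' = 2 * j + 1" using oddE by blast
        hence "k' * g = g + N * j" using Ng by (simp add: algebra_simps)
        hence "(k' * g) mod N = g mod N" by (simp only: mod_mult_self2)
        hence "x = res_norm N g" unfolding x by (rule res_norm_cong)
        also have "\<dots> = g" using Ng g(1) N0 by (intro res_norm_small) auto
        finally show ?thesis by simp
      qed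
    qed
    ultimately show False using A B mk ga N Ng by arith
  qed
  ultimately have "q = 1" using q0 by arith
  hence "g = N" using q by simp
  thus ?thesis using g(2) by simp
qed

context
  fixes N k :: int
  assumes N: "N > 6" and k: "2 < k" "2 * k < N"
begin

section \<open>Orders and leading coefficients of Lambda at the cusps\<close>

lemma N_pos: "N > 0" using N by simp

lemma row_not_dvd:
  assumes "coprime c d" "0 < j" "j < N"
  shows "\<not> (N dvd j * c \<and> N dvd j * d)"
proof
  assume "N dvd j * c \<and> N dvd j * d"
  hence "N dvd gcd (j * c) (j * d)" by simp
  also have "gcd (j * c) (j * d) = j" using assms by (simp add: gcd_mult_left)
  finally have "N dvd j" .
  thus False using zdvd_imp_le[of N j] assms by simp
qed

lemma row_distinct:
  assumes "coprime c d" "0 < i" "i < j" "i + j < N"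
  shows "\<not> (N dvd j * c - i * c \<and> N dvd j * d - i * d)" "\<not> (N dvd j * c + i * c \<and> N dvd j * d + i * d)"
  using row_not_dvd[OF assms(1), of "j - i"] row_not_dvd[OF assms(1), of "j + i"] assms
  by (simp_all add: algebra_simps)

lemma SL2Z_coprime: fixes A :: "int^2^2" shows "A \<in> SL2Z \<Longrightarrow> coprime (A $ 2 $ 1) (A $ 2 $ 2)"
proof (rule coprimeI)
  fix x assume A: "A \<in> SL2Z" and x: "x dvd A $ 2 $ 1" "x dvd A $ 2 $ 2"
  have "x dvd A $ 1 $ 1 * A $ 2 $ 2 - A $ 1 $ 2 * A $ 2 $ 1" using x by (intro dvd_diff dvd_mult)
  thus "is_unit x" using A by (simp add: SL2Z_det)
qed

lemma wp_div_distinct: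
  assumes "coprime c d" "0 < i" "i < j" "i + j < N" "\<tau> \<in> uhp"
  shows "wp_div N (j * c) (j * d) \<tau> \<noteq> wp_div N (i * c) (i * d) \<tau>"
  using wp_div_eq_iff[OF N_pos assms(5) row_not_dvd row_not_dvd, of c d j c d i] row_distinct[OF assms(1-4)] assms
  by auto

lemma Lambda_row_holomorphic:
  assumes "coprime c d"
  shows "Lambda_row N k c d holomorphic_on uhp"
proof -
  have "wp_div N (2 * c) (2 * d) \<tau> \<noteq> wp_div N (1 * c) (1 * d) \<tau>" if "\<tau> \<in> uhp" for \<tau>
    using wp_div_distinct[OF assms, of 1 2] that N by simp
  moreover have "wp_div N (j * c) (j * d) holomorphic_on uhp" if "0 < j" "j < N" for j
    by (rule wp_div_holomorphic[OF N_pos row_not_dvd[OF assms that]])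
  from this[of k] this[of 2] this[of 1] have "wp_div N (k * c) (k * d) holomorphic_on uhp"
    "wp_div N (2 * c) (2 * d) holomorphic_on uhp" "wp_div N c d holomorphic_on uhp" using N k by auto
  ultimately show ?thesis unfolding Lambda_row_def[abs_def] by (intro holomorphic_intros) auto
qed

definition Lambda_row_fourier :: "int \<Rightarrow> int \<Rightarrow> complex fls" where
  "Lambda_row_fourier c d = (wp_fourier N (k * c) (k * d) - wp_fourier N c d) /
     (wp_fourier N (2 * c) (2 * d) - wp_fourier N c d)"

lemma Lambda_row_fourier:
  assumes "coprime c d"
  shows "has_fourier_expansion N (Lambda_row N k c d) (Lambda_row_fourier c d)"
proof -
  define C where "C = fls_const ((2 * of_real pi * \<i>) ^ 2 :: complex)"
  have C: "C \<noteq> 0" by (simp add: C_def)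
  have F: "has_fourier_expansion N (wp_div N (j * c) (j * d)) (C * wp_fourier N (j * c) (j * d))" if "0 < j" "j < N" for j
    unfolding C_def by (rule wp_div_fourier[OF N_pos row_not_dvd[OF assms that]])
  have F1: "has_fourier_expansion N (wp_div N c d) (C * wp_fourier N c d)" using F[of 1] N by simp
  have "has_fourier_expansion N (Lambda_row N k c d) ((C * wp_fourier N (k * c) (k * d) - C * wp_fourier N c d) /
     (C * wp_fourier N (2 * c) (2 * d) - C * wp_fourier N c d))"
    unfolding Lambda_row_def[abs_def]
    by (intro fourier_divide fourier_diff N_pos F F1) (use N k in auto)
  also have "(C * wp_fourier N (k * c) (k * d) - C * wp_fourier N c d) /
     (C * wp_fourier N (2 * c) (2 * d) - C * wp_fourier N c d) = Lambda_row_fourier c d"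
    using C by (simp add: Lambda_row_fourier_def flip: right_diff_distrib)
  finally show ?thesis .
qed

lemma row_diff:
  assumes "coprime c d" "0 < i" "i < j" "i + j < N"
  shows "wp_fourier N (j * c) (j * d) - wp_fourier N (i * c) (i * d) \<noteq> 0"
    "fls_subdegree (wp_fourier N (j * c) (j * d) - wp_fourier N (i * c) (i * d)) = min (res_norm N (j * c)) (res_norm N (i * c))"
  using wp_fourier_diff[OF N_pos row_not_dvd row_not_dvd row_distinct[OF assms]] assms by auto

lemma ladder_of_min:
  fixes a b c :: int
  assumes "min c b - min b a = 1" "min c a - min b a = 0"
  shows "a < b \<and> a < c \<and> (b = a + 1 \<or> c = a + 1)"
  using assms by (auto simp: min_def split: if_splits)

text \<open>At the row (1, 0) the functions \<open>Lambda N k\<close> and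
  \<open>Lambda N k - 1\<close> have orders 0 and 1, because the distances of 1, 2, k are 1, 2, k.
  The numerator of \<open>Lambda N k - 1\<close> is the difference for the multiples k and 2.
  Cross-multiplication makes the orders additive, and comparing them gives
  \<open>ladder\<close>.\<close>

lemma Lambda_row_eq:
  assumes co: "coprime c d" and eq: "Lambda_row_fourier c d = Lambda_row_fourier 1 0"
  defines "U \<equiv> \<lambda>j. wp_fourier N (j * c) (j * d)" and "Y \<equiv> \<lambda>j. wp_fourier N j 0"
  shows "(U k - U 2) * (Y 2 - Y 1) = (Y k - Y 2) * (U 2 - U 1)" and "ladder N k c"
proof -
  have co1: "coprime 1 (0::int)" by simp
  have lt: "0 < (1::int)" "(1::int) < 2" "1 + 2 < N" "0 < (2::int)" "2 < k" "2 + k < N" "1 < k" "1 + k < N" using N k by auto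
  note X21 = row_diff[OF co lt(1-3)] and Xk2 = row_diff[OF co lt(4-6)] and Xk1 = row_diff[OF co lt(1,7,8)]
  note Y21 = row_diff[OF co1 lt(1-3)] and Yk2 = row_diff[OF co1 lt(4-6)] and Yk1 = row_diff[OF co1 lt(1,7,8)]
  have nz: "U 2 - U 1 \<noteq> 0" "Y 2 - Y 1 \<noteq> 0" "U k - U 2 \<noteq> 0" "Y k - Y 2 \<noteq> 0" "U k - U 1 \<noteq> 0" "Y k - Y 1 \<noteq> 0"
    using X21 Y21 Xk2 Yk2 Xk1 Yk1 by (simp_all add: U_def Y_def)
  have "(U k - U 1) / (U 2 - U 1) = (Y k - Y 1) / (Y 2 - Y 1)"
    using eq by (simp add: Lambda_row_fourier_def U_def Y_def)
  hence 1: "(U k - U 1) * (Y 2 - Y 1) = (Y k - Y 1) * (U 2 - U 1)" by (subst (asm) frac_eq_eq) (use nz in auto)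
  hence "(U k - U 1) * (Y 2 - Y 1) - (U 2 - U 1) * (Y 2 - Y 1) = (Y k - Y 1) * (U 2 - U 1) - (Y 2 - Y 1) * (U 2 - U 1)"
    by (simp add: mult.commute)
  thus 2: "(U k - U 2) * (Y 2 - Y 1) = (Y k - Y 2) * (U 2 - U 1)"
    by (simp only: left_diff_distrib[symmetric]) simp
  have m: "res_norm N 1 = 1" "res_norm N 2 = 2" "res_norm N k = k" using N k by (auto intro: res_norm_small)
  have "fls_subdegree (U k - U 1) + fls_subdegree (Y 2 - Y 1) = fls_subdegree (Y k - Y 1) + fls_subdegree (U 2 - U 1)"
    using arg_cong[OF 1, of fls_subdegree] nz by simp
  hence A: "min (res_norm N (k * c)) (res_norm N c) + 1 = 1 + min (res_norm N (2 * c)) (res_norm N c)"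
    using X21(2) Y21(2) Xk1(2) Yk1(2) k by (simp add: U_def Y_def m)
  have "fls_subdegree (U k - U 2) + fls_subdegree (Y 2 - Y 1) = fls_subdegree (Y k - Y 2) + fls_subdegree (U 2 - U 1)"
    using arg_cong[OF 2, of fls_subdegree] nz by simp
  hence B: "min (res_norm N (k * c)) (res_norm N (2 * c)) + 1 = 2 + min (res_norm N (2 * c)) (res_norm N c)"
    using X21(2) Y21(2) Xk2(2) Yk2(2) k by (simp add: U_def Y_def m)
  show "ladder N k c" unfolding ladder_def by (rule ladder_of_min) (use A B in auto)
qed

text \<open>When N divides s the root of unity is 1. The leading coefficient is then 1, or 2 if r is
  congruent to N / 2 and both powers fall together.\<close>

lemma wp_fourier_nth_real:
  assumes s: "N dvd s" and n: "0 < n" "n \<le> res_norm N r"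
  shows "fls_nth (wp_fourier N r s) n = (if n = r mod N then 1 else 0) + (if n = N - r mod N then 1 else 0)"
proof -
  define \<rho> where "\<rho> = nat (r mod N)"
  have \<rho>: "int \<rho> = r mod N" "\<rho> < nat N" using N_pos by (simp_all add: \<rho>_def)
  have r0: "r mod N \<noteq> 0" using n by (auto simp: res_norm_def)
  hence rm: "0 < r mod N" using pos_mod_sign[OF N_pos, of r] by linarith
  have le: "n \<le> r mod N" "n \<le> N - r mod N" using n r0 by (auto simp: res_norm_def neg_mod_eq[OF N_pos])
  have nd: "\<not> (N dvd r \<and> N dvd s)" using r0 by (auto simp: dvd_eq_mod_eq_0)
  have c: "cexp (of_int s / of_nat (nat N)) = 1"
    using cexp_frac_eq_1_iff[of "nat N" s] N_pos s by simp
  have lt: "nat n < nat N" using le n rm by linarith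
  have "fls_nth (wp_fourier N r s) n = fps_nth (wpF (nat N) \<rho> s) (nat n)"
    using n by (simp add: wp_fourier_def \<rho>_def)
  also have "\<dots> = fps_nth (Efps 1 \<rho>) (nat n) + fps_nth (Efps 1 (nat N - \<rho>)) (nat n)"
    using wpF_nth_low[OF mod_nat_less[OF N_pos] not_dvd_cases[OF N_pos nd] lt] n c by (simp add: \<rho>_def)
  also have "fps_nth (Efps 1 \<rho>) (nat n) = (if n = r mod N then 1 else 0)"
  proof (cases "n = r mod N")
    case True
    hence "nat n = \<rho>" using \<rho> by auto
    thus ?thesis using Efps_nth(2)[of \<rho> 1] rm \<rho> True by simp
  next
    case False
    hence "nat n < \<rho>" using \<rho> le n by auto
    thus ?thesis using Efps_nth(1)[of \<rho> "nat n" 1] rm \<rho> False by simp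
  qed
  also have "fps_nth (Efps 1 (nat N - \<rho>)) (nat n) = (if n = N - r mod N then 1 else 0)"
  proof (cases "n = N - r mod N")
    case True
    hence "nat n = nat N - \<rho>" using \<rho> by auto
    thus ?thesis using Efps_nth(2)[of "nat N - \<rho>" 1] \<rho> True by simp
  next
    case False
    hence "nat n < nat N - \<rho>" using \<rho> le n by auto
    thus ?thesis using Efps_nth(1)[of "nat N - \<rho>" "nat n" 1] \<rho> False by simp
  qed
  finally show ?thesis .
qed

lemma wp_fourier_nth_lead:
  assumes "N dvd s" "0 < res_norm N r"
  shows "fls_nth (wp_fourier N r s) (res_norm N r) \<in> {1, 2}"
    and "2 * res_norm N r < N \<Longrightarrow> fls_nth (wp_fourier N r s) (res_norm N r) = 1"
    and "0 < n \<Longrightarrow> n < res_norm N r \<Longrightarrow> fls_nth (wp_fourier N r s) n = 0"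
proof -
  have r0: "r mod N \<noteq> 0" using assms(2) by (auto simp: res_norm_def)
  hence eq: "res_norm N r = min (r mod N) (N - r mod N)" by (simp add: res_norm_def neg_mod_eq[OF N_pos])
  show "fls_nth (wp_fourier N r s) (res_norm N r) \<in> {1, 2}"
    "2 * res_norm N r < N \<Longrightarrow> fls_nth (wp_fourier N r s) (res_norm N r) = 1"
    using wp_fourier_nth_real[OF assms(1,2) order_refl] eq by (auto simp: min_def split: if_splits)
  show "0 < n \<Longrightarrow> n < res_norm N r \<Longrightarrow> fls_nth (wp_fourier N r s) n = 0"
    using wp_fourier_nth_real[OF assms(1), of n r] eq by auto
qed

lemma res_norm_eq_imp:
  assumes "res_norm N a = res_norm N b"
  shows "N dvd a - b \<or> N dvd a + b"
proof -
  obtain \<sigma> t where a: "\<sigma> = 1 \<or> \<sigma> = -1" "a = \<sigma> * res_norm N a + N * t" using res_norm_rep[OF N_pos] by metis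
  obtain \<sigma>' t' where b: "\<sigma>' = 1 \<or> \<sigma>' = -1" "b = \<sigma>' * res_norm N b + N * t'" using res_norm_rep[OF N_pos] by metis
  have 1: "a - b = (\<sigma> - \<sigma>') * res_norm N b + N * (t - t')" "a + b = (\<sigma> + \<sigma>') * res_norm N b + N * (t + t')"
    using a(2) b(2) assms by (simp_all add: algebra_simps)
  show ?thesis
  proof (cases "\<sigma> = \<sigma>'")
    case True
    thus ?thesis using 1(1) by simp
  next
    case False
    hence "\<sigma> + \<sigma>' = 0" using a(1) b(1) by auto
    thus ?thesis using 1(2) by simp
  qed
qed

text \<open>When N divides c all roots of unity are 1 and the leading coefficients are 1 or 2. The
  lowest coefficients of the cross-multiplied identity for \<open>Lambda N k - 1\<close> show that,
  at exponent a + 1, the coefficient for 2 d exceeds the one for k d by 1. So the expansion for k d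
  cannot be the one that starts there, and the second alternative of \<open>ladder\<close> is
  excluded.\<close>

lemma ladder_unit:
  assumes co: "coprime d c" and c: "N dvd c" and eq: "Lambda_row_fourier d (- c) = Lambda_row_fourier 1 0"
  shows "res_norm N (2 * d) = res_norm N d + 1" "res_norm N d + 1 < res_norm N (k * d)" "3 * res_norm N d < N"
    "0 < res_norm N d"
proof -
  define a where "a = res_norm N d"
  have co': "coprime d (- c)" using co by simp
  have lad: "ladder N k d" by (rule Lambda_row_eq(2)[OF co' eq])
  show third: "3 * res_norm N d < N" by (rule ladder_third[OF N_pos lad])
  have coN: "coprime N d" using co c coprime_divisors[of N c d d] by (simp add: coprime_commute)
  show a0: "0 < res_norm N d"
  proof (rule ccontr)
    assume "\<not> 0 < res_norm N d"
    hence "res_norm N d = res_norm N 0" using res_norm_0_le[OF N_pos, of d] by (simp add: res_norm_def[of N 0])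
    hence "N dvd d" using res_norm_eq_imp[of d 0] by auto
    hence "is_unit N" using coN coprime_common_divisor[of N d N] by simp
    thus False using N by auto
  qed
  have L: "a < res_norm N (2 * d)" "a < res_norm N (k * d)" "res_norm N (2 * d) = a + 1 \<or> res_norm N (k * d) = a + 1"
    using lad by (auto simp: ladder_def a_def)
  \<comment> \<open>As d is a unit modulo N, equality would make N divide k - 2 or k + 2, both of
    which lie strictly between 0 and N.\<close>
  have kd2d: "res_norm N (k * d) \<noteq> res_norm N (2 * d)"
  proof
    assume "res_norm N (k * d) = res_norm N (2 * d)"
    hence "N dvd d * (k - 2) \<or> N dvd d * (k + 2)" using res_norm_eq_imp[of "k * d" "2 * d"] by (simp add: algebra_simps)
    hence "N dvd k - 2 \<or> N dvd k + 2" using coN by (simp add: coprime_dvd_mult_right_iff)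
    thus False using N k zdvd_imp_le[of N "k - 2"] zdvd_imp_le[of N "k + 2"] by auto
  qed
  define x y where "x = (\<lambda>j. fls_nth (wp_fourier N (j * d) (j * (- c))))" and "y = (\<lambda>j. fls_nth (wp_fourier N j 0))"
  have dvd: "N dvd j * (- c)" for j using c by simp
  have m: "res_norm N 1 = 1" "res_norm N 2 = 2" "res_norm N k = k" using N k by (auto intro: res_norm_small)
  have prod: "(wp_fourier N (k * d) (k * (- c)) - wp_fourier N (2 * d) (2 * (- c))) * (wp_fourier N 2 0 - wp_fourier N 1 0) =
        (wp_fourier N k 0 - wp_fourier N 2 0) * (wp_fourier N (2 * d) (2 * (- c)) - wp_fourier N (1 * d) (1 * (- c)))"
    by (rule Lambda_row_eq(1)[OF co' eq])
  have lt: "0 < (1::int)" "(1::int) < 2" "1 + 2 < N" "0 < (2::int)" "2 < k" "2 + k < N" using N k by auto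
  have co1: "coprime 1 (0::int)" by simp
  have sd: "fls_subdegree (wp_fourier N (k * d) (k * (- c)) - wp_fourier N (2 * d) (2 * (- c))) = a + 1"
    "fls_subdegree (wp_fourier N 2 0 - wp_fourier N 1 0) = 1"
    "fls_subdegree (wp_fourier N k 0 - wp_fourier N 2 0) = 2"
    "fls_subdegree (wp_fourier N (2 * d) (2 * (- c)) - wp_fourier N (1 * d) (1 * (- c))) = a"
    using row_diff(2)[OF co' lt(1-3)] row_diff(2)[OF co' lt(4-6)] row_diff(2)[OF co1 lt(1-3)] row_diff(2)[OF co1 lt(4-6)]
      L m k by (auto simp: a_def)
  have "fls_nth ((wp_fourier N (k * d) (k * (- c)) - wp_fourier N (2 * d) (2 * (- c))) * (wp_fourier N 2 0 - wp_fourier N 1 0)) (a + 1 + 1)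
      = (x k (a + 1) - x 2 (a + 1)) * (y 2 1 - y 1 1)"
    using fls_times_base[of "wp_fourier N (k * d) (k * (- c)) - wp_fourier N (2 * d) (2 * (- c))" "wp_fourier N 2 0 - wp_fourier N 1 0"]
    unfolding sd x_def y_def by simp
  moreover have "fls_nth ((wp_fourier N k 0 - wp_fourier N 2 0) * (wp_fourier N (2 * d) (2 * (- c)) - wp_fourier N (1 * d) (1 * (- c)))) (2 + a)
      = (y k 2 - y 2 2) * (x 2 a - x 1 a)"
    using fls_times_base[of "wp_fourier N k 0 - wp_fourier N 2 0" "wp_fourier N (2 * d) (2 * (- c)) - wp_fourier N (1 * d) (1 * (- c))"]
    unfolding sd x_def y_def by simp
  \<comment> \<open>The lowest coefficient of a product is the product of the lowest coefficients;
    the orders a + 1 and 1 on the left match 2 and a on the right.\<close>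
  ultimately have E: "(x k (a + 1) - x 2 (a + 1)) * (y 2 1 - y 1 1) = (y k 2 - y 2 2) * (x 2 a - x 1 a)"
    unfolding prod by (simp add: add_ac)
  have y: "y 2 1 = 0" "y 1 1 = 1" "y k 2 = 0" "y 2 2 = 1"
    unfolding y_def using wp_fourier_nth_lead(3)[of 0 2 1] wp_fourier_nth_lead(2)[of 0 1] wp_fourier_nth_lead(3)[of 0 k 2]
      wp_fourier_nth_lead(2)[of 0 2] m k N by simp_all
  have x: "x 2 a = 0" "x 1 a = 1"
    unfolding x_def using wp_fourier_nth_lead(3)[OF dvd, of "2 * d" a 2] wp_fourier_nth_lead(2)[OF dvd, of "1 * d" 1] L a0 third
    by (simp_all add: a_def)
  have "x 2 (a + 1) - x k (a + 1) = 1" using E unfolding x y by simp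
  hence E': "x k (a + 1) - x 2 (a + 1) = -1" using minus_diff_eq[of "x 2 (a + 1)" "x k (a + 1)"] by simp
  have "res_norm N (k * d) \<noteq> a + 1"
  proof
    assume eqk: "res_norm N (k * d) = a + 1"
    hence "a + 1 < res_norm N (2 * d)" using L kd2d by simp
    hence "x 2 (a + 1) = 0" unfolding x_def using a0 wp_fourier_nth_lead(3)[OF dvd, of "2 * d" "a + 1" 2] by (simp add: a_def)
    moreover have "x k (a + 1) \<in> {1, 2}"
      unfolding x_def using wp_fourier_nth_lead(1)[OF dvd, of "k * d" k] eqk a0 by (simp add: a_def)
    ultimately show False using E' by auto
  qed
  thus "res_norm N (2 * d) = res_norm N d + 1" "res_norm N d + 1 < res_norm N (k * d)"
    using L by (auto simp: a_def)
qed

text \<open>A further matrix (x, -1; 1, 0) turns the invariance into an identity between the rows (c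
  x + d, -c) and (1, 0). The ladder conditions for all x give N | c by \<open>ladder_coset\<close>.
  With a the distance of d, \<open>ladder_unit\<close> says that 2 a has distance a + 1, hence 2 a =
  a + 1 or N - 2 a = a + 1.\<close>

theorem Lambda_stabilizer:
  fixes A :: "int^2^2"
  assumes A: "A \<in> SL2Z" and inv: "\<And>\<tau>. \<tau> \<in> uhp \<Longrightarrow> Lambda N k (moebius A \<tau>) = Lambda N k \<tau>"
  shows "N dvd A $ 2 $ 1 \<and> (N dvd A $ 2 $ 2 - 1 \<or> N dvd A $ 2 $ 2 + 1)"
proof -
  have rows: "Lambda_row_fourier (A $ 2 $ 1 * x + A $ 2 $ 2) (- (A $ 2 $ 1)) = Lambda_row_fourier 1 0 \<and>
      coprime (A $ 2 $ 1 * x + A $ 2 $ 2) (- (A $ 2 $ 1))"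
    if A: "A \<in> SL2Z" and inv: "\<And>\<tau>. \<tau> \<in> uhp \<Longrightarrow> Lambda N k (moebius A \<tau>) = Lambda N k \<tau>" for A :: "int^2^2" and x
  proof -
    define B where "B = mat2 x (-1) 1 0"
    have B: "B \<in> SL2Z" by (simp add: B_def SL2Z_det)
    have AB: "A ** B \<in> SL2Z" by (rule SL2Z_mult[OF A B])
    have nth: "(A ** B) $ 2 $ 1 = A $ 2 $ 1 * x + A $ 2 $ 2" "(A ** B) $ 2 $ 2 = - (A $ 2 $ 1)"
      by (simp_all add: mult2_nth B_def)
    have co: "coprime (A $ 2 $ 1 * x + A $ 2 $ 2) (- (A $ 2 $ 1))"
      using SL2Z_coprime[OF AB] unfolding nth .
    have "Lambda_row N k (A $ 2 $ 1 * x + A $ 2 $ 2) (- (A $ 2 $ 1)) \<tau> = Lambda_row N k 1 0 \<tau>" if \<tau>: "\<tau> \<in> uhp" for \<tau>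
    proof -
      have "Lambda N k (moebius (A ** B) \<tau>) = Lambda N k (moebius B \<tau>)"
        unfolding moebius_mult[OF A B \<tau>] by (rule inv[OF moebius_uhp[OF B \<tau>]])
      thus ?thesis unfolding Lambda_moebius[OF AB \<tau>] Lambda_moebius[OF B \<tau>] nth by (simp add: B_def)
    qed
    hence "eventually (\<lambda>\<tau>. Lambda_row N k (A $ 2 $ 1 * x + A $ 2 $ 2) (- (A $ 2 $ 1)) \<tau> = Lambda_row N k 1 0 \<tau>) at_i_infinity"
      using eventually_at_i_infinity_uhp by (auto elim: eventually_mono)
    from fourier_cong[OF this Lambda_row_fourier[of 1 0]]
    have "has_fourier_expansion N (Lambda_row N k (A $ 2 $ 1 * x + A $ 2 $ 2) (- (A $ 2 $ 1))) (Lambda_row_fourier 1 0)" by simp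
    with Lambda_row_fourier[OF co] have "Lambda_row_fourier (A $ 2 $ 1 * x + A $ 2 $ 2) (- (A $ 2 $ 1)) = Lambda_row_fourier 1 0"
      by (rule fourier_unique[OF N_pos])
    with co show ?thesis by blast
  qed
  have main: "N dvd A $ 2 $ 1 \<and> res_norm N (2 * A $ 2 $ 2) = res_norm N (A $ 2 $ 2) + 1 \<and>
      res_norm N (A $ 2 $ 2) + 1 < res_norm N (k * A $ 2 $ 2) \<and>
      (res_norm N (A $ 2 $ 2) = 1 \<or> N = 3 * res_norm N (A $ 2 $ 2) + 1)"
    if A: "A \<in> SL2Z" and inv: "\<And>\<tau>. \<tau> \<in> uhp \<Longrightarrow> Lambda N k (moebius A \<tau>) = Lambda N k \<tau>" for A :: "int^2^2"
  proof -
    have c: "N dvd A $ 2 $ 1"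
    proof (rule ladder_coset[OF N])
      show "ladder N k (A $ 2 $ 1 * x + A $ 2 $ 2)" for x
        using rows[OF A inv, of x] Lambda_row_eq(2) by blast
    qed
    define a where "a = res_norm N (A $ 2 $ 2)"
    have "coprime (A $ 2 $ 2) (A $ 2 $ 1)" "Lambda_row_fourier (A $ 2 $ 2) (- (A $ 2 $ 1)) = Lambda_row_fourier 1 0"
      using rows[OF A inv, of 0] by simp_all
    note lu = ladder_unit[OF this(1) c this(2), folded a_def]
    obtain \<sigma> t where d: "\<sigma> = 1 \<or> \<sigma> = -1" "A $ 2 $ 2 = \<sigma> * a + N * t" "0 \<le> a" "2 * a \<le> N"
      unfolding a_def using res_norm_rep[OF N_pos] by metis
    have "res_norm N (2 * a) = a + 1" using lu(1) res_norm_mult_rep[OF N_pos d(1,2), of 2] by simp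
    moreover have "res_norm N (2 * a) = (if 4 * a \<le> N then 2 * a else N - 2 * a)"
    proof (cases "4 * a \<le> N")
      case True
      thus ?thesis using d N_pos by (simp add: res_norm_small)
    next
      case False
      have "res_norm N (2 * a) = res_norm N (- (2 * a))" by (simp add: res_norm_minus)
      also have "\<dots> = res_norm N (N - 2 * a)" by (rule res_norm_cong) simp
      finally show ?thesis using d N_pos False by (simp add: res_norm_small)
    qed
    ultimately have "a = 1 \<or> N = 3 * a + 1" by (auto split: if_splits)
    thus ?thesis using lu c by (simp add: a_def)
  qed
  define d where "d = A $ 2 $ 2"
  have m: "N dvd A $ 2 $ 1" "res_norm N d + 1 < res_norm N (k * d)" "res_norm N d = 1 \<or> N = 3 * res_norm N d + 1"
    using main[OF A inv] by (auto simp: d_def)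
  obtain \<sigma> t where d: "\<sigma> = 1 \<or> \<sigma> = -1" "d = \<sigma> * res_norm N d + N * t"
    using res_norm_rep[OF N_pos] by metis
  \<comment> \<open>If \<open>N = 3 a + 1\<close> with \<open>a \<noteq> 1\<close>, then \<open>inv2 A\<close> has the lower right entry \<open>\<plusminus>3\<close> modulo \<open>N\<close>, which leaves only \<open>N = 10\<close>.\<close>
  have "res_norm N d = 1"
  proof (rule ccontr)
    assume ne: "res_norm N d \<noteq> 1"
    hence N3: "N = 3 * res_norm N d + 1" using m by simp
    have iA: "inv2 A \<in> SL2Z" by (rule inv2(1)[OF A])
    have "Lambda N k (moebius (inv2 A) \<tau>) = Lambda N k \<tau>" if "\<tau> \<in> uhp" for \<tau>
      using inv[OF moebius_uhp[OF iA that]] moebius_inv2(1)[OF A that] by simp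
    from main[OF iA this] have m': "res_norm N (A $ 1 $ 1) = 1 \<or> N = 3 * res_norm N (A $ 1 $ 1) + 1"
      by (simp add: inv2_def)
    \<comment> \<open>The upper left entry inverts d modulo N, and d is congruent to \<sigma> a with
      3 a congruent to -1.\<close>
    have 3: "N dvd A $ 1 $ 1 + \<sigma> * 3"
    proof -
      have \<sigma>2: "\<sigma> * \<sigma> = 1" using d(1) by auto
      have "A $ 1 $ 1 * d - A $ 1 $ 2 * A $ 2 $ 1 = 1" using A by (simp add: SL2Z_det d_def)
      hence "A $ 1 $ 1 * d - 1 = A $ 1 $ 2 * A $ 2 $ 1" by linarith
      hence "N dvd A $ 1 $ 1 * d - 1" using m(1) by simp
      hence "N dvd 3 * \<sigma> * (A $ 1 $ 1 * d - 1)" by (rule dvd_mult)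
      moreover have "3 * \<sigma> * (A $ 1 $ 1 * d - 1) = A $ 1 $ 1 * (\<sigma> * \<sigma>) * (3 * res_norm N d) + N * (3 * \<sigma> * A $ 1 $ 1 * t) - 3 * \<sigma>"
        by (subst d(2)) (simp add: algebra_simps)
      hence "3 * \<sigma> * (A $ 1 $ 1 * d - 1) = A $ 1 $ 1 * (N - 1) + N * (3 * \<sigma> * A $ 1 $ 1 * t) - 3 * \<sigma>"
        using N3 \<sigma>2 by simp
      hence "A $ 1 $ 1 + \<sigma> * 3 = N * (A $ 1 $ 1 + 3 * \<sigma> * A $ 1 $ 1 * t) - 3 * \<sigma> * (A $ 1 $ 1 * d - 1)"
        by (simp add: algebra_simps)
      ultimately show ?thesis by simp
    qed
    then obtain u where "A $ 1 $ 1 + \<sigma> * 3 = N * u" by (auto simp: dvd_def)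
    hence "A $ 1 $ 1 = (- \<sigma>) * 3 + N * u" by simp
    from res_norm_mult_rep[OF N_pos _ this, of 1] d(1) have "res_norm N (A $ 1 $ 1) = res_norm N 3" by auto
    also have "res_norm N 3 = 3" using N by (intro res_norm_small) auto
    finally have N10: "N = 10" using m' by simp
    hence a3: "res_norm N d = 3" using N3 by simp
    \<comment> \<open>The multiples 9 and 12 of 3 have distances 1 and 2 to the multiples of 10,
      while \<open>ladder_unit\<close> asks for more than 4.\<close>
    have "k = 3 \<or> k = 4" using k N10 by auto
    moreover have "4 < res_norm N (k * 3)"
      using m(2) res_norm_mult_rep[OF N_pos d(1), of d "res_norm N d" t k] d(2) a3 by simp
    ultimately show False by (auto simp: N10 res_norm_def)
  qed
  hence "N dvd d - 1 \<or> N dvd d + 1" using d by auto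
  thus ?thesis using m by (simp add: d_def)
qed

end

section \<open>The invariant \<open>j\<close>\<close>

lemma e_wp_div: "e1 = wp_div 2 0 1" "e2 = wp_div 2 1 0" "e3 = wp_div 2 1 1"
  by (auto simp: fun_eq_iff e1_def e2_def e3_def wp_div_def)

text \<open>The half-period values are division values of level 2, so in this form holomorphy and
  the Fourier expansion of j come from \<open>wp_div_holomorphic\<close> and
  \<open>wp_div_fourier\<close>.\<close>

lemma klein_j_e:
  assumes "\<tau> \<in> uhp"
  shows "klein_j \<tau> = 1728 * (-4 * (e1 \<tau> * e2 \<tau> + e1 \<tau> * e3 \<tau> + e2 \<tau> * e3 \<tau>)) ^ 3 /
    (16 * (e1 \<tau> - e2 \<tau>) ^ 2 * (e1 \<tau> - e3 \<tau>) ^ 2 * (e2 \<tau> - e3 \<tau>) ^ 2)"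
  using assms unfolding klein_j_def g2_g3_e(3)[OF assms, symmetric] g2_g3_e(2)[OF assms, symmetric] by simp

lemma klein_j_holomorphic: "klein_j holomorphic_on uhp"
proof -
  have "e1 holomorphic_on uhp" "e2 holomorphic_on uhp" "e3 holomorphic_on uhp"
    unfolding e_wp_div by (intro wp_div_holomorphic; simp)+
  hence "(\<lambda>\<tau>. 1728 * (-4 * (e1 \<tau> * e2 \<tau> + e1 \<tau> * e3 \<tau> + e2 \<tau> * e3 \<tau>)) ^ 3 /
    (16 * (e1 \<tau> - e2 \<tau>) ^ 2 * (e1 \<tau> - e3 \<tau>) ^ 2 * (e2 \<tau> - e3 \<tau>) ^ 2)) holomorphic_on uhp"
    by (intro holomorphic_intros) (use e_distinct in auto)
  thus ?thesis by (rule holomorphic_transform) (simp add: klein_j_e)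
qed

lemma fls_over_numeral: "is_subfield K \<Longrightarrow> numeral n \<in> fls_over K"
  using fls_over_const[OF _ subfield_numeral, of K n] by (simp add: fls_const_numeral)

text \<open>Only the difference of \<open>e2\<close> and \<open>e3\<close> vanishes at the cusp, to
  order 1 in exp(pi i \<tau>), and its square in the discriminant gives the pole of order 2.
  Numerator and denominator are both of degree 6 in the factor \<open>C\<close>, which therefore
  cancels, and the remaining root of unity is -1, so the coefficients lie in every subfield.\<close>

lemma klein_j_fourier_2:
  obtains F where "has_fourier_expansion 2 klein_j F" "fls_subdegree F = -2" "F \<noteq> 0"
    "\<And>K. is_subfield K \<Longrightarrow> F \<in> fls_over K"
proof -
  define C where "C = fls_const ((2 * of_real pi * \<i>) ^ 2 :: complex)"
  have C: "C \<noteq> 0" by (simp add: C_def)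
  define X1 X2 X3 where "X1 = wp_fourier 2 0 1" and "X2 = wp_fourier 2 1 0" and "X3 = wp_fourier 2 1 1"
  define S where "S = X1 * X2 + X1 * X3 + X2 * X3"
  define D where "D = (X1 - X2) ^ 2 * (X1 - X3) ^ 2 * (X2 - X3) ^ 2"
  define F where "F = 1728 * (-4 * S) ^ 3 / (16 * D)"
  have e: "has_fourier_expansion 2 e1 (C * X1)" "has_fourier_expansion 2 e2 (C * X2)" "has_fourier_expansion 2 e3 (C * X3)"
    unfolding e_wp_div C_def X1_def X2_def X3_def by (intro wp_div_fourier; simp)+
  have "has_fourier_expansion 2 (\<lambda>\<tau>. 1728 * (-4 * (e1 \<tau> * e2 \<tau> + e1 \<tau> * e3 \<tau> + e2 \<tau> * e3 \<tau>)) ^ 3 /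
    (16 * (e1 \<tau> - e2 \<tau>) ^ 2 * (e1 \<tau> - e3 \<tau>) ^ 2 * (e2 \<tau> - e3 \<tau>) ^ 2))
    (fls_const 1728 * (fls_const (-4) * (C * X1 * (C * X2) + C * X1 * (C * X3) + C * X2 * (C * X3))) ^ 3 /
     (fls_const 16 * (C * X1 - C * X2) ^ 2 * (C * X1 - C * X3) ^ 2 * (C * X2 - C * X3) ^ 2))"
    by (intro fourier_divide fourier_mult fourier_power fourier_add fourier_diff fourier_const e) auto
  also have "fls_const 1728 * (fls_const (-4) * (C * X1 * (C * X2) + C * X1 * (C * X3) + C * X2 * (C * X3))) ^ 3 /
     (fls_const 16 * (C * X1 - C * X2) ^ 2 * (C * X1 - C * X3) ^ 2 * (C * X2 - C * X3) ^ 2) = F"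
  proof -
    have 1: "C * X1 * (C * X2) + C * X1 * (C * X3) + C * X2 * (C * X3) = C ^ 2 * S"
      by (simp add: S_def power2_eq_square algebra_simps)
    have 2: "fls_const (1728 :: complex) = 1728" "fls_const (16 :: complex) = 16" "fls_const (-4 :: complex) = -4"
      by (simp_all add: fls_const_numeral)
    have "fls_const 1728 * (fls_const (-4) * (C ^ 2 * S)) ^ 3 = C ^ 6 * (1728 * (-4 * S) ^ 3)"
      unfolding 2 power_mult_distrib by (simp add: mult_ac flip: power_mult)
    moreover have "fls_const 16 * (C * X1 - C * X2) ^ 2 * (C * X1 - C * X3) ^ 2 * (C * X2 - C * X3) ^ 2 = C ^ 6 * (16 * D)"
    proof -
      have "C ^ 6 = C ^ 2 * C ^ 2 * C ^ 2" by (simp flip: power_add)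
      thus ?thesis unfolding 2 D_def by (simp only: right_diff_distrib[symmetric] power_mult_distrib mult_ac)
    qed
    ultimately show ?thesis unfolding 1 F_def using C by simp
  qed
  finally have J: "has_fourier_expansion 2 klein_j F"
    by (rule fourier_cong[rotated]) (use eventually_at_i_infinity_uhp klein_j_e in \<open>auto elim: eventually_mono\<close>)
  have rn: "res_norm 2 0 = 0" "res_norm 2 1 = 1" by (simp_all add: res_norm_def)
  have d12: "X1 - X2 \<noteq> 0" "fls_subdegree (X1 - X2) = 0"
    using wp_fourier_diff[of 2 0 1 1 0] by (simp_all add: X1_def X2_def rn)
  have d13: "X1 - X3 \<noteq> 0" "fls_subdegree (X1 - X3) = 0"
    using wp_fourier_diff[of 2 0 1 1 1] by (simp_all add: X1_def X3_def rn)
  have d23: "X2 - X3 \<noteq> 0" "fls_subdegree (X2 - X3) = 1"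
    using wp_fourier_diff[of 2 1 0 1 1] by (simp_all add: X2_def X3_def rn)
  have D: "D \<noteq> 0" "fls_subdegree D = 2"
    unfolding D_def using d12 d13 d23 by (simp_all add: fls_subdegree_pow)
  \<comment> \<open>The three constant terms are -1/6, 1/12 and 1/12, the first being 1/12 +
    E(-1).\<close>
  have S0: "fls_nth S 0 = - 1 / 48"
  proof -
    define Y1 Y2 Y3 where "Y1 = wpF 2 0 1" and "Y2 = wpF 2 1 0" and "Y3 = wpF 2 1 1"
    have S: "S = fps_to_fls (Y1 * Y2 + Y1 * Y3 + Y2 * Y3)"
      unfolding S_def X1_def X2_def X3_def wp_fourier_def Y1_def Y2_def Y3_def
      by (simp add: fls_times_fps_to_fls)
    have c: "cexp (1 / 2) = -1" by (simp add: cexp_def)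
    have "fps_nth (Efps (-1) 0) 0 = E (-1)"
      using has_fps_expansion_imp_0_eq_fps_nth_0[OF Efps_expansion[of 0 "-1"]] by simp
    hence y1: "fps_nth Y1 0 = - 1 / 6"
      using wpF_nth_low[of 0 2 1 0] by (simp add: Y1_def c Efps_nth E_def)
    have y23: "fps_nth Y2 0 = 1 / 12" "fps_nth Y3 0 = 1 / 12"
      using wpF_nth_low[of 1 2 0 0] wpF_nth_low[of 1 2 1 0] by (simp_all add: Y2_def Y3_def Efps_nth)
    have "fls_nth S 0 = fps_nth Y1 0 * fps_nth Y2 0 + fps_nth Y1 0 * fps_nth Y3 0 + fps_nth Y2 0 * fps_nth Y3 0"
      unfolding S by simp
    thus ?thesis unfolding y1 y23 by simp
  qed
  have S: "S \<noteq> 0" using S0 by auto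
  have Ssd: "fls_subdegree S = 0"
  proof (rule fls_subdegree_eqI)
    show "fls_nth S 0 \<noteq> 0" by (simp add: S0)
    fix i :: int assume "i < 0"
    have "S = fps_to_fls (wpF 2 0 1 * wpF 2 1 0 + wpF 2 0 1 * wpF 2 1 1 + wpF 2 1 0 * wpF 2 1 1)"
      unfolding S_def X1_def X2_def X3_def wp_fourier_def by (simp add: fls_times_fps_to_fls)
    thus "fls_nth S i = 0" using \<open>i < 0\<close> by simp
  qed
  have 0: "F \<noteq> 0" using S D by (simp add: F_def)
  have "fls_subdegree F = -2"
    unfolding F_def using S D Ssd by (simp add: fls_divide_subdegree fls_subdegree_pow)
  moreover have "F \<in> fls_over K" if K: "is_subfield K" for K
  proof -
    have c: "cexp (of_int s / of_nat 2) \<in> K" if "s = 0 \<or> s = 1" for s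
    proof -
      have "cexp (1 / 2) = -1" by (simp add: cexp_def)
      thus ?thesis using that is_subfieldD(1,4)[OF K] by auto
    qed
    have "wpF 2 0 1 \<in> fps_over K" "wpF 2 1 0 \<in> fps_over K" "wpF 2 1 1 \<in> fps_over K"
      using wpF_over[OF K, of 0 2 1] wpF_over[OF K, of 1 2 0] wpF_over[OF K, of 1 2 1] c[of 0] c[of 1] by simp_all
    hence X: "X1 \<in> fls_over K" "X2 \<in> fls_over K" "X3 \<in> fls_over K"
      by (simp_all add: X1_def X2_def X3_def wp_fourier_def fls_over_fps[OF K])
    show ?thesis unfolding F_def D_def S_def
      by (intro fls_over_divide[OF K] fls_over_mult[OF K] fls_over_power[OF K] fls_over_add[OF K] fls_over_diff[OF K]
            fls_over_uminus[OF K] fls_over_numeral[OF K] X)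
  qed
  ultimately show ?thesis using J 0 by (intro that)
qed

section \<open>The expansion of j at level N\<close>

lemma fps_even_sqrt:
  fixes P :: "complex fps"
  assumes rad: "fps_conv_radius P > 0" and odd: "\<And>n. odd n \<Longrightarrow> fps_nth P n = 0"
  defines "Q \<equiv> Abs_fps (\<lambda>n. fps_nth P (2 * n))"
  shows "fps_conv_radius Q > 0" "ereal (norm x) < fps_conv_radius P \<Longrightarrow> eval_fps Q (x ^ 2) = eval_fps P x"
proof -
  have mono: "strict_mono (\<lambda>n::nat. 2 * n)" by (auto simp: strict_mono_def)
  have z: "fps_nth P n * x ^ n = 0" if "n \<notin> range (\<lambda>n. 2 * n)" for n x
    using odd[of n] that by (auto elim!: evenE)
  have eq: "fps_nth P (2 * n) * x ^ (2 * n) = fps_nth Q n * (x ^ 2) ^ n" for n x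
    by (simp add: Q_def power_mult)
  show "eval_fps Q (x ^ 2) = eval_fps P x"
    unfolding eval_fps_def using suminf_mono_reindex[where f = "\<lambda>n. fps_nth P n * x ^ n", OF mono z] by (simp add: eq)
  obtain r where r: "0 < r" "ereal r < fps_conv_radius P"
    using rad ereal_dense2[of 0 "fps_conv_radius P"] by (auto simp: zero_ereal_def)
  have "summable (\<lambda>n. fps_nth P n * of_real r ^ n)"
    using r by (intro summable_fps) simp
  hence "summable (\<lambda>n. fps_nth P (2 * n) * of_real r ^ (2 * n))"
    using summable_mono_reindex[where f = "\<lambda>n. fps_nth P n * of_real r ^ n", OF mono z] by simp
  hence "summable (\<lambda>n. fps_nth Q n * (of_real r ^ 2) ^ n)" by (simp only: eq)
  from conv_radius_geI[OF this] have "fps_conv_radius Q \<ge> norm (of_real r ^ 2 :: complex)"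
    by (simp add: fps_conv_radius_def)
  moreover have "ereal (norm (of_real r ^ 2 :: complex)) > 0" using r by (simp add: norm_power)
  ultimately show "fps_conv_radius Q > 0" by (rule less_le_trans[rotated])
qed

lemma filterlim_shift_at_i_infinity: "filterlim (\<lambda>\<tau>. \<tau> + 1) at_i_infinity at_i_infinity"
proof -
  have "eventually (\<lambda>\<tau>. P (\<tau> + 1)) at_i_infinity" if P: "eventually P at_i_infinity" for P
  proof -
    obtain Y where Y: "\<And>\<tau>. Im \<tau> > Y \<Longrightarrow> P \<tau>" using P unfolding eventually_at_i_infinity by blast
    have "P (\<tau> + 1)" if "Im \<tau> > Y" for \<tau> using that by (intro Y) simp
    thus ?thesis unfolding eventually_at_i_infinity by blast
  qed
  thus ?thesis unfolding filterlim_def le_filter_def eventually_filtermap by blast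
qed

lemma klein_j_shift: "\<tau> \<in> uhp \<Longrightarrow> klein_j (\<tau> + 1) = klein_j \<tau>"
  using klein_j_moebius[of "mat2 1 1 0 1" \<tau>] by (simp add: SL2Z_det moebius_def)

text \<open>Translation of \<tau> by 1 is x \<mapsto> -x for x = exp(pi i \<tau>), so the series of
  level 2 is even and is a series in exp(2 pi i \<tau>). Level N is reached by substituting an N-th
  power. The coefficients are only moved to other places, so they remain in the same
  subfield.\<close>

lemma klein_j_fourier:
  assumes N: "N > 0"
  obtains F where "has_fourier_expansion N klein_j F" "fls_subdegree F = - N" "F \<noteq> 0"
    "\<And>K. is_subfield K \<Longrightarrow> F \<in> fls_over K"
proof -
  obtain F where F: "has_fourier_expansion 2 klein_j F" "fls_subdegree F = -2" "F \<noteq> 0"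
    "\<And>K. is_subfield K \<Longrightarrow> F \<in> fls_over K"
    using klein_j_fourier_2 by blast
  \<comment> \<open>This is x^2 times \<open>F\<close>, a power series, for which parity can be read
    off from composition with -x.\<close>
  define P where "P = fls_base_factor_to_fps F"
  have P_nth: "fps_nth P n = fls_nth F (int n - 2)" for n
    unfolding P_def fls_base_factor_to_fps_nth F(2) by (simp add: algebra_simps)
  have FP: "F = fls_shift 2 (fps_to_fls P)"
    using fls_conv_base_factor_to_fps_shift_subdegree[of F] by (simp add: P_def F(2))
  have rad: "fps_conv_radius P > 0"
    using F(1) unfolding fourier_iff FP by simp
  have evF: "eval_fls F x = eval_fps P x / x ^ 2" if "x \<noteq> 0" "ereal (norm x) < fps_conv_radius P" for x
  proof -
    have "eval_fls F x = eval_fls (fps_to_fls P) x * x powi (- 2)"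
      unfolding FP using that(1) by (subst eval_fls_shift) auto
    thus ?thesis using that by (simp add: eval_fps_to_fls power_int_minus divide_inverse)
  qed
  have small: "eventually (\<lambda>x::complex. x \<noteq> 0 \<and> ereal (norm x) < fps_conv_radius P) (at 0)"
    using filter_leD[OF at_within_le_nhds eventually_conv_radius[OF rad]] eventually_neq_at_within[of 0 0]
    by eventually_elim auto
  have j_eq: "eventually (\<lambda>\<tau>. klein_j \<tau> = eval_fps P (cexp (\<tau> / 2)) / cexp (\<tau> / 2) ^ 2
       \<and> ereal (norm (cexp (\<tau> / 2))) < fps_conv_radius P) at_i_infinity"
  proof -
    have "eventually (\<lambda>\<tau>. cexp (\<tau> / of_int 2) \<noteq> 0 \<and> ereal (norm (cexp (\<tau> / of_int 2))) < fps_conv_radius P) at_i_infinity"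
      by (subst eventually_q_iff_int) (use small in auto)
    with fourier_laurent(2)[OF F(1)] show ?thesis
      by eventually_elim (simp add: evF)
  qed
  have half: "cexp ((\<tau> + 1) / 2) = - cexp (\<tau> / 2)" for \<tau>
  proof -
    have "cexp (1 / 2) = -1" by (simp add: cexp_def)
    thus ?thesis by (simp add: add_divide_distrib cexp_add)
  qed
  have "eventually (\<lambda>\<tau>. eval_fps P (- cexp (\<tau> / of_int 2)) = eval_fps P (cexp (\<tau> / of_int 2))) at_i_infinity"
    using j_eq eventually_compose_filterlim[OF j_eq filterlim_shift_at_i_infinity] eventually_at_i_infinity_uhp
    by eventually_elim (simp add: klein_j_shift half)
  hence "eventually (\<lambda>x. eval_fps P (- x) = eval_fps P x) (at 0)"
    by (subst (asm) eventually_q_iff_int) auto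
  hence even: "eventually (\<lambda>x. (eval_fps P \<circ> uminus) x = eval_fps P x) (nhds 0)"
    by (simp add: eventually_nhds_conv_at)
  have P: "eval_fps P has_fps_expansion P" using rad by (simp add: has_fps_expansion_def)
  have neg: "uminus has_fps_expansion (- fps_X :: complex fps)"
    using has_fps_expansion_minus[OF has_fps_expansion_fps_X] by simp
  have "(eval_fps P \<circ> uminus) has_fps_expansion (P oo (- fps_X))"
    by (rule has_fps_expansion_compose[OF P neg]) simp
  hence "eval_fps P has_fps_expansion (P oo (- fps_X))" using has_fps_expansion_cong[OF even refl] by blast
  with P have "P = P oo (- fps_X)" by (rule fps_expansion_unique_complex)
  hence sgn: "fps_nth P n = (-1) ^ n * fps_nth P n" for n
    by (metis fps_compose_uminus' fps_nth_Abs_fps)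
  have odd: "fps_nth P n = 0" if "odd n" for n using sgn[of n] that by simp
  define Q where "Q = Abs_fps (\<lambda>n. fps_nth P (2 * n))"
  have Q: "fps_conv_radius Q > 0"
    "ereal (norm x) < fps_conv_radius P \<Longrightarrow> eval_fps Q (x ^ 2) = eval_fps P x" for x
    unfolding Q_def using fps_even_sqrt[OF rad] odd by blast+
  define n where "n = nat N"
  have n: "n > 0" "int n = N" using N by (simp_all add: n_def)
  define R where "R = Q oo fps_X ^ n"
  define G where "G = fls_shift N (fps_to_fls R)"
  have R: "(eval_fps Q \<circ> (\<lambda>x. x ^ n)) has_fps_expansion R"
    unfolding R_def
  proof (rule has_fps_expansion_compose)
    show "eval_fps Q has_fps_expansion Q" using Q(1) by (simp add: has_fps_expansion_def)
    show "(\<lambda>x. x ^ n) has_fps_expansion (fps_X ^ n :: complex fps)" by (intro fps_expansion_intros)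
  qed (use n in simp)
  have G: "(\<lambda>x. eval_fps Q (x ^ n) * x powi (- N)) has_laurent_expansion G"
    unfolding G_def using has_laurent_expansion_shift[OF has_laurent_expansion_fps[OF R], of "- N"] by (simp add: o_def)
  have jG: "has_fourier_expansion N klein_j G"
  proof (rule fourierI[OF N G])
    show "eventually (\<lambda>\<tau>. klein_j \<tau> = eval_fps Q (cexp (\<tau> / of_int N) ^ n) * cexp (\<tau> / of_int N) powi (- N)) at_i_infinity"
      using j_eq
    proof eventually_elim
      case (elim \<tau>)
      have q: "cexp (\<tau> / of_int N) ^ n = cexp (\<tau> / 2) ^ 2"
      proof -
        have "of_nat n * (\<tau> / of_int N) = of_nat 2 * (\<tau> / 2)" using n N by (simp flip: n(2))
        thus ?thesis by (metis cexp_of_nat_mult)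
      qed
      have "x powi (- N) = inverse (x ^ n)" for x :: complex
        by (simp only: n(2)[symmetric] power_int_minus power_int_of_nat)
      hence "cexp (\<tau> / of_int N) powi (- N) = inverse (cexp (\<tau> / 2) ^ 2)" by (simp only: q)
      thus ?case
        unfolding q Q(2)[OF conjunct2[OF elim]] conjunct1[OF elim] by (simp only: divide_inverse)
    qed
  qed
  have R_nth: "fps_nth R m \<in> L" if L: "is_subfield L" "Q \<in> fps_over L" for m L
    unfolding R_def fps_compose_nth power_mult[symmetric] using that is_subfieldD[OF L(1)]
    by (intro subfield_sum[OF L(1)]) (auto simp: fps_over_def fps_X_power_nth)
  have R0: "fps_nth R 0 = fls_nth F (- 2)" by (simp add: R_def Q_def P_nth)
  have F0: "fls_nth F (- 2) \<noteq> 0" using F(2,3) nth_fls_subdegree_nonzero by metis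
  have sd: "fls_subdegree G = - N"
  proof (rule fls_subdegree_eqI)
    show "fls_nth G (- N) \<noteq> 0" using R0 F0 by (simp add: G_def)
  qed (simp add: G_def)
  have "G \<noteq> 0" using sd N by auto
  moreover have "G \<in> fls_over L" if L: "is_subfield L" for L
  proof -
    have "Q \<in> fps_over L" using F(4)[OF L] by (simp add: Q_def P_nth fps_over_def fls_over_def)
    hence "R \<in> fps_over L" using R_nth[OF L] by (simp add: fps_over_def)
    thus ?thesis unfolding G_def by (intro fls_over_shift[OF L] fls_over_fps[OF L])
  qed
  ultimately show ?thesis using jG sd by (intro that)
qed

section \<open>Functions invariant under the modular group\<close>

text \<open>The norm of c \<tau> + d is minimized over the group and the result translated to the
  central strip. Minimality against inversion then gives norm at least 1, and with |Re| \<le> 1/2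
  this bounds the height from below. The bound 1/2, weaker than the sharp one, already keeps the
  truncated strip compact in the half plane.\<close>

lemma fundamental_domain:
  assumes \<tau>: "\<tau> \<in> uhp"
  obtains A where "A \<in> SL2Z" "\<bar>Re (moebius A \<tau>)\<bar> \<le> 1 / 2" "Im (moebius A \<tau>) \<ge> 1 / 2"
proof -
  \<comment> \<open>The cut at 1, the value at the identity matrix, makes the set finite and keeps
    it nonempty.\<close>
  define S where "S = {x. \<exists>A\<in>SL2Z. x = norm (automorphy A \<tau>) \<and> x \<le> 1}"
  have "S \<subseteq> (\<lambda>p. norm (lattice_point \<tau> p)) ` {p. norm (lattice_point \<tau> p) \<le> 1}"
    by (auto simp: S_def automorphy_lattice)
  hence fin: "finite S" using finite_lattice_points_le[OF \<tau>, of 1] finite_surj by blast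
  have one: "1 \<in> S" unfolding S_def using mat_1_SL2Z by (auto intro!: bexI[of _ "mat 1"] simp: automorphy_def mat_def)
  have "Min S \<in> S" using fin one by (intro Min_in) auto
  then obtain A where A: "A \<in> SL2Z" "norm (automorphy A \<tau>) = Min S" by (auto simp: S_def)
  have min: "norm (automorphy A \<tau>) \<le> norm (automorphy B \<tau>)" if "B \<in> SL2Z" for B
  proof (cases "norm (automorphy B \<tau>) \<le> 1")
    case True
    hence "norm (automorphy B \<tau>) \<in> S" using that by (auto simp: S_def)
    thus ?thesis using fin A(2) by simp
  next
    case False
    moreover have "Min S \<le> 1" using fin one by (intro Min_le) auto
    ultimately show ?thesis using A(2) by simp
  qed
  define n where "n = - round (Re (moebius A \<tau>))"
  define T where "T = mat2 1 n 0 1"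
  have T: "T \<in> SL2Z" by (simp add: T_def SL2Z_det)
  define B where "B = T ** A"
  have B: "B \<in> SL2Z" unfolding B_def by (rule SL2Z_mult[OF T A(1)])
  have mB: "moebius B \<tau> = moebius A \<tau> + of_int n"
    unfolding B_def moebius_mult[OF T A(1) \<tau>] by (simp add: T_def moebius_def)
  have autB: "automorphy B \<tau> = automorphy A \<tau>" by (simp add: automorphy_def B_def mult2_nth T_def)
  have re: "\<bar>Re (moebius B \<tau>)\<bar> \<le> 1 / 2"
    using of_int_round_abs_le[of "Re (moebius A \<tau>)"] by (simp add: mB n_def abs_minus_commute)
  define W where "W = mat2 0 (-1) 1 0"
  have W: "W \<in> SL2Z" by (simp add: W_def SL2Z_det)
  have "automorphy (W ** B) \<tau> = moebius B \<tau> * automorphy B \<tau>"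
    using automorphy_nonzero[OF B \<tau>] by (simp add: automorphy_def mult2_nth W_def moebius_def)
  hence "norm (automorphy A \<tau>) \<le> norm (moebius B \<tau>) * norm (automorphy A \<tau>)"
    using min[OF SL2Z_mult[OF W B]] by (simp add: norm_mult autB)
  hence ge1: "1 \<le> norm (moebius B \<tau>)" using automorphy_nonzero[OF A(1) \<tau>] by simp
  have im: "Im (moebius B \<tau>) > 0" using moebius_uhp[OF B \<tau>] by (rule uhp_D)
  have "Im (moebius B \<tau>) \<ge> 1 / 2"
  proof (rule ccontr)
    assume "\<not> Im (moebius B \<tau>) \<ge> 1 / 2"
    hence "Im (moebius B \<tau>) ^ 2 < (1 / 2) ^ 2" using im by (intro power_strict_mono) auto
    moreover have "Re (moebius B \<tau>) ^ 2 \<le> (1 / 2) ^ 2" using re by (simp add: abs_le_square_iff[symmetric])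
    moreover have "norm (moebius B \<tau>) ^ 2 \<ge> 1" using ge1 by simp
    moreover have "(1 / 2 :: real) ^ 2 = 1 / 4" by (simp add: power2_eq_square)
    ultimately show False using cmod_power2[of "moebius B \<tau>"] by linarith
  qed
  with B re show ?thesis by (rule that)
qed

definition fund_strip :: "real \<Rightarrow> complex set" where
  "fund_strip Y = {\<tau>. \<bar>Re \<tau>\<bar> \<le> 1 / 2 \<and> 1 / 2 \<le> Im \<tau> \<and> Im \<tau> \<le> Y}"

lemma fund_strip: "compact (fund_strip Y)" "fund_strip Y \<subseteq> uhp"
proof -
  have "fund_strip Y = cbox (Complex (-1/2) (1/2)) (Complex (1/2) Y)"
    by (auto simp: fund_strip_def in_cbox_complex_iff abs_le_iff)
  thus "compact (fund_strip Y)" by simp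
  show "fund_strip Y \<subseteq> uhp" by (auto simp: fund_strip_def uhp_def)
qed

lemma filterlim_q:
  assumes "N > (0 :: int)"
  shows "filterlim (\<lambda>\<tau>. cexp (\<tau> / of_int N)) (at 0) at_i_infinity"
  unfolding filterlim_def le_filter_def eventually_filtermap using eventually_q_iff_int[OF assms] by blast

lemma at_i_infinity_nontrivial: "at_i_infinity \<noteq> bot"
proof
  assume "at_i_infinity = bot"
  hence "eventually (\<lambda>_. False) at_i_infinity" by simp
  then obtain Y where "\<And>\<tau>. Im \<tau> > Y \<Longrightarrow> False" unfolding eventually_at_i_infinity by blast
  from this[of "Complex 0 (Y + 1)"] show False by simp
qed

lemma fourier_tendsto:
  assumes N: "N > 0" and F: "has_fourier_expansion N f F" "fls_subdegree F \<ge> 0"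
  shows "(f \<longlongrightarrow> fls_nth F 0) at_i_infinity"
proof -
  have "((\<lambda>\<tau>. eval_fls F (cexp (\<tau> / of_int N))) \<longlongrightarrow> fls_nth F 0) at_i_infinity"
    by (rule filterlim_compose[OF has_laurent_expansion_imp_tendsto_0[OF fourier_laurent(1)[OF F(1)] F(2)] filterlim_q[OF N]])
  thus ?thesis
    by (rule Lim_transform_eventually) (use fourier_laurent(2)[OF F(1)] in \<open>auto elim: eventually_mono\<close>)
qed

text \<open>After subtraction of the value at the cusp the function is small high up. A nonzero
  value would make its modulus attain a maximum over the compact strip, which by invariance is a
  maximum over the half plane; the function would be constant, and the constant is its limit
  0.\<close>

lemma invariant_imp_const:
  assumes N: "N > 0" and hol: "f holomorphic_on uhp"
    and inv: "\<And>A \<tau>. A \<in> SL2Z \<Longrightarrow> \<tau> \<in> uhp \<Longrightarrow> f (moebius A \<tau>) = f \<tau>"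
    and F: "has_fourier_expansion N f F" "fls_subdegree F \<ge> 0"
  shows "\<exists>c. \<forall>\<tau>\<in>uhp. f \<tau> = c"
proof -
  define h where "h = (\<lambda>\<tau>. f \<tau> - fls_nth F 0)"
  have h_hol: "h holomorphic_on uhp" unfolding h_def by (intro holomorphic_intros hol)
  have h_inv: "h (moebius A \<tau>) = h \<tau>" if "A \<in> SL2Z" "\<tau> \<in> uhp" for A \<tau>
    using inv[OF that] by (simp add: h_def)
  have h0: "(h \<longlongrightarrow> 0) at_i_infinity"
    unfolding h_def using tendsto_diff[OF fourier_tendsto[OF N F] tendsto_const[of "fls_nth F 0"]] by simp
  have "h \<tau>0 = 0" if \<tau>0: "\<tau>0 \<in> uhp" for \<tau>0
  proof (rule ccontr)
    assume nz: "h \<tau>0 \<noteq> 0"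
    define \<epsilon> where "\<epsilon> = norm (h \<tau>0)"
    have "\<epsilon> > 0" using nz by (simp add: \<epsilon>_def)
    hence "eventually (\<lambda>\<tau>. norm (h \<tau>) < \<epsilon>) at_i_infinity"
      using h0 by (auto simp: tendsto_iff dist_norm)
    then obtain Y where Y: "\<And>\<tau>. Im \<tau> > Y \<Longrightarrow> norm (h \<tau>) < \<epsilon>" unfolding eventually_at_i_infinity by blast
    obtain A0 where A0: "A0 \<in> SL2Z" "\<bar>Re (moebius A0 \<tau>0)\<bar> \<le> 1 / 2" "Im (moebius A0 \<tau>0) \<ge> 1 / 2"
      using fundamental_domain[OF \<tau>0] by blast
    have "norm (h (moebius A0 \<tau>0)) = \<epsilon>" using h_inv[OF A0(1) \<tau>0] by (simp add: \<epsilon>_def)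
    hence "\<not> Im (moebius A0 \<tau>0) > Y" using Y[of "moebius A0 \<tau>0"] by auto
    hence A0': "moebius A0 \<tau>0 \<in> fund_strip Y" using A0 by (simp add: fund_strip_def)
    have "continuous_on (fund_strip Y) (\<lambda>\<tau>. norm (h \<tau>))"
      using holomorphic_on_imp_continuous_on[OF h_hol] fund_strip(2)[of Y]
      by (intro continuous_intros) (rule continuous_on_subset)
    then obtain \<tau>1 where \<tau>1: "\<tau>1 \<in> fund_strip Y" "\<And>\<tau>. \<tau> \<in> fund_strip Y \<Longrightarrow> norm (h \<tau>) \<le> norm (h \<tau>1)"
      using continuous_attains_sup[OF fund_strip(1)[of Y], of "\<lambda>\<tau>. norm (h \<tau>)"] A0' by blast
    have ge: "\<epsilon> \<le> norm (h \<tau>1)" using \<tau>1(2)[OF A0'] \<open>norm (h (moebius A0 \<tau>0)) = \<epsilon>\<close> by simp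
    have "norm (h \<tau>) \<le> norm (h \<tau>1)" if \<tau>: "\<tau> \<in> uhp" for \<tau>
    proof -
      obtain A where A: "A \<in> SL2Z" "\<bar>Re (moebius A \<tau>)\<bar> \<le> 1 / 2" "Im (moebius A \<tau>) \<ge> 1 / 2"
        using fundamental_domain[OF \<tau>] by blast
      have "norm (h (moebius A \<tau>)) \<le> norm (h \<tau>1)"
      proof (cases "Im (moebius A \<tau>) > Y")
        case True
        thus ?thesis using Y[of "moebius A \<tau>"] ge by simp
      next
        case False
        thus ?thesis using A by (intro \<tau>1(2)) (simp add: fund_strip_def)
      qed
      thus ?thesis using h_inv[OF A(1) \<tau>] by simp
    qed
    hence "h constant_on uhp"
      using \<tau>1(1) fund_strip(2)[of Y]
      by (intro maximum_modulus_principle[OF h_hol open_uhp connected_uhp open_uhp order_refl, of \<tau>1]) auto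
    then obtain c where c: "\<And>\<tau>. \<tau> \<in> uhp \<Longrightarrow> h \<tau> = c" by (auto simp: constant_on_def)
    define \<tau>2 where "\<tau>2 = Complex 0 (max 1 (Y + 1))"
    have "\<tau>2 \<in> uhp" "Im \<tau>2 > Y" by (auto simp: \<tau>2_def uhp_def)
    hence "norm (h \<tau>2) < \<epsilon>" "h \<tau>2 = h \<tau>0" using Y c \<tau>0 by auto
    thus False by (simp add: \<epsilon>_def)
  qed
  hence "\<forall>\<tau>\<in>uhp. f \<tau> = fls_nth F 0" by (simp add: h_def)
  thus ?thesis by blast
qed

text \<open>The expansion is only given in powers of exp(2 pi i \<tau> / N). Multiplication by the
  d-th power of this variable gives a function \<open>g\<close> with limit a at i\<infinity>, and
  translation by 1 multiplies \<open>g\<close> by \<xi>^d, so \<xi>^d = 1. The pole order is thus a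
  multiple of N and can be matched by a power of j.\<close>

lemma fourier_lead_dvd:
  assumes N: "N > 0" and F: "has_fourier_expansion N f F" "F \<noteq> 0" "fls_subdegree F = - int d"
    and inv: "\<And>\<tau>. \<tau> \<in> uhp \<Longrightarrow> f (\<tau> + 1) = f \<tau>"
  shows "nat N dvd d"
proof -
  define a where "a = fls_nth F (- int d)"
  have a: "a \<noteq> 0" using F(2,3) nth_fls_subdegree_nonzero[of F] by (simp add: a_def)
  define g where "g = (\<lambda>\<tau>. f \<tau> * cexp (\<tau> / of_int N) ^ d)"
  have "(\<lambda>\<tau>. cexp (\<tau> / of_int N) ^ d) = (\<lambda>\<tau>. (\<lambda>x. x ^ d) (cexp (\<tau> / of_int N)))" by simp
  have X: "has_fourier_expansion N (\<lambda>\<tau>. cexp (\<tau> / of_int N) ^ d) (fls_X ^ d)"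
    by (rule fourierI[OF N, of "\<lambda>x. x ^ d"]) (auto intro!: laurent_expansion_intros)
  have G: "has_fourier_expansion N g (F * fls_X ^ d)" unfolding g_def by (rule fourier_mult[OF N F(1) X])
  have "(g \<longlongrightarrow> fls_nth (F * fls_X ^ d) 0) at_i_infinity"
    using F by (intro fourier_tendsto[OF N G]) simp
  moreover have "fls_nth (F * fls_X ^ d) 0 = a"
    by (simp add: a_def fls_X_power_conv_shift_1 fls_times_both_shifted_simp fls_shifted_times_simps)
  ultimately have lim: "(g \<longlongrightarrow> a) at_i_infinity" by simp
  define \<xi> where "\<xi> = cexp (1 / of_int N)"
  have "((\<lambda>\<tau>. g (\<tau> + 1)) \<longlongrightarrow> a) at_i_infinity"
    by (rule filterlim_compose[OF lim filterlim_shift_at_i_infinity])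
  moreover have "eventually (\<lambda>\<tau>. g (\<tau> + 1) = g \<tau> * \<xi> ^ d) at_i_infinity"
    using eventually_at_i_infinity_uhp
    by eventually_elim (simp add: g_def inv \<xi>_def add_divide_distrib cexp_add power_mult_distrib)
  ultimately have "((\<lambda>\<tau>. g \<tau> * \<xi> ^ d) \<longlongrightarrow> a) at_i_infinity" by (rule Lim_transform_eventually)
  moreover have "((\<lambda>\<tau>. g \<tau> * \<xi> ^ d) \<longlongrightarrow> a * \<xi> ^ d) at_i_infinity" by (intro tendsto_intros lim)
  ultimately have "a = a * \<xi> ^ d" using at_i_infinity_nontrivial tendsto_unique by blast
  hence "\<xi> ^ d = 1" using a by simp
  hence "cexp (of_int (int d) / of_nat (nat N)) = 1"
    using N cexp_of_nat_mult[of d "1 / of_int N"] by (simp add: \<xi>_def)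
  hence "int (nat N) dvd int d" using cexp_frac_eq_1_iff[of "nat N" "int d"] N by simp
  thus ?thesis by (simp only: int_dvd_int_iff)
qed

lemma moebius_shift: "moebius (mat2 1 1 0 1) \<tau> = \<tau> + 1" "mat2 1 1 0 1 \<in> SL2Z"
  by (simp_all add: moebius_def SL2Z_det)

text \<open>Induction on the pole order at i\<infinity>: a multiple of a power of j removes the
  leading term, and without a pole the function is constant.\<close>

lemma invariant_holomorphic_imp_poly:
  assumes N: "N > 0" and hol: "f holomorphic_on uhp"
    and inv: "\<And>A \<tau>. A \<in> SL2Z \<Longrightarrow> \<tau> \<in> uhp \<Longrightarrow> f (moebius A \<tau>) = f \<tau>"
    and F: "has_fourier_expansion N f F"
  shows "\<exists>P. \<forall>\<tau>\<in>uhp. f \<tau> = poly P (klein_j \<tau>)"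
  using hol inv F
proof (induction "nat (- fls_subdegree F)" arbitrary: f F rule: less_induct)
  case less
  show ?case
  proof (cases "F = 0 \<or> fls_subdegree F \<ge> 0")
    case True
    hence "fls_subdegree F \<ge> 0" by auto
    then obtain c where "\<forall>\<tau>\<in>uhp. f \<tau> = c"
      using invariant_imp_const[OF N less.prems] by blast
    hence "\<forall>\<tau>\<in>uhp. f \<tau> = poly [:c:] (klein_j \<tau>)" by simp
    thus ?thesis by blast
  next
    case False
    define d where "d = nat (- fls_subdegree F)"
    have d: "fls_subdegree F = - int d" "d > 0" "F \<noteq> 0" using False by (auto simp: d_def)
    have per: "f (\<tau> + 1) = f \<tau>" if "\<tau> \<in> uhp" for \<tau>
      using less.prems(2)[OF moebius_shift(2) that] by (simp add: moebius_shift(1))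
    have "nat N dvd d" by (rule fourier_lead_dvd[where f = f, OF N less.prems(3) d(3,1)]) (rule per)
    define e where "e = d div nat N"
    have e: "d = nat N * e" using \<open>nat N dvd d\<close> by (simp add: e_def)
    obtain J where J: "has_fourier_expansion N klein_j J" "fls_subdegree J = - N" "J \<noteq> 0"
      by (rule klein_j_fourier[OF N]) (rule that)
    define a b where "a = fls_nth F (- int d)" and "b = fls_nth J (- N)"
    have b: "b \<noteq> 0" using J nth_fls_subdegree_nonzero[of J] by (simp add: b_def)
    have Je: "fls_subdegree (J ^ e) = - int d" "fls_nth (J ^ e) (- int d) = b ^ e"
    proof -
      have nd: "int e * - N = - int d" using N by (simp add: e)
      show "fls_subdegree (J ^ e) = - int d" by (simp only: fls_subdegree_pow J(2) nd)
      show "fls_nth (J ^ e) (- int d) = b ^ e"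
        using fls_pow_base[of J e] unfolding b_def J(2) nd .
    qed
    define f' where "f' = (\<lambda>\<tau>. f \<tau> - a / b ^ e * klein_j \<tau> ^ e)"
    define F' where "F' = F - fls_const (a / b ^ e) * J ^ e"
    have F': "has_fourier_expansion N f' F'"
      unfolding f'_def F'_def by (intro fourier_diff fourier_mult fourier_const fourier_power N J less.prems)
    have nth: "fls_nth F' i = 0" if "i \<le> - int d" for i
    proof (cases "i = - int d")
      case True
      thus ?thesis using Je(2) b by (simp add: F'_def a_def)
    next
      case False
      hence "i < fls_subdegree F" "i < fls_subdegree (J ^ e)" using that d Je by auto
      thus ?thesis by (simp add: F'_def fls_eq0_below_subdegree)
    qed
    have "F' = 0 \<or> fls_subdegree F' > - int d"
    proof (rule ccontr)
      assume *: "\<not> (F' = 0 \<or> fls_subdegree F' > - int d)"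
      hence "fls_nth F' (fls_subdegree F') = 0" by (intro nth) simp
      thus False using * nth_fls_subdegree_nonzero by blast
    qed
    hence lt: "nat (- fls_subdegree F') < nat (- fls_subdegree F)" using d by auto
    have "f' holomorphic_on uhp"
      unfolding f'_def by (intro holomorphic_intros less.prems klein_j_holomorphic)
    moreover have "f' (moebius A \<tau>) = f' \<tau>" if "A \<in> SL2Z" "\<tau> \<in> uhp" for A \<tau>
      using less.prems(2)[OF that] klein_j_moebius[OF that] by (simp add: f'_def)
    ultimately obtain P where P: "\<forall>\<tau>\<in>uhp. f' \<tau> = poly P (klein_j \<tau>)"
      using less.hyps[OF lt _ _ F'] by blast
    have "\<forall>\<tau>\<in>uhp. f \<tau> = poly (P + Polynomial.monom (a / b ^ e) e) (klein_j \<tau>)"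
    proof
      fix \<tau> assume "\<tau> \<in> uhp"
      with P have "f' \<tau> = poly P (klein_j \<tau>)" by blast
      thus "f \<tau> = poly (P + Polynomial.monom (a / b ^ e) e) (klein_j \<tau>)" by (simp add: f'_def poly_monom algebra_simps)
    qed
    thus ?thesis by blast
  qed
qed

section \<open>Invariant meromorphic functions\<close>

lemma tendsto_imp_not_is_pole: "f \<midarrow>z\<rightarrow> c \<Longrightarrow> \<not> is_pole f (z :: complex)"
  unfolding is_pole_def using not_tendsto_and_filterlim_at_infinity at_neq_bot by blast

lemma not_is_pole_iff_tendsto:
  assumes "f meromorphic_on {z}"
  shows "\<not> is_pole f z \<longleftrightarrow> (\<exists>c. f \<midarrow>z\<rightarrow> c)"
proof
  assume np: "\<not> is_pole f z"
  have L: "(\<lambda>w. f (z + w)) has_laurent_expansion laurent_expansion f z"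
    using meromorphic_on_imp_has_laurent_expansion[OF assms] by simp
  have "fls_subdegree (laurent_expansion f z) \<ge> 0"
    using has_laurent_expansion_imp_is_pole_iff[OF L] np by simp
  from has_laurent_expansion_imp_tendsto[OF L this] show "\<exists>c. f \<midarrow>z\<rightarrow> c" by blast
qed (blast dest: tendsto_imp_not_is_pole)

lemma not_is_pole_mult_analytic:
  assumes "f meromorphic_on {z}" "\<not> is_pole f z" "h analytic_on {z}"
  shows "\<not> is_pole (\<lambda>w. f w * h w) z"
proof -
  obtain c where "f \<midarrow>z\<rightarrow> c" using assms(1,2) not_is_pole_iff_tendsto by blast
  moreover have "h \<midarrow>z\<rightarrow> h z" using assms(3) by (simp add: analytic_at_imp_isCont isContD)
  ultimately have "(\<lambda>w. f w * h w) \<midarrow>z\<rightarrow> c * h z" by (rule tendsto_mult)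
  thus ?thesis by (rule tendsto_imp_not_is_pole)
qed

text \<open>The conclusion covers all large exponents, so that a single exponent can serve finitely
  many poles at once.\<close>

lemma pole_cancel:
  assumes f: "f meromorphic_on {z}" and h: "h analytic_on {z}" "h z = 0"
  obtains M where "\<And>m. m \<ge> M \<Longrightarrow> \<not> is_pole (\<lambda>w. f w * h w ^ m) z"
proof -
  define L where "L = laurent_expansion f z"
  have L: "(\<lambda>w. f (z + w)) has_laurent_expansion L"
    using meromorphic_on_imp_has_laurent_expansion[OF f] by (simp add: L_def)
  obtain G where G: "(\<lambda>w. h (z + w)) has_fps_expansion G"
    using analytic_at_imp_has_fps_expansion[OF h(1)] by blast
  have "fps_nth G 0 = 0" using has_fps_expansion_imp_0_eq_fps_nth_0[OF G] h(2) by simp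
  hence sd: "G = 0 \<or> subdegree G > 0" by (metis gr0I nth_subdegree_nonzero)
  have "\<not> is_pole (\<lambda>w. f w * h w ^ m) z" if m: "m \<ge> nat (- fls_subdegree L) + 1" for m
  proof -
    have *: "(\<lambda>w. f (z + w) * h (z + w) ^ m) has_laurent_expansion L * fps_to_fls G ^ m"
      by (intro laurent_expansion_intros L has_laurent_expansion_fps G)
    have "fls_subdegree (L * fps_to_fls G ^ m) \<ge> 0"
    proof (cases "L = 0 \<or> G = 0")
      case True
      thus ?thesis using m by (auto simp: power_0_left)
    next
      case False
      hence "int m * 1 \<le> int m * int (subdegree G)" using sd by (intro mult_left_mono) auto
      moreover have "fls_subdegree (L * fps_to_fls G ^ m) = fls_subdegree L + int m * int (subdegree G)"
        using False by (simp add: fls_subdegree_pow fls_subdegree_fls_to_fps)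
      ultimately show ?thesis using m by linarith
    qed
    thus ?thesis using has_laurent_expansion_imp_is_pole_iff[OF *] by simp
  qed
  thus ?thesis using that by blast
qed

lemma filterlim_moebius_at:
  assumes A: "A \<in> SL2Z" and z: "z \<in> uhp"
  shows "filterlim (moebius A) (at (moebius A z)) (at z)"
proof (rule filterlim_atI)
  have "isCont (moebius A) z"
    using holomorphic_on_imp_continuous_on[OF moebius_holomorphic[OF A]] open_uhp z
    by (simp add: continuous_on_eq_continuous_at)
  thus "moebius A \<midarrow>z\<rightarrow> moebius A z" by (rule isContD)
  have "eventually (\<lambda>w. w \<in> uhp \<and> w \<noteq> z) (at z)"
    using eventually_in_uhp[OF z] eventually_neq_at_within[of z z] by eventually_elim simp
  thus "eventually (\<lambda>w. moebius A w \<noteq> moebius A z) (at z)"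
    by eventually_elim (metis moebius_inv2(2)[OF A] z)
qed

lemma fourier_analytic:
  assumes N: "N > 0" and F: "has_fourier_expansion N f F"
  obtains Y where "Y > 0" "\<And>\<tau>. Im \<tau> > Y \<Longrightarrow> f analytic_on {\<tau>}"
proof -
  have rad: "fls_conv_radius F > 0" using F by (simp add: fourier_iff)
  have "eventually (\<lambda>x. x \<in> eball 0 (fls_conv_radius F)) (nhds 0)"
    using rad by (intro eventually_nhds_in_open) (auto simp: zero_ereal_def)
  hence "eventually (\<lambda>x. x \<in> eball 0 (fls_conv_radius F)) (at 0)"
    by (rule filter_leD[OF at_within_le_nhds])
  hence "eventually (\<lambda>\<tau>. cexp (\<tau> / of_int N) \<in> eball 0 (fls_conv_radius F)) at_i_infinity"
    by (subst eventually_q_iff_int[OF N])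
  with fourier_laurent(2)[OF F]
  have "eventually (\<lambda>\<tau>. cexp (\<tau> / of_int N) \<in> eball 0 (fls_conv_radius F) \<and>
          f \<tau> = eval_fls F (cexp (\<tau> / of_int N))) at_i_infinity"
    by eventually_elim simp
  then obtain Y0 where Y0: "\<And>\<tau>. Im \<tau> > Y0 \<Longrightarrow> cexp (\<tau> / of_int N) \<in> eball 0 (fls_conv_radius F) \<and>
          f \<tau> = eval_fls F (cexp (\<tau> / of_int N))"
    unfolding eventually_at_i_infinity by blast
  have "(\<lambda>\<tau>. eval_fls F (cexp (\<tau> / of_int N))) holomorphic_on {\<tau>. Im \<tau> > Y0}"
    using Y0 N by (intro holomorphic_intros) (auto simp: cexp_def intro!: holomorphic_intros)
  hence "f holomorphic_on {\<tau>. Im \<tau> > Y0}" by (rule holomorphic_transform) (use Y0 in auto)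
  hence "f analytic_on {\<tau>. Im \<tau> > Y0}" by (simp add: analytic_on_open open_halfspace_Im_gt)
  hence "f analytic_on {\<tau>}" if "Im \<tau> > max 1 Y0" for \<tau>
    using that by (auto intro: analytic_on_subset)
  thus ?thesis by (intro that[of "max 1 Y0"]) auto
qed

text \<open>Up to the group there are only finitely many poles: none high up because of the Fourier
  expansion, and finitely many in a compact strip. A power of the product of j - j(p) over these
  poles p cancels them, and what is left is, after removal of singularities, a polynomial in
  j.\<close>

lemma invariant_meromorphic_imp_rational:
  assumes N: "N > 0" and mer: "f meromorphic_on uhp"
    and inv: "\<And>A \<tau>. A \<in> SL2Z \<Longrightarrow> \<tau> \<in> uhp \<Longrightarrow> f (moebius A \<tau>) = f \<tau>"
    and F: "has_fourier_expansion N f F"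
  shows "\<exists>P Q. Q \<noteq> 0 \<and> (\<forall>z\<in>uhp. \<forall>\<^sub>F w in at z. f w * poly Q (klein_j w) = poly P (klein_j w))"
proof -
  have merz: "f meromorphic_on {z}" if "z \<in> uhp" for z
    using mer by (rule meromorphic_on_subset) (use that in auto)
  obtain Y where Y: "Y > 0" "\<And>\<tau>. Im \<tau> > Y \<Longrightarrow> f analytic_on {\<tau>}"
    using fourier_analytic[OF N F] by blast
  define S where "S = {p \<in> fund_strip Y. is_pole f p}"
  have "{p. is_pole f p} sparse_in uhp"
    using meromorphic_on_imp_not_pole_cosparse[OF mer] by (simp add: eventually_cosparse)
  hence "{p. is_pole f p} sparse_in fund_strip Y"
    by (rule sparse_in_subset) (rule fund_strip)
  hence "finite (fund_strip Y \<inter> {p. is_pole f p})"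
    by (rule sparse_in_compact_finite) (rule fund_strip)
  hence S: "finite S" by (simp add: S_def Int_def)
  have S_uhp: "p \<in> uhp" if "p \<in> S" for p using that fund_strip(2)[of Y] by (auto simp: S_def)
  define Q0 where "Q0 = (\<Prod>p\<in>S. [:- klein_j p, 1:])"
  define h where "h = (\<lambda>\<tau>. poly Q0 (klein_j \<tau>))"
  have "h holomorphic_on uhp"
    unfolding h_def poly_altdef by (intro holomorphic_intros klein_j_holomorphic)
  hence h_an: "h analytic_on {z}" if "z \<in> uhp" for z
    using that by (meson analytic_on_open analytic_on_subset empty_subsetI insert_subset open_uhp)
  have "\<forall>p\<in>S. \<exists>M. \<forall>m\<ge>M. \<not> is_pole (\<lambda>w. f w * h w ^ m) p"
  proof
    fix p assume p: "p \<in> S"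
    have "h p = 0" unfolding h_def Q0_def poly_prod using S p by (auto intro!: bexI[of _ p])
    thus "\<exists>M. \<forall>m\<ge>M. \<not> is_pole (\<lambda>w. f w * h w ^ m) p"
      using pole_cancel[OF merz[OF S_uhp[OF p]] h_an[OF S_uhp[OF p]]] by blast
  qed
  then obtain m where m: "\<And>p. p \<in> S \<Longrightarrow> \<forall>i\<ge>m p. \<not> is_pole (\<lambda>w. f w * h w ^ i) p" by metis
  define M where "M = (\<Sum>p\<in>S. m p)"
  have M: "m p \<le> M" if "p \<in> S" for p unfolding M_def using S that by (simp add: member_le_sum)
  define g where "g = (\<lambda>\<tau>. f \<tau> * h \<tau> ^ M)"
  have h_inv: "h (moebius A \<tau>) = h \<tau>" if "A \<in> SL2Z" "\<tau> \<in> uhp" for A \<tau>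
    using klein_j_moebius[OF that] by (simp add: h_def)
  have g_inv: "g (moebius A \<tau>) = g \<tau>" if "A \<in> SL2Z" "\<tau> \<in> uhp" for A \<tau>
    using h_inv[OF that] inv[OF that] by (simp add: g_def)
  have g_mer: "g meromorphic_on uhp"
    unfolding g_def using \<open>h holomorphic_on uhp\<close> open_uhp
    by (intro meromorphic_intros mer analytic_on_imp_meromorphic_on) (simp add: analytic_on_open)
  have g_merz: "g meromorphic_on {z}" if "z \<in> uhp" for z
    using g_mer by (rule meromorphic_on_subset) (use that in auto)
  have np: "\<not> is_pole g z" if z: "z \<in> uhp" "Im z > Y \<or> z \<in> fund_strip Y" for z
  proof (cases "z \<in> S")
    case True
    thus ?thesis using m M by (simp add: g_def)
  next
    case False
    have "\<not> is_pole f z"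
    proof (cases "Im z > Y")
      case True
      thus ?thesis using Y(2) analytic_at_imp_no_pole by blast
    next
      case False
      thus ?thesis using \<open>z \<notin> S\<close> z by (simp add: S_def)
    qed
    thus ?thesis
      unfolding g_def using h_an[OF z(1)]
      by (intro not_is_pole_mult_analytic merz z analytic_intros)
  qed
  \<comment> \<open>Limits are carried along by the group. This spreads the absence of poles from
    the fundamental domain to the half plane and makes \<open>remove_sings g\<close> invariant as
    well.\<close>
  have tends: "g \<midarrow>z\<rightarrow> c" if A: "A \<in> SL2Z" and z: "z \<in> uhp" and c: "g \<midarrow>moebius A z\<rightarrow> c" for A z c
  proof -
    have "((\<lambda>w. g (moebius A w)) \<longlongrightarrow> c) (at z)"
      by (rule filterlim_compose[OF c filterlim_moebius_at[OF A z]])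
    moreover have "eventually (\<lambda>w. g (moebius A w) = g w) (at z)"
      using eventually_in_uhp[OF z] by eventually_elim (rule g_inv[OF A])
    ultimately show ?thesis by (rule Lim_transform_eventually)
  qed
  have np': "\<not> is_pole g z" if z: "z \<in> uhp" for z
  proof -
    obtain A where A: "A \<in> SL2Z" "\<bar>Re (moebius A z)\<bar> \<le> 1 / 2" "Im (moebius A z) \<ge> 1 / 2"
      using fundamental_domain[OF z] by blast
    have Az: "moebius A z \<in> uhp" by (rule moebius_uhp[OF A(1) z])
    have "\<not> is_pole g (moebius A z)"
      using A(2,3) by (intro np Az) (auto simp: fund_strip_def)
    then obtain c where "g \<midarrow>moebius A z\<rightarrow> c" using not_is_pole_iff_tendsto[OF g_merz[OF Az]] by blast
    from tends[OF A(1) z this] show ?thesis by (rule tendsto_imp_not_is_pole)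
  qed
  define r where "r = remove_sings g"
  have r_lim: "g \<midarrow>z\<rightarrow> r z" if z: "z \<in> uhp" for z
  proof -
    obtain c where "g \<midarrow>z\<rightarrow> c" using np'[OF z] not_is_pole_iff_tendsto[OF g_merz[OF z]] by blast
    thus ?thesis unfolding r_def using remove_sings_eqI by metis
  qed
  have "r nicely_meromorphic_on uhp" unfolding r_def by (rule remove_sings_nicely_meromorphic[OF g_mer])
  moreover have ev: "eventually (\<lambda>w. r w = g w) (at z)" if "z \<in> uhp" for z
    unfolding r_def using g_mer that by (intro eventually_remove_sings_eq_at) (meson meromorphic_onE)
  have "\<not> is_pole r z" if z: "z \<in> uhp" for z
    using is_pole_cong[OF ev[OF z] refl] np'[OF z] by simp
  ultimately have "r analytic_on {z}" if "z \<in> uhp" for z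
    using nicely_meromorphic_on_imp_analytic_at that by blast
  hence r_hol: "r holomorphic_on uhp"
    by (meson analytic_imp_holomorphic analytic_on_analytic_at)
  have r_inv: "r (moebius A z) = r z" if "A \<in> SL2Z" "z \<in> uhp" for A z
    using tends[OF that r_lim[OF moebius_uhp[OF that]]] unfolding r_def by (metis remove_sings_eqI)
  obtain J where J: "has_fourier_expansion N klein_j J" by (rule klein_j_fourier[OF N]) (rule that)
  have "eventually (\<lambda>\<tau>. Im \<tau> > Y) at_i_infinity" unfolding eventually_at_i_infinity by blast
  hence "eventually (\<lambda>\<tau>. r \<tau> = g \<tau>) at_i_infinity"
  proof eventually_elim
    case (elim \<tau>)
    have "g analytic_on {\<tau>}" unfolding g_def using Y(1) elim
      by (intro analytic_intros Y h_an) (simp_all add: uhp_def)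
    thus ?case by (simp add: r_def)
  qed
  moreover have "has_fourier_expansion N g
      (F * (\<Sum>i\<le>Polynomial.degree Q0. fls_const (poly.coeff Q0 i) * J ^ i) ^ M)"
    unfolding g_def h_def poly_altdef
    by (intro fourier_mult fourier_power fourier_sum fourier_const N F J)
  ultimately have "has_fourier_expansion N r (F * (\<Sum>i\<le>Polynomial.degree Q0. fls_const (poly.coeff Q0 i) * J ^ i) ^ M)"
    by (rule fourier_cong)
  from invariant_holomorphic_imp_poly[OF N r_hol r_inv this]
  obtain P where P: "\<forall>\<tau>\<in>uhp. r \<tau> = poly P (klein_j \<tau>)" by blast
  have "eventually (\<lambda>w. f w * poly (Q0 ^ M) (klein_j w) = poly P (klein_j w)) (at z)" if z: "z \<in> uhp" for z
    using ev[OF z] eventually_in_uhp[OF z]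
  proof eventually_elim
    case (elim w)
    thus ?case using P by (auto simp: g_def h_def)
  qed
  moreover have "Q0 ^ M \<noteq> 0" using S by (simp add: Q0_def)
  ultimately show ?thesis by blast
qed

section \<open>Symmetrization over the modular group\<close>

definition mero_fourier :: "int \<Rightarrow> (complex \<Rightarrow> complex) \<Rightarrow> bool" where
  "mero_fourier N f \<longleftrightarrow> f meromorphic_on uhp \<and> (\<exists>F. has_fourier_expansion N f F)"

text \<open>With the cut-off, conjugates that agree on \<open>uhp\<close> are equal as HOL
  functions, so the orbit is a set with a meaningful cardinality.\<close>

definition slash :: "int^2^2 \<Rightarrow> (complex \<Rightarrow> complex) \<Rightarrow> complex \<Rightarrow> complex" where
  "slash A f = (\<lambda>\<tau>. if \<tau> \<in> uhp then f (moebius A \<tau>) else 0)"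

lemma slash_mult:
  assumes "A \<in> SL2Z" "B \<in> SL2Z"
  shows "slash A (slash B f) = slash (B ** A) f"
  using moebius_mult[OF assms(2,1)] moebius_uhp[OF assms(1)] by (auto simp: slash_def fun_eq_iff)

lemma holomorphic_uhp_eventually_nonzero:
  assumes hol: "f holomorphic_on uhp" and z0: "z0 \<in> uhp" "f z0 \<noteq> 0" and z: "z \<in> uhp"
  shows "\<forall>\<^sub>F w in at z. f w \<noteq> 0"
proof (rule ccontr)
  assume "\<not> (\<forall>\<^sub>F w in at z. f w \<noteq> 0)"
  hence fr: "\<exists>\<^sub>F w in at z. f w = 0" by (simp add: frequently_def)
  have mer: "f meromorphic_on uhp"
    using hol by (simp add: analytic_on_imp_meromorphic_on analytic_on_open open_uhp)
  have "\<forall>\<^sub>F x in at z0. f x = 0"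
    by (rule meromorphic_identity[OF mer open_uhp connected_uhp z fr z0(1)])
  hence "(f \<longlongrightarrow> 0) (at z0)" by (rule tendsto_eventually)
  moreover have "isCont f z0"
    using holomorphic_on_imp_continuous_on[OF hol] z0 open_uhp by (simp add: continuous_on_eq_continuous_at)
  hence "(f \<longlongrightarrow> f z0) (at z0)" by (rule isContD)
  ultimately show False using at_neq_bot tendsto_unique z0(2) by blast
qed

context
  fixes N :: int assumes N: "N > 0"
begin

lemma mero_fourier_const: "mero_fourier N (\<lambda>_. c)"
  using fourier_const[OF N, of c] by (auto simp: mero_fourier_def)

lemma mero_fourier_add:
  assumes "mero_fourier N f" "mero_fourier N g"
  shows "mero_fourier N (\<lambda>\<tau>. f \<tau> + g \<tau>)"
  using assms fourier_add[OF N] unfolding mero_fourier_def by (blast intro: meromorphic_on_add)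

lemma mero_fourier_mult:
  assumes "mero_fourier N f" "mero_fourier N g"
  shows "mero_fourier N (\<lambda>\<tau>. f \<tau> * g \<tau>)"
  using assms fourier_mult[OF N] unfolding mero_fourier_def by (blast intro: meromorphic_on_mult)

lemma mero_fourier_uminus:
  assumes "mero_fourier N f"
  shows "mero_fourier N (\<lambda>\<tau>. - f \<tau>)"
  using mero_fourier_mult[OF mero_fourier_const[of "-1"] assms] by simp

lemma mero_fourier_sum:
  assumes "\<And>i. i \<in> I \<Longrightarrow> mero_fourier N (f i)"
  shows "mero_fourier N (\<lambda>\<tau>. \<Sum>i\<in>I. f i \<tau>)"
  using assms
  by (induction I rule: infinite_finite_induct) (auto intro: mero_fourier_add mero_fourier_const)

lemma mero_fourier_coeff_prod:
  assumes "\<And>h. h \<in> S \<Longrightarrow> mero_fourier N h"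
  shows "mero_fourier N (\<lambda>\<tau>. poly.coeff (\<Prod>h\<in>S. [:- h \<tau>, 1:]) i)"
  using assms
proof (induction S arbitrary: i rule: infinite_finite_induct)
  case (insert h S)
  have eq: "poly.coeff (\<Prod>h\<in>insert h S. [:- h \<tau>, 1:]) i =
      - h \<tau> * poly.coeff (\<Prod>h\<in>S. [:- h \<tau>, 1:]) i +
      (if i = 0 then 0 else poly.coeff (\<Prod>h\<in>S. [:- h \<tau>, 1:]) (i - 1))" for \<tau>
    using insert.hyps by (simp add: coeff_pCons split: nat.split)
  have "mero_fourier N (\<lambda>\<tau>. if i = 0 then 0 else poly.coeff (\<Prod>h\<in>S. [:- h \<tau>, 1:]) (i - 1))"
    using insert by (cases "i = 0") (simp_all add: mero_fourier_const)
  with insert show ?case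
    unfolding eq by (intro mero_fourier_add mero_fourier_mult mero_fourier_uminus) auto
qed (simp_all add: mero_fourier_const)

text \<open>The interpolation polynomial takes at each conjugate of h0 the corresponding conjugate
  of f. The group permutes its summands, so its coefficients are invariant, and at h0 all summands
  but one contain a vanishing factor.\<close>

lemma lagrange_interpolation:
  fixes h0 f :: "complex \<Rightarrow> complex"
  defines "Orb \<equiv> (\<lambda>A. slash A h0) ` SL2Z"
  assumes fin: "finite Orb"
    and stab: "\<And>A \<tau>. A \<in> SL2Z \<Longrightarrow> (\<And>\<tau>. \<tau> \<in> uhp \<Longrightarrow> h0 (moebius A \<tau>) = h0 \<tau>) \<Longrightarrow>
                 \<tau> \<in> uhp \<Longrightarrow> f (moebius A \<tau>) = f \<tau>"
    and h0: "\<And>A. A \<in> SL2Z \<Longrightarrow> mero_fourier N (slash A h0)"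
    and f: "\<And>A. A \<in> SL2Z \<Longrightarrow> mero_fourier N (slash A f)"
  obtains c where "\<And>i. mero_fourier N (c i)"
    "\<And>i A \<tau>. A \<in> SL2Z \<Longrightarrow> \<tau> \<in> uhp \<Longrightarrow> c i (moebius A \<tau>) = c i \<tau>"
    "\<And>\<tau>. \<tau> \<in> uhp \<Longrightarrow> f \<tau> * (\<Prod>h\<in>Orb - {slash (mat 1) h0}. h0 \<tau> - h \<tau>) = (\<Sum>i\<le>card Orb. c i \<tau> * h0 \<tau> ^ i)"
proof -
  \<comment> \<open>The conjugate of f that belongs to a conjugate of h0. It does not depend on the
    choice: two matrices with the same conjugate of h0 differ by one that fixes h0 and hence, by
    \<open>stab\<close>, f.\<close>
  define \<psi> where "\<psi> = (\<lambda>h. SOME g. \<exists>A\<in>SL2Z. h = slash A h0 \<and> g = slash A f)"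
  have \<psi>: "\<psi> (slash A h0) = slash A f" if A: "A \<in> SL2Z" for A
  proof -
    have "\<exists>g. \<exists>B\<in>SL2Z. slash A h0 = slash B h0 \<and> g = slash B f" using A by blast
    from someI_ex[OF this] obtain B where B: "B \<in> SL2Z" "slash A h0 = slash B h0" "\<psi> (slash A h0) = slash B f"
      unfolding \<psi>_def by blast
    define C where "C = B ** inv2 A"
    note iA = inv2(1)[OF A]
    have C: "C \<in> SL2Z" unfolding C_def by (intro SL2Z_mult B iA)
    have "h0 (moebius C \<tau>) = h0 \<tau>" if \<tau>: "\<tau> \<in> uhp" for \<tau>
    proof -
      have "h0 (moebius C \<tau>) = slash B h0 (moebius (inv2 A) \<tau>)"
        using moebius_mult[OF B(1) iA \<tau>] moebius_uhp[OF iA \<tau>] by (simp add: slash_def C_def)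
      also have "\<dots> = slash A h0 (moebius (inv2 A) \<tau>)" by (simp only: B(2))
      also have "\<dots> = h0 \<tau>" using moebius_uhp[OF iA \<tau>] moebius_inv2(1)[OF A \<tau>] by (simp add: slash_def)
      finally show ?thesis .
    qed
    hence inv: "f (moebius C \<tau>) = f \<tau>" if "\<tau> \<in> uhp" for \<tau> using stab[OF C] that by blast
    have "f (moebius B \<tau>) = f (moebius A \<tau>)" if \<tau>: "\<tau> \<in> uhp" for \<tau>
      using inv[OF moebius_uhp[OF A \<tau>]] moebius_mult[OF B(1) iA moebius_uhp[OF A \<tau>]] moebius_inv2(2)[OF A \<tau>]
      by (simp add: C_def)
    hence "slash B f = slash A f" by (auto simp: slash_def)
    thus ?thesis using B(3) by simp
  qed
  have Orb_act: "slash A h \<in> Orb" if "A \<in> SL2Z" "h \<in> Orb" for A h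
    using that by (auto simp: Orb_def slash_mult intro!: imageI SL2Z_mult)
  have \<psi>_act: "\<psi> (slash A h) = slash A (\<psi> h)" if A: "A \<in> SL2Z" and h: "h \<in> Orb" for A h
  proof -
    obtain B where B: "B \<in> SL2Z" "h = slash B h0" using h by (auto simp: Orb_def)
    show ?thesis using \<psi>[OF B(1)] \<psi>[OF SL2Z_mult[OF B(1) A]] by (simp add: B slash_mult A)
  qed
  have cancel: "slash (inv2 A) (slash A h) = h" if A: "A \<in> SL2Z" and h: "h \<in> Orb" for A h
  proof -
    obtain B where B: "B \<in> SL2Z" "h = slash B h0" using h by (auto simp: Orb_def)
    have "slash (inv2 A) (slash A h) = slash (A ** inv2 A) h" using A inv2(1)[OF A] by (rule slash_mult[rotated])
    also have "\<dots> = h" using inv2(2)[OF A] by (auto simp: slash_def B)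
    finally show ?thesis .
  qed
  have inj: "inj_on (slash A) Orb" if "A \<in> SL2Z" for A
    by (rule inj_on_inverseI[of _ "slash (inv2 A)"]) (rule cancel[OF that])
  have bij: "bij_betw (slash A) Orb Orb" if A: "A \<in> SL2Z" for A
    unfolding bij_betw_def using inj[OF A] endo_inj_surj[OF fin _ inj[OF A]] Orb_act[OF A] by auto
  define t where "t = (\<lambda>\<tau> h. Polynomial.smult (\<psi> h \<tau>) (\<Prod>h'\<in>Orb - {h}. [:- h' \<tau>, 1:]))"
  define T where "T = (\<lambda>\<tau>. \<Sum>h\<in>Orb. t \<tau> h)"
  have T_inv: "T (moebius A \<tau>) = T \<tau>" if A: "A \<in> SL2Z" and \<tau>: "\<tau> \<in> uhp" for A \<tau>
  proof -
    have sl: "slash A h \<tau> = h (moebius A \<tau>)" for h using \<tau> by (simp add: slash_def)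
    have "t (moebius A \<tau>) h = t \<tau> (slash A h)" if h: "h \<in> Orb" for h
    proof -
      have "Orb - {slash A h} = slash A ` (Orb - {h})"
        using inj[OF A] bij[OF A] h by (subst inj_on_image_set_diff[of _ Orb]) (auto simp: bij_betw_def)
      hence "(\<Prod>h'\<in>Orb - {slash A h}. [:- h' \<tau>, 1:]) = (\<Prod>h'\<in>Orb - {h}. [:- h' (moebius A \<tau>), 1:])"
        using inj_on_subset[OF inj[OF A], of "Orb - {h}"] by (simp add: prod.reindex sl)
      thus ?thesis unfolding t_def \<psi>_act[OF A h] sl by simp
    qed
    hence "T (moebius A \<tau>) = (\<Sum>h\<in>Orb. t \<tau> (slash A h))" unfolding T_def by (intro sum.cong refl)
    also have "\<dots> = T \<tau>" unfolding T_def by (rule sum.reindex_bij_betw[OF bij[OF A]])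
    finally show ?thesis .
  qed
  define c where "c = (\<lambda>i \<tau>. poly.coeff (T \<tau>) i)"
  have c_nice: "mero_fourier N (c i)" for i
  proof -
    have "mero_fourier N (\<psi> h)" "mero_fourier N h" if "h \<in> Orb" for h using that f h0 \<psi> by (auto simp: Orb_def)
    hence "mero_fourier N (\<lambda>\<tau>. \<Sum>h\<in>Orb. \<psi> h \<tau> * poly.coeff (\<Prod>h'\<in>Orb - {h}. [:- h' \<tau>, 1:]) i)"
      by (intro mero_fourier_sum mero_fourier_mult mero_fourier_coeff_prod) auto
    thus ?thesis by (simp add: c_def T_def t_def coeff_sum)
  qed
  have deg: "Polynomial.degree (T \<tau>) \<le> card Orb" for \<tau>
  proof -
    have "Polynomial.degree (t \<tau> h) \<le> card Orb" for h
    proof -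
      have "Polynomial.degree (t \<tau> h) \<le> Polynomial.degree (\<Prod>h'\<in>Orb - {h}. [:- h' \<tau>, 1:])"
        unfolding t_def by (rule degree_smult_le)
      also have "\<dots> \<le> (\<Sum>h'\<in>Orb - {h}. Polynomial.degree [:- h' \<tau>, 1:])"
        using degree_prod_sum_le[of "Orb - {h}" "\<lambda>h'. [:- h' \<tau>, 1:]"] fin by (simp only: o_def finite_Diff)
      also have "\<dots> = card (Orb - {h})" by simp
      also have "\<dots> \<le> card Orb" by (rule card_mono[OF fin]) auto
      finally show ?thesis .
    qed
    thus ?thesis unfolding T_def by (intro degree_sum_le fin)
  qed
  have "f \<tau> * (\<Prod>h\<in>Orb - {slash (mat 1) h0}. h0 \<tau> - h \<tau>) = (\<Sum>i\<le>card Orb. c i \<tau> * h0 \<tau> ^ i)" if \<tau>: "\<tau> \<in> uhp" for \<tau>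
  proof -
    define e where "e = slash (mat 1) h0"
    have e: "e \<in> Orb" "e \<tau> = h0 \<tau>" "\<psi> e \<tau> = f \<tau>"
      using \<psi>[OF mat_1_SL2Z] mat_1_SL2Z \<tau> by (auto simp: Orb_def e_def slash_def)
    have p: "poly (t \<tau> h) x = \<psi> h \<tau> * (\<Prod>h'\<in>Orb - {h}. x - h' \<tau>)" for h x
      by (simp add: t_def poly_prod)
    have "poly (T \<tau>) (h0 \<tau>) = (\<Sum>h\<in>Orb. poly (t \<tau> h) (h0 \<tau>))" by (simp add: T_def poly_sum)
    also have "\<dots> = (\<Sum>h\<in>{e}. poly (t \<tau> h) (h0 \<tau>))"
    proof (rule sum.mono_neutral_right[OF fin])
      show "\<forall>h\<in>Orb - {e}. poly (t \<tau> h) (h0 \<tau>) = 0"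
      proof
        fix h assume "h \<in> Orb - {e}"
        hence "e \<in> Orb - {h}" using e by auto
        hence "(\<Prod>h'\<in>Orb - {h}. h0 \<tau> - h' \<tau>) = 0" using fin e(2) by (intro prod_zero) (auto intro!: bexI[of _ e])
        thus "poly (t \<tau> h) (h0 \<tau>) = 0" by (simp add: p)
      qed
    qed (use e in auto)
    also have "\<dots> = f \<tau> * (\<Prod>h\<in>Orb - {e}. h0 \<tau> - h \<tau>)" by (simp add: p e)
    finally have "f \<tau> * (\<Prod>h\<in>Orb - {e}. h0 \<tau> - h \<tau>) = poly (T \<tau>) (h0 \<tau>)" by simp
    also have "\<dots> = (\<Sum>i\<le>Polynomial.degree (T \<tau>). c i \<tau> * h0 \<tau> ^ i)" by (simp add: poly_altdef c_def)
    also have "\<dots> = (\<Sum>i\<le>card Orb. c i \<tau> * h0 \<tau> ^ i)"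
      using deg[of \<tau>] by (intro sum.mono_neutral_left) (auto simp: c_def coeff_eq_0)
    finally show ?thesis by (simp add: e_def)
  qed
  moreover have "c i (moebius A \<tau>) = c i \<tau>" if "A \<in> SL2Z" "\<tau> \<in> uhp" for i A \<tau>
    using T_inv[OF that] by (simp add: c_def)
  ultimately show ?thesis using c_nice that by blast
qed

text \<open>If the composite vanished identically, j would map the connected half plane into a
  finite set of roots and be constant, against its pole at i\<infinity>.\<close>

lemma poly_klein_j_nonzero:
  assumes Q: "Q \<noteq> 0" and z: "z \<in> uhp"
  shows "\<forall>\<^sub>F w in at z. poly Q (klein_j w) \<noteq> 0"
proof (rule ccontr)
  assume *: "\<not> (\<forall>\<^sub>F w in at z. poly Q (klein_j w) \<noteq> 0)"
  have hol: "(\<lambda>w. poly Q (klein_j w)) holomorphic_on uhp"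
    unfolding poly_altdef by (intro holomorphic_intros klein_j_holomorphic)
  have "poly Q (klein_j w) = 0" if w: "w \<in> uhp" for w
    using holomorphic_uhp_eventually_nonzero[OF hol w _ z] * by blast
  hence "klein_j ` uhp \<subseteq> {x. poly Q x = 0}" by auto
  hence "finite (klein_j ` uhp)" using poly_roots_finite[OF Q] finite_subset by blast
  hence "klein_j constant_on uhp"
    by (intro continuous_finite_range_constant connected_uhp holomorphic_on_imp_continuous_on klein_j_holomorphic)
  then obtain c where c: "\<And>w. w \<in> uhp \<Longrightarrow> klein_j w = c" by (auto simp: constant_on_def)
  obtain J where J: "has_fourier_expansion N klein_j J" "fls_subdegree J = - N" by (rule klein_j_fourier[OF N]) (rule that)
  have "has_fourier_expansion N klein_j (fls_const c)"
    by (rule fourier_cong[OF _ fourier_const[OF N]]) (use eventually_at_i_infinity_uhp c in \<open>auto elim: eventually_mono\<close>)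
  hence "J = fls_const c" using fourier_unique[OF N J(1)] by blast
  thus False using J(2) N by simp
qed

lemma common_denominator:
  assumes "finite I" "\<And>i. i \<in> I \<Longrightarrow> mero_fourier N (c i)"
    "\<And>i A \<tau>. i \<in> I \<Longrightarrow> A \<in> SL2Z \<Longrightarrow> \<tau> \<in> uhp \<Longrightarrow> c i (moebius A \<tau>) = c i \<tau>"
  shows "\<exists>Q P. Q \<noteq> 0 \<and> (\<forall>i\<in>I. \<forall>z\<in>uhp. \<forall>\<^sub>F w in at z. c i w * poly Q (klein_j w) = poly (P i) (klein_j w))"
proof -
  have "\<forall>i\<in>I. \<exists>P Q. Q \<noteq> 0 \<and> (\<forall>z\<in>uhp. \<forall>\<^sub>F w in at z. c i w * poly Q (klein_j w) = poly P (klein_j w))"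
  proof
    fix i assume i: "i \<in> I"
    obtain F where F: "c i meromorphic_on uhp" "has_fourier_expansion N (c i) F"
      using assms(2)[OF i] by (auto simp: mero_fourier_def)
    show "\<exists>P Q. Q \<noteq> 0 \<and> (\<forall>z\<in>uhp. \<forall>\<^sub>F w in at z. c i w * poly Q (klein_j w) = poly P (klein_j w))"
      by (rule invariant_meromorphic_imp_rational[OF N F(1) assms(3)[OF i] F(2)])
  qed
  then obtain P Q where PQ: "\<And>i. i \<in> I \<Longrightarrow> Q i \<noteq> 0"
    "\<And>i z. i \<in> I \<Longrightarrow> z \<in> uhp \<Longrightarrow> \<forall>\<^sub>F w in at z. c i w * poly (Q i) (klein_j w) = poly (P i) (klein_j w)"
    by metis
  define R where "R = prod Q I"
  define S where "S = (\<lambda>i. P i * prod Q (I - {i}))"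
  have "\<forall>\<^sub>F w in at z. c i w * poly R (klein_j w) = poly (S i) (klein_j w)" if i: "i \<in> I" and z: "z \<in> uhp" for i z
    using PQ(2)[OF that]
  proof eventually_elim
    case (elim w)
    have "R = Q i * prod Q (I - {i})" unfolding R_def by (rule prod.remove[OF assms(1) i])
    thus ?case using elim by (simp add: S_def mult.assoc[symmetric])
  qed
  moreover have "R \<noteq> 0" using PQ(1) assms(1) by (simp add: R_def)
  ultimately show ?thesis by blast
qed

end

section \<open>Modular functions for \<open>\<Gamma>\<^sub>1(N)\<close> as rational functions over the complex numbers\<close>

lemma wp_div_cong:
  assumes N: "N > 0" and \<tau>: "\<tau> \<in> uhp" and rs: "[r = r'] (mod N)" "[s = s'] (mod N)"
  shows "wp_div N r s \<tau> = wp_div N r' s' \<tau>"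
proof -
  obtain a b where ab: "r = r' + N * a" "s = s' + N * b"
    using rs by (metis cong_iff_lin cong_sym)
  have "(of_int r * \<tau> + of_int s) / of_int N =
      (of_int r' * \<tau> + of_int s') / of_int N + (of_int b + of_int a * \<tau>)"
    using N by (simp add: ab add_divide_distrib distrib_right)
  moreover have "of_int b + of_int a * \<tau> \<in> period_lattice \<tau>" by (auto simp: period_lattice_def)
  ultimately show ?thesis unfolding wp_div_def by (simp only: wp_periodic[OF \<tau>])
qed

lemma Lambda_row_cong:
  assumes "N > 0" "\<tau> \<in> uhp" "[c = c'] (mod N)" "[d = d'] (mod N)"
  shows "Lambda_row N k c d \<tau> = Lambda_row N k c' d' \<tau>"
  unfolding Lambda_row_def
  using wp_div_cong[OF assms(1,2) cong_scalar_left[OF assms(3)] cong_scalar_left[OF assms(4)]] wp_div_cong[OF assms]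
  by simp

lemma SL2Z_minus: "A \<in> SL2Z \<Longrightarrow> mat2 (- (A $ 1 $ 1)) (- (A $ 1 $ 2)) (- (A $ 2 $ 1)) (- (A $ 2 $ 2)) \<in> SL2Z"
  by (simp add: SL2Z_det)

lemma moebius_minus:
  "moebius (mat2 (- (A $ 1 $ 1)) (- (A $ 1 $ 2)) (- (A $ 2 $ 1)) (- (A $ 2 $ 2))) \<tau> = moebius A \<tau>"
proof -
  have "moebius (mat2 (- (A $ 1 $ 1)) (- (A $ 1 $ 2)) (- (A $ 2 $ 1)) (- (A $ 2 $ 2))) \<tau> =
      (- (of_int (A $ 1 $ 1) * \<tau> + of_int (A $ 1 $ 2))) / (- (of_int (A $ 2 $ 1) * \<tau> + of_int (A $ 2 $ 2)))"
    by (simp add: moebius_def)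
  also have "\<dots> = moebius A \<tau>" unfolding minus_divide_divide moebius_def ..
  finally show ?thesis .
qed

text \<open>Modulo N the determinant condition reads a d = 1, so a = 1 exactly when d = 1.
  \<open>Lambda_stabilizer\<close> gives information on the bottom row, whereas
  \<open>Gamma1\<close> is defined by the first column.\<close>

lemma Gamma1_iff:
  assumes "A \<in> SL2Z" "N dvd A $ 2 $ 1"
  shows "A \<in> Gamma1 N \<longleftrightarrow> N dvd A $ 2 $ 2 - 1"
proof -
  have det: "A $ 1 $ 1 * A $ 2 $ 2 - A $ 1 $ 2 * A $ 2 $ 1 = 1" using assms(1) by (simp add: SL2Z_det)
  hence 1: "A $ 1 $ 1 - 1 = A $ 1 $ 2 * A $ 2 $ 1 - A $ 1 $ 1 * (A $ 2 $ 2 - 1)"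
    and 2: "A $ 2 $ 2 - 1 = A $ 1 $ 2 * A $ 2 $ 1 - A $ 2 $ 2 * (A $ 1 $ 1 - 1)"
    by (simp_all add: algebra_simps)
  have "N dvd A $ 1 $ 1 - 1 \<longleftrightarrow> N dvd A $ 2 $ 2 - 1"
  proof
    assume "N dvd A $ 1 $ 1 - 1"
    from dvd_diff[OF dvd_mult[OF assms(2), of "A $ 1 $ 2"] dvd_mult[OF this, of "A $ 2 $ 2"]]
    show "N dvd A $ 2 $ 2 - 1" by (simp only: 2)
  next
    assume "N dvd A $ 2 $ 2 - 1"
    from dvd_diff[OF dvd_mult[OF assms(2), of "A $ 1 $ 2"] dvd_mult[OF this, of "A $ 1 $ 1"]]
    show "N dvd A $ 1 $ 1 - 1" by (simp only: 1)
  qed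
  thus ?thesis using assms by (simp add: Gamma1_def cong_iff_dvd_diff)
qed

lemma mero_fourier_slash_modular:
  assumes "f \<in> modular_functions N \<Gamma>" "A \<in> SL2Z"
  shows "mero_fourier N (slash A f)"
proof -
  obtain F where F: "has_fourier_expansion N (\<lambda>\<tau>. f (moebius A \<tau>)) F"
    using assms by (auto simp: modular_functions_def)
  have "has_fourier_expansion N (slash A f) F"
    by (rule fourier_cong[OF _ F]) (use eventually_at_i_infinity_uhp in \<open>auto simp: slash_def elim: eventually_mono\<close>)
  moreover have "(\<lambda>\<tau>. f (moebius A \<tau>)) meromorphic_on uhp"
  proof (rule meromorphic_on_compose[of f uhp "moebius A" uhp])
    show "f meromorphic_on uhp" using assms mero_uhp_meromorphic by (auto simp: modular_functions_def)
    show "moebius A analytic_on uhp" using moebius_holomorphic[OF assms(2)] by (simp add: analytic_on_open open_uhp)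
    show "moebius A ` uhp \<subseteq> uhp" using moebius_uhp[OF assms(2)] by auto
  qed
  moreover have "slash A f meromorphic_on uhp \<longleftrightarrow> (\<lambda>\<tau>. f (moebius A \<tau>)) meromorphic_on uhp"
  proof (rule meromorphic_on_cong)
    show "\<forall>\<^sub>F w in at z. slash A f w = f (moebius A w)" if "z \<in> uhp" for z
      using eventually_in_uhp[OF that] by eventually_elim (simp add: slash_def)
  qed (rule refl)
  ultimately show ?thesis by (auto simp: mero_fourier_def)
qed

context
  fixes N k :: int
  assumes N: "N > 6" and k: "2 < k" "2 * k < N"
begin

lemma slash_Lambda:
  assumes "A \<in> SL2Z"
  shows "slash A (Lambda N k) = (\<lambda>\<tau>. if \<tau> \<in> uhp then Lambda_row N k (A $ 2 $ 1) (A $ 2 $ 2) \<tau> else 0)"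
  using Lambda_moebius[OF assms] by (auto simp: slash_def)

lemma slash_Lambda_holomorphic:
  assumes A: "A \<in> SL2Z"
  shows "slash A (Lambda N k) holomorphic_on uhp"
  using Lambda_row_holomorphic[OF N k SL2Z_coprime[OF N k A]]
  by (rule holomorphic_transform) (simp add: slash_Lambda A)

lemma slash_Lambda_fourier:
  assumes A: "A \<in> SL2Z"
  shows "has_fourier_expansion N (slash A (Lambda N k)) (Lambda_row_fourier N k (A $ 2 $ 1) (A $ 2 $ 2))"
  by (rule fourier_cong[OF _ Lambda_row_fourier[OF N k SL2Z_coprime[OF N k A]]])
     (use eventually_at_i_infinity_uhp in \<open>auto simp: slash_Lambda A elim: eventually_mono\<close>)

lemma mero_fourier_slash_Lambda: "A \<in> SL2Z \<Longrightarrow> mero_fourier N (slash A (Lambda N k))"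
  using slash_Lambda_fourier slash_Lambda_holomorphic
  by (auto simp: mero_fourier_def analytic_on_open open_uhp intro!: analytic_on_imp_meromorphic_on)

lemma finite_orbit_Lambda: "finite ((\<lambda>A. slash A (Lambda N k)) ` SL2Z)"
proof (rule finite_subset)
  let ?g = "\<lambda>(c, d) \<tau>. if \<tau> \<in> uhp then Lambda_row N k c d \<tau> else 0"
  show "(\<lambda>A. slash A (Lambda N k)) ` SL2Z \<subseteq> ?g ` ({0..<N} \<times> {0..<N})"
  proof safe
    fix A :: "int^2^2" assume A: "A \<in> SL2Z"
    have "Lambda_row N k (A $ 2 $ 1) (A $ 2 $ 2) \<tau> = Lambda_row N k (A $ 2 $ 1 mod N) (A $ 2 $ 2 mod N) \<tau>"
      if "\<tau> \<in> uhp" for \<tau>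
      using N that by (intro Lambda_row_cong) (auto simp: cong_def)
    hence "slash A (Lambda N k) = ?g (A $ 2 $ 1 mod N, A $ 2 $ 2 mod N)"
      by (auto simp: slash_Lambda[OF A])
    thus "slash A (Lambda N k) \<in> ?g ` ({0..<N} \<times> {0..<N})"
      using N by (intro image_eqI[of _ _ "(A $ 2 $ 1 mod N, A $ 2 $ 2 mod N)"]) auto
  qed
qed simp

text \<open>The stabilizer theorem determines d only up to sign; in the second case the negative
  matrix lies in \<open>Gamma1 N\<close> and has the same action.\<close>

lemma Lambda_stabilizer_fixes:
  assumes f: "f \<in> modular_field1 N" and A: "A \<in> SL2Z"
    and inv: "\<And>\<tau>. \<tau> \<in> uhp \<Longrightarrow> Lambda N k (moebius A \<tau>) = Lambda N k \<tau>" and \<tau>: "\<tau> \<in> uhp"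
  shows "f (moebius A \<tau>) = f \<tau>"
proof -
  define B where "B = mat2 (- (A $ 1 $ 1)) (- (A $ 1 $ 2)) (- (A $ 2 $ 1)) (- (A $ 2 $ 2))"
  have B: "B \<in> SL2Z" unfolding B_def by (rule SL2Z_minus[OF A])
  have st: "N dvd A $ 2 $ 1" "N dvd A $ 2 $ 2 - 1 \<or> N dvd A $ 2 $ 2 + 1"
    using Lambda_stabilizer[OF N k A inv] by blast+
  have fG: "f (moebius C \<tau>) = f \<tau>" if "C \<in> Gamma1 N" for C
    using f that \<tau> by (auto simp: modular_field1_def modular_functions_def)
  from st(2) show ?thesis
  proof
    assume "N dvd A $ 2 $ 2 - 1"
    thus ?thesis using Gamma1_iff[OF A st(1)] fG by blast
  next
    assume "N dvd A $ 2 $ 2 + 1"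
    hence "N dvd - (A $ 2 $ 2 + 1)" by (simp only: dvd_minus_iff)
    hence "N dvd B $ 2 $ 2 - 1" by (simp add: B_def)
    moreover have "N dvd B $ 2 $ 1" using st(1) by (simp add: B_def)
    ultimately have "B \<in> Gamma1 N" using Gamma1_iff[OF B] by blast
    from fG[OF this] show ?thesis by (simp add: B_def moebius_minus)
  qed
qed

text \<open>Monomials in the two generators. A relation written with them is linear in its
  coefficients, which is the form needed for the descent.\<close>

definition jL :: "nat \<times> nat \<Rightarrow> complex \<Rightarrow> complex" where
  "jL s w = klein_j w ^ snd s * Lambda N k w ^ fst s"

text \<open>Interpolation is applied on the same orbit to f and to the constant 1. Both results have
  the product \<open>D\<close> on the left, so f is the quotient of two polynomials in
  \<open>Lambda N k\<close> with invariant coefficients, and these are rational in j.\<close>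

lemma modular_field1_rational:
  assumes f: "f \<in> modular_field1 N"
  obtains S a b where "finite S"
    "\<forall>z\<in>uhp. \<forall>\<^sub>F w in at z. f w * (\<Sum>s\<in>S. b s * jL s w) = (\<Sum>s\<in>S. a s * jL s w)"
    "\<forall>z\<in>uhp. \<forall>\<^sub>F w in at z. (\<Sum>s\<in>S. b s * jL s w) \<noteq> 0"
proof -
  have N0: "N > 0" using N by simp
  define Orb where "Orb = (\<lambda>A. slash A (Lambda N k)) ` SL2Z"
  define e where "e = slash (mat 1) (Lambda N k)"
  define D where "D = (\<lambda>\<tau>. \<Prod>h\<in>Orb - {e}. Lambda N k \<tau> - h \<tau>)"
  define n where "n = card Orb"
  have fin: "finite Orb" unfolding Orb_def by (rule finite_orbit_Lambda)
  obtain c where c: "\<And>i. mero_fourier N (c i)"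
    "\<And>i A \<tau>. A \<in> SL2Z \<Longrightarrow> \<tau> \<in> uhp \<Longrightarrow> c i (moebius A \<tau>) = c i \<tau>"
    "\<And>\<tau>. \<tau> \<in> uhp \<Longrightarrow> f \<tau> * D \<tau> = (\<Sum>i\<le>n. c i \<tau> * Lambda N k \<tau> ^ i)"
  proof (rule lagrange_interpolation[OF N0 finite_orbit_Lambda])
    show "f (moebius A \<tau>) = f \<tau>" if "A \<in> SL2Z" "\<And>\<tau>. \<tau> \<in> uhp \<Longrightarrow> Lambda N k (moebius A \<tau>) = Lambda N k \<tau>"
      "\<tau> \<in> uhp" for A \<tau> by (rule Lambda_stabilizer_fixes[OF f that])
    show "mero_fourier N (slash A (Lambda N k))" if "A \<in> SL2Z" for A by (rule mero_fourier_slash_Lambda[OF that])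
    show "mero_fourier N (slash A f)" if "A \<in> SL2Z" for A
      using f that unfolding modular_field1_def by (rule mero_fourier_slash_modular)
  qed (rule that, simp_all add: D_def n_def Orb_def e_def)
  obtain d where d: "\<And>i. mero_fourier N (d i)"
    "\<And>i A \<tau>. A \<in> SL2Z \<Longrightarrow> \<tau> \<in> uhp \<Longrightarrow> d i (moebius A \<tau>) = d i \<tau>"
    "\<And>\<tau>. \<tau> \<in> uhp \<Longrightarrow> 1 * D \<tau> = (\<Sum>i\<le>n. d i \<tau> * Lambda N k \<tau> ^ i)"
  proof (rule lagrange_interpolation[OF N0 finite_orbit_Lambda, where f = "\<lambda>_. 1"])
    show "mero_fourier N (slash A (Lambda N k))" if "A \<in> SL2Z" for A by (rule mero_fourier_slash_Lambda[OF that])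
    show "mero_fourier N (slash A (\<lambda>_. 1))" if "A \<in> SL2Z" for A
    proof -
      have "has_fourier_expansion N (slash A (\<lambda>_. 1)) (fls_const 1)"
        by (rule fourier_cong[OF _ fourier_const[OF N0]])
           (use eventually_at_i_infinity_uhp in \<open>auto simp: slash_def elim: eventually_mono\<close>)
      moreover have "slash A (\<lambda>_. 1) holomorphic_on uhp"
        by (rule holomorphic_transform[of "\<lambda>_. 1"]) (auto simp: slash_def)
      ultimately show ?thesis
        by (auto simp: mero_fourier_def analytic_on_open open_uhp intro!: analytic_on_imp_meromorphic_on)
    qed
  qed (rule refl, rule that, simp_all add: D_def n_def Orb_def e_def)
  \<comment> \<open>Every other member of the orbit is a holomorphic function different from
    \<open>Lambda N k\<close>, so each factor of the finite product has isolated zeros.\<close>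
  have D: "\<forall>\<^sub>F w in at z. D w \<noteq> 0" if z: "z \<in> uhp" for z
  proof -
    have "\<forall>\<^sub>F w in at z. Lambda N k w - h w \<noteq> 0" if h: "h \<in> Orb - {e}" for h
    proof -
      obtain A where A: "A \<in> SL2Z" "h = slash A (Lambda N k)" using h by (auto simp: Orb_def)
      have "e holomorphic_on uhp" "h holomorphic_on uhp"
        unfolding e_def A(2) by (intro slash_Lambda_holomorphic mat_1_SL2Z A)+
      hence hol: "(\<lambda>w. e w - h w) holomorphic_on uhp" by (intro holomorphic_intros)
      have "e \<noteq> h" using h by auto
      then obtain z0 where z0: "e z0 \<noteq> h z0" by (auto simp: fun_eq_iff)
      hence "z0 \<in> uhp" by (auto simp: e_def A slash_def split: if_splits)
      hence "\<forall>\<^sub>F w in at z. e w - h w \<noteq> 0"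
        by (intro holomorphic_uhp_eventually_nonzero[OF hol _ _ z]) (use z0 in auto)
      with eventually_in_uhp[OF z] show ?thesis by eventually_elim (simp add: e_def slash_def)
    qed
    hence "\<forall>\<^sub>F w in at z. \<forall>h\<in>Orb - {e}. Lambda N k w - h w \<noteq> 0"
      using fin by (intro eventually_ball_finite) auto
    thus ?thesis by eventually_elim (use fin in \<open>auto simp: D_def\<close>)
  qed
  \<comment> \<open>The Boolean separates numerator from denominator, so that one polynomial in j
    clears the denominators of both families of coefficients.\<close>
  define I where "I = (UNIV :: bool set) \<times> {..n}"
  define g where "g = (\<lambda>(x, i). if x then c i else d i)"
  have I: "finite I" by (simp add: I_def)
  have g_inv: "g i (moebius A \<tau>) = g i \<tau>" if "i \<in> I" "A \<in> SL2Z" "\<tau> \<in> uhp" for i A \<tau>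
    using c(2) d(2) that by (auto simp: g_def split: prod.splits)
  have g_mf: "mero_fourier N (g i)" if "i \<in> I" for i
    using c(1) d(1) by (auto simp: g_def split: prod.splits)
  have "\<exists>Q P. Q \<noteq> 0 \<and> (\<forall>i\<in>I. \<forall>z\<in>uhp. \<forall>\<^sub>F w in at z. g i w * poly Q (klein_j w) = poly (P i) (klein_j w))"
    by (rule common_denominator[OF N0 I, where c = g]) (fact g_mf, fact g_inv)
  then obtain Q P where PQ: "Q \<noteq> 0"
    "\<And>i z. i \<in> I \<Longrightarrow> z \<in> uhp \<Longrightarrow> \<forall>\<^sub>F w in at z. g i w * poly Q (klein_j w) = poly (P i) (klein_j w)"
    by blast
  define M where "M = (\<Sum>i\<in>I. Polynomial.degree (P i))"
  define S where "S = {..n} \<times> {..M}"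
  define a b where "a = (\<lambda>(i, l). poly.coeff (P (True, i)) l)" and "b = (\<lambda>(i, l). poly.coeff (P (False, i)) l)"
  have deg: "poly (P i) x = (\<Sum>l\<le>M. poly.coeff (P i) l * x ^ l)" if "i \<in> I" for i x
  proof -
    have "Polynomial.degree (P i) \<le> M" unfolding M_def using I that by (intro member_le_sum) auto
    thus ?thesis unfolding poly_altdef by (intro sum.mono_neutral_left) (auto simp: coeff_eq_0)
  qed
  have S_sum: "(\<Sum>s\<in>S. poly.coeff (P (x, fst s)) (snd s) * jL s w) = (\<Sum>i\<le>n. poly (P (x, i)) (klein_j w) * Lambda N k w ^ i)" for x w
  proof -
    have "(\<Sum>i\<le>n. poly (P (x, i)) (klein_j w) * Lambda N k w ^ i) =
        (\<Sum>i\<le>n. \<Sum>l\<le>M. poly.coeff (P (x, i)) l * jL (i, l) w)"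
      by (intro sum.cong refl) (simp add: deg I_def sum_distrib_right jL_def mult.assoc)
    also have "\<dots> = (\<Sum>s\<in>S. poly.coeff (P (x, fst s)) (snd s) * jL s w)"
      unfolding S_def by (simp add: sum.cartesian_product case_prod_beta)
    finally show ?thesis ..
  qed
  have a_sum: "(\<Sum>s\<in>S. a s * jL s w) = (\<Sum>i\<le>n. poly (P (True, i)) (klein_j w) * Lambda N k w ^ i)" for w
    using S_sum[of True w] by (simp add: a_def case_prod_beta)
  have b_sum: "(\<Sum>s\<in>S. b s * jL s w) = (\<Sum>i\<le>n. poly (P (False, i)) (klein_j w) * Lambda N k w ^ i)" for w
    using S_sum[of False w] by (simp add: b_def case_prod_beta)
  have main: "\<forall>\<^sub>F w in at z. (\<Sum>s\<in>S. b s * jL s w) = D w * poly Q (klein_j w) \<and>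
      (\<Sum>s\<in>S. a s * jL s w) = f w * (D w * poly Q (klein_j w))" if z: "z \<in> uhp" for z
  proof -
    have "\<forall>\<^sub>F w in at z. \<forall>i\<in>I. g i w * poly Q (klein_j w) = poly (P i) (klein_j w)"
      using I PQ(2) z by (intro eventually_ball_finite) auto
    with eventually_in_uhp[OF z] show ?thesis
    proof eventually_elim
      case (elim w)
      have P: "poly (P (x, i)) (klein_j w) = (if x then c i w else d i w) * poly Q (klein_j w)" if "i \<le> n" for x i
        using bspec[OF elim(2), of "(x, i)"] that by (cases x) (simp_all add: I_def g_def)
      have "(\<Sum>s\<in>S. b s * jL s w) = (\<Sum>i\<le>n. d i w * Lambda N k w ^ i) * poly Q (klein_j w)"
        unfolding b_sum sum_distrib_right by (intro sum.cong refl) (simp add: P)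
      moreover have "(\<Sum>s\<in>S. a s * jL s w) = (\<Sum>i\<le>n. c i w * Lambda N k w ^ i) * poly Q (klein_j w)"
        unfolding a_sum sum_distrib_right by (intro sum.cong refl) (simp add: P)
      ultimately show ?case using c(3)[OF elim(1)] d(3)[OF elim(1)] by (simp flip: mult.assoc)
    qed
  qed
  show ?thesis
  proof (rule that)
    show "finite S" by (simp add: S_def)
    show "\<forall>z\<in>uhp. \<forall>\<^sub>F w in at z. f w * (\<Sum>s\<in>S. b s * jL s w) = (\<Sum>s\<in>S. a s * jL s w)"
    proof
      fix z assume "z \<in> uhp"
      from main[OF this] show "\<forall>\<^sub>F w in at z. f w * (\<Sum>s\<in>S. b s * jL s w) = (\<Sum>s\<in>S. a s * jL s w)"
        by eventually_elim simp
    qed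
    show "\<forall>z\<in>uhp. \<forall>\<^sub>F w in at z. (\<Sum>s\<in>S. b s * jL s w) \<noteq> 0"
    proof
      fix z assume z: "z \<in> uhp"
      from main[OF z] D[OF z] poly_klein_j_nonzero[OF N0 PQ(1) z]
      show "\<forall>\<^sub>F w in at z. (\<Sum>s\<in>S. b s * jL s w) \<noteq> 0" by eventually_elim simp
    qed
  qed
qed

end

section \<open>Descent of the field of coefficients\<close>

text \<open>Coordinates are wanted only for the finitely many coefficients of one relation. A finite
  independent set is enough, grown by each number that lies outside the span so far.\<close>

lemma finite_basis_over:
  fixes Y :: "complex set"
  assumes K: "is_subfield K" and "finite Y"
  obtains B \<kappa> where "finite B" "\<And>x b. x \<in> Y \<Longrightarrow> b \<in> B \<Longrightarrow> \<kappa> x b \<in> K"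
    "\<And>x. x \<in> Y \<Longrightarrow> x = (\<Sum>b\<in>B. \<kappa> x b * b)"
    "\<And>c b. (\<And>b. b \<in> B \<Longrightarrow> c b \<in> K) \<Longrightarrow> (\<Sum>b\<in>B. c b * b) = 0 \<Longrightarrow> b \<in> B \<Longrightarrow> c b = 0"
  using assms(2)
proof (induction Y arbitrary: thesis rule: finite_induct)
  case empty
  show ?case by (rule empty[of "{}"]) auto
next
  case (insert x Y)
  note K' = is_subfieldD[OF K]
  obtain B \<kappa> where B: "finite B" "\<And>x b. x \<in> Y \<Longrightarrow> b \<in> B \<Longrightarrow> \<kappa> x b \<in> K"
    "\<And>x. x \<in> Y \<Longrightarrow> x = (\<Sum>b\<in>B. \<kappa> x b * b)"
    "\<And>c b. (\<And>b. b \<in> B \<Longrightarrow> c b \<in> K) \<Longrightarrow> (\<Sum>b\<in>B. c b * b) = 0 \<Longrightarrow> b \<in> B \<Longrightarrow> c b = 0"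
    by (rule insert.IH) blast
  show ?case
  proof (cases "\<exists>c. (\<forall>b\<in>B. c b \<in> K) \<and> x = (\<Sum>b\<in>B. c b * b)")
    case True
    then obtain c where c: "\<And>b. b \<in> B \<Longrightarrow> c b \<in> K" "x = (\<Sum>b\<in>B. c b * b)" by blast
    show ?thesis
    proof (rule insert.prems[of B "\<kappa>(x := c)"])
      show "(\<kappa>(x := c)) y b \<in> K" if "y \<in> insert x Y" "b \<in> B" for y b using that B(2) c(1) by auto
      show "y = (\<Sum>b\<in>B. (\<kappa>(x := c)) y b * b)" if "y \<in> insert x Y" for y
      proof (cases "y = x")
        case True
        thus ?thesis using c(2) by simp
      next
        case False
        thus ?thesis using that B(3)[of y] by simp
      qed
    qed (fact B)+
  next
    case False
    have "x \<notin> B"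
    proof
      assume x: "x \<in> B"
      have "(\<Sum>b\<in>B. (if b = x then 1 else 0) * b) = (\<Sum>b\<in>B. if b = x then b else 0)" by (intro sum.cong) auto
      also have "\<dots> = x" using x B(1) by simp
      finally have "x = (\<Sum>b\<in>B. (if b = x then 1 else 0) * b)" ..
      hence "\<exists>c. (\<forall>b\<in>B. c b \<in> K) \<and> x = (\<Sum>b\<in>B. c b * b)"
        using K'(1,2) by (intro exI[of _ "\<lambda>b. if b = x then 1 else 0"] conjI) auto
      thus False using False by blast
    qed
    define \<kappa>' where "\<kappa>' = (\<lambda>y b. if y = x then (if b = x then 1 else 0) else if b = x then 0 else \<kappa> y b)"
    show ?thesis
    proof (rule insert.prems[of "insert x B" \<kappa>'])
      show "finite (insert x B)" using B(1) by simp
      show "\<kappa>' y b \<in> K" if "y \<in> insert x Y" "b \<in> insert x B" for y b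
        using that B(2) K' by (auto simp: \<kappa>'_def)
      show "y = (\<Sum>b\<in>insert x B. \<kappa>' y b * b)" if "y \<in> insert x Y" for y
      proof (cases "y = x")
        case True
        have "(\<Sum>b\<in>B. \<kappa>' x b * b) = 0" using \<open>x \<notin> B\<close> by (intro sum.neutral) (auto simp: \<kappa>'_def)
        thus ?thesis using True B(1) \<open>x \<notin> B\<close> by (simp add: \<kappa>'_def)
      next
        case False
        have "(\<Sum>b\<in>B. \<kappa>' y b * b) = (\<Sum>b\<in>B. \<kappa> y b * b)"
          using False \<open>x \<notin> B\<close> by (intro sum.cong) (auto simp: \<kappa>'_def)
        also have "\<dots> = y" using B(3)[of y] False that by simp
        finally show ?thesis using False B(1) \<open>x \<notin> B\<close> by (simp add: \<kappa>'_def)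
      qed
      show "c b = 0" if c: "\<And>b. b \<in> insert x B \<Longrightarrow> c b \<in> K" "(\<Sum>b\<in>insert x B. c b * b) = 0" "b \<in> insert x B" for c b
      proof -
        have sum: "c x * x + (\<Sum>b\<in>B. c b * b) = 0" using c(2) B(1) \<open>x \<notin> B\<close> by simp
        have "c x = 0"
        proof (rule ccontr)
          assume nz: "c x \<noteq> 0"
          have "c x * x = - (\<Sum>b\<in>B. c b * b)" using sum by (simp add: eq_neg_iff_add_eq_0)
          hence "x = - (\<Sum>b\<in>B. c b * b) / c x" by (metis nz nonzero_mult_div_cancel_left)
          also have "\<dots> = (\<Sum>b\<in>B. (- c b / c x) * b)"
            by (simp add: sum_negf sum_divide_distrib)
          finally have "x = (\<Sum>b\<in>B. (- c b / c x) * b)" .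
          moreover have "\<forall>b\<in>B. - c b / c x \<in> K" using c(1) by (auto intro!: K')
          ultimately have "\<exists>c. (\<forall>b\<in>B. c b \<in> K) \<and> x = (\<Sum>b\<in>B. c b * b)"
            by (intro exI[of _ "\<lambda>b. - c b / c x"] conjI)
          thus False using False by blast
        qed
        moreover have "c b = 0" if "b \<in> B"
        proof (rule B(4)[of c])
          show "(\<Sum>b\<in>B. c b * b) = 0" using sum \<open>c x = 0\<close> by simp
        qed (use c(1) that in auto)
        ultimately show ?thesis using c(3) by blast
      qed
    qed
  qed
qed

text \<open>In each coefficient of the equation, only the numbers a s and b s may lie outside K.
  Expanded in a basis, that coefficient is a linear relation over K between basis elements, so the
  equation splits into one for each basis element. A nonzero denominator has a nonzero component,
  and the corresponding equation is kept.\<close>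

lemma fls_linear_descent:
  fixes F :: "complex fls" and U :: "'s \<Rightarrow> complex fls"
  assumes K: "is_subfield K" and S: "finite S" and F: "F \<in> fls_over K"
    and U: "\<And>s. s \<in> S \<Longrightarrow> U s \<in> fls_over K"
    and eq: "F * (\<Sum>s\<in>S. fls_const (b s) * U s) = (\<Sum>s\<in>S. fls_const (a s) * U s)"
    and nz: "(\<Sum>s\<in>S. fls_const (b s) * U s) \<noteq> 0"
  obtains a' b' where "\<And>s. s \<in> S \<Longrightarrow> a' s \<in> K" "\<And>s. s \<in> S \<Longrightarrow> b' s \<in> K"
    "F * (\<Sum>s\<in>S. fls_const (b' s) * U s) = (\<Sum>s\<in>S. fls_const (a' s) * U s)"
    "(\<Sum>s\<in>S. fls_const (b' s) * U s) \<noteq> 0"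
proof -
  note K' = is_subfieldD[OF K]
  have "finite (a ` S \<union> b ` S)" using S by simp
  then obtain B \<kappa> where B: "finite B" "\<And>x e. x \<in> a ` S \<union> b ` S \<Longrightarrow> e \<in> B \<Longrightarrow> \<kappa> x e \<in> K"
    "\<And>x. x \<in> a ` S \<union> b ` S \<Longrightarrow> x = (\<Sum>e\<in>B. \<kappa> x e * e)"
    "\<And>c e. (\<And>e. e \<in> B \<Longrightarrow> c e \<in> K) \<Longrightarrow> (\<Sum>e\<in>B. c e * e) = 0 \<Longrightarrow> e \<in> B \<Longrightarrow> c e = 0"
    by (rule finite_basis_over[OF K]) blast
  have a_eq: "a s = (\<Sum>e\<in>B. \<kappa> (a s) e * e)" if "s \<in> S" for s using that by (intro B(3)) auto
  have b_eq: "b s = (\<Sum>e\<in>B. \<kappa> (b s) e * e)" if "s \<in> S" for s using that by (intro B(3)) auto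
  have split: "fls_nth (F * (\<Sum>s\<in>S. fls_const (\<kappa> (b s) e) * U s)) n =
      fls_nth (\<Sum>s\<in>S. fls_const (\<kappa> (a s) e) * U s) n" if e: "e \<in> B" for e n
  proof -
    define \<delta> where "\<delta> = (\<lambda>e. \<Sum>s\<in>S. \<kappa> (b s) e * fls_nth (F * U s) n - \<kappa> (a s) e * fls_nth (U s) n)"
    have "F * (\<Sum>s\<in>S. fls_const (b s) * U s) = (\<Sum>s\<in>S. fls_const (b s) * (F * U s))" for b
      by (simp add: sum_distrib_left mult.left_commute)
    hence FU: "fls_nth (F * (\<Sum>s\<in>S. fls_const (b s) * U s)) n = (\<Sum>s\<in>S. b s * fls_nth (F * U s) n)" for b
      by (simp add: fls_nth_sum)
    have "(\<Sum>e\<in>B. \<delta> e * e) = (\<Sum>e\<in>B. \<Sum>s\<in>S. \<kappa> (b s) e * e * fls_nth (F * U s) n - \<kappa> (a s) e * e * fls_nth (U s) n)"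
      unfolding \<delta>_def sum_distrib_right by (intro sum.cong refl) (simp add: algebra_simps)
    also have "\<dots> = (\<Sum>s\<in>S. \<Sum>e\<in>B. \<kappa> (b s) e * e * fls_nth (F * U s) n - \<kappa> (a s) e * e * fls_nth (U s) n)"
      by (rule sum.swap)
    also have "\<dots> = (\<Sum>s\<in>S. b s * fls_nth (F * U s) n - a s * fls_nth (U s) n)"
      by (intro sum.cong refl) (simp only: sum_subtractf sum_distrib_right[symmetric] a_eq[symmetric] b_eq[symmetric])
    also have "\<dots> = fls_nth (F * (\<Sum>s\<in>S. fls_const (b s) * U s)) n - fls_nth (\<Sum>s\<in>S. fls_const (a s) * U s) n"
      unfolding FU by (simp add: fls_nth_sum sum_subtractf)
    also have "\<dots> = 0" by (simp add: eq)
    finally have "(\<Sum>e\<in>B. \<delta> e * e) = 0" .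
    moreover have "\<delta> e \<in> K" if "e \<in> B" for e
      unfolding \<delta>_def
    proof (intro subfield_sum[OF K] K'(3) K'(6))
      fix s assume s: "s \<in> S"
      show "\<kappa> (b s) e \<in> K" "\<kappa> (a s) e \<in> K" using that s by (auto intro: B(2))
      show "fls_nth (F * U s) n \<in> K" "fls_nth (U s) n \<in> K"
        using fls_over_mult[OF K F U[OF s]] U[OF s] by (auto simp: fls_over_def)
    qed
    ultimately have "\<delta> e = 0" using B(4) e by blast
    thus ?thesis unfolding FU by (simp add: \<delta>_def fls_nth_sum sum_subtractf)
  qed
  have "\<exists>e\<in>B. (\<Sum>s\<in>S. fls_const (\<kappa> (b s) e) * U s) \<noteq> 0"
  proof (rule ccontr)
    assume *: "\<not> (\<exists>e\<in>B. (\<Sum>s\<in>S. fls_const (\<kappa> (b s) e) * U s) \<noteq> 0)"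
    have "fls_nth (\<Sum>s\<in>S. fls_const (b s) * U s) n = 0" for n
    proof -
      have "fls_nth (\<Sum>s\<in>S. fls_const (b s) * U s) n = (\<Sum>s\<in>S. (\<Sum>e\<in>B. \<kappa> (b s) e * e) * fls_nth (U s) n)"
        by (simp add: fls_nth_sum flip: b_eq)
      also have "\<dots> = (\<Sum>e\<in>B. \<Sum>s\<in>S. \<kappa> (b s) e * e * fls_nth (U s) n)"
        unfolding sum_distrib_right by (rule sum.swap)
      also have "\<dots> = (\<Sum>e\<in>B. e * fls_nth (\<Sum>s\<in>S. fls_const (\<kappa> (b s) e) * U s) n)"
        by (intro sum.cong refl) (simp add: fls_nth_sum sum_distrib_left mult_ac)
      also have "\<dots> = 0" using * by (intro sum.neutral) auto
      finally show ?thesis .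
    qed
    hence "(\<Sum>s\<in>S. fls_const (b s) * U s) = 0" by (intro fls_eqI) simp
    thus False using nz by blast
  qed
  then obtain e where e: "e \<in> B" "(\<Sum>s\<in>S. fls_const (\<kappa> (b s) e) * U s) \<noteq> 0" by blast
  show ?thesis
  proof (rule that[of "\<lambda>s. \<kappa> (a s) e" "\<lambda>s. \<kappa> (b s) e"])
    show "F * (\<Sum>s\<in>S. fls_const (\<kappa> (b s) e) * U s) = (\<Sum>s\<in>S. fls_const (\<kappa> (a s) e) * U s)"
      by (intro fls_eqI split e)
  qed (use B(2) e in auto)
qed

section \<open>The cyclotomic field\<close>

text \<open>The operations of the algebraic structure are identified with those of the type
  \<open>complex\<close>; the convention \<open>inverse 0 = 0\<close> is matched separately.\<close>

lemma is_subfield_cyclotomic: "is_subfield (cyclotomic_field N)"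
proof -
  let ?R = "ring_of_type_algebra :: complex ring"
  interpret R: field ?R by (rule field_from_type_algebra)
  have R: "carrier ?R = UNIV" "monoid.mult ?R = (*)" "add ?R = (+)" "one ?R = 1" "ring.zero ?R = 0"
    by (simp_all add: ring_of_type_algebra_def fun_eq_iff)
  have um: "\<ominus>\<^bsub>?R\<^esub> a = - a" for a by (rule R.minus_equality) (simp_all add: R)
  have iv: "inv\<^bsub>?R\<^esub> a = inverse a" if "a \<noteq> 0" for a 
    by (rule R.inv_unique'[symmetric]) (use that in \<open>simp_all add: R\<close>)
  let ?K = "cyclotomic_field N"
  have K: "a + b \<in> ?K" "a * b \<in> ?K" "- a \<in> ?K" "a \<noteq> 0 \<Longrightarrow> inverse a \<in> ?K" if "a \<in> ?K" "b \<in> ?K" for a b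
    using generate_field.intros(3-6)[of _ ?R "{zeta N}"] that unfolding cyclotomic_field_def
    by (fastforce simp: um R dest: iv)+
  have 1: "1 \<in> ?K" using generate_field.one[of ?R] by (simp add: cyclotomic_field_def R)
  have 0: "0 \<in> ?K" using K(1)[OF 1 K(3)[OF 1 1]] by simp
  have "a - b \<in> ?K" if "a \<in> ?K" "b \<in> ?K" for a b using K(1)[OF that(1) K(3)[OF that(2) 1]] by simp
  moreover have "inverse a \<in> ?K" if "a \<in> ?K" for a using K(4)[OF that that] 0 by (cases "a = 0") auto
  ultimately show ?thesis unfolding is_subfield_def using 1 K(2) by blast
qed

lemma cexp_in_cyclotomic: "N > 0 \<Longrightarrow> cexp (of_nat s / of_int N) \<in> cyclotomic_field N"
proof -
  have "cexp (of_nat s / of_int N) = zeta N ^ s"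
    using cexp_of_nat_mult[of s "1 / of_int N"] by (simp add: zeta_def cexp_def)
  moreover have "zeta N \<in> cyclotomic_field N" unfolding cyclotomic_field_def by (rule generate_field.incl) simp
  ultimately show ?thesis using subfield_power[OF is_subfield_cyclotomic] by simp
qed

section \<open>Modular functions with coefficients in a field\<close>

text \<open>\<open>moebius A\<close> and its inverse carry punctured neighbourhoods into each other,
  so the limits on both sides exist together. If there is none, both sides take the same default
  value.\<close>

lemma remove_sings_moebius:
  assumes A: "A \<in> SL2Z" and \<tau>: "\<tau> \<in> uhp"
  shows "remove_sings g (moebius A \<tau>) = remove_sings (\<lambda>w. g (moebius A w)) \<tau>"
proof -
  have lim: "(g \<midarrow>moebius A \<tau>\<rightarrow> c) \<longleftrightarrow> ((\<lambda>w. g (moebius A w)) \<midarrow>\<tau>\<rightarrow> c)" for c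
  proof
    assume "g \<midarrow>moebius A \<tau>\<rightarrow> c"
    thus "(\<lambda>w. g (moebius A w)) \<midarrow>\<tau>\<rightarrow> c" by (rule filterlim_compose) (rule filterlim_moebius_at[OF A \<tau>])
  next
    assume *: "(\<lambda>w. g (moebius A w)) \<midarrow>\<tau>\<rightarrow> c"
    define B where "B = inv2 A"
    have B: "B \<in> SL2Z" unfolding B_def by (rule inv2(1)[OF A])
    have A\<tau>: "moebius A \<tau> \<in> uhp" by (rule moebius_uhp[OF A \<tau>])
    have "filterlim (moebius B) (at \<tau>) (at (moebius A \<tau>))"
      using filterlim_moebius_at[OF B A\<tau>] moebius_inv2(2)[OF A \<tau>] by (simp add: B_def)
    hence "(\<lambda>w. g (moebius A (moebius B w))) \<midarrow>moebius A \<tau>\<rightarrow> c" by (rule filterlim_compose[OF *])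
    moreover have "\<forall>\<^sub>F w in at (moebius A \<tau>). g (moebius A (moebius B w)) = g w"
      using eventually_in_uhp[OF A\<tau>] by eventually_elim (simp add: B_def moebius_inv2(1)[OF A])
    ultimately show "g \<midarrow>moebius A \<tau>\<rightarrow> c" by (rule Lim_transform_eventually)
  qed
  show ?thesis
  proof (cases "\<exists>c. g \<midarrow>moebius A \<tau>\<rightarrow> c")
    case True
    then obtain c where "g \<midarrow>moebius A \<tau>\<rightarrow> c" by blast
    with lim[of c] show ?thesis by (metis remove_sings_eqI)
  next
    case False
    thus ?thesis unfolding remove_sings_def lim by simp
  qed
qed

lemma fourier_remove_sings:
  assumes N: "N > 0" and F: "has_fourier_expansion N f F"
  shows "has_fourier_expansion N (remove_sings f) F"
proof -
  obtain Y where Y: "\<And>\<tau>. Im \<tau> > Y \<Longrightarrow> f analytic_on {\<tau>}" using fourier_analytic[OF N F] by blast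
  have "eventually (\<lambda>\<tau>. remove_sings f \<tau> = f \<tau>) at_i_infinity"
    unfolding eventually_at_i_infinity using Y by (intro exI[of _ Y]) auto
  thus ?thesis using F by (rule fourier_cong)
qed

text \<open>Relations between functions and between their expansions are equivalent. In one
  direction the identity theorem spreads vanishing from near i\<infinity> over the half plane; in
  the other, analyticity near i\<infinity> turns vanishing on punctured neighbourhoods into
  vanishing of values.\<close>

lemma fourier_eq_0_iff_uhp:
  assumes N: "N > 0" and F: "has_fourier_expansion N f F" and mer: "f meromorphic_on uhp"
  shows "F = 0 \<longleftrightarrow> (\<forall>z\<in>uhp. \<forall>\<^sub>F w in at z. f w = 0)"
proof
  assume "F = 0"
  then obtain Y where Y: "\<And>\<tau>. Im \<tau> > Y \<Longrightarrow> f \<tau> = 0"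
    using fourier_eq_0_iff[OF N F] by (auto simp: eventually_at_i_infinity)
  define z0 where "z0 = Complex 0 (max 1 (Y + 1))"
  have "z0 \<in> {\<tau>. Im \<tau> > Y}" by (auto simp: z0_def)
  hence "\<forall>\<^sub>F w in at z0. w \<in> {\<tau>. Im \<tau> > Y}" by (intro eventually_at_in_open') (auto simp: open_halfspace_Im_gt)
  hence "\<forall>\<^sub>F w in at z0. f w = 0" by eventually_elim (simp add: Y)
  hence fr: "\<exists>\<^sub>F w in at z0. f w = 0" by (intro eventually_frequently) auto
  have "z0 \<in> uhp" by (simp add: z0_def uhp_def)
  thus "\<forall>z\<in>uhp. \<forall>\<^sub>F w in at z. f w = 0"
    using meromorphic_identity[OF mer open_uhp connected_uhp _ fr] by blast
next
  assume *: "\<forall>z\<in>uhp. \<forall>\<^sub>F w in at z. f w = 0"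
  obtain Y where Y: "Y > 0" "\<And>\<tau>. Im \<tau> > Y \<Longrightarrow> f analytic_on {\<tau>}" using fourier_analytic[OF N F] by blast
  have "f \<tau> = 0" if \<tau>: "Im \<tau> > Y" for \<tau>
  proof -
    have "\<tau> \<in> uhp" using \<tau> Y(1) by (simp add: uhp_def)
    hence "(f \<longlongrightarrow> 0) (at \<tau>)" using * by (intro tendsto_eventually) auto
    moreover have "(f \<longlongrightarrow> f \<tau>) (at \<tau>)" using Y(2)[OF \<tau>] by (simp add: analytic_at_imp_isCont isContD)
    ultimately show ?thesis using at_neq_bot tendsto_unique by blast
  qed
  hence "eventually (\<lambda>\<tau>. f \<tau> = 0) at_i_infinity" unfolding eventually_at_i_infinity by blast
  thus "F = 0" using fourier_eq_0_iff[OF N F] by blast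
qed

text \<open>Pointwise data from which \<open>uhp_normalize\<close> produces a modular function; unlike the field
  operations of \<open>mero_uhp\<close>, pointwise operations commute with composition by \<open>moebius A\<close>.\<close>
definition premodular :: "int \<Rightarrow> complex set \<Rightarrow> (complex \<Rightarrow> complex) \<Rightarrow> bool" where
  "premodular N K g \<longleftrightarrow> g meromorphic_on uhp \<and>
     (\<forall>A\<in>Gamma1 N. \<forall>\<tau>\<in>uhp. g (moebius A \<tau>) = g \<tau>) \<and>
     (\<forall>A\<in>SL2Z. \<exists>F. has_fourier_expansion N (\<lambda>\<tau>. g (moebius A \<tau>)) F) \<and>
     (\<exists>F\<in>fls_over K. has_fourier_expansion N g F)"

context
  fixes N :: int and K :: "complex set"
  assumes N: "N > 0" and K: "is_subfield K"
begin

lemma premodular_normalize: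
  assumes g: "premodular N K g"
  shows "uhp_normalize g \<in> with_fourier_coeffs_in N K (modular_field1 N)"
proof -
  have mer: "g meromorphic_on uhp" and inv: "\<And>A \<tau>. A \<in> Gamma1 N \<Longrightarrow> \<tau> \<in> uhp \<Longrightarrow> g (moebius A \<tau>) = g \<tau>"
    and four: "\<And>A. A \<in> SL2Z \<Longrightarrow> \<exists>F. has_fourier_expansion N (\<lambda>\<tau>. g (moebius A \<tau>)) F"
    using g by (auto simp: premodular_def)
  obtain F where F: "F \<in> fls_over K" "has_fourier_expansion N g F" using g by (auto simp: premodular_def)
  have eq: "uhp_normalize g (moebius A \<tau>) = remove_sings (\<lambda>w. g (moebius A w)) \<tau>" if "A \<in> SL2Z" "\<tau> \<in> uhp" for A \<tau>
    using remove_sings_moebius[OF that, of g] moebius_uhp[OF that] by (simp add: uhp_normalize_def)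
  have "uhp_normalize g (moebius A \<tau>) = uhp_normalize g \<tau>" if A: "A \<in> Gamma1 N" and \<tau>: "\<tau> \<in> uhp" for A \<tau>
  proof -
    have "A \<in> SL2Z" using A by (simp add: Gamma1_def)
    moreover have "\<forall>\<^sub>F w in at \<tau>. g (moebius A w) = g w"
      using eventually_in_uhp[OF \<tau>] by eventually_elim (rule inv[OF A])
    hence "remove_sings (\<lambda>w. g (moebius A w)) \<tau> = remove_sings g \<tau>" by (rule remove_sings_cong) simp
    ultimately show ?thesis using eq \<tau> by (simp add: uhp_normalize_def)
  qed
  moreover have "\<exists>F. has_fourier_expansion N (\<lambda>\<tau>. uhp_normalize g (moebius A \<tau>)) F" if A: "A \<in> SL2Z" for A
  proof -
    obtain F where F: "has_fourier_expansion N (\<lambda>\<tau>. g (moebius A \<tau>)) F" using four[OF A] by blast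
    have "has_fourier_expansion N (\<lambda>\<tau>. uhp_normalize g (moebius A \<tau>)) F"
      by (rule fourier_cong[OF _ fourier_remove_sings[OF N F]])
         (use eventually_at_i_infinity_uhp eq[OF A] in \<open>auto elim: eventually_mono\<close>)
    thus ?thesis by blast
  qed
  moreover have "has_fourier_expansion N (uhp_normalize g) F"
    by (rule fourier_cong[OF _ fourier_remove_sings[OF N F(2)]])
       (use eventually_at_i_infinity_uhp in \<open>auto simp: uhp_normalize_def elim: eventually_mono\<close>)
  ultimately show ?thesis
    using uhp_normalize_closed[OF mer] F(1)
    by (auto simp: with_fourier_coeffs_in_def modular_field1_def modular_functions_def fls_over_def)
qed

lemma premodular_of_modular:
  assumes "f \<in> with_fourier_coeffs_in N K (modular_field1 N)"
  shows "premodular N K f"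
  using assms mero_uhp_meromorphic
  by (auto simp: premodular_def with_fourier_coeffs_in_def modular_field1_def modular_functions_def fls_over_def)

lemma premodular_const: "c \<in> K \<Longrightarrow> premodular N K (\<lambda>_. c)"
  unfolding premodular_def using fourier_const[OF N, of c] fls_over_const[OF K, of c] by auto

text \<open>One closure argument for sum, product and, with a map that ignores its second argument,
  the inverse.\<close>

lemma premodular_map2:
  assumes f: "premodular N K f" and g: "premodular N K g"
    and mer: "(\<lambda>w. \<phi> (f w) (g w)) meromorphic_on uhp"
    and four: "\<And>f g F G. has_fourier_expansion N f F \<Longrightarrow> has_fourier_expansion N g G \<Longrightarrow>
                 has_fourier_expansion N (\<lambda>w. \<phi> (f w) (g w)) (\<Phi> F G)"
    and over: "\<And>F G. F \<in> fls_over K \<Longrightarrow> G \<in> fls_over K \<Longrightarrow> \<Phi> F G \<in> fls_over K"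
  shows "premodular N K (\<lambda>w. \<phi> (f w) (g w))"
  unfolding premodular_def
proof (intro conjI ballI)
  fix A \<tau> assume "A \<in> Gamma1 N" "\<tau> \<in> uhp"
  thus "\<phi> (f (moebius A \<tau>)) (g (moebius A \<tau>)) = \<phi> (f \<tau>) (g \<tau>)"
    using f g by (simp add: premodular_def)
next
  fix A assume A: "A \<in> SL2Z"
  obtain F G where "has_fourier_expansion N (\<lambda>\<tau>. f (moebius A \<tau>)) F" "has_fourier_expansion N (\<lambda>\<tau>. g (moebius A \<tau>)) G"
    using f g A unfolding premodular_def by blast
  from four[OF this] show "\<exists>F. has_fourier_expansion N (\<lambda>\<tau>. \<phi> (f (moebius A \<tau>)) (g (moebius A \<tau>))) F" by blast
next
  obtain F G where "F \<in> fls_over K" "has_fourier_expansion N f F" "G \<in> fls_over K" "has_fourier_expansion N g G"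
    using f g unfolding premodular_def by blast
  thus "\<exists>F\<in>fls_over K. has_fourier_expansion N (\<lambda>w. \<phi> (f w) (g w)) F"
    using four over by blast
qed (rule mer)

lemma premodular_add: "premodular N K f \<Longrightarrow> premodular N K g \<Longrightarrow> premodular N K (\<lambda>w. f w + g w)"
  by (rule premodular_map2[where \<phi> = "(+)" and \<Phi> = "(+)"])
     (auto simp: premodular_def intro: meromorphic_on_add fourier_add[OF N] fls_over_add[OF K])

lemma premodular_mult: "premodular N K f \<Longrightarrow> premodular N K g \<Longrightarrow> premodular N K (\<lambda>w. f w * g w)"
  by (rule premodular_map2[where \<phi> = "(*)" and \<Phi> = "(*)"])
     (auto simp: premodular_def intro: meromorphic_on_mult fourier_mult[OF N] fls_over_mult[OF K])

lemma premodular_inverse: "premodular N K f \<Longrightarrow> premodular N K (\<lambda>w. inverse (f w))"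
  by (rule premodular_map2[where f = f and g = f and \<phi> = "\<lambda>x _. inverse x" and \<Phi> = "\<lambda>F _. inverse F"])
     (auto simp: premodular_def intro: meromorphic_on_inverse fourier_inverse[OF N] fls_over_inverse[OF K])

end

section \<open>The field of meromorphic functions\<close>

lemma uhp_normalize_add:
  assumes "f meromorphic_on uhp" "g meromorphic_on uhp"
  shows "uhp_normalize (\<lambda>w. f w + g w) = uhp_normalize f \<oplus>\<^bsub>mero_uhp\<^esub> uhp_normalize g"
proof -
  have "uhp_normalize (\<lambda>w. f w + g w) = uhp_normalize (\<lambda>w. uhp_normalize f w + uhp_normalize g w)"
  proof (rule uhp_normalize_cong)
    fix z assume z: "z \<in> uhp"
    show "\<forall>\<^sub>F w in at z. f w + g w = uhp_normalize f w + uhp_normalize g w"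
      using uhp_normalize_eventually[OF assms(1) z] uhp_normalize_eventually[OF assms(2) z]
      by eventually_elim simp
  qed
  thus ?thesis by (simp add: mero_uhp_def)
qed

lemma uhp_normalize_mult:
  assumes "f meromorphic_on uhp" "g meromorphic_on uhp"
  shows "uhp_normalize (\<lambda>w. f w * g w) = uhp_normalize f \<otimes>\<^bsub>mero_uhp\<^esub> uhp_normalize g"
proof -
  have "uhp_normalize (\<lambda>w. f w * g w) = uhp_normalize (\<lambda>w. uhp_normalize f w * uhp_normalize g w)"
  proof (rule uhp_normalize_cong)
    fix z assume z: "z \<in> uhp"
    show "\<forall>\<^sub>F w in at z. f w * g w = uhp_normalize f w * uhp_normalize g w"
      using uhp_normalize_eventually[OF assms(1) z] uhp_normalize_eventually[OF assms(2) z]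
      by eventually_elim simp
  qed
  thus ?thesis by (simp add: mero_uhp_def)
qed

lemma uhp_normalize_const: "uhp_normalize (\<lambda>_. c) = uhp_const c"
proof -
  have "uhp_normalize (\<lambda>_. c) = uhp_normalize (uhp_const c)"
    using uhp_const_eventually by (intro uhp_normalize_cong) (simp add: eq_commute)
  thus ?thesis by (simp add: uhp_normalize_id uhp_const_closed)
qed

lemma uhp_normalize_holomorphic:
  assumes hol: "f holomorphic_on uhp" and 0: "\<And>\<tau>. \<tau> \<notin> uhp \<Longrightarrow> f \<tau> = 0"
  shows "uhp_normalize f = f"
proof
  fix \<tau>
  show "uhp_normalize f \<tau> = f \<tau>"
  proof (cases "\<tau> \<in> uhp")
    case True
    hence "f analytic_on {\<tau>}"
      using hol analytic_on_open[OF open_uhp] analytic_on_subset by blast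
    thus ?thesis by (simp add: uhp_normalize_def True)
  qed (simp add: uhp_normalize_def 0)
qed

text \<open>Negation appears as multiplication by the constant -1, so that
  \<open>premodular_const\<close> and \<open>premodular_mult\<close> cover it.\<close>

lemma mero_uhp_uminus:
  assumes f: "f \<in> carrier mero_uhp"
  shows "\<ominus>\<^bsub>mero_uhp\<^esub> f = uhp_normalize (\<lambda>w. - 1 * f w)"
proof -
  interpret F: field mero_uhp by (rule field_mero_uhp)
  note mer = mero_uhp_meromorphic[OF f]
  have mer': "(\<lambda>w. - 1 * f w) meromorphic_on uhp" by (intro meromorphic_intros mer)
  have "uhp_normalize (\<lambda>w. - 1 * f w) \<oplus>\<^bsub>mero_uhp\<^esub> f = uhp_normalize (\<lambda>w. - 1 * f w + f w)"
    by (simp only: uhp_normalize_add[OF mer' mer] uhp_normalize_id[OF f])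
  also have "\<dots> = \<zero>\<^bsub>mero_uhp\<^esub>" by (simp add: uhp_normalize_const mero_uhp_zero)
  finally show ?thesis using f uhp_normalize_closed[OF mer'] by (intro F.minus_equality)
qed

lemma mero_uhp_nonzero_eventually:
  assumes f: "f \<in> carrier mero_uhp" "f \<noteq> \<zero>\<^bsub>mero_uhp\<^esub>" and z: "z \<in> uhp"
  shows "\<forall>\<^sub>F w in at z. f w \<noteq> 0"
proof (rule ccontr)
  assume "\<not> (\<forall>\<^sub>F w in at z. f w \<noteq> 0)"
  hence fr: "\<exists>\<^sub>F w in at z. f w = 0" by (simp add: frequently_def)
  have "f = uhp_const 0"
  proof (rule mero_uhp_eqI[OF f(1) uhp_const_closed])
    fix x assume x: "x \<in> uhp"
    show "\<forall>\<^sub>F w in at x. f w = uhp_const 0 w"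
      using meromorphic_identity[OF mero_uhp_meromorphic[OF f(1)] open_uhp connected_uhp z fr x]
        uhp_const_eventually[OF x, of 0] by eventually_elim simp
  qed
  thus False using f(2) by (simp add: mero_uhp_zero)
qed

lemma mero_uhp_inv:
  assumes f: "f \<in> carrier mero_uhp" "f \<noteq> \<zero>\<^bsub>mero_uhp\<^esub>"
  shows "inv\<^bsub>mero_uhp\<^esub> f = uhp_normalize (\<lambda>w. inverse (f w))"
proof -
  interpret F: field mero_uhp by (rule field_mero_uhp)
  note mer = mero_uhp_meromorphic[OF f(1)]
  have mer': "(\<lambda>w. inverse (f w)) meromorphic_on uhp" by (intro meromorphic_intros mer)
  define g where "g = uhp_normalize (\<lambda>w. inverse (f w))"
  have g: "g \<in> carrier mero_uhp" unfolding g_def by (rule uhp_normalize_closed[OF mer'])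
  have "f \<otimes>\<^bsub>mero_uhp\<^esub> g = uhp_normalize (\<lambda>w. f w * inverse (f w))"
    by (simp only: uhp_normalize_mult[OF mer mer'] uhp_normalize_id[OF f(1)] g_def)
  also have "\<dots> = uhp_normalize (\<lambda>_. 1)"
  proof (rule uhp_normalize_cong)
    fix z assume z: "z \<in> uhp"
    show "\<forall>\<^sub>F w in at z. f w * inverse (f w) = 1"
      using mero_uhp_nonzero_eventually[OF f z] by eventually_elim simp
  qed
  also have "\<dots> = \<one>\<^bsub>mero_uhp\<^esub>" by (simp only: uhp_normalize_const mero_uhp_one)
  finally have fg: "f \<otimes>\<^bsub>mero_uhp\<^esub> g = \<one>\<^bsub>mero_uhp\<^esub>" .
  hence "g \<otimes>\<^bsub>mero_uhp\<^esub> f = \<one>\<^bsub>mero_uhp\<^esub>" using F.m_comm[OF f(1) g] by simp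
  with fg show ?thesis unfolding g_def[symmetric] by (intro F.inv_unique'[OF f(1) g, symmetric])
qed

section \<open>Generators over the cyclotomic field\<close>

context
  fixes N k :: int
  assumes N: "N > 6" and k: "2 < k" "2 * k < N"
begin

lemma N0: "N > 0" using N by simp

lemma Lambda_holomorphic: "Lambda N k holomorphic_on uhp"
proof -
  have "Lambda_row N k 0 1 holomorphic_on uhp" by (rule Lambda_row_holomorphic[OF N k]) simp
  thus ?thesis by (rule holomorphic_transform) (simp add: Lambda_eq_row)
qed

text \<open>At the row (0, 1) the only roots of unity are \<open>cexp (s / N)\<close>, powers of
  \<open>zeta N\<close>, and the factor (2 pi i)^2 has already cancelled in
  \<open>Lambda_row_fourier\<close>.\<close>

lemma Lambda_fourier:
  obtains F where "has_fourier_expansion N (Lambda N k) F" "F \<in> fls_over (cyclotomic_field N)"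
proof -
  note K = is_subfield_cyclotomic[of N]
  have F: "has_fourier_expansion N (Lambda_row N k 0 1) (Lambda_row_fourier N k 0 1)"
    by (rule Lambda_row_fourier[OF N k]) simp
  have "has_fourier_expansion N (Lambda N k) (Lambda_row_fourier N k 0 1)"
    by (rule fourier_cong[OF _ F]) (use eventually_at_i_infinity_uhp Lambda_eq_row in \<open>auto elim: eventually_mono\<close>)
  moreover have "wp_fourier N 0 s \<in> fls_over (cyclotomic_field N)" if s: "0 < s" "s < N" for s
  proof -
    have "\<not> N dvd s" using s zdvd_imp_le by fastforce
    hence "\<not> int (nat N) dvd s" using N by simp
    moreover have "cexp (of_int s / of_nat (nat N)) \<in> cyclotomic_field N"
      using cexp_in_cyclotomic[OF N0, of "nat s"] s N by simp
    ultimately have "wpF (nat N) 0 s \<in> fps_over (cyclotomic_field N)"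
      using N by (intro wpF_over[OF K]) auto
    thus ?thesis unfolding wp_fourier_def by (intro fls_over_fps[OF K]) simp
  qed
  from this[of k] this[of 2] this[of 1] have "Lambda_row_fourier N k 0 1 \<in> fls_over (cyclotomic_field N)"
    unfolding Lambda_row_fourier_def[OF N k] using N k by (intro fls_over_divide[OF K] fls_over_diff[OF K]) auto
  ultimately show ?thesis by (rule that)
qed

lemma premodular_Lambda: "premodular N (cyclotomic_field N) (Lambda N k)"
  unfolding premodular_def
proof (intro conjI ballI)
  show "Lambda N k meromorphic_on uhp"
    using Lambda_holomorphic by (simp add: analytic_on_imp_meromorphic_on analytic_on_open open_uhp)
  show "\<exists>F\<in>fls_over (cyclotomic_field N). has_fourier_expansion N (Lambda N k) F"
    using Lambda_fourier by blast
next
  fix A \<tau> assume A: "A \<in> Gamma1 N" and \<tau>: "\<tau> \<in> uhp"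
  have A': "A \<in> SL2Z" and c: "[A $ 2 $ 1 = 0] (mod N)" using A by (auto simp: Gamma1_def)
  have "N dvd A $ 2 $ 2 - 1" using Gamma1_iff[OF A', of N] A c by (simp add: cong_0_iff)
  hence "Lambda_row N k (A $ 2 $ 1) (A $ 2 $ 2) \<tau> = Lambda_row N k 0 1 \<tau>"
    by (intro Lambda_row_cong N0 \<tau> c) (simp add: cong_iff_dvd_diff)
  thus "Lambda N k (moebius A \<tau>) = Lambda N k \<tau>" by (simp only: Lambda_moebius[OF A' \<tau>] Lambda_eq_row[OF \<tau>])
next
  fix A :: "int^2^2" assume A: "A \<in> SL2Z"
  have "has_fourier_expansion N (\<lambda>\<tau>. Lambda N k (moebius A \<tau>)) (Lambda_row_fourier N k (A $ 2 $ 1) (A $ 2 $ 2))"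
    by (rule fourier_cong[OF _ slash_Lambda_fourier[OF N k A]])
       (use eventually_at_i_infinity_uhp in \<open>auto simp: slash_def elim: eventually_mono\<close>)
  thus "\<exists>F. has_fourier_expansion N (\<lambda>\<tau>. Lambda N k (moebius A \<tau>)) F" by blast
qed

lemma premodular_klein_j: "premodular N (cyclotomic_field N) klein_j"
  unfolding premodular_def
proof (intro conjI ballI)
  show "klein_j meromorphic_on uhp"
    using klein_j_holomorphic by (simp add: analytic_on_imp_meromorphic_on analytic_on_open open_uhp)
  obtain J where J: "has_fourier_expansion N klein_j J" "J \<in> fls_over (cyclotomic_field N)"
    by (rule klein_j_fourier[OF N0]) (rule that, assumption, simp add: is_subfield_cyclotomic)
  show "\<exists>F\<in>fls_over (cyclotomic_field N). has_fourier_expansion N klein_j F" using J by blast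
  show "\<exists>F. has_fourier_expansion N (\<lambda>\<tau>. klein_j (moebius A \<tau>)) F" if A: "A \<in> SL2Z" for A
  proof -
    have "has_fourier_expansion N (\<lambda>\<tau>. klein_j (moebius A \<tau>)) J"
      by (rule fourier_cong[OF _ J(1)])
         (use eventually_at_i_infinity_uhp klein_j_moebius[OF A] in \<open>auto elim: eventually_mono\<close>)
    thus ?thesis by blast
  qed
qed (simp add: klein_j_moebius Gamma1_def)

lemma generators_in_carrier: "uhp_const ` K \<union> {Lambda N k, klein_j} \<subseteq> carrier mero_uhp"
proof -
  have "f \<in> carrier mero_uhp" if "f holomorphic_on uhp" "\<And>\<tau>. \<tau> \<notin> uhp \<Longrightarrow> f \<tau> = 0" for f
    using uhp_normalize_closed[of f] uhp_normalize_holomorphic[OF that] that(1)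
    by (simp add: analytic_on_imp_meromorphic_on analytic_on_open open_uhp)
  from this[OF Lambda_holomorphic] this[OF klein_j_holomorphic] show ?thesis
    by (auto simp: uhp_const_closed Lambda_def klein_j_def)
qed

text \<open>Induction over the generation of the field: each field operation is the normal form of a
  pointwise operation, under which \<open>premodular\<close> is closed.\<close>

lemma adjoin_subset_modular:
  "function_field_adjoin (cyclotomic_field N) {Lambda N k, klein_j} \<subseteq>
     with_fourier_coeffs_in N (cyclotomic_field N) (modular_field1 N)"
proof
  let ?K = "cyclotomic_field N"
  let ?M = "with_fourier_coeffs_in N ?K (modular_field1 N)"
  note K = is_subfield_cyclotomic[of N]
  note norm = premodular_normalize[OF N0 K] and pre = premodular_of_modular[OF N0 K]
  have M_carrier: "f \<in> carrier mero_uhp" if "f \<in> ?M" for f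
    using that by (simp add: with_fourier_coeffs_in_def modular_field1_def modular_functions_def)
  have const: "uhp_const c \<in> ?M" if "c \<in> ?K" for c
    using norm[OF premodular_const[OF N0 K that]] by (simp only: uhp_normalize_const)
  fix f assume "f \<in> function_field_adjoin ?K {Lambda N k, klein_j}"
  hence "f \<in> generate_field mero_uhp (uhp_const ` ?K \<union> {Lambda N k, klein_j})"
    by (simp only: function_field_adjoin_def)
  thus "f \<in> ?M"
  proof induction
    case one
    show ?case using const[OF is_subfieldD(1)[OF K]] by (simp only: mero_uhp_one)
  next
    case (incl h)
    have "Lambda N k \<in> ?M"
      using norm[OF premodular_Lambda] uhp_normalize_holomorphic[OF Lambda_holomorphic] by (simp add: Lambda_def)
    moreover have "klein_j \<in> ?M"
      using norm[OF premodular_klein_j] uhp_normalize_holomorphic[OF klein_j_holomorphic] by (simp add: klein_j_def)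
    ultimately show ?case using incl const by auto
  next
    case (a_inv h)
    have "- 1 \<in> ?K" by (intro is_subfieldD(4)[OF K] is_subfieldD(1)[OF K])
    from premodular_mult[OF N0 K premodular_const[OF N0 K this] pre[OF a_inv.IH]]
    show ?case unfolding mero_uhp_uminus[OF M_carrier[OF a_inv.IH]] by (rule norm)
  next
    case (m_inv h)
    from premodular_inverse[OF N0 K pre[OF m_inv.IH]]
    show ?case unfolding mero_uhp_inv[OF M_carrier[OF m_inv.IH] m_inv.hyps(2)] by (rule norm)
  next
    case (eng_add h1 h2)
    from norm[OF premodular_add[OF N0 K pre[OF eng_add.IH(1)] pre[OF eng_add.IH(2)]]]
    show ?case by (simp add: mero_uhp_def)
  next
    case (eng_mult h1 h2)
    from norm[OF premodular_mult[OF N0 K pre[OF eng_mult.IH(1)] pre[OF eng_mult.IH(2)]]]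
    show ?case by (simp add: mero_uhp_def)
  qed
qed

lemma jL_combination_in_adjoin:
  assumes "finite S" "\<And>s. s \<in> S \<Longrightarrow> a s \<in> K"
  shows "uhp_normalize (\<lambda>w. \<Sum>s\<in>S. a s * jL N k s w) \<in> function_field_adjoin K {Lambda N k, klein_j}"
proof -
  let ?E = "function_field_adjoin K {Lambda N k, klein_j}"
  interpret F: field mero_uhp by (rule field_mero_uhp)
  \<comment> \<open>Functions whose normal form lies in the field. Here the operations are
    pointwise, so powers and finite sums are the ordinary ones.\<close>
  define G where "G = {g. g meromorphic_on uhp \<and> uhp_normalize g \<in> ?E}"
  have gen: "h \<in> ?E" if "h \<in> uhp_const ` K \<union> {Lambda N k, klein_j}" for h
    unfolding function_field_adjoin_def by (rule generate_field.incl[OF that])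
  have "uhp_const 0 \<in> ?E"
    using F.zero_in_generate unfolding function_field_adjoin_def mero_uhp_zero by blast
  moreover have "uhp_const 1 \<in> ?E"
    using generate_field.one[of mero_uhp] unfolding function_field_adjoin_def mero_uhp_one by simp
  ultimately have const: "(\<lambda>_. c) \<in> G" if "c \<in> K \<union> {0, 1}" for c
    using that gen by (auto simp: G_def uhp_normalize_const)
  have L: "Lambda N k \<in> G" and J: "klein_j \<in> G"
    using gen generators_in_carrier[of K] by (auto simp: G_def uhp_normalize_id mero_uhp_meromorphic)
  have add: "(\<lambda>w. f w + g w) \<in> G" and mult: "(\<lambda>w. f w * g w) \<in> G" if "f \<in> G" "g \<in> G" for f g
    using that unfolding G_def function_field_adjoin_def
    by (auto simp: uhp_normalize_add uhp_normalize_mult intro: meromorphic_on_add meromorphic_on_mult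
        generate_field.eng_add generate_field.eng_mult)
  have power: "(\<lambda>w. f w ^ n) \<in> G" if "f \<in> G" for f n
    by (induction n) (use that const[of 1] in \<open>auto intro: mult\<close>)
  have "(\<lambda>w. jL N k s w) \<in> G" for s unfolding jL_def[OF N k] by (intro mult power L J)
  hence "(\<lambda>w. a s * jL N k s w) \<in> G" if "s \<in> S" for s using assms(2)[OF that] by (intro mult const) auto
  with assms(1) have "(\<lambda>w. \<Sum>s\<in>S. a s * jL N k s w) \<in> G"
    by (induction S rule: finite_induct) (auto intro: add const)
  thus ?thesis by (simp add: G_def)
qed

text \<open>The complex relation of \<open>modular_field1_rational\<close> is carried to Fourier
  series, where its coefficients can be descended, and the new relation is carried back; the local
  equivalence \<open>iff\<close> serves both passages. In the field, f is then the quotient of two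
  combinations of monomials over the cyclotomic field.\<close>

lemma modular_subset_adjoin:
  "with_fourier_coeffs_in N (cyclotomic_field N) (modular_field1 N) \<subseteq>
     function_field_adjoin (cyclotomic_field N) {Lambda N k, klein_j}"
proof
  let ?K = "cyclotomic_field N"
  let ?E = "function_field_adjoin ?K {Lambda N k, klein_j}"
  note K = is_subfield_cyclotomic[of N]
  interpret R: field mero_uhp by (rule field_mero_uhp)
  fix f assume f: "f \<in> with_fourier_coeffs_in N ?K (modular_field1 N)"
  hence f1: "f \<in> modular_field1 N" and f_carrier: "f \<in> carrier mero_uhp"
    by (auto simp: with_fourier_coeffs_in_def modular_field1_def modular_functions_def)
  note f_mer = mero_uhp_meromorphic[OF f_carrier]
  obtain F where F: "has_fourier_expansion N f F" "F \<in> fls_over ?K"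
    using f by (auto simp: with_fourier_coeffs_in_def fls_over_def)
  obtain L where L: "has_fourier_expansion N (Lambda N k) L" "L \<in> fls_over ?K" using Lambda_fourier by blast
  obtain J where J: "has_fourier_expansion N klein_j J" "J \<in> fls_over ?K"
    using premodular_klein_j by (auto simp: premodular_def)
  define U where "U = (\<lambda>s. J ^ snd s * L ^ fst s)"
  have U: "U s \<in> fls_over ?K" for s unfolding U_def by (intro fls_over_mult[OF K] fls_over_power[OF K] J L)
  define \<phi> where "\<phi> = (\<lambda>S a w. \<Sum>s\<in>S. a s * jL N k s w)"
  have \<phi>_mer: "\<phi> S a meromorphic_on uhp" for S a
  proof -
    have "\<phi> S a holomorphic_on uhp"
      unfolding \<phi>_def jL_def[OF N k] by (intro holomorphic_intros Lambda_holomorphic klein_j_holomorphic)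
    thus ?thesis by (simp add: analytic_on_imp_meromorphic_on analytic_on_open open_uhp)
  qed
  have \<phi>_fourier: "has_fourier_expansion N (\<phi> S a) (\<Sum>s\<in>S. fls_const (a s) * U s)" for S a
    unfolding \<phi>_def jL_def[OF N k] U_def
    by (intro fourier_sum fourier_mult fourier_const fourier_power N0 J L)
  have iff: "F * (\<Sum>s\<in>S. fls_const (b s) * U s) = (\<Sum>s\<in>S. fls_const (a s) * U s) \<longleftrightarrow>
      (\<forall>z\<in>uhp. \<forall>\<^sub>F w in at z. f w * \<phi> S b w = \<phi> S a w)" for S a b
  proof -
    have "has_fourier_expansion N (\<lambda>w. f w * \<phi> S b w - \<phi> S a w)
        (F * (\<Sum>s\<in>S. fls_const (b s) * U s) - (\<Sum>s\<in>S. fls_const (a s) * U s))"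
      by (intro fourier_diff fourier_mult \<phi>_fourier F N0)
    moreover have "(\<lambda>w. f w * \<phi> S b w - \<phi> S a w) meromorphic_on uhp"
      by (intro meromorphic_intros f_mer \<phi>_mer)
    ultimately show ?thesis using fourier_eq_0_iff_uhp[OF N0] by fastforce
  qed
  obtain S a b where S: "finite S" and eq: "\<forall>z\<in>uhp. \<forall>\<^sub>F w in at z. f w * \<phi> S b w = \<phi> S a w"
    and nz: "\<forall>z\<in>uhp. \<forall>\<^sub>F w in at z. \<phi> S b w \<noteq> 0"
    unfolding \<phi>_def by (rule modular_field1_rational[OF N k f1]) (rule that[unfolded \<phi>_def])
  have "F * (\<Sum>s\<in>S. fls_const (b s) * U s) = (\<Sum>s\<in>S. fls_const (a s) * U s)" using iff eq by blast
  moreover have "(\<Sum>s\<in>S. fls_const (b s) * U s) \<noteq> 0"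
  proof
    assume "(\<Sum>s\<in>S. fls_const (b s) * U s) = 0"
    hence "\<forall>z\<in>uhp. \<forall>\<^sub>F w in at z. \<phi> S b w = 0"
      using fourier_eq_0_iff_uhp[OF N0 \<phi>_fourier \<phi>_mer] by blast
    moreover have "\<i> \<in> uhp" by (simp add: uhp_def)
    ultimately have "\<forall>\<^sub>F w in at \<i>. \<phi> S b w = 0" "\<forall>\<^sub>F w in at \<i>. \<phi> S b w \<noteq> 0" using nz by blast+
    hence "\<forall>\<^sub>F w in at \<i>. False" by eventually_elim simp
    thus False by simp
  qed
  ultimately obtain a' b' where ab: "\<And>s. s \<in> S \<Longrightarrow> a' s \<in> ?K" "\<And>s. s \<in> S \<Longrightarrow> b' s \<in> ?K"
    "F * (\<Sum>s\<in>S. fls_const (b' s) * U s) = (\<Sum>s\<in>S. fls_const (a' s) * U s)"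
    "(\<Sum>s\<in>S. fls_const (b' s) * U s) \<noteq> 0"
    by (rule fls_linear_descent[OF K S F(2) U]) blast
  define A B where "A = uhp_normalize (\<phi> S a')" and "B = uhp_normalize (\<phi> S b')"
  have AB: "A \<in> ?E" "B \<in> ?E" "A \<in> carrier mero_uhp" "B \<in> carrier mero_uhp"
    unfolding A_def B_def \<phi>_def using jL_combination_in_adjoin[OF S] ab(1,2) \<phi>_mer[unfolded \<phi>_def]
    by (auto intro: uhp_normalize_closed)
  have "f \<otimes>\<^bsub>mero_uhp\<^esub> B = uhp_normalize (\<lambda>w. f w * \<phi> S b' w)"
    unfolding B_def uhp_normalize_mult[OF f_mer \<phi>_mer] by (simp only: uhp_normalize_id[OF f_carrier])
  also have "\<dots> = A" unfolding A_def using iff ab(3) by (intro uhp_normalize_cong) blast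
  finally have fBA: "f \<otimes>\<^bsub>mero_uhp\<^esub> B = A" .
  \<comment> \<open>The descent guarantees a nonzero denominator only as a series, and
    \<open>fourier_eq_0_iff_uhp\<close> transfers this to the function.\<close>
  have B0: "B \<noteq> \<zero>\<^bsub>mero_uhp\<^esub>"
  proof
    assume B: "B = \<zero>\<^bsub>mero_uhp\<^esub>"
    have "\<forall>\<^sub>F w in at z. \<phi> S b' w = 0" if z: "z \<in> uhp" for z
      using uhp_normalize_eventually[OF \<phi>_mer[of S b'] z] uhp_const_eventually[OF z, of 0]
      unfolding B_def[symmetric] B mero_uhp_zero by eventually_elim simp
    thus False using fourier_eq_0_iff_uhp[OF N0 \<phi>_fourier \<phi>_mer] ab(4) by blast
  qed
  have iB: "inv\<^bsub>mero_uhp\<^esub> B \<in> ?E" using generate_field.m_inv AB(2) B0 unfolding function_field_adjoin_def by fast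
  have "B \<in> Units mero_uhp" using AB(4) B0 by (simp add: R.field_Units)
  hence "f = A \<otimes>\<^bsub>mero_uhp\<^esub> inv\<^bsub>mero_uhp\<^esub> B"
    using f_carrier AB(4) by (simp add: fBA[symmetric] R.m_assoc)
  thus "f \<in> ?E" using generate_field.eng_mult[OF _ iB[unfolded function_field_adjoin_def]] AB(1)
    unfolding function_field_adjoin_def by fast
qed

end

theorem theorem4p1:
  fixes N k :: int
  assumes "N > 6" and "2 < k" and "real_of_int k < real_of_int N / 2"
  shows "with_fourier_coeffs_in N (cyclotomic_field N) (modular_field1 N) =
         function_field_adjoin (cyclotomic_field N) {Lambda N k, klein_j}"
proof
  have "2 * k < N" using assms(3) by linarith
  note hyps = assms(1,2) this
  show "with_fourier_coeffs_in N (cyclotomic_field N) (modular_field1 N) \<subseteq>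
      function_field_adjoin (cyclotomic_field N) {Lambda N k, klein_j}"
    by (rule modular_subset_adjoin[OF hyps])
  show "function_field_adjoin (cyclotomic_field N) {Lambda N k, klein_j} \<subseteq>
      with_fourier_coeffs_in N (cyclotomic_field N) (modular_field1 N)"
    by (rule adjoin_subset_modular[OF hyps])
qed

end
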